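(* For each level $j\in\mathbb{Z}$ let $w_{j,t}$ ($t=1,\dots,M_j$) be the $(L_j+1)^2$-dimensional vector formed by the rotated angular localization coefficients $$\kappa_{lm}^{j,t}=\sum_{m'=-l}^{l}W(\lambda_t)_{l,m}^{m'}\,\kappa_{l,m'},\qquad 0\le l\le L_j,\ -l\le m\le l,$$ for a localization window centered at $\lambda_t\in S^2$, where $W(\lambda_t)_{l,m}^{m'}$ is the Wigner-D matrix implementing rotation in the spherical harmonics domain, and let $G^{lm}$ be the $(L_j+1)^2\times(L_j+1)^2$ matrix formed by the spherical harmonics product coefficients $G_{l_1,m_1;l_2,m_2}^{l,m}$ for fixed $(l,m)$. When the Calderón condition $$\sum_{j\in\mathbb{Z}}\big|\hat h(2^{-j}|\xi|)\big|^2=1\qquad\text{for all }\xi\in\mathbb{R}^3\setminus\{0\}$$ is satisfied for the radial window $\hat h$, and $$\delta_{l,0}\,\delta_{m,0}=\sum_{t=1}^{M_j}w_{j,t}\,G^{lm}\,w_{j,t}$$ for all $(l,m)$ and all levels $j$ (where $\delta_{i,j}$ is the Kronecker delta), then any $\vec u\in L_2^{\mathrm{div}}(\mathbb{R}^{3,3})$ has the representation $$\vec u(x)=\sum_{a=1}^{3}\sum_{j\in\mathbb{Z}}\sum_{k\in\mathbb{Z}^3}\sum_{t=1}^{M_j}\big\langle\vec u(y),\vec\psi_{j,k,t}^{\,a}(y)\big\rangle\,\vec\psi_{j,k,t}^{\,a}(x)$$ with frame functions $$\vec\psi_{j,k,t}^{\,a}(x)=\frac{2^{3j/2}}{(2\pi)^{3/2}}\,\vec\psi_a\big(R_{\lambda_t}(2^jx-k)\big),$$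 where $\vec\psi_a$ is the three-dimensional divergence free polar mother wavelet for the $a$-th coordinate axis with angular coefficients $(\kappa_{lm})$ and radial window $\hat h$, defined in the context, and $R_{\lambda_t}$ is the rotation from the North pole to $\lambda_t$.
   Context: The Fourier transform on $\mathbb{R}^n$ is unitary: $\hat f(\xi)=(2\pi)^{-n/2}\int_{\mathbb{R}^n}f(x)e^{-i\langle x,\xi\rangle}dx$, applied componentwise to vector fields. $L_2^{\mathrm{div}}(\mathbb{R}^{3,3})$ is the space of divergence free vector fields on $\mathbb{R}^3$ with finite $L_2$-norm. The inner product is $\langle\vec u,\vec v\rangle=\int_{\mathbb{R}^3}\vec u(y)\cdot\overline{\vec v(y)}\,dy$. For $\xi\ne0$, $\bar\xi=\xi/|\xi|\in S^2$, and likewise $\bar x=x/|x|$. The radial window $\hat h$ is a scalar function of $|\xi|$ and is bandlimited, i.e. it vanishes outside a bounded set of frequencies. The functions $y_{lm}(\theta,\phi)=C_{lm}P_l^m(\cos\theta)e^{im\phi}$ are the standard complex spherical harmonics, with $P_l^m$ the associated Legendre polynomials and $C_{lm}$ chosen so that they are orthonormal in $L_2(S^2)$. The spherical harmonics product coefficients are $$G_{l_1,m_1;l_2,m_2}^{l,m}=\int_{S^2}y_{l_1m_1}(\omega)\,y_{l_2m_2}(\omega)\,\overline{y_{lm}(\omega)}\,d\omega,$$ and $w_{j,t}\,G^{lm}\,w_{j,t}$ denotes the bilinear expression $\sum_{l_1,m_1}\sum_{l_2,m_2}\kappa_{l_1m_1}^{j,t}\,G_{l_1,m_1;l_2,m_2}^{l,m}\,\kappa_{l_2m_2}^{j,t}$.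 The numbers $\kappa_{lm}$ are the spherical harmonics coefficients of the unrotated angular localization window $\sum_{l,m}\kappa_{lm}y_{lm}$; the window, like its band limit $L_j$, the number $M_j$ of orientations and the orientations $\lambda_t$, may depend on the level $j$, which is suppressed in the notation. For $a=1,2,3$, $\vec\tau_a=\partial/\partial\phi_a$ is the tangent vector field of $S^2$ induced by the longitudinal geographic coordinate $\phi_a$ with respect to the $a$-th coordinate axis (for example $\vec\tau_3=(-\sin\theta\sin\phi,\ \sin\theta\cos\phi,\ 0)$). The mother wavelet $\vec\psi_a$ for the $a$-th axis is the vector field with Fourier transform $$\hat{\vec\psi}_a(\xi)=-i\Big(\sum_{l}\sum_{m=-l}^{l}\kappa_{lm}\,y_{lm}(\bar\xi)\Big)\hat h(|\xi|)\,\vec\tau_a(\bar\xi),$$ the sum being finite ($0\le l\le L_j$). In space, for $a=3$ (and analogously for the other two axes), $$\vec\psi_3(x)=\frac{2}{\sqrt3}\sum_{l,m}\kappa_{lm}\sum_{l_2=l-1}^{l+1}i^{l_2}\,h_{l_2}(|x|)\sum_{\sigma\in\{-1,1\}}G_{l,m;1,\sigma}^{l_2,m+\sigma}\,y_{l_2,m+\sigma}(\bar x)\begin{pmatrix}-1\\ i\sigma\\ 0\end{pmatrix},\qquad h_l(r)=\int_0^\infty\hat h(\rho)\,j_l(\rho r)\,\rho^2\,d\rho,$$ with $j_l$ the spherical Bessel function.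
   Formalization: Formalized with: normalized (mass 1) measure on S^2 for y_lm and G; radial window vanishing for |xi|>pi rather than outside some bounded set; real-valued angular windows; frame functions use the rotated field R psi(R^{-1}(2^j x-k)) in place of psi(R(2^j x-k)). *)

theory Defs
  imports "HOL-Analysis.Analysis" "HOL-Computational_Algebra.Polynomial"
begin

section \<open>Geographic coordinates on the sphere\<close>

text \<open>
  The coordinates are taken with respect to the \<open>a\<close>-th coordinate axis.  Arithmetic on the index
  type \<open>3\<close> is modulo 3, so that \<open>a\<close>, \<open>a + 1\<close>, \<open>a + 2\<close> are the three axes in cyclic (hence
  right-handed) order; for \<open>a = 3\<close> this is the usual
  \<open>(sin \<theta> cos \<phi>, sin \<theta> sin \<phi>, cos \<theta>)\<close>.
\<close>

definition sphere_point :: "3 \<Rightarrow> real \<Rightarrow> real \<Rightarrow> real ^ 3" where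
  "sphere_point a \<theta> \<phi> =
     (\<chi> i. if i = a then cos \<theta> else if i = a + 1 then sin \<theta> * cos \<phi> else sin \<theta> * sin \<phi>)"

definition colat :: "3 \<Rightarrow> real ^ 3 \<Rightarrow> real" where
  "colat a \<omega> = arccos (\<omega> $ a)"

definition longi :: "3 \<Rightarrow> real ^ 3 \<Rightarrow> real" where
  "longi a \<omega> = Arg (Complex (\<omega> $ (a + 1)) (\<omega> $ (a + 2)))"

text \<open>The tangent field \<open>\<partial>/\<partial>\<phi>\<^sub>a\<close> of the sphere.\<close>

definition tangent_field :: "3 \<Rightarrow> real ^ 3 \<Rightarrow> real ^ 3" where
  "tangent_field a \<omega> =
     vector_derivative (sphere_point a (colat a \<omega>)) (at (longi a \<omega>))"

lemma axis3_arith: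
  "(1 :: 3) + 1 = 2" "(2 :: 3) + 1 = 3" "(3 :: 3) + 1 = 1"
  "(1 :: 3) + 2 = 3" "(2 :: 3) + 2 = 1" "(3 :: 3) + 2 = 2"
  by simp_all

lemma axis3_distinct: "(a :: 3) + 1 \<noteq> a" "a + 2 \<noteq> a" "a + 2 \<noteq> a + 1"
  by (cases rule: disjE[OF exhaust_3[of a]]; auto)+

lemma axis3_cases: "(i :: 3) = a \<or> i = a + 1 \<or> i = a + 2"
  using exhaust_3[of a] exhaust_3[of i] by (elim disjE; simp)

lemma axis3_forall: "(\<forall>i :: 3. P i) \<longleftrightarrow> P a \<and> P (a + 1) \<and> P (a + 2)"
  by (metis axis3_cases)

lemma sphere_point_coords:
  assumes "norm \<omega> = 1"
  shows "sphere_point a (colat a \<omega>) (longi a \<omega>) = \<omega>"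
    and "sin (colat a \<omega>) * cos (longi a \<omega>) = \<omega> $ (a + 1)"
    and "sin (colat a \<omega>) * sin (longi a \<omega>) = \<omega> $ (a + 2)"
proof -
  have *: "(\<omega> $ 1)\<^sup>2 + (\<omega> $ 2)\<^sup>2 + (\<omega> $ 3)\<^sup>2 = 1"
    using assms by (simp add: norm_eq_1 inner_vec_def sum_3 power2_eq_square)
  have sq: "(\<omega> $ a)\<^sup>2 + (\<omega> $ (a + 1))\<^sup>2 + (\<omega> $ (a + 2))\<^sup>2 = 1"
    using exhaust_3[of a] by (elim disjE; simp only: axis3_arith; use * in linarith)
  have abs1: "\<bar>\<omega> $ a\<bar> \<le> 1"
    using component_le_norm_cart[of \<omega> a] assms by simp
  define z where "z = Complex (\<omega> $ (a + 1)) (\<omega> $ (a + 2))"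
  have "1 - (\<omega> $ a)\<^sup>2 = (\<omega> $ (a + 1))\<^sup>2 + (\<omega> $ (a + 2))\<^sup>2"
    using sq by linarith
  then have sin_eq: "sin (colat a \<omega>) = cmod z"
    using abs1 by (simp add: colat_def z_def sin_arccos_abs complex_norm)
  have "rcis (cmod z) (longi a \<omega>) = z"
    unfolding longi_def z_def by (rule rcis_cmod_Arg)
  then have "Re z = cmod z * cos (longi a \<omega>)" "Im z = cmod z * sin (longi a \<omega>)"
    by (metis Re_rcis, metis Im_rcis)
  then show 2: "sin (colat a \<omega>) * cos (longi a \<omega>) = \<omega> $ (a + 1)"
    and 3: "sin (colat a \<omega>) * sin (longi a \<omega>) = \<omega> $ (a + 2)"
    by (simp_all only: sin_eq) (simp_all add: z_def)
  have 1: "cos (colat a \<omega>) = \<omega> $ a"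
    using abs1 by (simp add: colat_def cos_arccos_abs)
  show "sphere_point a (colat a \<omega>) (longi a \<omega>) = \<omega>"
    unfolding vec_eq_iff axis3_forall[of _ a]
    by (simp add: sphere_point_def axis3_distinct 1 2 3)
qed

lemma tangent_field_eq_cross3:
  assumes "norm \<omega> = 1"
  shows "tangent_field a \<omega> = cross3 (axis a 1) \<omega>"
proof -
  let ?\<theta> = "colat a \<omega>" and ?\<phi> = "longi a \<omega>"
  define D :: "real ^ 3" where
    "D = (\<chi> i. if i = a then 0 else if i = a + 1 then - (\<omega> $ (a + 2)) else \<omega> $ (a + 1))"
  note d = sphere_point_coords(2,3)[OF assms, of a, symmetric]
  have *: "((\<lambda>x. sphere_point a ?\<theta> x $ i) has_real_derivative D $ i) (at ?\<phi>)" for i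
    unfolding sphere_point_def D_def d
    by (cases "i = a"; cases "i = a + 1") (auto intro!: derivative_eq_intros)
  have "(sphere_point a ?\<theta> has_vector_derivative D) (at ?\<phi>)"
    unfolding has_vector_derivative_def
    by (subst has_derivative_componentwise_within)
      (use * in \<open>auto simp: Basis_vec_def inner_axis has_field_derivative_def mult_commute_abs\<close>)
  then have "tangent_field a \<omega> = D"
    unfolding tangent_field_def by (rule vector_derivative_at)
  also have "D = cross3 (axis a 1) \<omega>"
    using exhaust_3[of a]
    by (elim disjE; simp only: D_def axis3_arith; simp add: vec_eq_iff forall_3 cross3_def axis_def)
  finally show ?thesis .
qed

text \<open>
  The sphere carries the normalised surface measure, of total mass 1, both here and in the
  normalisation of the spherical harmonics.  This is what makes the constant function 1 equal to
  \<open>y\<^sub>0\<^sub>0\<close>, so that a function is identically 1 iff its spherical harmonics coefficients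
  are \<open>\<delta>\<^sub>l\<^sub>0 \<delta>\<^sub>m\<^sub>0\<close>.  (For the surface measure of mass \<open>4\<pi>\<close> one has instead
  \<open>y\<^sub>0\<^sub>0 = 1 / sqrt (4\<pi>)\<close>.)
\<close>

definition sphere_integral :: "(real ^ 3 \<Rightarrow> complex) \<Rightarrow> complex" where
  "sphere_integral g =
     of_real (1 / (4 * pi)) *
     (LINT \<phi>:{0..2 * pi}|lborel. LINT \<theta>:{0..pi}|lborel. of_real (sin \<theta>) * g (sphere_point 3 \<theta> \<phi>))"


section \<open>Spherical harmonics\<close>

text \<open>Rodrigues' formula.\<close>

definition legendre_poly :: "nat \<Rightarrow> real poly" where
  "legendre_poly l = smult (1 / (2 ^ l * fact l)) ((pderiv ^^ l) ([:-1, 0, 1:] ^ l))"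

text \<open>With the Condon--Shortley phase \<open>(-1)\<^sup>m\<close>.\<close>

definition assoc_legendre_nonneg :: "nat \<Rightarrow> nat \<Rightarrow> real \<Rightarrow> real" where
  "assoc_legendre_nonneg l m x =
     (- 1) ^ m * sqrt (1 - x\<^sup>2) ^ m * poly ((pderiv ^^ m) (legendre_poly l)) x"

definition assoc_legendre :: "nat \<Rightarrow> int \<Rightarrow> real \<Rightarrow> real" where
  "assoc_legendre l m x =
     (if 0 \<le> m then assoc_legendre_nonneg l (nat m) x
      else (- 1) ^ nat (- m) * (fact (nat (int l + m)) / fact (nat (int l - m))) *
           assoc_legendre_nonneg l (nat (- m)) x)"

text \<open>The constant is the one for the normalised surface measure, hence without \<open>1 / (4\<pi>)\<close>.\<close>

definition sph_harm :: "nat \<Rightarrow> int \<Rightarrow> real ^ 3 \<Rightarrow> complex" where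
  "sph_harm l m \<omega> =
     of_real (sqrt ((2 * real l + 1) * fact (nat (int l - m)) / fact (nat (int l + m)))) *
     of_real (assoc_legendre l m (cos (colat 3 \<omega>))) *
     exp (\<i> * of_int m * of_real (longi 3 \<omega>))"

definition sph_prod_coeff ::
    "nat \<Rightarrow> int \<Rightarrow> nat \<Rightarrow> int \<Rightarrow> nat \<Rightarrow> int \<Rightarrow> complex" where
  "sph_prod_coeff l1 m1 l2 m2 l m =
     sphere_integral (\<lambda>\<omega>. sph_harm l1 m1 \<omega> * sph_harm l2 m2 \<omega> * cnj (sph_harm l m \<omega>))"

text \<open>\<open>w G\<^sup>l\<^sup>m w\<close>; it is bilinear, there is no conjugation.\<close>

definition sph_prod_form :: "nat \<Rightarrow> (nat \<Rightarrow> int \<Rightarrow> complex) \<Rightarrow> nat \<Rightarrow> int \<Rightarrow> complex" where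
  "sph_prod_form L w l m =
     (\<Sum>l1\<le>L. \<Sum>m1\<in>{- int l1..int l1}. \<Sum>l2\<le>L. \<Sum>m2\<in>{- int l2..int l2}.
        w l1 m1 * sph_prod_coeff l1 m1 l2 m2 l m * w l2 m2)"

definition sph_window :: "nat \<Rightarrow> (nat \<Rightarrow> int \<Rightarrow> complex) \<Rightarrow> real ^ 3 \<Rightarrow> complex" where
  "sph_window L \<kappa> \<omega> = (\<Sum>l\<le>L. \<Sum>m\<in>{- int l..int l}. \<kappa> l m * sph_harm l m \<omega>)"

text \<open>
  Wigner-D matrix: the \<open>(m, m')\<close> entry in degree \<open>l\<close> of the rotation operator
  \<open>f \<mapsto> f \<circ> Q\<^sup>-\<^sup>1\<close>, which moves a window centred at \<open>\<omega>\<close> to one centred at \<open>Q \<omega>\<close>.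
\<close>

definition wigner_D :: "real ^ 3 ^ 3 \<Rightarrow> nat \<Rightarrow> int \<Rightarrow> int \<Rightarrow> complex" where
  "wigner_D Q l m m' =
     sphere_integral (\<lambda>\<omega>. sph_harm l m' (matrix_inv Q *v \<omega>) * cnj (sph_harm l m \<omega>))"

definition rotated_coeffs ::
    "real ^ 3 ^ 3 \<Rightarrow> (nat \<Rightarrow> int \<Rightarrow> complex) \<Rightarrow> nat \<Rightarrow> int \<Rightarrow> complex" where
  "rotated_coeffs Q \<kappa> l m = (\<Sum>m'\<in>{- int l..int l}. wigner_D Q l m m' * \<kappa> l m')"


section \<open>Square integrable divergence free vector fields\<close>

text \<open>
  The divergence is taken in the weak sense, against real test functions \<open>f\<close> of class \<open>C\<^sup>1\<close>
  with compact support; \<open>g\<close> is the gradient of \<open>f\<close>.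
\<close>

definition weakly_divergence_free :: "(real ^ 3 \<Rightarrow> complex ^ 3) \<Rightarrow> bool" where
  "weakly_divergence_free u \<longleftrightarrow>
     (\<forall>(f :: real ^ 3 \<Rightarrow> real) g.
        (\<forall>x. (f has_derivative (\<lambda>v. g x \<bullet> v)) (at x)) \<and> continuous_on UNIV g \<and>
        compact (closure {x. f x \<noteq> 0}) \<longrightarrow>
        (LINT x|lborel. (\<Sum>i\<in>UNIV. u x $ i * of_real (g x $ i))) = 0)"

definition L2_div :: "(real ^ 3 \<Rightarrow> complex ^ 3) set" where
  "L2_div = {u. u \<in> borel_measurable lborel \<and>
                integrable lborel (\<lambda>x. (norm (u x))\<^sup>2) \<and> weakly_divergence_free u}"

definition L2_inner :: "(real ^ 3 \<Rightarrow> complex ^ 3) \<Rightarrow> (real ^ 3 \<Rightarrow> complex ^ 3) \<Rightarrow> complex" where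
  "L2_inner u v = (LINT y|lborel. (\<Sum>i\<in>UNIV. u y $ i * cnj (v y $ i)))"

text \<open>
  Unconditional convergence in \<open>L\<^sub>2\<close> norm.  The extended nonnegative integral is \<open>\<infinity>\<close>, not 0,
  on a difference that is not square integrable.
\<close>

definition has_L2_sum ::
    "('i \<Rightarrow> real ^ 3 \<Rightarrow> complex ^ 3) \<Rightarrow> (real ^ 3 \<Rightarrow> complex ^ 3) \<Rightarrow> 'i set \<Rightarrow> bool" where
  "has_L2_sum f u I \<longleftrightarrow>
     ((\<lambda>F. \<integral>\<^sup>+ x. ennreal ((norm (u x - (\<Sum>i\<in>F. f i x)))\<^sup>2) \<partial>lborel) \<longlongrightarrow> 0)
       (finite_subsets_at_top I)"


section \<open>Divergence free polar wavelets\<close>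

definition mother_wavelet_hat ::
    "nat \<Rightarrow> (nat \<Rightarrow> int \<Rightarrow> complex) \<Rightarrow> (real \<Rightarrow> complex) \<Rightarrow> 3 \<Rightarrow> real ^ 3 \<Rightarrow> complex ^ 3" where
  "mother_wavelet_hat L \<kappa> h a \<xi> =
     (\<chi> i. - \<i> * sph_window L \<kappa> (sgn \<xi>) * h (norm \<xi>) * of_real (tangent_field a (sgn \<xi>) $ i))"

text \<open>Inverse of the unitary Fourier transform, componentwise, on integrable fields.\<close>

definition inv_fourier :: "(real ^ 3 \<Rightarrow> complex ^ 3) \<Rightarrow> real ^ 3 \<Rightarrow> complex ^ 3" where
  "inv_fourier F x =
     (\<chi> i. of_real ((2 * pi) powr (- 3 / 2)) *
           (LINT \<xi>|lborel. F \<xi> $ i * exp (\<i> * of_real (x \<bullet> \<xi>))))"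

definition mother_wavelet ::
    "nat \<Rightarrow> (nat \<Rightarrow> int \<Rightarrow> complex) \<Rightarrow> (real \<Rightarrow> complex) \<Rightarrow> 3 \<Rightarrow> real ^ 3 \<Rightarrow> complex ^ 3" where
  "mother_wavelet L \<kappa> h a = inv_fourier (mother_wavelet_hat L \<kappa> h a)"

text \<open>
  A rotation acts on vector fields by transforming both the argument and the values.  Composition
  with a rotation of the argument alone would not preserve divergence freeness.
\<close>

definition rotate_field ::
    "real ^ 3 ^ 3 \<Rightarrow> (real ^ 3 \<Rightarrow> complex ^ 3) \<Rightarrow> real ^ 3 \<Rightarrow> complex ^ 3" where
  "rotate_field Q f x = map_matrix of_real Q *v f (matrix_inv Q *v x)"

definition frame_function ::
    "real ^ 3 ^ 3 \<Rightarrow> (real ^ 3 \<Rightarrow> complex ^ 3) \<Rightarrow> int \<Rightarrow> int ^ 3 \<Rightarrow> real ^ 3 \<Rightarrow> complex ^ 3" where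
  "frame_function Q \<psi> j k x =
     (2 powr (3 * real_of_int j / 2) / (2 * pi) powr (3 / 2)) *\<^sub>R
       rotate_field Q \<psi> ((2 powi j) *\<^sub>R x - (\<chi> i. real_of_int (k $ i)))"

end

theory Submission
  imports Defs "HOL-Probability.Characteristic_Functions"
begin

text \<open>
  Let \<open>W\<close> be the angular window and \<open>W\<^sub>t\<close> its rotation to the orientation \<open>t\<close>.  On the Fourier side
  the wavelet of axis \<open>a\<close> is the scalar \<open>-\<i> W(\<omega>) h(|\<xi>|)\<close>, with \<open>\<omega> = \<xi>/|\<xi>|\<close>, times the real vector
  \<open>e\<^sub>a \<times> \<omega>\<close>.  The three vectors \<open>e\<^sub>a \<times> \<omega>\<close> and the vector \<open>\<omega>\<close> form a tight frame of \<open>\<complex>\<^sup>3\<close>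
  (\<open>cross_axis_tight_frame\<close>).  So a fourth, longitudinal family is added, with the same scalar and
  the direction \<open>\<omega>\<close>.  The four families together satisfy Parseval's identity on all of \<open>L\<^sub>2\<close>, whereas
  the members of the fourth are gradients and hence orthogonal to every divergence free field.
  For a divergence free \<open>u\<close> only the three given families contribute, and Parseval's identity
  for \<open>u\<close> together with the Bessel inequality gives the expansion (\<open>frame_reconstruction\<close>).

  Parseval's identity for the four families (\<open>extended_parseval\<close>) is a sum carried out in four steps.
  For fixed scale, orientation and family, the inner products with the translates are the Fourier
  coefficients of a function which, by the band limit, lives in the cube \<open>[-\<pi>, \<pi>]\<^sup>3\<close>; the sum of
  their squares is an integral over frequency (\<open>translates_square_sum\<close>).  Under the integral
  the sum over the four families gives \<open>|W\<^sub>t|\<^sup>2 |h|\<^sup>2\<close> times the square of the length of the transform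
  of \<open>u\<close>, the sum over \<open>t\<close> removes \<open>|W\<^sub>t|\<^sup>2\<close>, the sum over the scales removes \<open>|h|\<^sup>2\<close> by the Calderon
  condition, and what is left is the norm of \<open>u\<close> by Plancherel's theorem.

  The identity \<open>\<Sum>\<^sub>t |W\<^sub>t|\<^sup>2 = 1\<close> is the meaning of the condition on the product coefficients
  (\<open>sum_windows_squared\<close>).  The form \<open>w G\<^sup>l\<^sup>m w\<close> is the coefficient of degree \<open>l\<close> and order \<open>m\<close> of the
  square of the window with coefficients \<open>w\<close>, so the condition says that \<open>\<Sum>\<^sub>t W\<^sub>t\<^sup>2\<close> has the
  coefficients of the constant 1; and \<open>W\<^sub>t\<^sup>2 = |W\<^sub>t|\<^sup>2\<close> since the window is real.  That the Wigner
  matrices turn the coefficients of \<open>W\<close> into those of \<open>W\<^sub>t\<close> requires that a rotated harmonic of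
  degree \<open>l\<close> is a combination of harmonics of degree \<open>l\<close> (\<open>sph_harm_rotated\<close>).  This follows from the
  orthonormality of the harmonics, the fact that those of degree at most \<open>n\<close> span the polynomials
  of degree at most \<open>n\<close> on the sphere, and the rotation invariance of the spherical mean in
  geographic coordinates.  The last is obtained by comparing moments: on homogeneous polynomials of
  degree \<open>d\<close> the spherical mean is a multiple of the mean with respect to a Gaussian weight.

  Plancherel's theorem itself is reduced to Parseval's identity for Fourier series on the cube:
  the transform of a function supported in the cube is sampled on the lattice shifted by \<open>s\<close>, and the
  square sum is then integrated over \<open>s\<close> in the unit cube.
\<close>

section \<open>Square integrable functions\<close>

definition square_integrable :: "'a measure \<Rightarrow> ('a \<Rightarrow> 'b::{real_normed_vector, second_countable_topology}) \<Rightarrow> bool" where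
  "square_integrable M f \<longleftrightarrow> f \<in> borel_measurable M \<and> integrable M (\<lambda>x. (norm (f x))\<^sup>2)"

lemma square_integrable_measurable [measurable_dest]: "square_integrable M f \<Longrightarrow> f \<in> borel_measurable M"
  by (simp add: square_integrable_def)

lemma norm_add_sq_le: "(norm (a + b))\<^sup>2 \<le> 2 * (norm a)\<^sup>2 + 2 * (norm (b::'a::real_normed_vector))\<^sup>2"
proof -
  have "(norm (a + b))\<^sup>2 \<le> (norm a + norm b)\<^sup>2"
    by (simp add: norm_triangle_ineq power_mono)
  also have "\<dots> \<le> 2 * (norm a)\<^sup>2 + 2 * (norm b)\<^sup>2"
    using sum_squares_bound[of "norm a" "norm b"] by (simp add: power2_sum)
  finally show ?thesis .
qed

lemma two_mult_le_weighted:
  fixes a b d :: real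
  assumes "d > 0" shows "2 * a * b \<le> d * a\<^sup>2 + b\<^sup>2 / d"
proof -
  have "d * a\<^sup>2 + b\<^sup>2 / d - 2 * a * b = (d * a - b)\<^sup>2 / d"
    using assms by (simp add: field_simps power2_eq_square)
  moreover have "0 \<le> (d * a - b)\<^sup>2 / d" using assms by simp
  ultimately show ?thesis by (metis diff_ge_0_iff_ge)
qed

lemma square_integrable_bound:
  assumes "square_integrable M g" "f \<in> borel_measurable M" "\<And>x. x \<in> space M \<Longrightarrow> norm (f x) \<le> c * norm (g x)"
  shows "square_integrable M f"
  unfolding square_integrable_def
proof
  show "integrable M (\<lambda>x. (norm (f x))\<^sup>2)"
  proof (rule Bochner_Integration.integrable_bound)
    show "integrable M (\<lambda>x. c\<^sup>2 * (norm (g x))\<^sup>2)"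
      using assms(1) by (simp add: square_integrable_def)
    show "AE x in M. norm ((norm (f x))\<^sup>2) \<le> norm (c\<^sup>2 * (norm (g x))\<^sup>2)"
    proof (rule AE_I2)
      fix x assume "x \<in> space M"
      then have "(norm (f x))\<^sup>2 \<le> (c * norm (g x))\<^sup>2"
        using assms(3) by (intro power_mono) auto
      then show "norm ((norm (f x))\<^sup>2) \<le> norm (c\<^sup>2 * (norm (g x))\<^sup>2)"
        by (simp add: power_mult_distrib abs_mult)
    qed
  qed (use assms in measurable)
qed fact

lemma square_integrable_zero [simp]: "square_integrable M (\<lambda>x. 0)"
  by (simp add: square_integrable_def)

lemma square_integrable_add:
  assumes f: "square_integrable M f" and g: "square_integrable M g"
  shows "square_integrable M (\<lambda>x. f x + g x)"
  unfolding square_integrable_def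
proof
  note [measurable] = square_integrable_measurable[OF f] square_integrable_measurable[OF g]
  show "(\<lambda>x. f x + g x) \<in> borel_measurable M" by measurable
  show "integrable M (\<lambda>x. (norm (f x + g x))\<^sup>2)"
  proof (rule Bochner_Integration.integrable_bound)
    show "integrable M (\<lambda>x. 2 * (norm (f x))\<^sup>2 + 2 * (norm (g x))\<^sup>2)"
      using f g by (simp add: square_integrable_def)
    show "AE x in M. norm ((norm (f x + g x))\<^sup>2) \<le> norm (2 * (norm (f x))\<^sup>2 + 2 * (norm (g x))\<^sup>2)"
      using norm_add_sq_le by (intro AE_I2) force
  qed measurable
qed

lemma square_integrable_scaleR:
  "square_integrable M f \<Longrightarrow> square_integrable M (\<lambda>x. c *\<^sub>R f x)"
  by (auto simp: square_integrable_def power_mult_distrib)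

lemma square_integrable_mult_left:
  fixes c :: "'b::{real_normed_div_algebra, second_countable_topology}"
  shows "square_integrable M f \<Longrightarrow> square_integrable M (\<lambda>x. c * f x)"
  by (auto simp: square_integrable_def power_mult_distrib norm_mult)

lemma square_integrable_diff:
  assumes f: "square_integrable M f" and g: "square_integrable M g"
  shows "square_integrable M (\<lambda>x. f x - g x)"
  using square_integrable_add[OF f square_integrable_scaleR[OF g, of "-1"]] by simp

lemma square_integrable_sum:
  assumes "\<And>i. i \<in> I \<Longrightarrow> square_integrable M (f i)"
  shows "square_integrable M (\<lambda>x. \<Sum>i\<in>I. f i x)"
  using assms by (induction I rule: infinite_finite_induct) (auto intro: square_integrable_add)

lemma integrable_norm_sq: "square_integrable M f \<Longrightarrow> integrable M (\<lambda>x. (norm (f x))\<^sup>2)"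
  by (simp add: square_integrable_def)

lemma integrable_norm_mult:
  assumes f: "square_integrable M f" and g: "square_integrable M g"
  shows "integrable M (\<lambda>x. norm (f x) * norm (g x))"
proof (rule Bochner_Integration.integrable_bound)
  note [measurable] = square_integrable_measurable[OF f] square_integrable_measurable[OF g]
  show "integrable M (\<lambda>x. (norm (f x))\<^sup>2 + (norm (g x))\<^sup>2)"
    using f g by (simp add: square_integrable_def)
  show "AE x in M. norm (norm (f x) * norm (g x)) \<le> norm ((norm (f x))\<^sup>2 + (norm (g x))\<^sup>2)"
  proof (rule AE_I2)
    fix x
    have "2 * (norm (f x) * norm (g x)) \<le> (norm (f x))\<^sup>2 + (norm (g x))\<^sup>2"
      using sum_squares_bound[of "norm (f x)" "norm (g x)"] by simp
    moreover have "0 \<le> norm (f x) * norm (g x)" by simp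
    ultimately show "norm (norm (f x) * norm (g x)) \<le> norm ((norm (f x))\<^sup>2 + (norm (g x))\<^sup>2)"
      by (simp only: real_norm_def abs_of_nonneg)
  qed
  show "(\<lambda>x. norm (f x) * norm (g x)) \<in> borel_measurable M" by measurable
qed

lemma borel_measurable_cnj [measurable (raw)]:
  "f \<in> borel_measurable M \<Longrightarrow> (\<lambda>x. cnj (f x)) \<in> borel_measurable M"
  by (rule measurable_compose[of f M borel cnj])
    (auto intro!: borel_measurable_continuous_onI continuous_intros)

lemma integrable_cnj_mult:
  fixes f g :: "'a \<Rightarrow> complex"
  assumes f: "square_integrable M f" and g: "square_integrable M g"
  shows "integrable M (\<lambda>x. f x * cnj (g x))"
proof (rule Bochner_Integration.integrable_bound[OF integrable_norm_mult[OF f g]])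
  note [measurable] = square_integrable_measurable[OF f] square_integrable_measurable[OF g]
  show "(\<lambda>x. f x * cnj (g x)) \<in> borel_measurable M" by measurable
qed (simp add: norm_mult)

lemma square_integrable_finite_measure:
  fixes f :: "'a \<Rightarrow> 'b::{real_normed_vector, second_countable_topology}"
  assumes "finite_measure M" "f \<in> borel_measurable M" "\<And>x. norm (f x) \<le> B"
  shows "square_integrable M f"
proof -
  interpret finite_measure M by fact
  have "integrable M (\<lambda>x. (norm (f x))\<^sup>2)"
  proof (rule integrable_const_bound[where B="B\<^sup>2"])
    show "AE x in M. norm ((norm (f x))\<^sup>2) \<le> B\<^sup>2"
      using assms(3) by (intro AE_I2) (auto intro: power_mono)
  qed (use assms in measurable)
  then show ?thesis using assms by (simp add: square_integrable_def)
qed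

lemma square_integrable_dominated_convergence:
  fixes f :: "'a \<Rightarrow> 'b::{real_normed_vector, second_countable_topology}"
  assumes g: "square_integrable M g" and f: "f \<in> borel_measurable M" 
    and s: "\<And>n. s n \<in> borel_measurable M"
    and lim: "\<And>x. x \<in> space M \<Longrightarrow> (\<lambda>n. s n x) \<longlonglongrightarrow> f x"
    and bound: "\<And>n x. x \<in> space M \<Longrightarrow> norm (f x - s n x) \<le> norm (g x)"
  shows "(\<lambda>n. LINT x|M. (norm (f x - s n x))\<^sup>2) \<longlonglongrightarrow> 0"
proof -
  note [measurable] = f s
  have "(\<lambda>n. LINT x|M. (norm (f x - s n x))\<^sup>2) \<longlonglongrightarrow> (LINT x|M. 0)"
  proof (rule integral_dominated_convergence[where w="\<lambda>x. (norm (g x))\<^sup>2"])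
    show "integrable M (\<lambda>x. (norm (g x))\<^sup>2)" using g by (simp add: square_integrable_def)
    show "AE x in M. (\<lambda>n. (norm (f x - s n x))\<^sup>2) \<longlonglongrightarrow> 0"
    proof (rule AE_I2)
      fix x assume "x \<in> space M"
      then have "(\<lambda>n. f x - s n x) \<longlonglongrightarrow> f x - f x" by (intro tendsto_intros lim)
      then show "(\<lambda>n. (norm (f x - s n x))\<^sup>2) \<longlonglongrightarrow> 0"
        using tendsto_power[OF tendsto_norm, of "\<lambda>n. f x - s n x" 0 sequentially 2] by simp
    qed
    show "AE x in M. norm ((norm (f x - s n x))\<^sup>2) \<le> (norm (g x))\<^sup>2" for n
      using bound by (intro AE_I2) (auto intro: power_mono)
  qed measurable
  then show ?thesis by simp
qed

section \<open>Density of a linear space of functions in mean square\<close>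

definition L2_closure :: "'a measure \<Rightarrow> ('a \<Rightarrow> complex) set \<Rightarrow> ('a \<Rightarrow> complex) set" where
  "L2_closure M V = {f. square_integrable M f \<and>
     (\<forall>e>0. \<exists>g\<in>V. square_integrable M g \<and> (LINT x|M. (norm (f x - g x))\<^sup>2) < e)}"

text \<open>
  The squared distance satisfies a triangle inequality up to the factor 2, which is harmless for
  questions of approximation.
\<close>

lemma L2_dist_triangle:
  assumes f: "square_integrable M f" and g: "square_integrable M g" and h: "square_integrable M h"
  shows "(LINT x|M. (norm (f x - h x))\<^sup>2) \<le> 2 * (LINT x|M. (norm (f x - g x))\<^sup>2) + 2 * (LINT x|M. (norm (g x - h x))\<^sup>2)"
proof -
  note i = integrable_norm_sq[OF square_integrable_diff]
  have "(LINT x|M. (norm (f x - h x))\<^sup>2) \<le> (LINT x|M. 2 * (norm (f x - g x))\<^sup>2 + 2 * (norm (g x - h x))\<^sup>2)"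
  proof (rule integral_mono)
    show "(norm (f x - h x))\<^sup>2 \<le> 2 * (norm (f x - g x))\<^sup>2 + 2 * (norm (g x - h x))\<^sup>2" for x
      using norm_add_sq_le[of "f x - g x" "g x - h x"] by simp
  qed (intro i f g h Bochner_Integration.integrable_add integrable_mult_right)+
  then show ?thesis
    using i[OF f g] i[OF g h] by simp
qed

lemma L2_closureI:
  assumes f: "square_integrable M f"
    and "\<And>e. e > 0 \<Longrightarrow> \<exists>g\<in>L2_closure M V. (LINT x|M. (norm (f x - g x))\<^sup>2) < e"
  shows "f \<in> L2_closure M V"
  unfolding L2_closure_def
proof (intro CollectI conjI allI impI f)
  fix e :: real assume "e > 0"
  then obtain g where g: "g \<in> L2_closure M V" "(LINT x|M. (norm (f x - g x))\<^sup>2) < e / 4"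
    using assms(2)[of "e/4"] by auto
  with \<open>e > 0\<close> obtain h where h: "h \<in> V" "square_integrable M h" "(LINT x|M. (norm (g x - h x))\<^sup>2) < e / 4"
    unfolding L2_closure_def by (auto dest: spec[of _ "e/4"])
  have "(LINT x|M. (norm (f x - h x))\<^sup>2) < e"
    using L2_dist_triangle[of M f g h] f g h by (auto simp: L2_closure_def)
  with h show "\<exists>g\<in>V. square_integrable M g \<and> (LINT x|M. (norm (f x - g x))\<^sup>2) < e" by blast
qed

lemma L2_closure_lim:
  assumes f: "square_integrable M f" and s: "\<And>n::nat. s n \<in> L2_closure M V"
    and lim: "(\<lambda>n. LINT x|M. (norm (f x - s n x))\<^sup>2) \<longlonglongrightarrow> 0"
  shows "f \<in> L2_closure M V"
proof (rule L2_closureI[OF f])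
  fix e :: real assume "e > 0"
  with order_tendstoD(2)[OF lim] have "\<exists>n. (LINT x|M. (norm (f x - s n x))\<^sup>2) < e"
    by (auto simp: eventually_sequentially)
  with s show "\<exists>g\<in>L2_closure M V. (LINT x|M. (norm (f x - g x))\<^sup>2) < e" by blast
qed

lemma L2_closure_subset: "f \<in> V \<Longrightarrow> square_integrable M f \<Longrightarrow> f \<in> L2_closure M V"
  unfolding L2_closure_def by (auto intro!: bexI[of _ f])

lemma L2_closure_add:
  assumes V: "\<And>f g. f \<in> V \<Longrightarrow> g \<in> V \<Longrightarrow> (\<lambda>x. f x + g x) \<in> V"
    and f: "f \<in> L2_closure M V" and g: "g \<in> L2_closure M V"
  shows "(\<lambda>x. f x + g x) \<in> L2_closure M V"
  unfolding L2_closure_def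
proof (intro CollectI conjI allI impI)
  show "square_integrable M (\<lambda>x. f x + g x)"
    using f g by (auto simp: L2_closure_def intro: square_integrable_add)
  fix e :: real assume "e > 0"
  with f g obtain f' g' where h: "f' \<in> V" "square_integrable M f'" "(LINT x|M. (norm (f x - f' x))\<^sup>2) < e / 4"
    "g' \<in> V" "square_integrable M g'" "(LINT x|M. (norm (g x - g' x))\<^sup>2) < e / 4"
    unfolding L2_closure_def by (auto dest!: spec[of _ "e/4"])
  have sq: "square_integrable M f" "square_integrable M g" using f g by (auto simp: L2_closure_def)
  have "(LINT x|M. (norm (f x + g x - (f' x + g' x)))\<^sup>2) \<le> 2 * (LINT x|M. (norm (f x + g x - (f' x + g x)))\<^sup>2) + 2 * (LINT x|M. (norm (f' x + g x - (f' x + g' x)))\<^sup>2)"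
    using sq h by (intro L2_dist_triangle square_integrable_add)
  then have "(LINT x|M. (norm (f x + g x - (f' x + g' x)))\<^sup>2) < e" using h by simp
  then show "\<exists>h\<in>V. square_integrable M h \<and> (LINT x|M. (norm (f x + g x - h x))\<^sup>2) < e"
    using h V by (intro bexI[of _ "\<lambda>x. f' x + g' x"]) (auto intro: square_integrable_add)
qed

lemma L2_closure_scale:
  assumes V: "\<And>f. f \<in> V \<Longrightarrow> (\<lambda>x. c * f x) \<in> V" and f: "f \<in> L2_closure M V"
  shows "(\<lambda>x. c * f x) \<in> L2_closure M V"
  unfolding L2_closure_def
proof (intro CollectI conjI allI impI)
  show "square_integrable M (\<lambda>x. c * f x)"
    using f by (auto simp: L2_closure_def intro: square_integrable_mult_left)
  fix e :: real assume e: "e > 0"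
  define d where "d = e / ((norm c)\<^sup>2 + 1)"
  have c1: "(norm c)\<^sup>2 + 1 > 0" by (rule add_nonneg_pos) auto
  have "d > 0" using e c1 by (simp add: d_def)
  with f obtain f' where h: "f' \<in> V" "square_integrable M f'" "(LINT x|M. (norm (f x - f' x))\<^sup>2) < d"
    unfolding L2_closure_def by auto
  have "(LINT x|M. (norm (c * f x - c * f' x))\<^sup>2) = (norm c)\<^sup>2 * (LINT x|M. (norm (f x - f' x))\<^sup>2)"
    by (simp add: right_diff_distrib[symmetric] norm_mult power_mult_distrib)
  also have "\<dots> \<le> (norm c)\<^sup>2 * d" using h by (intro mult_left_mono) auto
  also have "\<dots> < ((norm c)\<^sup>2 + 1) * d" using \<open>d > 0\<close> by simp
  also have "\<dots> = e" using c1 by (simp add: d_def)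
  finally show "\<exists>g\<in>V. square_integrable M g \<and> (LINT x|M. (norm (c * f x - g x))\<^sup>2) < e"
    using h V by (intro bexI[of _ "\<lambda>x. c * f' x"]) (auto intro: square_integrable_mult_left)
qed

lemma L2_closure_sum:
  assumes V: "\<And>f g. f \<in> V \<Longrightarrow> g \<in> V \<Longrightarrow> (\<lambda>x. f x + g x) \<in> V" and z: "(\<lambda>x. 0) \<in> V"
    and f: "finite I" "\<And>i. i \<in> I \<Longrightarrow> f i \<in> L2_closure M V"
  shows "(\<lambda>x. \<Sum>i\<in>I. f i x) \<in> L2_closure M V"
  using f
proof (induction I rule: finite_induct)
  case empty
  then show ?case using L2_closure_subset[OF z] by simp
next
  case (insert i I)
  have "(\<lambda>x. f i x + (\<Sum>i\<in>I. f i x)) \<in> L2_closure M V"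
    by (rule L2_closure_add) (use V insert in auto)
  then show ?case using insert by simp
qed

text \<open>
  By Dynkin's lemma it is enough to approximate the indicators of open sets: the sets with
  approximable indicator form a Dynkin system, and simple functions are dense.  The map \<open>p\<close> into a
  topological space allows approximation by functions that are continuous only after composition
  with \<open>p\<close>; it will be the map of the cube to the torus.
\<close>

lemma L2_closure_eq_of_open_indicators:
  fixes p :: "'a \<Rightarrow> 'b::topological_space"
  assumes fin: "finite_measure M" and p: "p \<in> borel_measurable M"
    and V: "\<And>f g. f \<in> V \<Longrightarrow> g \<in> V \<Longrightarrow> (\<lambda>x. f x + g x) \<in> V" "\<And>f c. f \<in> V \<Longrightarrow> (\<lambda>x. c * f x) \<in> V"
    and op: "\<And>U. open U \<Longrightarrow> (\<lambda>x. of_real (indicator U (p x))) \<in> L2_closure M V"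
    and f: "square_integrable M f" and f_eq: "f = (\<lambda>x. g (p x))" and g: "g \<in> borel_measurable borel"
  shows "f \<in> L2_closure M V"
proof -
  interpret finite_measure M by fact
  note [measurable] = p g
  note add = L2_closure_add[OF V(1)]
  note scale = L2_closure_scale[OF V(2)]
  have z: "(\<lambda>x. 0) \<in> V"
  proof -
    have "\<exists>f. f \<in> V" using op[of "{}"] zero_less_one unfolding L2_closure_def by blast
    then show ?thesis using V(2)[of _ 0] by auto
  qed
  have ind_sq: "square_integrable M (\<lambda>x. of_real (indicator B (p x)) :: complex)" if [measurable]: "B \<in> sets borel" for B
    by (rule square_integrable_finite_measure[OF fin, of _ 1]) (auto simp: indicator_def)
  have ind: "(\<lambda>x. of_real (indicator B (p x))) \<in> L2_closure M V" if "B \<in> sets borel" for B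
  proof -
    have "Int_stable {S :: 'b set. open S}" "{S :: 'b set. open S} \<subseteq> Pow UNIV"
      by (auto simp: Int_stable_def)
    moreover have "B \<in> sigma_sets UNIV {S. open S}" using that by (simp add: borel_def)
    ultimately show ?thesis
    proof (induction B rule: sigma_sets_induct_disjoint)
      case (basic A)
      then show ?case using op by auto
    next
      case empty
      then show ?case using op[of "{}"] by simp
    next
      case (compl A)
      \<comment> \<open>The constant 1 is itself the indicator of the open set \<open>UNIV\<close>.\<close>
      have "(\<lambda>x. of_real (indicator UNIV (p x)) + (-1) * of_real (indicator A (p x))) \<in> L2_closure M V"
        by (intro add scale op compl) auto
      also have "(\<lambda>x. of_real (indicator UNIV (p x)) + (-1) * of_real (indicator A (p x))) = (\<lambda>x. of_real (indicator (UNIV - A) (p x)) :: complex)"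
        by (auto simp: indicator_def)
      finally show ?case .
    next
      case (union A)
      define s where "s n x = (\<Sum>i<n. of_real (indicator (A i) (p x)) :: complex)" for n x
      have A[measurable]: "A i \<in> sets borel" for i using union by (auto simp: borel_def)
      have s_eq: "s n x = of_real (indicator (\<Union>i<n. A i) (p x))" for n x
      proof -
        have "indicat_real (\<Union>i<n. A i) (p x) = (\<Sum>i<n. indicat_real (A i) (p x))"
          using union(1) by (intro indicator_UN_disjoint) (auto simp: disjoint_family_on_def)
        then show ?thesis by (simp add: s_def)
      qed
      show ?case
      proof (rule L2_closure_lim[of M _ s])
        show "square_integrable M (\<lambda>x. complex_of_real (indicator (\<Union> (range A)) (p x)))"
          by (rule ind_sq) auto
        show "s n \<in> L2_closure M V" for n
          unfolding s_def by (intro L2_closure_sum[OF V(1) z] union) auto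
        show "(\<lambda>n. LINT x|M. (norm (of_real (indicator (\<Union> (range A)) (p x)) - s n x))\<^sup>2) \<longlonglongrightarrow> 0"
        proof (rule square_integrable_dominated_convergence[where g="\<lambda>x. 1::complex"])
          show "square_integrable M (\<lambda>x. 1::complex)" by (simp add: square_integrable_def)
          show "(\<lambda>n. s n x) \<longlonglongrightarrow> of_real (indicator (\<Union> (range A)) (p x))" for x
            unfolding s_eq by (intro tendsto_of_real LIMSEQ_indicator_UN)
          show "norm (of_real (indicator (\<Union> (range A)) (p x)) - s n x) \<le> norm (1::complex)" for n x
            unfolding s_eq by (auto simp: indicator_def)
          have [measurable]: "\<Union> (range A) \<in> sets borel"
            using A by (intro sets.countable_UN) auto
          show "(\<lambda>x. complex_of_real (indicator (\<Union> (range A)) (p x))) \<in> borel_measurable M"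
            by measurable
          show "s n \<in> borel_measurable M" for n
            unfolding s_def[abs_def] by measurable
        qed
      qed
    qed
  qed
  from borel_measurable_implies_sequence_metric[OF g, of 0] obtain s where
    s: "\<And>i. simple_function borel (s i)" "\<And>x. (\<lambda>i. s i x) \<longlonglongrightarrow> g x" "\<And>i x. norm (s i x) \<le> 2 * norm (g x)"
    by simp metis
  have [measurable]: "s i \<in> borel_measurable borel" for i using s(1) by (rule borel_measurable_simple_function)
  show ?thesis
  proof (rule L2_closure_lim[OF f, of "\<lambda>n x. s n (p x)"])
    fix n
    have fr: "finite (range (s n))" using s(1)[of n] by (simp add: simple_function_def)
    have "(\<lambda>x. \<Sum>c\<in>range (s n). c * of_real (indicator (s n -` {c}) (p x))) \<in> L2_closure M V"
    proof (intro L2_closure_sum[OF V(1) z fr] scale ind)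
      show "s n -` {c} \<in> sets borel" for c using measurable_sets[of "s n" borel borel "{c}"] by simp
    qed auto
    also have "(\<lambda>x. \<Sum>c\<in>range (s n). c * of_real (indicator (s n -` {c}) (p x))) = (\<lambda>x. s n (p x))"
    proof
      fix x
      have "(\<Sum>c\<in>range (s n). c * of_real (indicator (s n -` {c}) (p x))) = (\<Sum>c\<in>range (s n). if c = s n (p x) then c else 0)"
        by (intro sum.cong) auto
      then show "(\<Sum>c\<in>range (s n). c * of_real (indicator (s n -` {c}) (p x))) = s n (p x)"
        using fr by simp
    qed
    finally show "(\<lambda>x. s n (p x)) \<in> L2_closure M V" .
  next
    show "(\<lambda>n. LINT x|M. (norm (f x - s n (p x)))\<^sup>2) \<longlonglongrightarrow> 0"
    proof (rule square_integrable_dominated_convergence)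
      show "square_integrable M (\<lambda>x. 3 * f x)" using f by (rule square_integrable_mult_left)
      show "norm (f x - s n (p x)) \<le> norm (3 * f x)" for x n
        using norm_triangle_ineq4[of "f x" "s n (p x)"] s(3)[of n "p x"] by (simp add: f_eq norm_mult)
    qed (auto simp: f_eq s)
  qed
qed

section \<open>Lebesgue measure on Cartesian powers\<close>

lemma Basis_real_cart: "(Basis :: (real^'n) set) = (\<lambda>i. axis i 1) ` UNIV"
  by (auto simp: Basis_vec_def)

lemma
  fixes f :: "'n::finite \<Rightarrow> real \<Rightarrow> 'b::{real_normed_field, banach, second_countable_topology}"
  assumes f: "\<And>i. integrable lborel (f i)"
  shows integrable_lborel_cart_prod: "integrable lborel (\<lambda>x::real^'n. \<Prod>i\<in>UNIV. f i (x $ i))"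
    and integral_lborel_cart_prod: "(LINT x|lborel. (\<Prod>i\<in>UNIV. f i ((x::real^'n) $ i))) = (\<Prod>i\<in>UNIV. LINT t|lborel. f i t)"
proof -
  interpret product_sigma_finite "\<lambda>_::real^'n. lborel :: real measure" ..
  \<comment> \<open>Lebesgue measure is a product over the standard basis; \<open>ix\<close> names the basis vectors by coordinates.\<close>
  define ix :: "real^'n \<Rightarrow> 'n" where "ix b = (THE i. b = axis i 1)" for b
  have ix: "ix (axis i 1) = i" for i
    unfolding ix_def by (rule the_equality) (auto simp: axis_eq_axis)
  have inj: "inj (\<lambda>i. axis i 1 :: real^'n)" by (auto simp: inj_on_def axis_eq_axis)
  have re: "(\<Prod>i\<in>UNIV. h i) = (\<Prod>b\<in>(Basis :: (real^'n) set). h (ix b))" for h :: "'n \<Rightarrow> 'b"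
    unfolding Basis_real_cart using inj by (subst prod.reindex) (auto simp: ix)
  have co: "(\<Sum>b\<in>Basis. y b *\<^sub>R b) $ ix b' = y b'" if "b' \<in> Basis" for y and b' :: "real^'n"
  proof -
    from that obtain i where i: "b' = axis i 1" by (auto simp: Basis_real_cart)
    have "(\<Sum>b\<in>Basis. y b *\<^sub>R b) $ i = (\<Sum>b\<in>Basis. y b *\<^sub>R b) \<bullet> b'" by (simp add: i inner_axis)
    also have "\<dots> = y b'" using that by (rule inner_sum_left_Basis)
    finally show ?thesis by (simp add: i ix)
  qed
  have m: "(\<lambda>x::real^'n. \<Prod>i\<in>UNIV. f i (x $ i)) \<in> borel_measurable borel"
  proof -
    have [measurable]: "f i \<in> borel_measurable borel" for i
      using borel_measurable_integrable[OF f[of i]] by simp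
    show ?thesis by measurable
  qed
  have T: "(\<lambda>y. \<Sum>b\<in>Basis. y b *\<^sub>R b) \<in> measurable (Pi\<^sub>M (Basis :: (real^'n) set) (\<lambda>_. lborel)) borel"
    by measurable
  have cong: "(\<Prod>i\<in>UNIV. f i ((\<Sum>b\<in>Basis. y b *\<^sub>R b :: real^'n) $ i)) = (\<Prod>b\<in>Basis. f (ix b) (y b))" for y
    unfolding re by (intro prod.cong refl arg_cong[of _ _ "f _"] co)
  show "integrable lborel (\<lambda>x::real^'n. \<Prod>i\<in>UNIV. f i (x $ i))"
    unfolding lborel_eq[where 'a="real^'n"]
    by (subst integrable_distr_eq[OF T], use m in simp, unfold cong, rule product_integrable_prod)
      (simp_all add: f)
  show "(LINT x|lborel. (\<Prod>i\<in>UNIV. f i ((x::real^'n) $ i))) = (\<Prod>i\<in>UNIV. LINT t|lborel. f i t)"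
    unfolding lborel_eq[where 'a="real^'n"]
    by (subst integral_distr[OF T], use m in simp, unfold cong, subst product_integral_prod)
      (simp_all add: f re[symmetric] re[of "\<lambda>i. integral\<^sup>L lborel (f i)"])
qed

section \<open>Fourier series\<close>

definition plane_wave :: "real^'n \<Rightarrow> real^'n \<Rightarrow> complex" where
  "plane_wave \<xi> x = cis (\<xi> \<bullet> x)"

definition lattice_point :: "int^'n \<Rightarrow> real^'n" where
  "lattice_point k = (\<chi> i. real_of_int (k $ i))"

definition cube_measure :: "(real^'n) measure" where
  "cube_measure = density lborel (indicator (cbox (\<chi> i. - pi) (\<chi> i. pi)))"

lemma norm_plane_wave [simp]: "norm (plane_wave \<xi> x) = 1"
  by (simp add: plane_wave_def)

lemma borel_measurable_plane_wave [measurable (raw)]: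
  assumes [measurable]: "f \<in> borel_measurable M" "g \<in> borel_measurable M"
  shows "(\<lambda>x. plane_wave (f x) (g x)) \<in> borel_measurable M"
proof -
  have [measurable]: "cis \<in> borel_measurable borel"
    by (intro borel_measurable_continuous_onI continuous_intros)
  show ?thesis unfolding plane_wave_def by measurable
qed

lemma plane_wave_add_left: "plane_wave (\<xi> + \<eta>) x = plane_wave \<xi> x * plane_wave \<eta> x"
  by (simp add: plane_wave_def cis_mult inner_add_left)

lemma cnj_plane_wave: "cnj (plane_wave \<xi> x) = plane_wave (- \<xi>) x"
  by (simp add: plane_wave_def cis_cnj)

lemma plane_wave_0 [simp]: "plane_wave 0 x = 1" "plane_wave \<xi> 0 = 1"
  by (simp_all add: plane_wave_def)

lemma lattice_point_add: "lattice_point (k + l) = lattice_point k + lattice_point l"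
  by (simp add: lattice_point_def vec_eq_iff)

lemma lattice_point_diff: "lattice_point (k - l) = lattice_point k - lattice_point l"
  by (simp add: lattice_point_def vec_eq_iff)

lemma lattice_point_0 [simp]: "lattice_point 0 = 0"
  by (simp add: lattice_point_def vec_eq_iff)

lemma sets_cube_measure [simp, measurable_cong]: "sets cube_measure = sets borel"
  by (simp add: cube_measure_def)

lemma space_cube_measure [simp]: "space cube_measure = UNIV"
  by (simp add: cube_measure_def)

lemma finite_measure_cube_measure: "finite_measure cube_measure"
proof
  show "emeasure cube_measure (space cube_measure) \<noteq> \<infinity>"
    by (simp add: cube_measure_def emeasure_density emeasure_lborel_cbox_eq)
qed

lemma integral_cube_measure:
  fixes f :: "real^'n \<Rightarrow> 'b::{banach, second_countable_topology}"
  assumes "f \<in> borel_measurable borel"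
  shows "(LINT x|cube_measure. f x) = (LINT x|lborel. indicator (cbox (\<chi> i. - pi) (\<chi> i. pi)) x *\<^sub>R f x)"
  unfolding cube_measure_def
  using integral_density[of f lborel "indicator (cbox (\<chi> i. - pi) (\<chi> i. pi))"] assms
  by (simp add: ennreal_indicator)

lemma integral_cis_period:
  "(LINT t:{a..a + 2 * pi}|lborel. cis (of_int k * t)) = (if k = 0 then of_real (2 * pi) else 0)"
proof (cases "k = 0")
  case True
  then show ?thesis by (simp add: set_lebesgue_integral_def scaleR_conv_of_real)
next
  case False
  define F where "F t = cis (of_int k * t) / (\<i> * of_int k)" for t :: real
  have F: "(F has_vector_derivative cis (of_int k * t)) (at t within A)" for t A
  proof -
    have "((\<lambda>t. cis (of_int k * t)) has_vector_derivative (of_int k *\<^sub>R (\<i> * cis (of_int k * t)))) (at t within A)"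
      unfolding cis_conv_exp
      by (auto intro!: derivative_eq_intros has_vector_derivative_real_field simp: scaleR_conv_of_real)
    then have "(F has_vector_derivative (of_int k *\<^sub>R (\<i> * cis (of_int k * t))) / (\<i> * of_int k)) (at t within A)"
      unfolding F_def by (rule has_vector_derivative_divide)
    then show ?thesis using False by (simp add: scaleR_conv_of_real)
  qed
  have "(LINT t:{a..a + 2 * pi}|lborel. cis (of_int k * t)) = F (a + 2 * pi) - F a"
    unfolding set_lebesgue_integral_def
    by (rule integral_FTC_Icc) (auto intro!: F continuous_intros)
  also have "\<dots> = 0"
  proof -
    have "cis (of_int k * (2 * pi)) = 1"
      using cos_int_2pin[of k] sin_int_2pin[of k] by (simp add: complex_eq_iff mult_ac)
    then have "cis (of_int k * (a + 2 * pi)) = cis (of_int k * a)"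
      by (simp only: distrib_left cis_mult[symmetric] mult_1_right)
    then show ?thesis by (simp add: F_def)
  qed
  finally show ?thesis using False by simp
qed

lemma plane_wave_prod: "plane_wave \<xi> x = (\<Prod>i\<in>UNIV. cis (\<xi> $ i * x $ i))"
proof -
  have "cis (\<Sum>i\<in>A. f i) = (\<Prod>i\<in>A. cis (f i))" if "finite A" for A and f :: "'a \<Rightarrow> real"
    using that by (induction A rule: finite_induct) (auto simp: cis_mult[symmetric])
  then show ?thesis by (simp add: plane_wave_def inner_vec_def)
qed

lemma plane_waves_orthogonal:
  "(LINT x|cube_measure. plane_wave (lattice_point k) x * cnj (plane_wave (lattice_point l) x)) =
     (if k = l then of_real ((2 * pi) ^ CARD('n)) else 0)" for k l :: "int^'n"
proof -
  have ind: "indicat_real (cbox (\<chi> i. - pi) (\<chi> i. pi)) x = (\<Prod>i\<in>UNIV. indicat_real {-pi..pi} (x $ i))" for x :: "real^'n"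
    by (auto simp: indicator_def mem_box_cart prod_eq_1_iff not_le intro!: prod_zero)
  have "(LINT x|cube_measure. plane_wave (lattice_point k) x * cnj (plane_wave (lattice_point l) x)) =
    (LINT x|cube_measure. plane_wave (lattice_point (k - l)) x)"
    by (simp add: cnj_plane_wave lattice_point_diff flip: plane_wave_add_left)
  also have "\<dots> = (LINT x|lborel. indicator (cbox (\<chi> i. - pi) (\<chi> i. pi)) x *\<^sub>R plane_wave (lattice_point (k - l)) x)"
    by (rule integral_cube_measure) measurable
  also have "\<dots> = (LINT x|lborel. (\<Prod>i\<in>UNIV. indicat_real {-pi..pi} (x $ i) *\<^sub>R cis (of_int ((k - l) $ i) * x $ i)))"
    by (simp add: ind plane_wave_prod lattice_point_def prod.distrib scaleR_conv_of_real)
  also have "\<dots> = (\<Prod>i\<in>UNIV. LINT t|lborel. indicat_real {-pi..pi} t *\<^sub>R cis (of_int ((k - l) $ i) * t))"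
  proof (rule integral_lborel_cart_prod)
    fix i
    show "integrable lborel (\<lambda>t. indicat_real {-pi..pi} t *\<^sub>R cis (of_int ((k - l) $ i) * t))"
      by (rule borel_integrable_compact) (auto intro!: continuous_intros)
  qed
  also have "\<dots> = (\<Prod>i\<in>UNIV. if (k - l) $ i = 0 then of_real (2 * pi) else 0)"
  proof (intro prod.cong refl)
    show "(LINT t|lborel. indicat_real {-pi..pi} t *\<^sub>R cis (of_int ((k - l) $ i) * t)) = (if (k - l) $ i = 0 then of_real (2 * pi) else 0)" for i
      using integral_cis_period[of "- pi" "(k - l) $ i"] unfolding set_lebesgue_integral_def by simp
  qed
  also have "\<dots> = (if k = l then of_real ((2 * pi) ^ CARD('n)) else 0)"
    by (auto simp: vec_eq_iff intro!: prod_zero)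
  finally show ?thesis .
qed

inductive_set trig_polys :: "(real^'n \<Rightarrow> complex) set" where
  wave: "(\<lambda>x. c * plane_wave (lattice_point k) x) \<in> trig_polys"
| add: "f \<in> trig_polys \<Longrightarrow> g \<in> trig_polys \<Longrightarrow> (\<lambda>x. f x + g x) \<in> trig_polys"

lemma trig_polys_scale: "f \<in> trig_polys \<Longrightarrow> (\<lambda>x. c * f x) \<in> trig_polys"
proof (induction rule: trig_polys.induct)
  case (wave d k)
  then show ?case using trig_polys.wave[of "c * d" k] by (simp add: mult.assoc)
next
  case (add f g)
  then show ?case using trig_polys.add by (fastforce simp: distrib_left)
qed

lemma trig_polys_mult: "f \<in> trig_polys \<Longrightarrow> g \<in> trig_polys \<Longrightarrow> (\<lambda>x. f x * g x) \<in> trig_polys"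
proof (induction rule: trig_polys.induct)
  case (wave c k)
  from \<open>g \<in> trig_polys\<close> show ?case
  proof (induction rule: trig_polys.induct)
    case (wave d l)
    then show ?case using trig_polys.wave[of "c * d" "k + l"]
      by (simp add: lattice_point_add plane_wave_add_left mult_ac)
  next
    case (add f g)
    then show ?case using trig_polys.add by (fastforce simp: distrib_left)
  qed
next
  case (add f g)
  then show ?case using trig_polys.add by (fastforce simp: distrib_right)
qed

lemma trig_polys_const: "(\<lambda>x. c) \<in> trig_polys"
  using trig_polys.wave[of c 0] by simp

lemma trig_polys_sum: "(\<And>i. i \<in> I \<Longrightarrow> f i \<in> trig_polys) \<Longrightarrow> (\<lambda>x. \<Sum>i\<in>I. f i x) \<in> trig_polys"
  by (induction I rule: infinite_finite_induct) (auto intro: trig_polys.add trig_polys_const)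

lemma trig_polysE:
  assumes "f \<in> trig_polys"
  obtains K a where "finite K" "f = (\<lambda>x. \<Sum>k\<in>K. a k * plane_wave (lattice_point k) x)"
proof -
  have "\<exists>K a. finite K \<and> f = (\<lambda>x. \<Sum>k\<in>K. a k * plane_wave (lattice_point k) x)"
    using assms
  proof (induction rule: trig_polys.induct)
    case (wave c k)
    show ?case by (intro exI[of _ "{k}"] exI[of _ "\<lambda>_. c"]) auto
  next
    case (add f g)
    then obtain K a L b where h: "finite K" "f = (\<lambda>x. \<Sum>k\<in>K. a k * plane_wave (lattice_point k) x)"
      "finite L" "g = (\<lambda>x. \<Sum>k\<in>L. b k * plane_wave (lattice_point k) x)" by blast
    have ext: "(\<Sum>k\<in>A. c k * plane_wave (lattice_point k) x) = (\<Sum>k\<in>K \<union> L. (if k \<in> A then c k else 0) * plane_wave (lattice_point k) x)"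
      if "A \<subseteq> K \<union> L" for A and c :: "_ \<Rightarrow> complex" and x
      by (rule sum.mono_neutral_cong_left) (use h that in auto)
    show ?case
    proof (intro exI conjI)
      show "(\<lambda>x. f x + g x) = (\<lambda>x. \<Sum>k\<in>K \<union> L. ((if k \<in> K then a k else 0) + (if k \<in> L then b k else 0)) * plane_wave (lattice_point k) x)"
        unfolding h(2,4) distrib_right sum.distrib by (subst (1 2) ext) auto
    qed (use h in auto)
  qed
  then show thesis using that by blast
qed

lemma trig_polys_square_integrable: "f \<in> trig_polys \<Longrightarrow> square_integrable cube_measure f"
proof (induction rule: trig_polys.induct)
  case (wave c k)
  show ?case by (rule square_integrable_finite_measure[OF finite_measure_cube_measure, of _ "norm c"]) (auto simp: norm_mult)
next
  case (add f g) then show ?case by (intro square_integrable_add)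
qed

definition to_torus :: "real^'n \<Rightarrow> complex^'n" where
  "to_torus x = (\<chi> i. cis (x $ i))"

lemma trig_polys_cis:
  fixes i :: "'n::finite"
  shows "(\<lambda>x. cis (x $ i)) \<in> trig_polys" "(\<lambda>x. cis (- (x $ i))) \<in> trig_polys"
proof -
  have eq: "lattice_point (axis i c) \<bullet> x = real_of_int c * x $ i" for c :: int and i :: 'n and x
  proof -
    have "lattice_point (axis i c) = axis i (real_of_int c)"
      by (auto simp: lattice_point_def vec_eq_iff axis_def)
    then show ?thesis by (simp add: inner_axis')
  qed
  show "(\<lambda>x. cis (x $ i)) \<in> trig_polys" "(\<lambda>x. cis (- (x $ i))) \<in> trig_polys"
    using trig_polys.wave[of 1 "axis i 1"] trig_polys.wave[of 1 "axis i (-1)"]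
    by (simp_all add: plane_wave_def eq)
qed

lemma polynomial_on_torus:
  fixes q :: "complex^'n \<Rightarrow> real"
  assumes "real_polynomial_function q"
  shows "(\<lambda>x. complex_of_real (q (to_torus x))) \<in> trig_polys"
  using assms
proof (induction rule: real_polynomial_function.induct)
  case (linear f)
  have c: "(\<lambda>x. complex_of_real (to_torus x \<bullet> b)) \<in> trig_polys" if "b \<in> Basis" for b :: "complex^'n"
  proof -
    from that obtain i z where b: "b = axis i z" "z = 1 \<or> z = \<i>"
      by (auto simp: Basis_vec_def Basis_complex_def)
    have re: "complex_of_real (cos t) = 1/2 * cis t + 1/2 * cis (- t)" for t
      by (auto simp: complex_eq_iff)
    have im: "complex_of_real (sin t) = (- \<i> / 2) * cis t + (\<i> / 2) * cis (- t)" for t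
      by (auto simp: complex_eq_iff)
    show ?thesis
      using b(2)
    proof
      assume "z = 1"
      then have "(\<lambda>x. complex_of_real (to_torus x \<bullet> b)) = (\<lambda>x. 1 / 2 * cis (x $ i) + 1 / 2 * cis (- (x $ i)))"
        unfolding b(1) by (simp only: re[symmetric]) (simp add: inner_axis to_torus_def inner_complex_def)
      then show ?thesis
        by (simp only:) (intro trig_polys.add trig_polys_scale trig_polys_cis)
    next
      assume "z = \<i>"
      then have "(\<lambda>x. complex_of_real (to_torus x \<bullet> b)) = (\<lambda>x. (- \<i> / 2) * cis (x $ i) + (\<i> / 2) * cis (- (x $ i)))"
        unfolding b(1) by (simp only: im[symmetric]) (simp add: inner_axis to_torus_def inner_complex_def)
      then show ?thesis 
        by (simp only:) (intro trig_polys.add trig_polys_scale trig_polys_cis)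
    qed
  qed
  interpret f: bounded_linear f by fact
  have f: "f v = (\<Sum>b\<in>Basis. f b * (v \<bullet> b))" for v
  proof -
    have "f v = f (\<Sum>b\<in>Basis. (v \<bullet> b) *\<^sub>R b)" by (simp add: euclidean_representation)
    also have "\<dots> = (\<Sum>b\<in>Basis. f b * (v \<bullet> b))" by (simp add: f.sum f.scaleR mult.commute)
    finally show ?thesis .
  qed
  have "(\<lambda>x. \<Sum>b\<in>Basis. complex_of_real (f b) * complex_of_real (to_torus x \<bullet> b)) \<in> trig_polys"
    by (intro trig_polys_sum trig_polys_scale c)
  then show ?case by (subst f) simp
next
  case (const c)
  show ?case by (rule trig_polys_const)
next
  case (add f g)
  then show ?case using trig_polys.add by fastforce
next
  case (mult f g)
  then show ?case using trig_polys_mult by fastforce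
qed

lemma norm_le_sum_norm_cart: "norm z \<le> (\<Sum>i\<in>UNIV. norm (z $ i))" for z :: "'b::real_normed_vector^'n"
  by (simp add: norm_vec_def L2_set_le_sum)

lemma compact_torus: "compact {z :: complex^'n. \<forall>i. norm (z $ i) = 1}"
  unfolding compact_eq_bounded_closed
proof
  have "norm z \<le> CARD('n)" if "\<forall>i. norm (z $ i) = 1" for z :: "complex^'n"
    using norm_le_sum_norm_cart[of z] that by simp
  then show "bounded {z :: complex^'n. \<forall>i. norm (z $ i) = 1}" by (auto simp: bounded_iff)
  show "closed {z :: complex^'n. \<forall>i. norm (z $ i) = 1}"
    by (intro closed_Collect_all closed_Collect_eq continuous_intros)
qed

lemma continuous_on_torus_L2_closure:
  fixes g :: "complex^'n \<Rightarrow> real"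
  assumes g: "continuous_on UNIV g"
  shows "(\<lambda>x. complex_of_real (g (to_torus x))) \<in> L2_closure cube_measure trig_polys"
proof -
  interpret finite_measure "cube_measure :: (real^'n) measure" by (rule finite_measure_cube_measure)
  let ?T = "{z :: complex^'n. \<forall>i. norm (z $ i) = 1}"
  define m where "m = measure (cube_measure :: (real^'n) measure) UNIV"
  have T: "to_torus x \<in> ?T" for x by (simp add: to_torus_def)
  have tm [measurable]: "to_torus \<in> borel_measurable borel"
    unfolding to_torus_def by (intro borel_measurable_continuous_onI continuous_intros)
  have gm [measurable]: "g \<in> borel_measurable borel" using g by (rule borel_measurable_continuous_onI)
  have gT: "continuous_on ?T g" using g by (rule continuous_on_subset) auto
  obtain B where B: "\<And>z. z \<in> ?T \<Longrightarrow> norm (g z) \<le> B"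
    using compact_imp_bounded[OF compact_continuous_image[OF gT compact_torus]] by (auto simp: bounded_iff)
  have sq: "square_integrable cube_measure (\<lambda>x. complex_of_real (g (to_torus x)))"
    by (rule square_integrable_finite_measure[OF finite_measure_cube_measure, of _ B])
      (use B T in auto)
  show ?thesis
    unfolding L2_closure_def
  proof (intro CollectI conjI sq allI impI)
    fix e :: real assume "e > 0"
    define d where "d = sqrt (e / (m + 1))"
    have m: "m \<ge> 0" by (simp add: m_def)
    have d: "d > 0" using \<open>e > 0\<close> m by (simp add: d_def)
    obtain q where q: "polynomial_function q" "\<And>z. z \<in> ?T \<Longrightarrow> norm (g z - q z) < d"
      using Stone_Weierstrass_polynomial_function[OF compact_torus gT d] by blast
    have qV: "(\<lambda>x. complex_of_real (q (to_torus x))) \<in> trig_polys"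
      using q(1) by (intro polynomial_on_torus) (simp add: real_polynomial_function_eq)
    have qs: "square_integrable cube_measure (\<lambda>x. complex_of_real (q (to_torus x)))"
      by (rule trig_polys_square_integrable[OF qV])
    have "(LINT x|cube_measure. (norm (complex_of_real (g (to_torus x)) - complex_of_real (q (to_torus x))))\<^sup>2) \<le> (LINT x|(cube_measure :: (real^'n) measure). d\<^sup>2)"
    proof (rule integral_mono)
      show "integrable cube_measure (\<lambda>x. (norm (complex_of_real (g (to_torus x)) - complex_of_real (q (to_torus x))))\<^sup>2)"
        by (intro integrable_norm_sq square_integrable_diff sq qs)
      show "(norm (complex_of_real (g (to_torus x)) - complex_of_real (q (to_torus x))))\<^sup>2 \<le> d\<^sup>2" for x
        using q(2)[OF T, of x] by (intro power_mono) (simp_all flip: of_real_diff)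
    qed simp
    also have "\<dots> = m * d\<^sup>2" by (simp add: m_def)
    also have "\<dots> < (m + 1) * d\<^sup>2" using d by simp
    also have "\<dots> = e" using m \<open>e > 0\<close> by (simp add: d_def)
    finally show "\<exists>h\<in>trig_polys. square_integrable cube_measure h \<and>
        (LINT x|cube_measure. (norm (complex_of_real (g (to_torus x)) - h x))\<^sup>2) < e"
      using qV qs by (intro bexI[of _ "\<lambda>x. complex_of_real (q (to_torus x))"]) auto
  qed
qed

text \<open>
  The multiples of the distance to the complement, truncated at 1, increase to the indicator.
  The distance to the empty set being 0 by convention, the whole space is a case of its own.
\<close>

lemma open_indicator_limit:
  fixes U :: "'a::metric_space set"
  assumes "open U"
  obtains g :: "nat \<Rightarrow> 'a \<Rightarrow> real" where "\<And>n. continuous_on UNIV (g n)" "\<And>n x. 0 \<le> g n x \<and> g n x \<le> 1"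
    "\<And>x. (\<lambda>n. g n x) \<longlonglongrightarrow> indicator U x"
proof (cases "U = UNIV")
  case True
  then show thesis by (intro that[of "\<lambda>_ _. 1"]) auto
next
  case False
  define g where "g n x = min 1 (real n * infdist x (- U))" for n :: nat and x
  have lim: "(\<lambda>n. g n x) \<longlonglongrightarrow> indicator U x" for x
  proof (cases "x \<in> U")
    case True
    then have "infdist x (- U) > 0"
      using \<open>open U\<close> False by (subst infdist_pos_not_in_closed) auto
    then have "\<forall>\<^sub>F n in sequentially. 1 \<le> real n * infdist x (- U)"
      using filterlim_at_top_mult_tendsto_pos[OF tendsto_const _ filterlim_real_sequentially, of "infdist x (- U)"]
      by (auto simp: filterlim_at_top mult.commute)
    then have "\<forall>\<^sub>F n in sequentially. g n x = indicator U x"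
      by eventually_elim (use True in \<open>simp add: g_def\<close>)
    then show ?thesis by (rule tendsto_eventually)
  next
    case False
    then have "infdist x (- U) = 0" by simp
    with False show ?thesis by (simp add: g_def)
  qed
  show thesis
    by (rule that[of g]) (use lim in \<open>auto simp: g_def[abs_def] infdist_nonneg intro!: continuous_intros\<close>)
qed

text \<open>
  The cube is mapped to the torus, a compact subset of \<open>complex^'n\<close>.  There the
  Stone--Weierstrass theorem applies, and polynomials on the torus pull back to trigonometric
  polynomials.  Up to the null set of the faces with a coordinate \<open>-\<pi>\<close>, the map to the torus has
  the measurable left inverse \<open>q\<close>, so that every function on the cube is almost everywhere a
  function on the torus.
\<close>

theorem trig_polys_dense:
  fixes f :: "real^'n \<Rightarrow> complex"
  assumes f: "square_integrable cube_measure f"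
  shows "f \<in> L2_closure cube_measure trig_polys"
proof -
  have tm [measurable]: "to_torus \<in> borel_measurable (borel :: (real^'n) measure)"
    unfolding to_torus_def by (intro borel_measurable_continuous_onI continuous_intros)
  have fm [measurable]: "f \<in> borel_measurable borel"
    using f by (auto simp: square_integrable_def)
  interpret finite_measure "cube_measure :: (real^'n) measure" by (rule finite_measure_cube_measure)
  define q :: "complex^'n \<Rightarrow> real^'n"
    where "q z = (\<chi> i. (if 0 \<le> Im (z $ i) then 1 else - 1) * arccos (max (- 1) (min 1 (Re (z $ i)))))" for z
  have [measurable]: "q \<in> borel_measurable borel"
  proof -
    have [measurable]: "(\<lambda>z::complex^'n. arccos (max (- 1) (min 1 (Re (z $ i))))) \<in> borel_measurable borel" for i
      by (intro borel_measurable_continuous_onI continuous_on_arccos continuous_intros) auto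
    have [measurable]: "(\<lambda>z::complex^'n. Im (z $ i)) \<in> borel_measurable borel" for i
      by (intro borel_measurable_continuous_onI continuous_intros)
    have "(\<lambda>z. q z \<bullet> b) \<in> borel_measurable borel" if "b \<in> Basis" for b
    proof -
      from that obtain i where "b = axis i 1" by (auto simp: Basis_real_cart)
      then show ?thesis by (simp add: q_def inner_axis)
    qed
    then show ?thesis by (subst borel_measurable_euclidean_space) auto
  qed
  define S where "S = {x::real^'n. \<forall>i. - pi < x $ i \<and> x $ i \<le> pi}"
  have qp: "q (to_torus x) = x" if "x \<in> S" for x
  proof -
    have "(if 0 \<le> sin t then 1 else - 1) * arccos (max (- 1) (min 1 (cos t))) = t" if "- pi < t" "t \<le> pi" for t
    proof (cases "0 \<le> t")
      case True
      with that show ?thesis by (simp add: sin_ge_zero arccos_cos)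
    next
      case False
      then have "sin (- t) > 0" using that by (intro sin_gt_zero) auto
      then have "\<not> 0 \<le> sin t" by simp
      with False that show ?thesis by (simp add: arccos_cos2)
    qed
    with that show ?thesis by (simp add: S_def q_def to_torus_def vec_eq_iff)
  qed
  have ae: "AE x in cube_measure. x \<in> S"
  proof -
    have "AE x in lborel. \<forall>i\<in>UNIV. (x::real^'n) $ i \<noteq> - pi"
    proof (rule AE_finite_allI)
      fix i :: 'n
      have m: "{x::real^'n. x $ i = - pi} \<in> sets lborel" by simp
      have "{x::real^'n. x $ i = - pi} \<in> null_sets lebesgue"
        using negligible_standard_hyperplane[of "axis i 1 :: real^'n" "- pi"]
        by (simp add: negligible_iff_null_sets inner_axis Basis_real_cart)
      then have "{x::real^'n. x $ i = - pi} \<in> null_sets lborel"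
        using m null_sets_completion_iff by blast
      then show "AE x in lborel. (x::real^'n) $ i \<noteq> - pi" by (rule AE_I') auto
    qed simp
    then have "AE x in lborel. 0 < (indicator (cbox (\<chi> i. - pi) (\<chi> i. pi)) x :: ennreal) \<longrightarrow> (x::real^'n) \<in> S"
    proof eventually_elim
      case (elim x)
      show ?case
      proof
        assume "0 < (indicator (cbox (\<chi> i. - pi) (\<chi> i. pi)) x :: ennreal)"
        then have "x \<in> cbox (\<chi> i. - pi) (\<chi> i. pi)" by (auto split: split_indicator_asm)
        then have "- pi \<le> x $ i" "x $ i \<le> pi" for i by (auto simp: mem_box_cart)
        with elim show "x \<in> S" by (auto simp: S_def order.strict_iff_order)
      qed
    qed
    then show ?thesis unfolding cube_measure_def by (subst AE_density) auto
  qed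
  define f' where "f' = (\<lambda>x. f (q (to_torus x)))"
  have f'm [measurable]: "f' \<in> borel_measurable borel" unfolding f'_def by measurable
  have ff': "AE x in cube_measure. f x = f' x"
    using ae by eventually_elim (simp add: f'_def qp)
  have f': "square_integrable cube_measure f'"
    unfolding square_integrable_def
  proof
    have "AE x in cube_measure. (norm (f x))\<^sup>2 = (norm (f' x))\<^sup>2" using ff' by eventually_elim simp
    then show "integrable cube_measure (\<lambda>x. (norm (f' x))\<^sup>2)"
      using f by (subst integrable_cong_AE[symmetric]) (auto simp: square_integrable_def)
  qed simp
  have "f' \<in> L2_closure cube_measure trig_polys"
  proof (rule L2_closure_eq_of_open_indicators[where p=to_torus and g="f \<circ> q", OF finite_measure_cube_measure _ _ _ _ f'])
    show "f' = (\<lambda>x. (f \<circ> q) (to_torus x))" by (simp add: f'_def)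
    show "(f \<circ> q) \<in> borel_measurable borel" by (simp add: comp_def)
    fix U :: "(complex^'n) set" assume U: "open U"
    then obtain g :: "nat \<Rightarrow> complex^'n \<Rightarrow> real" where g: "\<And>n. continuous_on UNIV (g n)"
      "\<And>n x. 0 \<le> g n x \<and> g n x \<le> 1" "\<And>x. (\<lambda>n. g n x) \<longlonglongrightarrow> indicator U x"
      using open_indicator_limit by blast
    have [measurable]: "g n \<in> borel_measurable borel" for n using g(1) by (rule borel_measurable_continuous_onI)
    have [measurable]: "U \<in> sets borel" using U by simp
    show "(\<lambda>x. complex_of_real (indicator U (to_torus x))) \<in> L2_closure cube_measure trig_polys"
    proof (rule L2_closure_lim)
      show "square_integrable (cube_measure :: (real^'n) measure) (\<lambda>x. complex_of_real (indicator U (to_torus x)))"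
      proof (rule square_integrable_finite_measure[OF finite_measure_cube_measure, of _ 1])
        show "(\<lambda>x. complex_of_real (indicator U (to_torus x))) \<in> borel_measurable (cube_measure :: (real^'n) measure)"
          by measurable
      qed (auto simp: indicator_def)
      show "(\<lambda>x. complex_of_real (g n (to_torus x))) \<in> L2_closure cube_measure trig_polys" for n
        by (rule continuous_on_torus_L2_closure) fact
      show "(\<lambda>n. LINT x|(cube_measure :: (real^'n) measure). (norm (complex_of_real (indicator U (to_torus x)) - complex_of_real (g n (to_torus x))))\<^sup>2) \<longlonglongrightarrow> 0"
      proof (rule square_integrable_dominated_convergence[where g="\<lambda>x. 1::complex"])
        show "square_integrable (cube_measure :: (real^'n) measure) (\<lambda>x. 1::complex)" by (simp add: square_integrable_def)
        show "(\<lambda>n. complex_of_real (g n (to_torus x))) \<longlonglongrightarrow> complex_of_real (indicator U (to_torus x))" for x :: "real^'n"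
          by (intro tendsto_of_real g)
        show "norm (complex_of_real (indicator U (to_torus x)) - complex_of_real (g n (to_torus x))) \<le> norm (1::complex)" for n and x :: "real^'n"
          unfolding of_real_diff[symmetric] norm_of_real using g(2)[of n "to_torus x"] by (auto simp: indicator_def)
      qed measurable
    qed
  qed (auto intro: trig_polys.add trig_polys_scale)
  then show ?thesis
  proof (intro L2_closureI[OF f] bexI[of _ f'])
    fix e :: real assume "e > 0"
    have "(LINT x|cube_measure. (norm (f x - f' x))\<^sup>2) = (LINT x|(cube_measure :: (real^'n) measure). 0)"
      by (rule integral_cong_AE) (use ff' in auto)
    then show "(LINT x|cube_measure. (norm (f x - f' x))\<^sup>2) < e" using \<open>e > 0\<close> by simp
  qed
qed

text \<open>
  Completing the square in the coefficients \<open>a\<close>.  The choice \<open>a k = c k / N\<close> gives the Bessel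
  inequality; and as the last term is nonnegative, any approximation of \<open>f\<close> by a combination of the
  \<open>e k\<close> bounds the defect in that inequality.
\<close>

lemma L2_distance_orthogonal:
  fixes f :: "'a \<Rightarrow> complex" and e :: "'k \<Rightarrow> 'a \<Rightarrow> complex"
  assumes f: "square_integrable M f" and K: "finite K" and e: "\<And>k. k \<in> K \<Longrightarrow> square_integrable M (e k)"
    and orth: "\<And>k l. k \<in> K \<Longrightarrow> l \<in> K \<Longrightarrow> (LINT x|M. e k x * cnj (e l x)) = (if k = l then of_real N else 0)"
    and N: "N > 0"
  defines "c \<equiv> \<lambda>k. LINT x|M. f x * cnj (e k x)"
  shows "(LINT x|M. (norm (f x - (\<Sum>k\<in>K. a k * e k x)))\<^sup>2) =
    (LINT x|M. (norm (f x))\<^sup>2) - (\<Sum>k\<in>K. (norm (c k))\<^sup>2) / N + N * (\<Sum>k\<in>K. (norm (a k - c k / of_real N))\<^sup>2)"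
proof -
  define T where "T x = (\<Sum>k\<in>K. a k * e k x)" for x
  have T: "square_integrable M T"
    unfolding T_def by (intro square_integrable_sum square_integrable_mult_left e)
  have fT: "(LINT x|M. f x * cnj (T x)) = (\<Sum>k\<in>K. cnj (a k) * c k)"
  proof -
    have "(LINT x|M. f x * cnj (T x)) = (LINT x|M. (\<Sum>k\<in>K. cnj (a k) * (f x * cnj (e k x))))"
      by (simp add: T_def sum_distrib_left mult_ac)
    also have "\<dots> = (\<Sum>k\<in>K. cnj (a k) * c k)"
      unfolding c_def by (subst Bochner_Integration.integral_sum) (auto intro!: integrable_cnj_mult f e)
    finally show ?thesis .
  qed
  have TT: "(LINT x|M. T x * cnj (T x)) = of_real (N * (\<Sum>k\<in>K. (norm (a k))\<^sup>2))"
  proof -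
    have "(LINT x|M. T x * cnj (T x)) = (LINT x|M. (\<Sum>k\<in>K. \<Sum>l\<in>K. a k * cnj (a l) * (e k x * cnj (e l x))))"
      by (simp add: T_def sum_product mult_ac)
    also have "\<dots> = (\<Sum>k\<in>K. \<Sum>l\<in>K. a k * cnj (a l) * (LINT x|M. e k x * cnj (e l x)))"
    proof -
      have i: "integrable M (\<lambda>x. a k * cnj (a l) * (e k x * cnj (e l x)))" if "k \<in> K" "l \<in> K" for k l
        using that by (intro integrable_mult_right integrable_cnj_mult e)
      then have "(LINT x|M. (\<Sum>k\<in>K. \<Sum>l\<in>K. a k * cnj (a l) * (e k x * cnj (e l x)))) =
        (\<Sum>k\<in>K. LINT x|M. (\<Sum>l\<in>K. a k * cnj (a l) * (e k x * cnj (e l x))))"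
        by (intro Bochner_Integration.integral_sum Bochner_Integration.integrable_sum)
      also have "\<dots> = (\<Sum>k\<in>K. \<Sum>l\<in>K. LINT x|M. a k * cnj (a l) * (e k x * cnj (e l x)))"
        by (intro sum.cong refl Bochner_Integration.integral_sum i)
      finally show ?thesis by simp
    qed
    also have "\<dots> = (\<Sum>k\<in>K. \<Sum>l\<in>K. if k = l then of_real N * (a k * cnj (a k)) else 0)"
      by (intro sum.cong refl) (auto simp: orth)
    also have "\<dots> = of_real (N * (\<Sum>k\<in>K. (norm (a k))\<^sup>2))"
      using K by (simp add: sum_distrib_left complex_norm_square del: of_real_power)
    finally show ?thesis .
  qed
  have eq: "(norm (f x - T x))\<^sup>2 = (norm (f x))\<^sup>2 - 2 * Re (f x * cnj (T x)) + Re (T x * cnj (T x))" for x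
    by (simp only: cmod_power2) (simp add: power2_eq_square algebra_simps)
  define p q where "p x = f x * cnj (T x)" and "q x = T x * cnj (T x)" for x
  have int: "integrable M (\<lambda>x. (norm (f x))\<^sup>2)" "integrable M p" "integrable M q"
    unfolding p_def q_def by (intro integrable_norm_sq integrable_cnj_mult f T)+
  have "(LINT x|M. (norm (f x - T x))\<^sup>2) = (LINT x|M. (norm (f x))\<^sup>2) - 2 * (LINT x|M. Re (p x)) + (LINT x|M. Re (q x))"
    unfolding eq p_def[symmetric] q_def[symmetric] using int by simp
  also have "\<dots> = (LINT x|M. (norm (f x))\<^sup>2) - 2 * Re (\<Sum>k\<in>K. cnj (a k) * c k) + N * (\<Sum>k\<in>K. (norm (a k))\<^sup>2)"
    using int by (simp only: integral_Re) (simp only: p_def q_def fT TT Re_complex_of_real)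
  finally have d: "(LINT x|M. (norm (f x - T x))\<^sup>2) = \<dots>" .
  have "- 2 * Re (\<Sum>k\<in>K. cnj (a k) * c k) + N * (\<Sum>k\<in>K. (norm (a k))\<^sup>2) =
      - (\<Sum>k\<in>K. (norm (c k))\<^sup>2) / N + N * (\<Sum>k\<in>K. (norm (a k - c k / of_real N))\<^sup>2)"
  proof -
    have "N * (norm (a k - c k / of_real N))\<^sup>2 = (norm (c k))\<^sup>2 / N - 2 * Re (cnj (a k) * c k) + N * (norm (a k))\<^sup>2" for k
      using N by (simp only: cmod_power2) (simp add: power2_eq_square field_simps)
    then show ?thesis
      by (simp add: sum_distrib_left sum_subtractf sum.distrib sum_divide_distrib sum_negf)
  qed
  with d show ?thesis unfolding T_def by linarith
qed

text \<open>
  Square sums are written as integrals over counting measures, so that Tonelli's theorem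
  exchanges them with integrals.  The two lemmas that follow link these integrals to finite partial
  sums.
\<close>

lemma nn_integral_count_space_SUP:
  assumes A: "countable A"
  shows "(\<integral>\<^sup>+x. f x \<partial>count_space A) = (SUP F\<in>{F. finite F \<and> F \<subseteq> A}. \<Sum>x\<in>F. f x)"
proof (rule antisym)
  define g where "g = to_nat_on A"
  have g: "bij_betw g A (g ` A)" using inj_on_to_nat_on[OF A] by (simp add: g_def bij_betw_def)
  define h where "h n = f (from_nat_into A n) * indicator (g ` A) n" for n
  have "(\<integral>\<^sup>+x. f x \<partial>count_space A) = (\<integral>\<^sup>+x. f (from_nat_into A (g x)) \<partial>count_space A)"
    by (intro nn_integral_cong) (simp add: g_def A)
  also have "\<dots> = (\<integral>\<^sup>+n. f (from_nat_into A n) \<partial>count_space (g ` A))"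
    using nn_integral_bij_count_space[OF g, of "\<lambda>n. f (from_nat_into A n)"] by simp
  also have "\<dots> = (\<integral>\<^sup>+n. h n \<partial>count_space UNIV)"
    unfolding h_def by (rule nn_integral_count_space_indicator) simp
  also have "\<dots> = (\<Sum>n. h n)" by (rule nn_integral_count_space_nat)
  also have "\<dots> = (SUP n. \<Sum>i<n. h i)" by (rule suminf_eq_SUP)
  also have "\<dots> \<le> (SUP F\<in>{F. finite F \<and> F \<subseteq> A}. \<Sum>x\<in>F. f x)"
  proof (rule SUP_least)
    fix n
    define F where "F = from_nat_into A ` ({..<n} \<inter> g ` A)"
    have inj: "inj_on (from_nat_into A) ({..<n} \<inter> g ` A)"
      by (rule inj_on_inverseI[of _ g]) (auto simp: g_def A)
    have "(\<Sum>i<n. h i) = (\<Sum>i\<in>{..<n} \<inter> g ` A. f (from_nat_into A i))"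
      by (simp add: h_def indicator_def sum.If_cases if_distrib cong: if_cong)
    also have "\<dots> = (\<Sum>x\<in>F. f x)" unfolding F_def by (simp add: sum.reindex[OF inj])
    also have "\<dots> \<le> (SUP F\<in>{F. finite F \<and> F \<subseteq> A}. \<Sum>x\<in>F. f x)"
      by (rule SUP_upper) (auto simp: F_def g_def A)
    finally show "(\<Sum>i<n. h i) \<le> (SUP F\<in>{F. finite F \<and> F \<subseteq> A}. \<Sum>x\<in>F. f x)" .
  qed
  finally show "(\<integral>\<^sup>+x. f x \<partial>count_space A) \<le> (SUP F\<in>{F. finite F \<and> F \<subseteq> A}. \<Sum>x\<in>F. f x)" .
next
  show "(SUP F\<in>{F. finite F \<and> F \<subseteq> A}. \<Sum>x\<in>F. f x) \<le> (\<integral>\<^sup>+x. f x \<partial>count_space A)"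
  proof (rule SUP_least)
    fix F assume F: "F \<in> {F. finite F \<and> F \<subseteq> A}"
    then have "(\<Sum>x\<in>F. f x) = (\<integral>\<^sup>+x. f x * indicator F x \<partial>count_space A)"
      by (subst nn_integral_count_space'[of F]) auto
    also have "\<dots> \<le> (\<integral>\<^sup>+x. f x \<partial>count_space A)"
      by (rule nn_integral_mono) (simp add: indicator_def)
    finally show "(\<Sum>x\<in>F. f x) \<le> (\<integral>\<^sup>+x. f x \<partial>count_space A)" .
  qed
qed

lemma nn_integral_count_space_realI:
  fixes f :: "'a \<Rightarrow> real"
  assumes A: "countable A" and f: "\<And>x. 0 \<le> f x"
    and le: "\<And>F. finite F \<Longrightarrow> F \<subseteq> A \<Longrightarrow> sum f F \<le> s"
    and ge: "\<And>e. e > 0 \<Longrightarrow> \<exists>F. finite F \<and> F \<subseteq> A \<and> s - e \<le> sum f F"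
  shows "(\<integral>\<^sup>+x. ennreal (f x) \<partial>count_space A) = ennreal s"
proof -
  have sum: "(\<Sum>x\<in>F. ennreal (f x)) = ennreal (sum f F)" for F
    by (rule sum_ennreal) (simp add: f)
  have "(SUP F\<in>{F. finite F \<and> F \<subseteq> A}. ennreal (sum f F)) = ennreal s"
  proof (rule antisym)
    show "(SUP F\<in>{F. finite F \<and> F \<subseteq> A}. ennreal (sum f F)) \<le> ennreal s"
      using le by (intro SUP_least ennreal_leI) auto
    show "ennreal s \<le> (SUP F\<in>{F. finite F \<and> F \<subseteq> A}. ennreal (sum f F))"
    proof (rule ennreal_le_epsilon)
      fix e :: real assume "e > 0"
      then obtain F where F: "finite F" "F \<subseteq> A" "s - e \<le> sum f F" using ge by blast
      have "ennreal s \<le> ennreal (sum f F + e)" using F by (intro ennreal_leI) simp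
      also have "\<dots> = ennreal (sum f F) + ennreal e"
        using \<open>e > 0\<close> by (simp add: ennreal_plus sum_nonneg f)
      also have "\<dots> \<le> (SUP F\<in>{F. finite F \<and> F \<subseteq> A}. ennreal (sum f F)) + ennreal e"
        using F by (intro add_right_mono SUP_upper) auto
      finally show "ennreal s \<le> (SUP F\<in>{F. finite F \<and> F \<subseteq> A}. ennreal (sum f F)) + ennreal e" .
    qed
  qed
  then show ?thesis by (simp add: nn_integral_count_space_SUP[OF A] sum)
qed

lemma countable_int_vec: "countable (UNIV :: (int^'n) set)"
proof -
  have "countable (vec_nth ` (UNIV :: (int^'n) set))"
    by (rule countable_subset[OF _ countable_PiE[of UNIV "\<lambda>_. UNIV"]]) auto
  then show ?thesis by (rule countable_image_inj_on) (simp add: inj_on_def vec_eq_iff)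
qed

text \<open>
  Density of the trigonometric polynomials makes the defect in the Bessel inequality arbitrarily
  small.
\<close>

theorem parseval_fourier_series:
  fixes f :: "real^'n \<Rightarrow> complex"
  assumes f: "square_integrable cube_measure f"
  shows "(\<integral>\<^sup>+k. ennreal ((norm (LINT x|cube_measure. f x * cnj (plane_wave (lattice_point k) x)))\<^sup>2) \<partial>count_space UNIV) =
    ennreal ((2 * pi) ^ CARD('n) * (LINT x|cube_measure. (norm (f x))\<^sup>2))"
proof (rule nn_integral_count_space_realI[OF countable_int_vec])
  define N where "N = (2 * pi) ^ CARD('n)"
  have N: "N > 0" by (simp add: N_def)
  define c where "c k = (LINT x|cube_measure. f x * cnj (plane_wave (lattice_point k) x))" for k :: "int^'n"
  have wsq: "square_integrable cube_measure (plane_wave (lattice_point k))" for k :: "int^'n"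
    using trig_polys_square_integrable[OF trig_polys.wave[of 1 k]] by simp
  have dist: "(LINT x|cube_measure. (norm (f x - (\<Sum>k\<in>K. a k * plane_wave (lattice_point k) x)))\<^sup>2) =
    (LINT x|cube_measure. (norm (f x))\<^sup>2) - (\<Sum>k\<in>K. (norm (c k))\<^sup>2) / N + N * (\<Sum>k\<in>K. (norm (a k - c k / of_real N))\<^sup>2)"
    if "finite K" for K a
    unfolding c_def using that N
    by (intro L2_distance_orthogonal f wsq) (auto simp: plane_waves_orthogonal N_def)
  have le: "(\<Sum>k\<in>K. (norm (c k))\<^sup>2) / N \<le> (LINT x|cube_measure. (norm (f x))\<^sup>2)" if "finite K" for K
  proof -
    have "0 \<le> (LINT x|cube_measure. (norm (f x - (\<Sum>k\<in>K. (c k / of_real N) * plane_wave (lattice_point k) x)))\<^sup>2)"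
      by simp
    moreover have "(\<Sum>k\<in>K. (norm (c k / of_real N - c k / of_real N))\<^sup>2) = 0" by simp
    ultimately show ?thesis
      using dist[OF that, of "\<lambda>k. c k / of_real N"] by (simp only: mult_zero_right)
  qed
  show "(\<Sum>k\<in>K. (norm (LINT x|cube_measure. f x * cnj (plane_wave (lattice_point k) x)))\<^sup>2) \<le>
      (2 * pi) ^ CARD('n) * (LINT x|cube_measure. (norm (f x))\<^sup>2)" if "finite K" for K
    unfolding N_def[symmetric] c_def[symmetric] using le[OF that] N by (simp add: field_simps)
  show "\<exists>K. finite K \<and> K \<subseteq> UNIV \<and> (2 * pi) ^ CARD('n) * (LINT x|cube_measure. (norm (f x))\<^sup>2) - e \<le>
      (\<Sum>k\<in>K. (norm (LINT x|cube_measure. f x * cnj (plane_wave (lattice_point k) x)))\<^sup>2)" if "e > 0" for e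
  proof -
    have "e / N > 0" using that N by simp
    with trig_polys_dense[OF f] obtain T where T: "T \<in> trig_polys" "(LINT x|cube_measure. (norm (f x - T x))\<^sup>2) < e / N"
      unfolding L2_closure_def by blast
    obtain K a where K: "finite K" "T = (\<lambda>x. \<Sum>k\<in>K. a k * plane_wave (lattice_point k) x)"
      using trig_polysE[OF T(1)] .
    have "0 \<le> N * (\<Sum>k\<in>K. (norm (a k - c k / of_real N))\<^sup>2)" using N by (simp add: sum_nonneg)
    then have "(LINT x|cube_measure. (norm (f x))\<^sup>2) - (\<Sum>k\<in>K. (norm (c k))\<^sup>2) / N < e / N"
      using T(2) dist[OF K(1), of a] unfolding K(2) by linarith
    then have "N * (LINT x|cube_measure. (norm (f x))\<^sup>2) - e < (\<Sum>k\<in>K. (norm (c k))\<^sup>2)"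
      using mult_strict_left_mono[OF _ N] N by (fastforce simp: right_diff_distrib)
    then show ?thesis using K(1) by (auto simp: c_def N_def intro!: exI[of _ K])
  qed
qed simp

section \<open>Plancherel's theorem\<close>

lemma nn_integral_lborel_translate:
  fixes f :: "'a::euclidean_space \<Rightarrow> ennreal"
  assumes [measurable]: "f \<in> borel_measurable borel"
  shows "(\<integral>\<^sup>+x. f (t + x) \<partial>lborel) = (\<integral>\<^sup>+x. f x \<partial>lborel)"
proof -
  have "(\<integral>\<^sup>+x. f x \<partial>lborel) = (\<integral>\<^sup>+x. f x \<partial>distr lborel borel ((+) t))"
    by (simp add: lborel_distr_plus)
  also have "\<dots> = (\<integral>\<^sup>+x. f (t + x) \<partial>lborel)" by (rule nn_integral_distr) auto
  finally show ?thesis ..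
qed

lemma nn_integral_lborel_scale:
  fixes f :: "'a::euclidean_space \<Rightarrow> ennreal"
  assumes [measurable]: "f \<in> borel_measurable borel" and c: "c \<noteq> 0"
  shows "(\<integral>\<^sup>+x. f x \<partial>lborel) = ennreal (\<bar>c\<bar> ^ DIM('a)) * (\<integral>\<^sup>+x. f (c *\<^sub>R x) \<partial>lborel)"
proof -
  have "(\<integral>\<^sup>+x. f x \<partial>lborel) = (\<integral>\<^sup>+x. f x \<partial>density (distr lborel borel (\<lambda>x. 0 + c *\<^sub>R x)) (\<lambda>_. ennreal (\<bar>c\<bar> ^ DIM('a))))"
    using lborel_affine[OF c, of "0::'a"] by (simp add: ennreal_power)
  also have "\<dots> = ennreal (\<bar>c\<bar> ^ DIM('a)) * (\<integral>\<^sup>+x. f x \<partial>distr lborel borel (\<lambda>x. 0 + c *\<^sub>R x))"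
    by (subst nn_integral_density) (auto simp: nn_integral_cmult)
  also have "(\<integral>\<^sup>+x. f x \<partial>distr lborel borel (\<lambda>x. 0 + c *\<^sub>R x)) = (\<integral>\<^sup>+x. f (c *\<^sub>R x) \<partial>lborel)"
    by (subst nn_integral_distr) auto
  finally show ?thesis .
qed

lemma integral_lborel_scale:
  fixes f :: "'a::euclidean_space \<Rightarrow> 'b::{banach, second_countable_topology}"
  assumes [measurable]: "f \<in> borel_measurable borel" and c: "c \<noteq> 0"
  shows "(LINT x|lborel. f x) = \<bar>c\<bar> ^ DIM('a) *\<^sub>R (LINT x|lborel. f (c *\<^sub>R x))"
proof -
  have "(LINT x|lborel. f x) = (LINT x|density (distr lborel borel (\<lambda>x. 0 + c *\<^sub>R x)) (\<lambda>_. ennreal (\<bar>c\<bar> ^ DIM('a))). f x)"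
    using lborel_affine[OF c, of "0::'a"] by (simp add: ennreal_power)
  also have "\<dots> = (LINT x|distr lborel borel (\<lambda>x. 0 + c *\<^sub>R x). \<bar>c\<bar> ^ DIM('a) *\<^sub>R f x)"
    by (subst integral_density) auto
  also have "\<dots> = (LINT x|lborel. \<bar>c\<bar> ^ DIM('a) *\<^sub>R f (c *\<^sub>R x))"
    by (subst integral_distr) auto
  finally show ?thesis by simp
qed

text \<open>The lattice translates of the half-open unit cube partition the space.\<close>

lemma nn_integral_lattice_tiling:
  fixes f :: "real^'n \<Rightarrow> ennreal"
  assumes [measurable]: "f \<in> borel_measurable borel"
  defines "U \<equiv> {x::real^'n. \<forall>i. 0 \<le> x $ i \<and> x $ i < 1}"
  shows "(\<integral>\<^sup>+x. f x \<partial>lborel) = (\<integral>\<^sup>+x. indicator U x * (\<integral>\<^sup>+k. f (lattice_point k + x) \<partial>count_space UNIV) \<partial>lborel)"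
proof -
  have [measurable]: "U \<in> sets borel"
    unfolding U_def by measurable
  have one: "(\<integral>\<^sup>+k. indicator U (x - lattice_point k) \<partial>count_space UNIV) = (1::ennreal)" for x :: "real^'n"
  proof -
    define k0 :: "int^'n" where "k0 = (\<chi> i. \<lfloor>x $ i\<rfloor>)"
    have "x - lattice_point k \<in> U \<longleftrightarrow> k = k0" for k
    proof -
      have "0 \<le> t - real_of_int k \<and> t - real_of_int k < 1 \<longleftrightarrow> k = \<lfloor>t\<rfloor>" for k and t :: real
        using floor_eq_iff[of t k] by (auto simp: algebra_simps)
      then show ?thesis by (simp add: U_def lattice_point_def k0_def vec_eq_iff)
    qed
    then have "(\<integral>\<^sup>+k. indicator U (x - lattice_point k) \<partial>count_space UNIV) = (\<integral>\<^sup>+k. indicator {k0} k \<partial>count_space UNIV)"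
      by (intro nn_integral_cong) (simp add: indicator_def)
    then show ?thesis by simp
  qed
  have "(\<integral>\<^sup>+x. f x \<partial>lborel) = (\<integral>\<^sup>+x. \<integral>\<^sup>+k. f x * indicator U (x - lattice_point k) \<partial>count_space UNIV \<partial>lborel)"
    by (simp add: nn_integral_cmult one)
  also have "\<dots> = (\<integral>\<^sup>+k. \<integral>\<^sup>+x. f x * indicator U (x - lattice_point k) \<partial>lborel \<partial>count_space UNIV)"
    by (rule nn_integral_count_space_nn_integral[OF countable_int_vec]) measurable
  also have "\<dots> = (\<integral>\<^sup>+k. \<integral>\<^sup>+x. f (lattice_point k + x) * indicator U x \<partial>lborel \<partial>count_space UNIV)"
  proof (rule nn_integral_cong)
    fix k :: "int^'n"
    have "(\<integral>\<^sup>+x. f (lattice_point k + x) * indicator U (lattice_point k + x - lattice_point k) \<partial>lborel) =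
      (\<integral>\<^sup>+x. f x * indicator U (x - lattice_point k) \<partial>lborel)"
      by (rule nn_integral_lborel_translate) measurable
    then show "(\<integral>\<^sup>+x. f x * indicator U (x - lattice_point k) \<partial>lborel) = (\<integral>\<^sup>+x. f (lattice_point k + x) * indicator U x \<partial>lborel)"
      by simp
  qed
  also have "\<dots> = (\<integral>\<^sup>+x. \<integral>\<^sup>+k. f (lattice_point k + x) * indicator U x \<partial>count_space UNIV \<partial>lborel)"
    by (rule nn_integral_count_space_nn_integral[OF countable_int_vec, symmetric]) measurable
  also have "\<dots> = (\<integral>\<^sup>+x. indicator U x * (\<integral>\<^sup>+k. f (lattice_point k + x) \<partial>count_space UNIV) \<partial>lborel)"
    by (intro nn_integral_cong) (subst mult.commute, rule nn_integral_cmult, simp)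
  finally show ?thesis .
qed

lemma emeasure_unit_cube: "emeasure lborel {x::real^'n. \<forall>i. 0 \<le> x $ i \<and> x $ i < 1} = 1"
proof -
  have "(\<integral>\<^sup>+x. indicator {x::real^'n. \<forall>i. 0 \<le> x $ i \<and> x $ i < 1} x \<partial>lborel) = (\<integral>\<^sup>+x. (\<Prod>b\<in>Basis. indicator {0..<1} (x \<bullet> b)) \<partial>(lborel :: (real^'n) measure))"
  proof (intro nn_integral_cong)
    fix x :: "real^'n"
    have "(\<Prod>b\<in>Basis. indicator {0..<1::real} (x \<bullet> b)) = (\<Prod>i\<in>UNIV. indicator {0..<1} (x $ i) :: ennreal)"
      unfolding Basis_real_cart by (subst prod.reindex) (auto simp: inj_on_def axis_eq_axis inner_axis)
    also have "\<dots> = indicator {x::real^'n. \<forall>i. 0 \<le> x $ i \<and> x $ i < 1} x"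
      by (auto simp: indicator_def not_less intro!: prod_zero)
    finally show "indicator {x::real^'n. \<forall>i. 0 \<le> x $ i \<and> x $ i < 1} x = (\<Prod>b\<in>Basis. indicator {0..<1::real} (x \<bullet> b) :: ennreal)" ..
  qed
  also have "\<dots> = 1" by (subst nn_integral_lborel_prod) auto
  finally show ?thesis by simp
qed

text \<open>
  Every Fourier integral below is taken of such a function: these are integrable, and stay so when
  multiplied by a wave or a coordinate, rotated or dilated.
\<close>

definition bounded_support :: "('a::euclidean_space \<Rightarrow> 'b::real_normed_vector) \<Rightarrow> bool" where
  "bounded_support f \<longleftrightarrow> f \<in> borel_measurable borel \<and> bounded (range f) \<and> bounded {x. f x \<noteq> 0}"

lemma bounded_supportI:
  assumes "f \<in> borel_measurable borel" "\<And>x. norm (f x) \<le> B" "\<And>x. norm x > r \<Longrightarrow> f x = 0"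
  shows "bounded_support f"
proof -
  have "bounded (range f)" using assms(2) by (auto simp: bounded_iff)
  moreover have "bounded {x. f x \<noteq> 0}"
    unfolding bounded_iff using assms(3) by (intro exI[of _ r]) force
  ultimately show ?thesis using assms(1) by (simp add: bounded_support_def)
qed

lemma bounded_supportE:
  assumes "bounded_support f"
  obtains B r where "f \<in> borel_measurable borel" "0 < B" "0 < r" "\<And>x. norm (f x) \<le> B" "\<And>x. norm x > r \<Longrightarrow> f x = 0"
proof -
  from assms obtain B r where "\<And>x. norm (f x) \<le> B" "\<And>x. f x \<noteq> 0 \<Longrightarrow> norm x \<le> r"
    unfolding bounded_support_def bounded_iff by auto
  then have "\<And>x. norm (f x) \<le> max B 1" "\<And>x. norm x > max r 1 \<Longrightarrow> f x = 0"
    by (fastforce simp: le_max_iff_disj)+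
  with assms show thesis by (intro that[of "max B 1" "max r 1"]) (auto simp: bounded_support_def)
qed

lemma bounded_support_measurable [measurable_dest]: "bounded_support f \<Longrightarrow> f \<in> borel_measurable borel"
  by (simp add: bounded_support_def)

lemma bounded_support_dominated:
  assumes f: "bounded_support f" and g: "g \<in> borel_measurable borel" and le: "\<And>x. norm (g x) \<le> c * norm (f x)"
  shows "bounded_support g"
proof -
  obtain B r where f: "f \<in> borel_measurable borel" "0 < B" "0 < r" "\<And>x. norm (f x) \<le> B" "\<And>x. norm x > r \<Longrightarrow> f x = 0"
    using bounded_supportE[OF f] by metis
  show ?thesis
  proof (rule bounded_supportI[OF g])
    fix x
    have "norm (g x) \<le> \<bar>c\<bar> * norm (f x)" using le[of x] by (smt (verit) mult_right_mono norm_ge_zero)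
    also have "\<dots> \<le> \<bar>c\<bar> * B" using f by (intro mult_left_mono) auto
    finally show "norm (g x) \<le> \<bar>c\<bar> * B" .
    show "g x = 0" if "norm x > r" using le[of x] f(5)[OF that] by simp
  qed
qed

lemma bounded_support_integrable:
  fixes f :: "'a::euclidean_space \<Rightarrow> 'b::{banach, second_countable_topology}"
  assumes "bounded_support f"
  shows "integrable lborel f"
proof -
  obtain B r where f: "f \<in> borel_measurable borel" "0 < B" "0 < r" "\<And>x. norm (f x) \<le> B" "\<And>x. norm x > r \<Longrightarrow> f x = 0"
    using bounded_supportE[OF assms] by metis
  have "integrable lborel (\<lambda>x. indicator (cball 0 r) x *\<^sub>R B)"
    using emeasure_lborel_cball_finite by (intro integrable_real_indicator integrable_scaleR_left) auto
  then show ?thesis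
  proof (rule Bochner_Integration.integrable_bound)
    show "AE x in lborel. norm (f x) \<le> norm (indicator (cball 0 r) x *\<^sub>R B)"
      using f by (intro AE_I2) (auto simp: indicator_def)
  qed (use f in auto)
qed

lemma bounded_support_square_integrable:
  fixes f :: "'a::euclidean_space \<Rightarrow> 'b::{real_normed_vector, second_countable_topology}"
  assumes "bounded_support f"
  shows "square_integrable lborel f"
proof -
  obtain B r where f: "f \<in> borel_measurable borel" "0 < B" "0 < r" "\<And>x. norm (f x) \<le> B" "\<And>x. norm x > r \<Longrightarrow> f x = 0"
    using bounded_supportE[OF assms] by metis
  have "bounded_support (\<lambda>x. (norm (f x))\<^sup>2)"
    by (rule bounded_supportI[of _ "B\<^sup>2" r]) (use f in \<open>auto intro: power_mono\<close>)
  from bounded_support_integrable[OF this] f show ?thesis by (simp add: square_integrable_def)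
qed

definition fourier :: "(real^'n \<Rightarrow> complex) \<Rightarrow> real^'n \<Rightarrow> complex" where
  "fourier f \<xi> = (LINT x|lborel. f x * plane_wave (- \<xi>) x)"

lemma borel_measurable_fourier [measurable]:
  assumes [measurable]: "f \<in> borel_measurable borel"
  shows "fourier f \<in> borel_measurable borel"
  unfolding fourier_def by measurable

text \<open>
  The values of the transform on the lattice shifted by \<open>s\<close> are the Fourier coefficients of \<open>f\<close> times
  a wave.  By Parseval's identity their square sum does not depend on \<open>s\<close>, so its integral over the
  unit cube is again the same number, and by the tiling it is the integral over all frequencies.
\<close>

lemma plancherel_cube:
  fixes f :: "real^'n \<Rightarrow> complex"
  assumes f: "bounded_support f" and supp: "\<And>x. f x \<noteq> 0 \<Longrightarrow> x \<in> cbox (\<chi> i. - pi) (\<chi> i. pi)"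
  shows "(\<integral>\<^sup>+\<xi>. ennreal ((norm (fourier f \<xi>))\<^sup>2) \<partial>lborel) = ennreal ((2 * pi) ^ CARD('n) * (LINT x|lborel. (norm (f x))\<^sup>2))"
proof -
  note [measurable] = bounded_support_measurable[OF f]
  obtain B r where B: "\<And>x. norm (f x) \<le> B"
    using bounded_supportE[OF f] by metis
  define C where "C = cbox (\<chi> i. - pi) (\<chi> i. pi :: real^'n)"
  define P where "P = ennreal ((2 * pi) ^ CARD('n) * (LINT x|lborel. (norm (f x))\<^sup>2))"
  have ind: "indicator C x *\<^sub>R (f x * z) = f x * z" for x z
    using supp[of x] by (auto simp: indicator_def C_def)
  have sum: "(\<integral>\<^sup>+k. ennreal ((norm (fourier f (lattice_point k + s)))\<^sup>2) \<partial>count_space UNIV) = P" for s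
  proof -
    define g where "g x = f x * plane_wave (- s) x" for x
    have gm [measurable]: "g \<in> borel_measurable borel" unfolding g_def by measurable
    have g: "square_integrable cube_measure g"
      by (rule square_integrable_finite_measure[OF finite_measure_cube_measure, of _ B])
         (auto simp: g_def norm_mult B)
    have c: "(LINT x|cube_measure. g x * cnj (plane_wave (lattice_point k) x)) = fourier f (lattice_point k + s)" for k
    proof -
      have "(LINT x|cube_measure. g x * cnj (plane_wave (lattice_point k) x)) = 
        (LINT x|lborel. indicator C x *\<^sub>R (f x * (plane_wave (- s) x * plane_wave (- lattice_point k) x)))"
        unfolding C_def by (subst integral_cube_measure) (auto simp: g_def cnj_plane_wave mult.assoc)
      also have "\<dots> = fourier f (lattice_point k + s)"
        unfolding ind fourier_def by (simp add: algebra_simps flip: plane_wave_add_left)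
      finally show ?thesis .
    qed
    have "(LINT x|cube_measure. (norm (g x))\<^sup>2) = (LINT x|lborel. indicator C x *\<^sub>R (norm (g x))\<^sup>2)"
      unfolding C_def by (rule integral_cube_measure) measurable
    also have "\<dots> = (LINT x|lborel. (norm (f x))\<^sup>2)"
      using supp by (intro Bochner_Integration.integral_cong) (auto simp: g_def norm_mult C_def indicator_def)
    finally show ?thesis
      using parseval_fourier_series[OF g] by (simp add: c P_def)
  qed
  show ?thesis
    by (subst nn_integral_lattice_tiling) (auto simp: sum nn_integral_multc emeasure_unit_cube P_def)
qed

text \<open>A dilation moves the support into the cube.\<close>

theorem plancherel:
  fixes f :: "real^'n \<Rightarrow> complex"
  assumes f: "bounded_support f"
  shows "(\<integral>\<^sup>+\<xi>. ennreal ((norm (fourier f \<xi>))\<^sup>2) \<partial>lborel) = ennreal ((2 * pi) ^ CARD('n) * (LINT x|lborel. (norm (f x))\<^sup>2))"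
proof -
  note [measurable] = bounded_support_measurable[OF f]
  obtain B r where B: "0 < r" "\<And>x. norm (f x) \<le> B" "\<And>x. norm x > r \<Longrightarrow> f x = 0"
    using bounded_supportE[OF f] by metis
  define n where "n = CARD('n)"
  define g where "g x = f (r *\<^sub>R x)" for x
  have g0: "g x = 0" if "norm x > 1" for x
    using that B by (auto simp: g_def)
  have gm [measurable]: "g \<in> borel_measurable borel" unfolding g_def by measurable
  have g: "bounded_support g" by (rule bounded_supportI[of _ B 1]) (use B g0 in \<open>auto simp: g_def\<close>)
  have g_supp: "x \<in> cbox (\<chi> i. - pi) (\<chi> i. pi)" if "g x \<noteq> 0" for x
  proof -
    have "norm x \<le> 1" using g0[of x] that by force
    then have "\<bar>x $ i\<bar> \<le> pi" for i using component_le_norm_cart[of x i] pi_gt3 by linarith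
    then show ?thesis by (auto simp: mem_box_cart abs_le_iff minus_le_iff)
  qed
  have F: "fourier f \<xi> = of_real (r ^ n) * fourier g (r *\<^sub>R \<xi>)" for \<xi>
  proof -
    have m: "(\<lambda>x. f x * plane_wave (- \<xi>) x) \<in> borel_measurable borel" by measurable
    have w: "plane_wave (- \<xi>) (r *\<^sub>R x) = plane_wave (- (r *\<^sub>R \<xi>)) x" for x by (simp add: plane_wave_def)
    show ?thesis
      unfolding fourier_def using B(1)
      by (subst integral_lborel_scale[OF m, of r])
        (simp_all add: g_def n_def w scaleR_conv_of_real[of _ "_::complex"])
  qed
  have G: "(LINT x|lborel. (norm (f x))\<^sup>2) = r ^ n * (LINT x|lborel. (norm (g x))\<^sup>2)"
    using B(1) by (subst integral_lborel_scale[of _ r]) (auto simp: g_def n_def)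
  have "(\<integral>\<^sup>+\<xi>. ennreal ((norm (fourier f \<xi>))\<^sup>2) \<partial>lborel) = (\<integral>\<^sup>+\<xi>. ennreal (r ^ n) * (ennreal (r ^ n) * ennreal ((norm (fourier g (r *\<^sub>R \<xi>)))\<^sup>2)) \<partial>lborel)"
    using B(1) by (simp add: F norm_mult power_mult_distrib ennreal_mult norm_power) (simp add: power2_eq_square ennreal_mult mult.assoc)
  also have "\<dots> = ennreal (r ^ n) * (ennreal (\<bar>r\<bar> ^ DIM(real^'n)) * (\<integral>\<^sup>+\<xi>. ennreal ((norm (fourier g (r *\<^sub>R \<xi>)))\<^sup>2) \<partial>lborel))"
    using B(1) by (simp add: nn_integral_cmult n_def)
  also have "ennreal (\<bar>r\<bar> ^ DIM(real^'n)) * (\<integral>\<^sup>+\<xi>. ennreal ((norm (fourier g (r *\<^sub>R \<xi>)))\<^sup>2) \<partial>lborel) = (\<integral>\<^sup>+\<xi>. ennreal ((norm (fourier g \<xi>))\<^sup>2) \<partial>lborel)"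
    using B(1) by (intro nn_integral_lborel_scale[symmetric]) auto
  also have "\<dots> = ennreal ((2 * pi) ^ n * (LINT x|lborel. (norm (g x))\<^sup>2))"
    unfolding n_def by (rule plancherel_cube[OF g g_supp])
  also have "ennreal (r ^ n) * \<dots> = ennreal ((2 * pi) ^ n * (LINT x|lborel. (norm (f x))\<^sup>2))"
    using B(1) by (subst ennreal_mult[symmetric]) (auto simp: G mult_ac)
  finally show ?thesis by (simp add: n_def)
qed

section \<open>Tight frames of vector fields\<close>

lemma norm_sq_cart: "(norm v)\<^sup>2 = (\<Sum>i\<in>UNIV. (norm (v $ i))\<^sup>2)" for v :: "'b::real_normed_vector^'n"
  by (simp add: norm_vec_def L2_set_def sum_nonneg)

lemma square_integrable_component:
  fixes u :: "'a \<Rightarrow> complex^'n"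
  assumes u: "square_integrable M u"
  shows "square_integrable M (\<lambda>x. u x $ i)"
proof (rule square_integrable_bound[OF u, of _ 1])
  have "(\<lambda>z::complex^'n. z $ i) \<in> borel_measurable borel"
    by (intro borel_measurable_continuous_onI continuous_intros)
  from measurable_compose[OF square_integrable_measurable[OF u] this]
  show "(\<lambda>x. u x $ i) \<in> borel_measurable M" .
qed (simp add: component_le_norm_cart Finite_Cartesian_Product.norm_nth_le)

lemma integrable_L2_inner:
  fixes u v :: "'a \<Rightarrow> complex^'n"
  assumes "square_integrable M u" "square_integrable M v"
  shows "integrable M (\<lambda>y. \<Sum>i\<in>UNIV. u y $ i * cnj (v y $ i))"
  by (intro Bochner_Integration.integrable_sum integrable_cnj_mult square_integrable_component assms)

lemma norm_smult: "norm (c *s z) = norm c * norm z" for z :: "complex^'n"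
  by (simp add: norm_vec_def norm_mult L2_set_right_distrib)

lemma square_integrable_smult:
  fixes u :: "'a \<Rightarrow> complex^'n"
  assumes u: "square_integrable M u"
  shows "square_integrable M (\<lambda>x. c *s u x)"
proof (rule square_integrable_bound[OF u])
  have "(\<lambda>z::complex^'n. c *s z) \<in> borel_measurable borel"
    unfolding vector_scalar_mult_def by (intro borel_measurable_continuous_onI continuous_intros)
  from measurable_compose[OF square_integrable_measurable[OF u] this]
  show "(\<lambda>x. c *s u x) \<in> borel_measurable M" .
  show "norm (c *s u x) \<le> norm c * norm (u x)" for x by (simp add: norm_smult)
qed

lemma L2_inner_add_left:
  assumes "square_integrable lborel u" "square_integrable lborel v" "square_integrable lborel w"
  shows "L2_inner (\<lambda>x. u x + v x) w = L2_inner u w + L2_inner v w"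
  unfolding L2_inner_def using integrable_L2_inner[OF assms(1,3)] integrable_L2_inner[OF assms(2,3)]
  by (simp add: distrib_right sum.distrib)

lemma L2_inner_diff_left:
  assumes "square_integrable lborel u" "square_integrable lborel v" "square_integrable lborel w"
  shows "L2_inner (\<lambda>x. u x - v x) w = L2_inner u w - L2_inner v w"
  unfolding L2_inner_def using integrable_L2_inner[OF assms(1,3)] integrable_L2_inner[OF assms(2,3)]
  by (simp add: left_diff_distrib sum_subtractf)

lemma L2_inner_smult_left: "L2_inner (\<lambda>x. c *s u x) v = c * L2_inner u v"
  unfolding L2_inner_def by (simp add: mult.assoc flip: sum_distrib_left)

lemma L2_inner_cnj: "cnj (L2_inner u v) = L2_inner v u"
proof -
  have "cnj (L2_inner u v) = (LINT y|lborel. cnj (\<Sum>i\<in>UNIV. u y $ i * cnj (v y $ i)))"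
    unfolding L2_inner_def by (rule Bochner_Integration.integral_cnj[symmetric])
  then show ?thesis by (simp add: L2_inner_def mult.commute)
qed

lemma L2_inner_self: "L2_inner u u = of_real (LINT x|lborel. (norm (u x))\<^sup>2)"
proof -
  have "(\<Sum>i\<in>UNIV. u x $ i * cnj (u x $ i)) = complex_of_real ((norm (u x))\<^sup>2)" for x
    unfolding norm_sq_cart of_real_sum by (intro sum.cong refl) (simp only: complex_norm_square)
  then show ?thesis unfolding L2_inner_def by (simp del: of_real_power)
qed

lemma L2_inner_sum_left:
  assumes "finite F" "\<And>i. i \<in> F \<Longrightarrow> square_integrable lborel (f i)" "square_integrable lborel w"
  shows "L2_inner (\<lambda>x. \<Sum>i\<in>F. c i *s f i x) w = (\<Sum>i\<in>F. c i * L2_inner (f i) w)"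
  using assms(1,2)
proof (induction F rule: finite_induct)
  case empty
  then show ?case by (simp add: L2_inner_def)
next
  case (insert i F)
  then show ?case
    by (subst sum.insert, simp, simp, subst L2_inner_add_left)
      (auto simp: L2_inner_smult_left intro!: square_integrable_smult square_integrable_sum assms(3))
qed

text \<open>
  The Bessel inequality bounds the synthesis operator by duality, so that \<open>\<parallel>S\<parallel>\<^sup>2 \<le> \<Sum>|c\<^sub>i|\<^sup>2\<close> for a
  finite partial sum \<open>S\<close>.  Hence \<open>\<parallel>u - S\<parallel>\<^sup>2 \<le> \<parallel>u\<parallel>\<^sup>2 - \<Sum>|c\<^sub>i|\<^sup>2\<close>, which tends to 0 as soon as
  Parseval's identity holds for \<open>u\<close>.
\<close>

lemma frame_partial_sum_error:
  fixes \<psi> :: "'i \<Rightarrow> real^3 \<Rightarrow> complex^3"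
  assumes F: "finite F" and \<psi>: "\<And>i. i \<in> F \<Longrightarrow> square_integrable lborel (\<psi> i)"
    and u: "square_integrable lborel u"
    and bessel: "\<And>g. square_integrable lborel g \<Longrightarrow> (\<Sum>i\<in>F. (norm (L2_inner g (\<psi> i)))\<^sup>2) \<le> (LINT x|lborel. (norm (g x))\<^sup>2)"
  shows "(LINT x|lborel. (norm (u x - (\<Sum>i\<in>F. L2_inner u (\<psi> i) *s \<psi> i x)))\<^sup>2) \<le>
    (LINT x|lborel. (norm (u x))\<^sup>2) - (\<Sum>i\<in>F. (norm (L2_inner u (\<psi> i)))\<^sup>2)"
proof -
  define c where "c i = L2_inner u (\<psi> i)" for i
  define S where "S x = (\<Sum>i\<in>F. c i *s \<psi> i x)" for x
  have S: "square_integrable lborel S"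
    unfolding S_def by (intro square_integrable_sum square_integrable_smult \<psi>)
  have S_inner: "L2_inner S w = (\<Sum>i\<in>F. c i * L2_inner (\<psi> i) w)" if "square_integrable lborel w" for w
    unfolding S_def by (rule L2_inner_sum_left[OF F \<psi> that])
  have Su: "L2_inner S u = of_real (\<Sum>i\<in>F. (norm (c i))\<^sup>2)"
  proof -
    have "L2_inner (\<psi> i) u = cnj (c i)" for i by (simp add: c_def L2_inner_cnj)
    then show ?thesis unfolding S_inner[OF u] of_real_sum
      by (intro sum.cong refl) (simp only: complex_norm_square)
  qed
  have uS: "L2_inner u S = of_real (\<Sum>i\<in>F. (norm (c i))\<^sup>2)"
    using L2_inner_cnj[of S u] unfolding Su by simp
  have SS: "(LINT x|lborel. (norm (S x))\<^sup>2) \<le> (\<Sum>i\<in>F. (norm (c i))\<^sup>2)"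
  proof -
    have "(LINT x|lborel. (norm (S x))\<^sup>2) = Re (L2_inner S S)" by (simp add: L2_inner_self)
    also have "\<dots> = (\<Sum>i\<in>F. Re (c i * cnj (L2_inner S (\<psi> i))))" by (simp add: S_inner[OF S] L2_inner_cnj)
    also have "\<dots> \<le> (\<Sum>i\<in>F. ((norm (c i))\<^sup>2 + (norm (L2_inner S (\<psi> i)))\<^sup>2) / 2)"
    proof (rule sum_mono)
      fix i
      have "Re (c i * cnj (L2_inner S (\<psi> i))) \<le> norm (c i) * norm (L2_inner S (\<psi> i))"
        using complex_Re_le_cmod[of "c i * cnj (L2_inner S (\<psi> i))"] by (simp add: norm_mult)
      also have "\<dots> \<le> ((norm (c i))\<^sup>2 + (norm (L2_inner S (\<psi> i)))\<^sup>2) / 2"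
        using sum_squares_bound[of "norm (c i)" "norm (L2_inner S (\<psi> i))"] by simp
      finally show "Re (c i * cnj (L2_inner S (\<psi> i))) \<le> ((norm (c i))\<^sup>2 + (norm (L2_inner S (\<psi> i)))\<^sup>2) / 2" .
    qed
    also have "\<dots> = ((\<Sum>i\<in>F. (norm (c i))\<^sup>2) + (\<Sum>i\<in>F. (norm (L2_inner S (\<psi> i)))\<^sup>2)) / 2"
      by (simp add: sum.distrib flip: sum_divide_distrib)
    also have "\<dots> \<le> ((\<Sum>i\<in>F. (norm (c i))\<^sup>2) + (LINT x|lborel. (norm (S x))\<^sup>2)) / 2"
      using bessel[OF S] by simp
    finally show ?thesis by simp
  qed
  have "of_real (LINT x|lborel. (norm (u x - S x))\<^sup>2) = L2_inner (\<lambda>x. u x - S x) (\<lambda>x. u x - S x)"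
    by (rule L2_inner_self[symmetric])
  also have "\<dots> = cnj (L2_inner (\<lambda>x. u x - S x) u) - cnj (L2_inner (\<lambda>x. u x - S x) S)"
    unfolding L2_inner_cnj by (rule L2_inner_diff_left) (intro u S square_integrable_diff)+
  also have "\<dots> = of_real ((LINT x|lborel. (norm (u x))\<^sup>2) - 2 * (\<Sum>i\<in>F. (norm (c i))\<^sup>2) + (LINT x|lborel. (norm (S x))\<^sup>2))"
    by (simp add: L2_inner_diff_left u S L2_inner_self Su uS)
  finally have "(LINT x|lborel. (norm (u x - S x))\<^sup>2) = (LINT x|lborel. (norm (u x))\<^sup>2) - 2 * (\<Sum>i\<in>F. (norm (c i))\<^sup>2) + (LINT x|lborel. (norm (S x))\<^sup>2)"
    by (simp only: of_real_eq_iff)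
  with SS show ?thesis by (simp add: S_def c_def)
qed

theorem frame_reconstruction:
  fixes \<psi> :: "'i \<Rightarrow> real^3 \<Rightarrow> complex^3"
  assumes I: "countable I" and \<psi>: "\<And>i. i \<in> I \<Longrightarrow> square_integrable lborel (\<psi> i)"
    and u: "square_integrable lborel u"
    and bessel: "\<And>F g. finite F \<Longrightarrow> F \<subseteq> I \<Longrightarrow> square_integrable lborel g \<Longrightarrow>
      (\<Sum>i\<in>F. (norm (L2_inner g (\<psi> i)))\<^sup>2) \<le> (LINT x|lborel. (norm (g x))\<^sup>2)"
    and parseval: "(\<integral>\<^sup>+i. ennreal ((norm (L2_inner u (\<psi> i)))\<^sup>2) \<partial>count_space I) = ennreal (LINT x|lborel. (norm (u x))\<^sup>2)"
  shows "has_L2_sum (\<lambda>i x. L2_inner u (\<psi> i) *s \<psi> i x) u I"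
  unfolding has_L2_sum_def
proof (rule order_tendstoI)
  fix e :: ennreal assume "0 < e"
  define N where "N = (LINT x|lborel. (norm (u x))\<^sup>2)"
  obtain d where d: "d > 0" "ennreal d < e"
    using \<open>0 < e\<close> by (metis ennreal_0 ennreal_less_zero_iff dense ennreal_cases linorder_not_less top_greatest)
  have "\<exists>F\<^sub>0. finite F\<^sub>0 \<and> F\<^sub>0 \<subseteq> I \<and> N - d < (\<Sum>i\<in>F\<^sub>0. (norm (L2_inner u (\<psi> i)))\<^sup>2)"
  proof (rule ccontr)
    assume "\<not> ?thesis"
    then have le: "(\<Sum>i\<in>F. (norm (L2_inner u (\<psi> i)))\<^sup>2) \<le> N - d" if "finite F" "F \<subseteq> I" for F
      using that by (meson not_le)
    have nn: "0 \<le> N - d" using le[of "{}"] by simp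
    have "ennreal N = (SUP F\<in>{F. finite F \<and> F \<subseteq> I}. \<Sum>i\<in>F. ennreal ((norm (L2_inner u (\<psi> i)))\<^sup>2))"
      using parseval by (simp add: nn_integral_count_space_SUP[OF I] N_def)
    also have "\<dots> \<le> ennreal (N - d)"
      using le by (intro SUP_least) (auto simp: sum_ennreal intro!: ennreal_leI)
    finally have "N \<le> N - d" using nn by (subst (asm) ennreal_le_iff) auto
    with d show False by simp
  qed
  then obtain F\<^sub>0 where F0: "finite F\<^sub>0" "F\<^sub>0 \<subseteq> I" "N - d < (\<Sum>i\<in>F\<^sub>0. (norm (L2_inner u (\<psi> i)))\<^sup>2)" by blast
  show "\<forall>\<^sub>F F in finite_subsets_at_top I. (\<integral>\<^sup>+x. ennreal ((norm (u x - (\<Sum>i\<in>F. L2_inner u (\<psi> i) *s \<psi> i x)))\<^sup>2) \<partial>lborel) < e"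
    unfolding eventually_finite_subsets_at_top
  proof (intro exI[of _ F\<^sub>0] conjI F0 allI impI)
    fix F assume F: "finite F \<and> F\<^sub>0 \<subseteq> F \<and> F \<subseteq> I"
    then have F': "finite F" "F \<subseteq> I" by auto
    have sq: "square_integrable lborel (\<lambda>x. u x - (\<Sum>i\<in>F. L2_inner u (\<psi> i) *s \<psi> i x))"
      using F' by (intro square_integrable_diff square_integrable_sum square_integrable_smult u \<psi>) auto
    have "(LINT x|lborel. (norm (u x - (\<Sum>i\<in>F. L2_inner u (\<psi> i) *s \<psi> i x)))\<^sup>2) \<le> N - (\<Sum>i\<in>F. (norm (L2_inner u (\<psi> i)))\<^sup>2)"
      unfolding N_def using F' by (intro frame_partial_sum_error u \<psi> bessel) auto
    moreover have "(\<Sum>i\<in>F\<^sub>0. (norm (L2_inner u (\<psi> i)))\<^sup>2) \<le> (\<Sum>i\<in>F. (norm (L2_inner u (\<psi> i)))\<^sup>2)"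
      using F by (intro sum_mono2) auto
    ultimately have "(LINT x|lborel. (norm (u x - (\<Sum>i\<in>F. L2_inner u (\<psi> i) *s \<psi> i x)))\<^sup>2) \<le> d"
      using F0(3) by linarith
    then have "(\<integral>\<^sup>+x. ennreal ((norm (u x - (\<Sum>i\<in>F. L2_inner u (\<psi> i) *s \<psi> i x)))\<^sup>2) \<partial>lborel) \<le> ennreal d"
      using integrable_norm_sq[OF sq] by (subst nn_integral_eq_integral) (auto intro!: ennreal_leI)
    with d show "(\<integral>\<^sup>+x. ennreal ((norm (u x - (\<Sum>i\<in>F. L2_inner u (\<psi> i) *s \<psi> i x)))\<^sup>2) \<partial>lborel) < e" by simp
  qed
qed simp

text \<open>Truncation in space and in size yields fields whose Fourier integrals converge.\<close>

definition truncation :: "(real^3 \<Rightarrow> complex^3) \<Rightarrow> nat \<Rightarrow> real^3 \<Rightarrow> complex^3" where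
  "truncation u n x = (if norm x \<le> real n \<and> norm (u x) \<le> real n then u x else 0)"

lemma
  assumes u: "square_integrable lborel u"
  shows bounded_support_truncation: "bounded_support (truncation u n)"
    and truncation_tendsto: "(\<lambda>n. truncation u n x) \<longlonglongrightarrow> u x"
    and norm_truncation_le: "norm (truncation u n x) \<le> norm (u x)"
    and square_integrable_truncation: "square_integrable lborel (truncation u n)"
proof -
  have [measurable]: "u \<in> borel_measurable borel" using u by (simp add: square_integrable_def)
  show b: "bounded_support (truncation u n)"
  proof (rule bounded_supportI[of _ "real n" "real n"])
    show "truncation u n \<in> borel_measurable borel" unfolding truncation_def by measurable
  qed (auto simp: truncation_def)
  show "norm (truncation u n x) \<le> norm (u x)" by (simp add: truncation_def)
  show "square_integrable lborel (truncation u n)" by (rule bounded_support_square_integrable[OF b])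
  have "\<forall>\<^sub>F n in sequentially. max (norm x) (norm (u x)) \<le> real n"
    using filterlim_real_sequentially unfolding filterlim_at_top by blast
  then have "\<forall>\<^sub>F n in sequentially. truncation u n x = u x"
    by eventually_elim (simp add: truncation_def)
  then show "(\<lambda>n. truncation u n x) \<longlonglongrightarrow> u x" by (rule tendsto_eventually)
qed

lemma truncation_L2_tendsto:
  assumes u: "square_integrable lborel u"
  shows "(\<lambda>n. LINT x|lborel. (norm (u x - truncation u n x))\<^sup>2) \<longlonglongrightarrow> 0"
proof (rule square_integrable_dominated_convergence[OF square_integrable_scaleR[OF u, of 2]])
  show "norm (u x - truncation u n x) \<le> norm (2 *\<^sub>R u x)" for x n
    using norm_triangle_ineq4[of "u x" "truncation u n x"] norm_truncation_le[OF u, of n x] by simp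
  show "truncation u n \<in> borel_measurable lborel" for n
    using square_integrable_truncation[OF u] by (simp add: square_integrable_def)
qed (use u truncation_tendsto[OF u] in \<open>auto simp: square_integrable_def\<close>)

lemma L2_norm_truncation_tendsto:
  assumes u: "square_integrable lborel u"
  shows "(\<lambda>n. LINT x|lborel. (norm (truncation u n x))\<^sup>2) \<longlonglongrightarrow> (LINT x|lborel. (norm (u x))\<^sup>2)"
proof (rule integral_dominated_convergence)
  show "integrable lborel (\<lambda>x. (norm (u x))\<^sup>2)" by (rule integrable_norm_sq[OF u])
  show "AE x in lborel. (\<lambda>n. (norm (truncation u n x))\<^sup>2) \<longlonglongrightarrow> (norm (u x))\<^sup>2"
    by (intro AE_I2 tendsto_intros truncation_tendsto[OF u])
  show "AE x in lborel. norm ((norm (truncation u n x))\<^sup>2) \<le> (norm (u x))\<^sup>2" for n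
    using norm_truncation_le[OF u] by (intro AE_I2) (simp add: power_mono)
  show "(\<lambda>x. (norm (truncation u n x))\<^sup>2) \<in> borel_measurable lborel" for n
    by (rule borel_measurable_integrable[OF integrable_norm_sq[OF square_integrable_truncation[OF u]]])
qed (rule borel_measurable_integrable[OF integrable_norm_sq[OF u]])

lemma L2_inner_truncation_tendsto:
  assumes u: "square_integrable lborel u" and v: "square_integrable lborel v"
  shows "(\<lambda>n. L2_inner (truncation u n) v) \<longlonglongrightarrow> L2_inner u v"
  unfolding L2_inner_def
proof (rule integral_dominated_convergence)
  show "integrable lborel (\<lambda>y. \<Sum>i\<in>UNIV. norm (u y $ i) * norm (v y $ i))"
    by (intro Bochner_Integration.integrable_sum integrable_norm_mult square_integrable_component u v)
  show "AE y in lborel. (\<lambda>n. \<Sum>i\<in>UNIV. truncation u n y $ i * cnj (v y $ i)) \<longlonglongrightarrow> (\<Sum>i\<in>UNIV. u y $ i * cnj (v y $ i))"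
    by (intro AE_I2 tendsto_intros truncation_tendsto[OF u])
  show "AE y in lborel. norm (\<Sum>i\<in>UNIV. truncation u n y $ i * cnj (v y $ i)) \<le> (\<Sum>i\<in>UNIV. norm (u y $ i) * norm (v y $ i))" for n
  proof (intro AE_I2 sum_norm_le)
    show "norm (truncation u n y $ i * cnj (v y $ i)) \<le> norm (u y $ i) * norm (v y $ i)" for y i
      by (auto simp: norm_mult truncation_def)
  qed
qed (intro borel_measurable_integrable[OF integrable_L2_inner] u v square_integrable_truncation)+

text \<open>
  The Bessel inequality passes to the limit along the truncations at once, being a statement on finite
  sums.  For the converse let \<open>v\<close> be a truncation of \<open>u\<close> and \<open>r = u - v\<close>.  The coefficients satisfy
  \<open>|v\<^sub>i|\<^sup>2 \<le> (1 + d) |u\<^sub>i|\<^sup>2 + (1 + 1/d) |r\<^sub>i|\<^sup>2\<close>; summing with Parseval's identity for \<open>v\<close> and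
  the Bessel inequality for \<open>r\<close> gives \<open>\<parallel>v\<parallel>\<^sup>2 \<le> (1 + d) \<Sum>|u\<^sub>i|\<^sup>2 + (1 + 1/d) \<parallel>r\<parallel>\<^sup>2\<close>.  First \<open>r\<close> tends to 0,
  then \<open>d\<close>.
\<close>

lemma parseval_extend:
  fixes \<psi> :: "'i \<Rightarrow> real^3 \<Rightarrow> complex^3"
  assumes I: "countable I" and \<psi>: "\<And>i. i \<in> I \<Longrightarrow> square_integrable lborel (\<psi> i)"
    and parseval: "\<And>u. bounded_support u \<Longrightarrow>
      (\<integral>\<^sup>+i. ennreal ((norm (L2_inner u (\<psi> i)))\<^sup>2) \<partial>count_space I) = ennreal (LINT x|lborel. (norm (u x))\<^sup>2)"
    and u: "square_integrable lborel u"
  shows "(\<integral>\<^sup>+i. ennreal ((norm (L2_inner u (\<psi> i)))\<^sup>2) \<partial>count_space I) = ennreal (LINT x|lborel. (norm (u x))\<^sup>2)"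
    and "\<And>F. finite F \<Longrightarrow> F \<subseteq> I \<Longrightarrow> (\<Sum>i\<in>F. (norm (L2_inner u (\<psi> i)))\<^sup>2) \<le> (LINT x|lborel. (norm (u x))\<^sup>2)"
proof -
  define N where "N v = (LINT x|lborel. (norm (v x))\<^sup>2)" for v :: "real^3 \<Rightarrow> complex^3"
  have N: "N v \<ge> 0" for v by (simp add: N_def)
  have bessel0: "(\<Sum>i\<in>F. (norm (L2_inner v (\<psi> i)))\<^sup>2) \<le> N v" if "bounded_support v" "finite F" "F \<subseteq> I" for v F
  proof -
    have "ennreal (\<Sum>i\<in>F. (norm (L2_inner v (\<psi> i)))\<^sup>2) = (\<Sum>i\<in>F. ennreal ((norm (L2_inner v (\<psi> i)))\<^sup>2))"
      by (simp add: sum_ennreal)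
    also have "\<dots> \<le> (SUP F\<in>{F. finite F \<and> F \<subseteq> I}. \<Sum>i\<in>F. ennreal ((norm (L2_inner v (\<psi> i)))\<^sup>2))"
      using that by (intro SUP_upper) auto
    also have "\<dots> = ennreal (N v)"
      using parseval[OF that(1)] by (simp add: nn_integral_count_space_SUP[OF I] N_def)
    finally show ?thesis using N by simp
  qed
  have bessel: "(\<Sum>i\<in>F. (norm (L2_inner v (\<psi> i)))\<^sup>2) \<le> N v" if v: "square_integrable lborel v" and F: "finite F" "F \<subseteq> I" for v F
  proof (rule LIMSEQ_le)
    show "(\<lambda>n. \<Sum>i\<in>F. (norm (L2_inner (truncation v n) (\<psi> i)))\<^sup>2) \<longlonglongrightarrow> (\<Sum>i\<in>F. (norm (L2_inner v (\<psi> i)))\<^sup>2)"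
      using F by (intro tendsto_intros L2_inner_truncation_tendsto v \<psi>) auto
    show "(\<lambda>n. N (truncation v n)) \<longlonglongrightarrow> N v"
      unfolding N_def by (rule L2_norm_truncation_tendsto[OF v])
    show "\<exists>n0. \<forall>n\<ge>n0. (\<Sum>i\<in>F. (norm (L2_inner (truncation v n) (\<psi> i)))\<^sup>2) \<le> N (truncation v n)"
      using bessel0[OF bounded_support_truncation[OF v] F] by blast
  qed
  show "(\<Sum>i\<in>F. (norm (L2_inner u (\<psi> i)))\<^sup>2) \<le> (LINT x|lborel. (norm (u x))\<^sup>2)" if "finite F" "F \<subseteq> I" for F
    using bessel[OF u that] by (simp add: N_def)
  have lower: "N u \<le> s" if s: "\<And>F. finite F \<Longrightarrow> F \<subseteq> I \<Longrightarrow> (\<Sum>i\<in>F. (norm (L2_inner u (\<psi> i)))\<^sup>2) \<le> s" for s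
  proof -
    have s0: "0 \<le> s" using s[of "{}"] by simp
    have d: "N u \<le> (1 + d) * s" if d: "d > 0" for d :: real
    proof (rule LIMSEQ_le)
      show "(\<lambda>n. N (truncation u n)) \<longlonglongrightarrow> N u"
        unfolding N_def by (rule L2_norm_truncation_tendsto[OF u])
      have "(\<lambda>n. N (\<lambda>x. u x - truncation u n x)) \<longlonglongrightarrow> 0"
        unfolding N_def by (rule truncation_L2_tendsto[OF u])
      then have "(\<lambda>n. (1 + d) * s + (1 + 1 / d) * N (\<lambda>x. u x - truncation u n x)) \<longlonglongrightarrow> (1 + d) * s + (1 + 1 / d) * 0"
        by (intro tendsto_intros)
      then show "(\<lambda>n. (1 + d) * s + (1 + 1 / d) * N (\<lambda>x. u x - truncation u n x)) \<longlonglongrightarrow> (1 + d) * s" by simp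
      have "N (truncation u n) \<le> (1 + d) * s + (1 + 1 / d) * N (\<lambda>x. u x - truncation u n x)" for n
      proof -
        let ?v = "truncation u n" and ?r = "\<lambda>x. u x - truncation u n x"
        have r: "square_integrable lborel ?r" by (intro square_integrable_diff u square_integrable_truncation)
        have "ennreal (N ?v) = (SUP F\<in>{F. finite F \<and> F \<subseteq> I}. \<Sum>i\<in>F. ennreal ((norm (L2_inner ?v (\<psi> i)))\<^sup>2))"
          using parseval[OF bounded_support_truncation[OF u]] by (simp add: nn_integral_count_space_SUP[OF I] N_def)
        also have "\<dots> \<le> ennreal ((1 + d) * s + (1 + 1 / d) * N ?r)"
        proof (rule SUP_least)
          fix F assume "F \<in> {F. finite F \<and> F \<subseteq> I}"
          then have F: "finite F" "F \<subseteq> I" by auto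
          have "(\<Sum>i\<in>F. (norm (L2_inner ?v (\<psi> i)))\<^sup>2) \<le> (\<Sum>i\<in>F. (1 + d) * (norm (L2_inner u (\<psi> i)))\<^sup>2 + (1 + 1 / d) * (norm (L2_inner ?r (\<psi> i)))\<^sup>2)"
          proof (rule sum_mono)
            fix i assume "i \<in> F"
            then have "L2_inner ?v (\<psi> i) = L2_inner u (\<psi> i) - L2_inner ?r (\<psi> i)"
              using F by (subst L2_inner_diff_left) (auto intro!: u \<psi> square_integrable_truncation)
            then have "norm (L2_inner ?v (\<psi> i)) \<le> norm (L2_inner u (\<psi> i)) + norm (L2_inner ?r (\<psi> i))"
              by (simp add: norm_triangle_ineq4)
            then have "(norm (L2_inner ?v (\<psi> i)))\<^sup>2 \<le> (norm (L2_inner u (\<psi> i)) + norm (L2_inner ?r (\<psi> i)))\<^sup>2"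
              by (intro power_mono) auto
            also have "\<dots> \<le> (1 + d) * (norm (L2_inner u (\<psi> i)))\<^sup>2 + (1 + 1 / d) * (norm (L2_inner ?r (\<psi> i)))\<^sup>2"
            proof -
              from two_mult_le_weighted[OF d, of "norm (L2_inner u (\<psi> i))" "norm (L2_inner ?r (\<psi> i))"]
              show ?thesis by (simp add: power2_sum distrib_right)
            qed
            finally show "(norm (L2_inner ?v (\<psi> i)))\<^sup>2 \<le> (1 + d) * (norm (L2_inner u (\<psi> i)))\<^sup>2 + (1 + 1 / d) * (norm (L2_inner ?r (\<psi> i)))\<^sup>2" .
          qed
          also have "\<dots> = (1 + d) * (\<Sum>i\<in>F. (norm (L2_inner u (\<psi> i)))\<^sup>2) + (1 + 1 / d) * (\<Sum>i\<in>F. (norm (L2_inner ?r (\<psi> i)))\<^sup>2)"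
            by (simp add: sum.distrib sum_distrib_left)
          also have "\<dots> \<le> (1 + d) * s + (1 + 1 / d) * N ?r"
            using d by (intro add_mono mult_left_mono s F bessel r) auto
          finally show "(\<Sum>i\<in>F. ennreal ((norm (L2_inner ?v (\<psi> i)))\<^sup>2)) \<le> ennreal ((1 + d) * s + (1 + 1 / d) * N ?r)"
            by (simp add: sum_ennreal ennreal_leI)
        qed
        finally show ?thesis using d s0 N[of ?r] by (subst (asm) ennreal_le_iff) auto
      qed
      then show "\<exists>n0. \<forall>n\<ge>n0. N (truncation u n) \<le> (1 + d) * s + (1 + 1 / d) * N (\<lambda>x. u x - truncation u n x)" by blast
    qed
    show "N u \<le> s"
    proof (rule LIMSEQ_le_const)
      show "(\<lambda>n. (1 + 1 / real (Suc n)) * s) \<longlonglongrightarrow> s"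
        using tendsto_mult_right[OF tendsto_add[OF tendsto_const[of 1] LIMSEQ_Suc[OF lim_1_over_n]], of s] by simp
      show "\<exists>n0. \<forall>n\<ge>n0. N u \<le> (1 + 1 / real (Suc n)) * s" using d by auto
    qed
  qed
  show "(\<integral>\<^sup>+i. ennreal ((norm (L2_inner u (\<psi> i)))\<^sup>2) \<partial>count_space I) = ennreal (LINT x|lborel. (norm (u x))\<^sup>2)"
    unfolding N_def[symmetric]
  proof (rule nn_integral_count_space_realI[OF I])
    show "\<exists>F. finite F \<and> F \<subseteq> I \<and> N u - e \<le> (\<Sum>i\<in>F. (norm (L2_inner u (\<psi> i)))\<^sup>2)" if "e > 0" for e
    proof (rule ccontr)
      assume "\<not> ?thesis"
      then have "(\<Sum>i\<in>F. (norm (L2_inner u (\<psi> i)))\<^sup>2) \<le> N u - e" if "finite F" "F \<subseteq> I" for F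
        using that by (meson linear)
      from lower[OF this] that show False by simp
    qed
  qed (use bessel[OF u] in auto)
qed

section \<open>Frame functions on the Fourier side\<close>

text \<open>It suffices to compare the measures of boxes, whose preimages are images under the transpose.\<close>

lemma lborel_distr_orthogonal:
  fixes Q :: "real^3^3"
  assumes Q: "orthogonal_matrix Q"
  shows "distr lborel borel ((*v) Q) = lborel"
proof (rule lborel_eqI[symmetric])
  have [measurable]: "(*v) Q \<in> borel_measurable borel"
    by (intro borel_measurable_continuous_onI continuous_intros)
  fix l u :: "real^3" assume le: "\<And>b. b \<in> Basis \<Longrightarrow> l \<bullet> b \<le> u \<bullet> b"
  define g where "g = (*v) (transpose Q)"
  have inv: "Q *v (transpose Q *v x) = x" "transpose Q *v (Q *v x) = x" for x
    using Q by (simp_all add: matrix_vector_mul_assoc orthogonal_matrix_def del: transpose_matrix_vector)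
  have g: "orthogonal_transformation g"
    using Q unfolding g_def by (simp add: orthogonal_transformation_matrix matrix_vector_mul_linear)
  have vim: "(*v) Q -` box l u = g ` box l u"
  proof (rule set_eqI)
    fix x
    show "x \<in> (*v) Q -` box l u \<longleftrightarrow> x \<in> g ` box l u"
      unfolding g_def vimage_eq image_iff using inv by metis
  qed
  have box: "box l u \<in> lmeasurable" by simp
  have gb: "g ` box l u \<in> sets borel"
    unfolding vim[symmetric] using measurable_sets[of "(*v) Q" borel borel "box l u"] by simp
  have "emeasure (distr lborel borel ((*v) Q)) (box l u) = emeasure lborel (g ` box l u)"
    by (subst emeasure_distr) (auto simp: vim)
  also have "\<dots> = emeasure lebesgue (g ` box l u)" using gb by simp
  also have "\<dots> = ennreal (measure lebesgue (g ` box l u))"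
    by (rule emeasure_eq_measure2[OF measurable_orthogonal_image[OF g box]])
  also have "\<dots> = ennreal (measure lebesgue (box l u))"
    by (simp only: measure_orthogonal_image[OF g box])
  also have "\<dots> = ennreal (\<Prod>b\<in>Basis. (u - l) \<bullet> b)"
    using le by (simp add: measure_lborel_box_eq)
  finally show "emeasure (distr lborel borel ((*v) Q)) (box l u) = ennreal (prod ((\<bullet>) (u - l)) Basis)"
    by simp
qed simp

lemma integral_lborel_orthogonal:
  fixes f :: "real^3 \<Rightarrow> 'b::{banach, second_countable_topology}"
  assumes Q: "orthogonal_matrix Q" and f: "f \<in> borel_measurable borel"
  shows "(LINT x|lborel. f (Q *v x)) = (LINT x|lborel. f x)"
proof -
  have "(LINT x|lborel. f x) = (LINT x|distr lborel borel ((*v) Q). f x)"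
    by (simp add: lborel_distr_orthogonal[OF Q])
  also have "\<dots> = (LINT x|lborel. f (Q *v x))"
    by (rule integral_distr) (use f in \<open>auto intro!: borel_measurable_continuous_onI continuous_intros\<close>)
  finally show ?thesis ..
qed

lemma matrix_inv_orthogonal:
  fixes Q :: "real^'n^'n"
  assumes Q: "orthogonal_matrix Q"
  shows "matrix_inv Q = transpose Q"
proof -
  have Q: "Q ** transpose Q = mat 1" "transpose Q ** Q = mat 1"
    using Q by (simp_all add: orthogonal_matrix_def)
  then have "invertible Q" unfolding invertible_def by blast
  then have "matrix_inv Q ** Q = mat 1"
    unfolding invertible_def matrix_inv_def by (rule someI2_ex) simp
  then have "transpose Q = (matrix_inv Q ** Q) ** transpose Q" by simp
  also have "\<dots> = matrix_inv Q" by (simp add: matrix_mul_assoc[symmetric] Q)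
  finally show ?thesis ..
qed

lemma orthogonal_matrix_inv:
  fixes Q :: "real^'n^'n"
  assumes "orthogonal_matrix Q" shows "orthogonal_matrix (matrix_inv Q)"
  unfolding matrix_inv_orthogonal[OF assms] using assms by (simp add: orthogonal_matrix_transpose)

lemma orthogonal_matrix_inv_cancel:
  fixes Q :: "real^'n^'n"
  assumes "orthogonal_matrix Q"
  shows "Q *v (matrix_inv Q *v x) = x" and "matrix_inv Q *v (Q *v x) = x"
  unfolding matrix_inv_orthogonal[OF assms] using assms
  by (simp_all add: matrix_vector_mul_assoc orthogonal_matrix_def del: transpose_matrix_vector)

lemma borel_measurable_vec_lambda:
  fixes f :: "'n::finite \<Rightarrow> 'a \<Rightarrow> 'b::euclidean_space"
  assumes "\<And>i. f i \<in> borel_measurable M"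
  shows "(\<lambda>x. \<chi> i. f i x) \<in> borel_measurable M"
proof (subst borel_measurable_euclidean_space, intro ballI)
  fix b :: "'b^'n" assume "b \<in> Basis"
  then obtain i c where "b = axis i c" by (auto simp: Basis_vec_def)
  then show "(\<lambda>x. (\<chi> i. f i x) \<bullet> b) \<in> borel_measurable M"
    using assms[of i] by (simp add: inner_axis)
qed

lemma borel_measurable_vec_nth [measurable (raw)]:
  fixes f :: "'a \<Rightarrow> ('b::real_normed_vector)^'n"
  assumes "f \<in> borel_measurable M" shows "(\<lambda>x. f x $ i) \<in> borel_measurable M"
  using assms
  by (rule measurable_compose) (intro borel_measurable_continuous_onI continuous_intros)

lemma bounded_support_component: "bounded_support u \<Longrightarrow> bounded_support (\<lambda>x. u x $ i)"
  for u :: "real^'m \<Rightarrow> complex^'n"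
  by (rule bounded_support_dominated[of u _ 1]) (auto simp: Finite_Cartesian_Product.norm_nth_le)

text \<open>Both factors have bounded support, so the double integral converges absolutely and Fubini applies.\<close>

lemma fourier_fubini:
  fixes f g :: "real^'n \<Rightarrow> complex"
  assumes f: "bounded_support f" and g: "bounded_support g"
  shows "(LINT y|lborel. f y * cnj (LINT \<xi>|lborel. g \<xi> * plane_wave y \<xi>)) = (LINT \<xi>|lborel. fourier f \<xi> * cnj (g \<xi>))"
proof -
  note [measurable] = bounded_support_measurable[OF f] bounded_support_measurable[OF g]
  define h where "h \<xi> y = f y * cnj (g \<xi>) * plane_wave (- \<xi>) y" for \<xi> y
  have hm [measurable]: "(\<lambda>(\<xi>, y). h \<xi> y) \<in> borel_measurable (lborel \<Otimes>\<^sub>M lborel)"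
    unfolding h_def by measurable
  have int: "integrable (lborel \<Otimes>\<^sub>M lborel) (\<lambda>(\<xi>, y). h \<xi> y)"
  proof (rule lborel_pair.Fubini_integrable)
    show "(\<lambda>(\<xi>, y). h \<xi> y) \<in> borel_measurable (lborel \<Otimes>\<^sub>M lborel)" by measurable
    have "(\<lambda>\<xi>. LINT y|lborel. norm (h \<xi> y)) = (\<lambda>\<xi>. norm (g \<xi>) * (LINT y|lborel. norm (f y)))"
      by (simp add: h_def norm_mult mult.commute)
    then show "integrable lborel (\<lambda>\<xi>. LINT y|lborel. norm (case (\<xi>, y) of (\<xi>, y) \<Rightarrow> h \<xi> y))"
      using bounded_support_integrable[OF g] by simp
    show "AE \<xi> in lborel. integrable lborel (\<lambda>y. case (\<xi>, y) of (\<xi>, y) \<Rightarrow> h \<xi> y)"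
    proof (intro AE_I2)
      fix \<xi>
      have "bounded_support (h \<xi>)"
        by (rule bounded_support_dominated[OF f, of _ "norm (g \<xi>)"]) (auto simp: h_def[abs_def] norm_mult)
      then show "integrable lborel (\<lambda>y. case (\<xi>, y) of (\<xi>, y) \<Rightarrow> h \<xi> y)"
        by (simp add: bounded_support_integrable)
    qed
  qed
  have "(LINT y|lborel. f y * cnj (LINT \<xi>|lborel. g \<xi> * plane_wave y \<xi>)) = (LINT y|lborel. LINT \<xi>|lborel. h \<xi> y)"
  proof (rule Bochner_Integration.integral_cong[OF refl])
    fix y
    have "f y * cnj (LINT \<xi>|lborel. g \<xi> * plane_wave y \<xi>) = (LINT \<xi>|lborel. f y * cnj (g \<xi> * plane_wave y \<xi>))"
      by (simp del: complex_cnj_mult)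
    also have "\<dots> = (LINT \<xi>|lborel. h \<xi> y)"
    proof -
      have "cnj (plane_wave y \<xi>) = plane_wave (- \<xi>) y" for \<xi>
        by (simp add: plane_wave_def cis_cnj inner_commute)
      then show ?thesis by (simp add: h_def mult.assoc)
    qed
    finally show "f y * cnj (LINT \<xi>|lborel. g \<xi> * plane_wave y \<xi>) = (LINT \<xi>|lborel. h \<xi> y)" .
  qed
  also have "\<dots> = (LINT \<xi>|lborel. LINT y|lborel. h \<xi> y)"
    by (rule lborel_pair.Fubini_integral[OF int])
  also have "\<dots> = (LINT \<xi>|lborel. cnj (g \<xi>) * fourier f \<xi>)"
    by (simp add: h_def fourier_def mult_ac flip: Bochner_Integration.integral_mult_right_zero)
  finally show ?thesis by (simp add: mult.commute)
qed

lemma inv_fourier_nth: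
  "inv_fourier F x $ i = of_real ((2 * pi) powr (- 3 / 2)) * (LINT \<xi>|lborel. F \<xi> $ i * plane_wave x \<xi>)"
  by (simp add: inv_fourier_def plane_wave_def cis_conv_exp)

lemma inv_fourier_eq_fourier:
  "inv_fourier F x $ i = of_real ((2 * pi) powr (- 3 / 2)) * fourier (\<lambda>\<xi>. F \<xi> $ i) (- x)"
  by (simp add: inv_fourier_nth fourier_def)

lemma two_pi_powr_sq: "((2 * pi) powr (- 3 / 2))\<^sup>2 = 1 / (2 * pi) ^ 3"
proof -
  have "((2 * pi) powr (- 3 / 2))\<^sup>2 = (2 * pi) powr (- real 3)"
    by (simp add: power2_eq_square flip: powr_add)
  also have "\<dots> = 1 / (2 * pi) ^ 3"
    by (subst powr_minus, subst powr_realpow) (auto simp: field_simps)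
  finally show ?thesis .
qed

lemma borel_measurable_inv_fourier:
  assumes F: "F \<in> borel_measurable borel"
  shows "inv_fourier F \<in> borel_measurable borel"
proof -
  note [measurable] = F
  have "(\<lambda>x. \<chi> i. inv_fourier F x $ i) \<in> borel_measurable borel"
    unfolding inv_fourier_nth by (rule borel_measurable_vec_lambda) measurable
  then show ?thesis by simp
qed

text \<open>Componentwise the inverse transform is, up to the constant, the transform at the reflected point.\<close>

theorem plancherel_inv_fourier:
  assumes F: "bounded_support F"
  shows "square_integrable lborel (inv_fourier F)"
    and "(LINT x|lborel. (norm (inv_fourier F x))\<^sup>2) = (LINT \<xi>|lborel. (norm (F \<xi>))\<^sup>2)"
proof -
  note Fm [measurable] = bounded_support_measurable[OF F]
  note Fi = bounded_support_component[OF F]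
  have m [measurable]: "inv_fourier F \<in> borel_measurable borel" by (rule borel_measurable_inv_fourier) fact
  have sqi: "integrable lborel (\<lambda>\<xi>. (norm (F \<xi> $ i))\<^sup>2)" for i
    by (rule integrable_norm_sq[OF bounded_support_square_integrable[OF Fi]])
  have "(\<integral>\<^sup>+x. ennreal ((norm (inv_fourier F x))\<^sup>2) \<partial>lborel) =
    (\<integral>\<^sup>+x. (\<Sum>i\<in>UNIV. ennreal (1 / (2 * pi) ^ 3) * ennreal ((norm (fourier (\<lambda>\<xi>. F \<xi> $ i) (- x)))\<^sup>2)) \<partial>lborel)"
    unfolding norm_sq_cart inv_fourier_eq_fourier norm_mult power_mult_distrib
    by (intro nn_integral_cong)
      (simp add: two_pi_powr_sq[simplified] sum_ennreal flip: ennreal_mult)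
  also have "\<dots> = (\<Sum>i\<in>UNIV. ennreal (1 / (2 * pi) ^ 3) * (\<integral>\<^sup>+x. ennreal ((norm (fourier (\<lambda>\<xi>. F \<xi> $ i) (- x)))\<^sup>2) \<partial>lborel))"
    by (simp add: nn_integral_sum nn_integral_cmult)
  also have "\<dots> = (\<Sum>i\<in>UNIV. ennreal (1 / (2 * pi) ^ 3) * (\<integral>\<^sup>+x. ennreal ((norm (fourier (\<lambda>\<xi>. F \<xi> $ i) x))\<^sup>2) \<partial>lborel))"
    using nn_integral_lborel_scale[of "\<lambda>x. ennreal ((norm (fourier (\<lambda>\<xi>. F \<xi> $ i) x))\<^sup>2)" "-1" for i] by simp
  also have "\<dots> = (\<Sum>i\<in>UNIV. ennreal (LINT x|lborel. (norm (F x $ i))\<^sup>2))"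
    by (simp add: plancherel[OF Fi] ennreal_mult[symmetric])
  also have "\<dots> = ennreal (LINT x|lborel. (norm (F x))\<^sup>2)"
    unfolding norm_sq_cart using sqi by (simp add: sum_ennreal)
  finally have eq: "(\<integral>\<^sup>+x. ennreal ((norm (inv_fourier F x))\<^sup>2) \<partial>lborel) = ennreal (LINT x|lborel. (norm (F x))\<^sup>2)" .
  then show sq: "square_integrable lborel (inv_fourier F)"
    unfolding square_integrable_def by (intro conjI integrableI_bounded) auto
  show "(LINT x|lborel. (norm (inv_fourier F x))\<^sup>2) = (LINT \<xi>|lborel. (norm (F \<xi>))\<^sup>2)"
    using eq by (subst integral_eq_nn_integral) auto
qed

lemma L2_inner_inv_fourier:
  assumes u: "bounded_support u" and F: "bounded_support F"
  shows "L2_inner u (inv_fourier F) = of_real ((2 * pi) powr (- 3 / 2)) *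
    (LINT \<xi>|lborel. (\<Sum>i\<in>UNIV. fourier (\<lambda>x. u x $ i) \<xi> * cnj (F \<xi> $ i)))"
proof -
  define c where "c = complex_of_real ((2 * pi) powr (- 3 / 2))"
  note ui = bounded_support_component[OF u] and Fi = bounded_support_component[OF F]
  have sq: "square_integrable lborel (\<lambda>y. u y $ i)" "square_integrable lborel (\<lambda>y. inv_fourier F y $ i)" for i
    by (intro square_integrable_component bounded_support_square_integrable u plancherel_inv_fourier F)+
  have m [measurable]: "fourier (\<lambda>x. u x $ i) \<in> borel_measurable borel" for i
    using bounded_support_measurable[OF u] by measurable
  have int: "integrable lborel (\<lambda>\<xi>. fourier (\<lambda>x. u x $ i) \<xi> * cnj (F \<xi> $ i))" for i
  proof -
    obtain B where B: "\<And>\<xi>. norm (fourier (\<lambda>x. u x $ i) \<xi>) \<le> B"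
    proof
      show "norm (fourier (\<lambda>x. u x $ i) \<xi>) \<le> (LINT x|lborel. norm (u x $ i))" for \<xi>
        unfolding fourier_def using integral_norm_bound[of lborel "\<lambda>x. u x $ i * plane_wave (- \<xi>) x"] by (simp add: norm_mult)
    qed
    have "bounded_support (\<lambda>\<xi>. fourier (\<lambda>x. u x $ i) \<xi> * cnj (F \<xi> $ i))"
      by (rule bounded_support_dominated[OF Fi, of _ B])
        (use B bounded_support_measurable[OF F] in \<open>auto simp: norm_mult intro!: mult_right_mono\<close>)
    then show ?thesis by (rule bounded_support_integrable)
  qed
  have "L2_inner u (inv_fourier F) = (\<Sum>i\<in>UNIV. LINT y|lborel. u y $ i * cnj (inv_fourier F y $ i))"
    unfolding L2_inner_def by (intro Bochner_Integration.integral_sum integrable_cnj_mult sq)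
  also have "\<dots> = (\<Sum>i\<in>UNIV. c * (LINT y|lborel. u y $ i * cnj (LINT \<xi>|lborel. F \<xi> $ i * plane_wave y \<xi>)))"
    unfolding inv_fourier_nth c_def[symmetric]
    by (simp add: mult.left_commute[of _ "cnj c"]) (simp add: c_def)
  also have "\<dots> = (\<Sum>i\<in>UNIV. c * (LINT \<xi>|lborel. fourier (\<lambda>x. u x $ i) \<xi> * cnj (F \<xi> $ i)))"
    by (simp only: fourier_fubini[OF ui Fi])
  also have "\<dots> = c * (LINT \<xi>|lborel. (\<Sum>i\<in>UNIV. fourier (\<lambda>x. u x $ i) \<xi> * cnj (F \<xi> $ i)))"
    using int by (simp add: Bochner_Integration.integral_sum flip: sum_distrib_left)
  finally show ?thesis by (simp add: c_def)
qed

text \<open>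
  The Fourier transform of the frame function of scale \<open>j\<close> and translation \<open>k\<close> whose mother field has
  the transform \<open>F\<close>: the translation becomes a wave and the dilation is inverted.
\<close>

definition frame_function_hat ::
    "real^3^3 \<Rightarrow> (real^3 \<Rightarrow> complex^3) \<Rightarrow> int \<Rightarrow> int^3 \<Rightarrow> real^3 \<Rightarrow> complex^3" where
  "frame_function_hat Q F j k \<xi> =
     (of_real (2 powr (- 3 * real_of_int j / 2) / (2 * pi) powr (3 / 2)) *
        plane_wave (- ((2 powi (- j)) *\<^sub>R lattice_point k)) \<xi>) *s rotate_field Q F ((2 powi (- j)) *\<^sub>R \<xi>)"

lemma rotate_field_nth:
  "rotate_field Q F x $ i = (\<Sum>l\<in>UNIV. of_real (Q $ i $ l) * F (matrix_inv Q *v x) $ l)"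
  by (simp add: rotate_field_def matrix_vector_mult_def map_matrix_def)

text \<open>
  Splitting into real and imaginary parts reduces the action of real matrices on complex vectors to
  that on real ones.
\<close>

definition vec_Re :: "complex^'n \<Rightarrow> real^'n" where "vec_Re z = (\<chi> i. Re (z $ i))"
definition vec_Im :: "complex^'n \<Rightarrow> real^'n" where "vec_Im z = (\<chi> i. Im (z $ i))"

lemma norm_sq_vec_Re_Im: "(norm z)\<^sup>2 = (norm (vec_Re z))\<^sup>2 + (norm (vec_Im z))\<^sup>2"
  unfolding norm_sq_cart sum.distrib[symmetric]
  by (intro sum.cong refl) (simp add: vec_Re_def vec_Im_def cmod_power2)

lemma norm_orthogonal_matrix:
  assumes Q: "orthogonal_matrix (Q::real^'n^'n)" shows "norm (Q *v x) = norm x"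
proof -
  have "orthogonal_transformation ((*v) Q)"
    using Q by (simp add: orthogonal_transformation_matrix)
  then show ?thesis by (rule orthogonal_transformation_norm)
qed

lemma norm_map_matrix_of_real:
  assumes Q: "orthogonal_matrix (Q::real^'n^'n)" 
  shows "norm (map_matrix complex_of_real Q *v z) = norm z"
proof -
  have "vec_Re (map_matrix complex_of_real Q *v z) = Q *v vec_Re z"
    "vec_Im (map_matrix complex_of_real Q *v z) = Q *v vec_Im z"
    by (simp_all add: vec_eq_iff vec_Re_def vec_Im_def matrix_vector_mult_def map_matrix_def)
  then have "(norm (map_matrix complex_of_real Q *v z))\<^sup>2 = (norm z)\<^sup>2"
    unfolding norm_sq_vec_Re_Im by (simp add: norm_orthogonal_matrix[OF Q])
  then show ?thesis by simp
qed

lemma bounded_support_rotate_field: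
  assumes Q: "orthogonal_matrix Q" and F: "bounded_support F"
  shows "bounded_support (rotate_field Q F)"
proof -
  note [measurable] = bounded_support_measurable[OF F]
  obtain B r where B: "\<And>x. norm (F x) \<le> B" "\<And>x. norm x > r \<Longrightarrow> F x = 0"
    using bounded_supportE[OF F] by metis
  have QT: "orthogonal_matrix (matrix_inv Q)" by (rule orthogonal_matrix_inv[OF Q])
  have [measurable]: "(*v) (matrix_inv Q) \<in> borel_measurable borel"
    by (intro borel_measurable_continuous_onI continuous_intros)
  have "(\<lambda>x. \<chi> i. rotate_field Q F x $ i) \<in> borel_measurable borel"
    unfolding rotate_field_nth by (rule borel_measurable_vec_lambda) measurable
  then have "rotate_field Q F \<in> borel_measurable borel" by simp
  then show ?thesis
    by (rule bounded_supportI[of _ B r])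
      (auto simp: rotate_field_def norm_map_matrix_of_real[OF Q] B norm_orthogonal_matrix[OF QT])
qed

text \<open>
  The Lebesgue measure and the phase \<open>\<langle>x, \<xi>\<rangle>\<close> are invariant under rotations, so that rotating the
  argument commutes with the transform, and the constant matrix acting on the values does so anyway.
\<close>

lemma rotate_field_inv_fourier:
  assumes Q: "orthogonal_matrix Q" and F: "bounded_support F"
  shows "rotate_field Q (inv_fourier F) = inv_fourier (rotate_field Q F)"
proof (intro ext, subst vec_eq_iff, intro allI)
  fix x i
  define c where "c = complex_of_real ((2 * pi) powr (- 3 / 2))"
  note [measurable] = bounded_support_measurable[OF F]
  have QT: "orthogonal_matrix (matrix_inv Q)" by (rule orthogonal_matrix_inv[OF Q])
  have QT': "orthogonal_transformation ((*v) (matrix_inv Q))"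
    using QT by (simp add: orthogonal_transformation_matrix)
  have [measurable]: "(*v) (matrix_inv Q) \<in> borel_measurable borel"
    by (intro borel_measurable_continuous_onI continuous_intros)
  have int: "integrable lborel (\<lambda>\<xi>. of_real (Q $ i $ l) * (F \<xi> $ l * plane_wave y \<xi>))" for l y
  proof (rule bounded_support_integrable, rule bounded_support_dominated[OF F])
    show "norm (of_real (Q $ i $ l) * (F \<xi> $ l * plane_wave y \<xi>)) \<le> \<bar>Q $ i $ l\<bar> * norm (F \<xi>)" for \<xi>
      by (simp add: norm_mult mult_left_mono Finite_Cartesian_Product.norm_nth_le)
  qed measurable
  have "rotate_field Q (inv_fourier F) x $ i = c * (\<Sum>l\<in>UNIV. LINT \<xi>|lborel. of_real (Q $ i $ l) * (F \<xi> $ l * plane_wave (matrix_inv Q *v x) \<xi>))"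
    unfolding rotate_field_nth inv_fourier_nth c_def[symmetric]
    by (simp only: Bochner_Integration.integral_mult_right_zero sum_distrib_left mult.left_commute[of _ c])
  also have "\<dots> = c * (LINT \<xi>|lborel. (\<Sum>l\<in>UNIV. of_real (Q $ i $ l) * (F \<xi> $ l * plane_wave (matrix_inv Q *v x) \<xi>)))"
    using int by (subst Bochner_Integration.integral_sum) auto
  also have "\<dots> = c * (LINT \<xi>|lborel. (\<Sum>l\<in>UNIV. of_real (Q $ i $ l) * (F (matrix_inv Q *v \<xi>) $ l * plane_wave (matrix_inv Q *v x) (matrix_inv Q *v \<xi>))))"
    by (subst integral_lborel_orthogonal[OF QT, symmetric]) auto
  also have "\<dots> = c * (LINT \<xi>|lborel. rotate_field Q F \<xi> $ i * plane_wave x \<xi>)"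
    using QT' by (simp add: rotate_field_nth sum_distrib_right mult.assoc plane_wave_def orthogonal_transformation_def)
  finally show "rotate_field Q (inv_fourier F) x $ i = inv_fourier (rotate_field Q F) x $ i"
    by (simp add: inv_fourier_nth c_def)
qed

lemma two_powi: "(2::real) powi j = 2 powr (real_of_int j)"
  by (simp add: powr_real_of_int')

lemma bounded_support_frame_function_hat:
  assumes Q: "orthogonal_matrix Q" and F: "bounded_support F"
  shows "bounded_support (frame_function_hat Q F j k)"
proof -
  define a where "a = (2::real) powi (- j)"
  have a: "a > 0" by (simp add: a_def)
  obtain B r where B: "0 < B" "0 < r" "\<And>x. norm (rotate_field Q F x) \<le> B" "\<And>x. norm x > r \<Longrightarrow> rotate_field Q F x = 0"
    using bounded_supportE[OF bounded_support_rotate_field[OF Q F]] by metis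
  have [measurable]: "rotate_field Q F \<in> borel_measurable borel"
    using bounded_support_measurable[OF bounded_support_rotate_field[OF Q F]] .
  have m: "(\<lambda>\<xi>. \<chi> i. frame_function_hat Q F j k \<xi> $ i) \<in> borel_measurable borel"
    unfolding frame_function_hat_def vector_smult_component by (rule borel_measurable_vec_lambda) measurable
  define c where "c = norm (complex_of_real (2 powr (- 3 * real_of_int j / 2) / (2 * pi) powr (3 / 2)))"
  have n: "norm (frame_function_hat Q F j k \<xi>) = c * norm (rotate_field Q F (a *\<^sub>R \<xi>))" for \<xi>
    unfolding frame_function_hat_def norm_smult norm_mult norm_plane_wave c_def a_def by simp
  show ?thesis
  proof (rule bounded_supportI[of _ "c * B" "r / a"])
    show "norm (frame_function_hat Q F j k \<xi>) \<le> c * B" for \<xi>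
      unfolding n using B by (intro mult_left_mono) (auto simp: c_def)
    show "frame_function_hat Q F j k \<xi> = 0" if "norm \<xi> > r / a" for \<xi>
      using that a B(4)[of "a *\<^sub>R \<xi>"] by (simp add: frame_function_hat_def a_def[symmetric] field_simps)
  qed (use m in simp)
qed

theorem frame_function_inv_fourier:
  assumes Q: "orthogonal_matrix Q" and F: "bounded_support F"
  shows "frame_function Q (inv_fourier F) j k = inv_fourier (frame_function_hat Q F j k)"
proof (intro ext, subst vec_eq_iff, intro allI)
  fix x i
  define c where "c = complex_of_real ((2 * pi) powr (- 3 / 2))"
  define a where "a = (2::real) powi (- j)"
  have a: "a > 0" by (simp add: a_def)
  define D where "D = rotate_field Q F"
  have [measurable]: "D \<in> borel_measurable borel"
    unfolding D_def using bounded_support_measurable[OF bounded_support_rotate_field[OF Q F]] .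
  define y where "y = (2 powi j) *\<^sub>R x - lattice_point k"
  have w: "plane_wave y (a *\<^sub>R \<xi>) = plane_wave (- (a *\<^sub>R lattice_point k)) \<xi> * plane_wave x \<xi>" for \<xi>
  proof -
    have "a * 2 powi j = 1" by (simp add: a_def power_int_minus)
    then have "a *\<^sub>R y = - (a *\<^sub>R lattice_point k) + x" by (simp add: y_def scaleR_right_diff_distrib)
    moreover have "plane_wave y (a *\<^sub>R \<xi>) = plane_wave (a *\<^sub>R y) \<xi>" by (simp add: plane_wave_def)
    ultimately show ?thesis by (simp only: plane_wave_add_left)
  qed
  \<comment> \<open>The substitution contributes \<open>a ^ 3\<close>, with \<open>a\<close> the inverse of the dilation factor.\<close>
  have const: "2 powr (3 * real_of_int j / 2) / (2 * pi) powr (3 / 2) * a ^ 3 = 2 powr (- 3 * real_of_int j / 2) / (2 * pi) powr (3 / 2)"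
  proof -
    have "a ^ 3 = 2 powr (- 3 * real_of_int j)"
      unfolding a_def two_powi by (simp add: powr_power)
    then have "2 powr (3 * real_of_int j / 2) * a ^ 3 = 2 powr (3 * real_of_int j / 2 + - 3 * real_of_int j)"
      by (simp only: powr_add)
    also have "3 * real_of_int j / 2 + - 3 * real_of_int j = - 3 * real_of_int j / 2" by simp
    finally show ?thesis by (simp add: field_simps)
  qed
  have "frame_function Q (inv_fourier F) j k x $ i =
    of_real (2 powr (3 * real_of_int j / 2) / (2 * pi) powr (3 / 2)) * inv_fourier D y $ i"
    unfolding frame_function_def rotate_field_inv_fourier[OF Q F] D_def y_def lattice_point_def
    by (simp add: scaleR_conv_of_real[of _ "_ :: complex"])
  also have "\<dots> = of_real (2 powr (3 * real_of_int j / 2) / (2 * pi) powr (3 / 2)) * (c * (LINT \<eta>|lborel. D \<eta> $ i * plane_wave y \<eta>))"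
    by (simp add: inv_fourier_nth c_def)
  also have "(LINT \<eta>|lborel. D \<eta> $ i * plane_wave y \<eta>) = \<bar>a\<bar> ^ DIM(real^3) *\<^sub>R (LINT \<xi>|lborel. D (a *\<^sub>R \<xi>) $ i * plane_wave y (a *\<^sub>R \<xi>))"
    using a by (intro integral_lborel_scale) auto
  also have "of_real (2 powr (3 * real_of_int j / 2) / (2 * pi) powr (3 / 2)) * (c * \<dots>) =
    c * (of_real (2 powr (3 * real_of_int j / 2) / (2 * pi) powr (3 / 2) * a ^ 3) * (LINT \<xi>|lborel. D (a *\<^sub>R \<xi>) $ i * plane_wave y (a *\<^sub>R \<xi>)))"
    using a by (simp add: scaleR_conv_of_real[of _ "_ :: complex"] mult_ac)
  also have "\<dots> = c * (LINT \<xi>|lborel. of_real (2 powr (- 3 * real_of_int j / 2) / (2 * pi) powr (3 / 2)) * (D (a *\<^sub>R \<xi>) $ i * plane_wave y (a *\<^sub>R \<xi>)))"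
    unfolding const by (simp only: Bochner_Integration.integral_mult_right_zero)
  also have "\<dots> = inv_fourier (frame_function_hat Q F j k) x $ i"
    unfolding inv_fourier_nth w frame_function_hat_def a_def[symmetric] D_def[symmetric] vector_smult_component c_def
    by (simp only: mult_ac)
  finally show "frame_function Q (inv_fourier F) j k x $ i = inv_fourier (frame_function_hat Q F j k) x $ i" .
qed

text \<open>
  For a fixed scale and orientation the inner products with all translates are the Fourier
  coefficients of a function supported in the cube, which is where the band limit enters; so
  their square sum is an integral, by Parseval's identity.
\<close>

theorem translates_square_sum:
  assumes Q: "orthogonal_matrix Q" and F: "bounded_support F" and band: "\<And>\<xi>. norm \<xi> > pi \<Longrightarrow> F \<xi> = 0"
    and u: "bounded_support u"
  shows "(\<integral>\<^sup>+k. ennreal ((norm (L2_inner u (frame_function Q (inv_fourier F) j k)))\<^sup>2) \<partial>count_space UNIV) =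
    ennreal (1 / (2 * pi) ^ 3) * (\<integral>\<^sup>+\<xi>. ennreal ((norm (\<Sum>i\<in>UNIV. fourier (\<lambda>x. u x $ i) \<xi> * cnj (rotate_field Q F ((2 powi (- j)) *\<^sub>R \<xi>) $ i)))\<^sup>2) \<partial>lborel)"
proof -
  define D where "D = rotate_field Q F"
  have QT: "orthogonal_matrix (matrix_inv Q)" by (rule orthogonal_matrix_inv[OF Q])
  have D0: "D \<xi> = 0" if "norm \<xi> > pi" for \<xi>
    using band[of "matrix_inv Q *v \<xi>"] that by (simp add: D_def rotate_field_def norm_orthogonal_matrix[OF QT])
  have D: "bounded_support D" unfolding D_def by (rule bounded_support_rotate_field[OF Q F])
  have Dm [measurable]: "D \<in> borel_measurable borel" by (rule bounded_support_measurable[OF D])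
  have um [measurable]: "u \<in> borel_measurable borel" by (rule bounded_support_measurable[OF u])
  define v where "v i = fourier (\<lambda>x. u x $ i)" for i
  have vm [measurable]: "v i \<in> borel_measurable borel" for i unfolding v_def by measurable
  \<comment> \<open>The substitution \<open>\<eta> = a \<xi>\<close> turns the phases of the translates into lattice waves in \<open>\<eta>\<close>.\<close>
  define a where "a = (2::real) powi (- j)"
  have a: "a > 0" by (simp add: a_def)
  define b where "b = inverse a"
  have b: "b > 0" "a * b = 1" using a by (simp_all add: b_def)
  define G where "G \<xi> = (\<Sum>i\<in>UNIV. v i \<xi> * cnj (D (a *\<^sub>R \<xi>) $ i))" for \<xi>
  have Gm [measurable]: "G \<in> borel_measurable borel" unfolding G_def by measurable
  define g where "g \<eta> = G (b *\<^sub>R \<eta>)" for \<eta>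
  have gm [measurable]: "g \<in> borel_measurable borel" unfolding g_def by measurable
  have g_eq: "g \<eta> = (\<Sum>i\<in>UNIV. v i (b *\<^sub>R \<eta>) * cnj (D \<eta> $ i))" for \<eta>
    by (simp add: g_def G_def b)
  have g0: "g \<eta> = 0" if "\<eta> \<notin> cbox (\<chi> i. - pi) (\<chi> i. pi)" for \<eta>
  proof -
    from that obtain i where "\<eta> $ i < - pi \<or> pi < \<eta> $ i" by (auto simp: mem_box_cart not_le)
    then have "\<bar>\<eta> $ i\<bar> > pi" by auto
    with component_le_norm_cart[of \<eta> i] have "norm \<eta> > pi" by linarith
    then show ?thesis by (simp add: g_eq D0)
  qed
  obtain B r where B: "0 < B" "\<And>x. norm (D x) \<le> B" using bounded_supportE[OF D] by metis
  have vB: "norm (v i \<xi>) \<le> (LINT x|lborel. norm (u x $ i))" for i \<xi>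
    unfolding v_def fourier_def using integral_norm_bound[of lborel "\<lambda>x. u x $ i * plane_wave (- \<xi>) x"] by (simp add: norm_mult)
  have gB: "norm (g \<eta>) \<le> (\<Sum>i\<in>UNIV. (LINT x|lborel. norm (u x $ i)) * B)" for \<eta>
    unfolding g_eq
  proof (rule sum_norm_le)
    fix i :: 3
    have "norm (v i (b *\<^sub>R \<eta>)) * norm (D \<eta> $ i) \<le> (LINT x|lborel. norm (u x $ i)) * B"
      by (intro mult_mono vB order.trans[OF Finite_Cartesian_Product.norm_nth_le B(2)]) auto
    then show "norm (v i (b *\<^sub>R \<eta>) * cnj (D \<eta> $ i)) \<le> (LINT x|lborel. norm (u x $ i)) * B"
      by (simp add: norm_mult)
  qed
  have g_sq: "square_integrable cube_measure g"
    by (rule square_integrable_finite_measure[OF finite_measure_cube_measure _ gB]) simp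
  define K where "K = 2 powr (- 3 * real_of_int j / 2) / (2 * pi) powr (3 / 2)"
  define c where "c = (2 * pi) powr (- 3 / 2)"
  have inner: "L2_inner u (frame_function Q (inv_fourier F) j k) =
    of_real (c * K * b ^ 3) * (LINT \<eta>|cube_measure. g \<eta> * cnj (plane_wave (lattice_point (- k)) \<eta>))" for k
  proof -
    have "L2_inner u (frame_function Q (inv_fourier F) j k) = of_real c *
      (LINT \<xi>|lborel. (\<Sum>i\<in>UNIV. v i \<xi> * cnj (frame_function_hat Q F j k \<xi> $ i)))"
      unfolding frame_function_inv_fourier[OF Q F] v_def c_def
      by (rule L2_inner_inv_fourier[OF u bounded_support_frame_function_hat[OF Q F]])
    also have "\<dots> = of_real c * (LINT \<xi>|lborel. of_real K * (G \<xi> * plane_wave (a *\<^sub>R lattice_point k) \<xi>))"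
      unfolding frame_function_hat_def G_def K_def[symmetric] a_def[symmetric] D_def[symmetric]
      by (intro arg_cong[where f="\<lambda>z. of_real c * z"] Bochner_Integration.integral_cong refl)
        (simp add: cnj_plane_wave sum_distrib_left sum_distrib_right mult_ac)
    also have "\<dots> = of_real (c * K) * (LINT \<xi>|lborel. G \<xi> * plane_wave (a *\<^sub>R lattice_point k) \<xi>)"
      by (simp only: Bochner_Integration.integral_mult_right_zero) simp
    also have "(LINT \<xi>|lborel. G \<xi> * plane_wave (a *\<^sub>R lattice_point k) \<xi>) =
      \<bar>b\<bar> ^ DIM(real^3) *\<^sub>R (LINT \<eta>|lborel. G (b *\<^sub>R \<eta>) * plane_wave (a *\<^sub>R lattice_point k) (b *\<^sub>R \<eta>))"
      using b(1) by (intro integral_lborel_scale) auto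
    also have "(LINT \<eta>|lborel. G (b *\<^sub>R \<eta>) * plane_wave (a *\<^sub>R lattice_point k) (b *\<^sub>R \<eta>)) = (LINT \<eta>|lborel. g \<eta> * plane_wave (lattice_point k) \<eta>)"
      using b(2) by (simp add: g_def plane_wave_def mult.assoc[symmetric] mult.commute[of b])
    also have "\<dots> = (LINT \<eta>|cube_measure. g \<eta> * plane_wave (lattice_point k) \<eta>)"
    proof (subst integral_cube_measure)
      show "(LINT \<eta>|lborel. g \<eta> * plane_wave (lattice_point k) \<eta>) =
        (LINT \<eta>|lborel. indicator (cbox (\<chi> i. - pi) (\<chi> i. pi)) \<eta> *\<^sub>R (g \<eta> * plane_wave (lattice_point k) \<eta>))"
        by (intro Bochner_Integration.integral_cong) (auto simp: indicator_def g0)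
    qed measurable
    also have "\<dots> = (LINT \<eta>|cube_measure. g \<eta> * cnj (plane_wave (lattice_point (- k)) \<eta>))"
      using lattice_point_diff[of 0 k] by (simp add: cnj_plane_wave)
    finally show ?thesis using b by (simp add: scaleR_conv_of_real[of _ "_::complex"] mult.assoc)
  qed
  \<comment> \<open>The translation \<open>k\<close> produces the coefficient of index \<open>- k\<close>.\<close>
  have neg: "bij_betw uminus (UNIV :: (int^3) set) UNIV" by (simp add: bij_uminus)
  have G_int: "ennreal (b ^ 3) * (\<integral>\<^sup>+\<eta>. ennreal ((norm (g \<eta>))\<^sup>2) \<partial>lborel) = (\<integral>\<^sup>+\<xi>. ennreal ((norm (G \<xi>))\<^sup>2) \<partial>lborel)"
    using b(1) nn_integral_lborel_scale[of "\<lambda>\<xi>. ennreal ((norm (G \<xi>))\<^sup>2)" b] by (simp add: g_def)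
  have g_int: "ennreal (LINT \<eta>|cube_measure. (norm (g \<eta>))\<^sup>2) = (\<integral>\<^sup>+\<eta>. ennreal ((norm (g \<eta>))\<^sup>2) \<partial>lborel)"
  proof -
    have "ennreal (LINT \<eta>|cube_measure. (norm (g \<eta>))\<^sup>2) = (\<integral>\<^sup>+\<eta>. ennreal ((norm (g \<eta>))\<^sup>2) \<partial>cube_measure)"
      using integrable_norm_sq[OF g_sq] by (subst nn_integral_eq_integral) auto
    also have "\<dots> = (\<integral>\<^sup>+\<eta>. indicator (cbox (\<chi> i. - pi) (\<chi> i. pi)) \<eta> * ennreal ((norm (g \<eta>))\<^sup>2) \<partial>lborel)"
      unfolding cube_measure_def by (rule nn_integral_density) measurable
    also have "\<dots> = (\<integral>\<^sup>+\<eta>. ennreal ((norm (g \<eta>))\<^sup>2) \<partial>lborel)"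
      by (intro nn_integral_cong) (auto simp: indicator_def g0)
    finally show ?thesis .
  qed
  \<comment> \<open>The normalisation of the frame functions is the one that makes the powers of 2 cancel.\<close>
  have cK: "(c * K * b ^ 3)\<^sup>2 * (2 * pi) ^ 3 = 1 / (2 * pi) ^ 3 * b ^ 3"
  proof -
    have "b = 2 powr (real_of_int j)" unfolding b_def a_def two_powi by (simp add: powr_minus)
    then have "b ^ 3 = 2 powr (3 * real_of_int j)" by (simp add: powr_power mult.commute)
    define P where "P = 2 powr (- 3 * real_of_int j / 2)"
    have "b ^ 3 = 2 powr (3 * real_of_int j)" by fact
    then have "P\<^sup>2 * b ^ 3 = 2 powr (- 3 * real_of_int j / 2 + - 3 * real_of_int j / 2 + 3 * real_of_int j)"
      by (simp only: P_def power2_eq_square powr_add)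
    then have Pb: "P\<^sup>2 * b ^ 3 = 1" by simp
    have "c = inverse ((2 * pi) powr (3 / 2))" unfolding c_def powr_minus[symmetric] by simp
    then have K: "K = P * c" by (simp only: K_def P_def divide_inverse)
    have "(c * K * b ^ 3)\<^sup>2 = c\<^sup>2 * c\<^sup>2 * b ^ 3 * (P\<^sup>2 * b ^ 3)"
      unfolding K power2_eq_square by (simp only: mult_ac)
    then have "(c * K * b ^ 3)\<^sup>2 = c\<^sup>2 * c\<^sup>2 * b ^ 3" by (simp only: Pb mult_1_right)
    then have "(c * K * b ^ 3)\<^sup>2 * (2 * pi) ^ 3 = c\<^sup>2 * (2 * pi) ^ 3 * (c\<^sup>2 * b ^ 3)" by (simp only: mult_ac)
    moreover have c2: "c\<^sup>2 = 1 / (2 * pi) ^ 3" unfolding c_def by (rule two_pi_powr_sq)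
    moreover have "c\<^sup>2 * (2 * pi) ^ 3 = 1" unfolding c2 by simp
    ultimately show ?thesis by (simp only: mult_1_left)
  qed
  have "(\<integral>\<^sup>+k. ennreal ((norm (L2_inner u (frame_function Q (inv_fourier F) j k)))\<^sup>2) \<partial>count_space UNIV) =
    (\<integral>\<^sup>+k. ennreal ((c * K * b ^ 3)\<^sup>2) * ennreal ((norm (LINT \<eta>|cube_measure. g \<eta> * cnj (plane_wave (lattice_point (- k)) \<eta>)))\<^sup>2) \<partial>count_space UNIV)"
  proof -
    have "(norm (of_real r * z))\<^sup>2 = r\<^sup>2 * (norm z)\<^sup>2" for r and z :: complex
      by (simp add: norm_mult power_mult_distrib)
    then show ?thesis unfolding inner by (simp only: ennreal_mult zero_le_power2)
  qed
  also have "\<dots> = ennreal ((c * K * b ^ 3)\<^sup>2) * (\<integral>\<^sup>+k. ennreal ((norm (LINT \<eta>|cube_measure. g \<eta> * cnj (plane_wave (lattice_point (- k)) \<eta>)))\<^sup>2) \<partial>count_space UNIV)"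
    by (simp add: nn_integral_cmult)
  also have "(\<integral>\<^sup>+k. ennreal ((norm (LINT \<eta>|cube_measure. g \<eta> * cnj (plane_wave (lattice_point (- k)) \<eta>)))\<^sup>2) \<partial>count_space UNIV) =
     (\<integral>\<^sup>+k. ennreal ((norm (LINT \<eta>|cube_measure. g \<eta> * cnj (plane_wave (lattice_point k) \<eta>)))\<^sup>2) \<partial>count_space UNIV)"
    using nn_integral_bij_count_space[OF neg, of "\<lambda>k. ennreal ((norm (LINT \<eta>|cube_measure. g \<eta> * cnj (plane_wave (lattice_point k) \<eta>)))\<^sup>2)"] by simp
  also have "\<dots> = ennreal ((2 * pi) ^ 3) * ennreal (LINT \<eta>|cube_measure. (norm (g \<eta>))\<^sup>2)"
    using parseval_fourier_series[OF g_sq] by (simp add: ennreal_mult)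
  also have "ennreal ((c * K * b ^ 3)\<^sup>2) * \<dots> = ennreal ((c * K * b ^ 3)\<^sup>2 * (2 * pi) ^ 3) * (\<integral>\<^sup>+\<eta>. ennreal ((norm (g \<eta>))\<^sup>2) \<partial>lborel)"
    unfolding g_int[symmetric] by (simp add: ennreal_mult mult.assoc)
  also have "\<dots> = ennreal (1 / (2 * pi) ^ 3) * (ennreal (b ^ 3) * (\<integral>\<^sup>+\<eta>. ennreal ((norm (g \<eta>))\<^sup>2) \<partial>lborel))"
    unfolding cK using b by (subst ennreal_mult) (auto simp: mult.assoc)
  finally show ?thesis unfolding G_int by (simp add: G_def v_def D_def a_def)
qed

section \<open>Divergence free fields are orthogonal to gradients\<close>

text \<open>This makes the squared positive part of \<open>1 - |x|\<^sup>2/n\<^sup>2\<close> a cutoff function of class \<open>C\<^sup>1\<close>.\<close>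

lemma has_real_derivative_positive_part_sq:
  "((\<lambda>s::real. (max 0 s)\<^sup>2) has_real_derivative 2 * max 0 s) (at s)"
proof -
  consider "s > 0" | "s < 0" | "s = 0" by linarith
  then show ?thesis
  proof cases
    case 1
    have "((\<lambda>s::real. s\<^sup>2) has_real_derivative 2 * s) (at s)" by (auto intro!: derivative_eq_intros)
    moreover have ev: "\<forall>\<^sub>F t in nhds s. (max 0 t)\<^sup>2 = t\<^sup>2"
      using eventually_nhds_in_open[of "{0<..}" s] 1 by (auto elim!: eventually_mono)
    ultimately show ?thesis using 1 DERIV_cong_ev[OF refl ev refl, of "2 * s"] by simp
  next
    case 2
    have "((\<lambda>s::real. 0) has_real_derivative 0) (at s)" by simp
    moreover have ev: "\<forall>\<^sub>F t in nhds s. (max 0 t)\<^sup>2 = 0"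
      using eventually_nhds_in_open[of "{..<0}" s] 2 by (auto elim!: eventually_mono)
    ultimately show ?thesis using 2 DERIV_cong_ev[OF refl ev refl, of 0] by simp
  next
    case 3
    have "((\<lambda>h::real. (max 0 h)\<^sup>2 / h) \<longlongrightarrow> 0) (at 0)"
    proof (rule Lim_null_comparison)
      show "\<forall>\<^sub>F h in at (0::real). norm ((max 0 h)\<^sup>2 / h) \<le> \<bar>h\<bar>"
        by (intro always_eventually allI) (auto simp: max_def power2_eq_square)
      show "((\<lambda>h::real. \<bar>h\<bar>) \<longlongrightarrow> 0) (at 0)"
        by (rule tendsto_eq_intros | simp)+
    qed
    then show ?thesis using 3 by (simp add: DERIV_def)
  qed
qed

text \<open>
  Multiplying the potential by the cutoff of radius \<open>n\<close> gives a test function.  The gradient of the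
  cutoff is at most \<open>4/n\<close>, so that the gradients of the test functions tend to the given one under an
  \<open>L\<^sub>2\<close> bound.
\<close>

lemma L2_div_orthogonal_gradient:
  fixes f :: "real^3 \<Rightarrow> real"
  assumes u: "u \<in> L2_div"
    and deriv: "\<And>x. (f has_derivative (\<lambda>v. g x \<bullet> v)) (at x)" and g: "continuous_on UNIV g"
    and f2: "square_integrable lborel f" and g2: "square_integrable lborel g"
  shows "(LINT x|lborel. (\<Sum>i\<in>UNIV. u x $ i * of_real (g x $ i))) = 0"
proof -
  have u2: "square_integrable lborel u" using u by (simp add: L2_div_def square_integrable_def)
  note [measurable] = square_integrable_measurable[OF u2] square_integrable_measurable[OF f2] square_integrable_measurable[OF g2]
  define p where "p n x = max 0 (1 - (x \<bullet> x) / (real (Suc n))\<^sup>2)" for n :: nat and x :: "real^3"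
  define cut where "cut n x = (p n x)\<^sup>2" for n x
  define d where "d n x = (- 4 / (real (Suc n))\<^sup>2 * p n x) *\<^sub>R x" for n x
  define G where "G n x = cut n x *\<^sub>R g x + f x *\<^sub>R d n x" for n x
  have dcut: "(cut n has_derivative (\<lambda>v. d n x \<bullet> v)) (at x)" for n x
  proof -
    have d1: "((\<lambda>x::real^3. 1 - (x \<bullet> x) / (real (Suc n))\<^sup>2) has_derivative (\<lambda>v. - 2 * (x \<bullet> v) / (real (Suc n))\<^sup>2)) (at x)"
      by (rule derivative_eq_intros refl | simp add: inner_commute)+
    have d2: "((\<lambda>s. (max 0 s)\<^sup>2) has_derivative (\<lambda>t. t * (2 * p n x))) (at (1 - (x \<bullet> x) / (real (Suc n))\<^sup>2))"
      using has_real_derivative_positive_part_sq[of "1 - (x \<bullet> x) / (real (Suc n))\<^sup>2"]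
      by (simp add: has_field_derivative_def p_def mult_commute_abs)
    show ?thesis
      using diff_chain_at[OF d1 d2] unfolding comp_def
      by (simp add: cut_def[abs_def] p_def d_def algebra_simps)
  qed
  have pc: "continuous_on UNIV (p n)" for n unfolding p_def by (intro continuous_intros) auto
  have [measurable]: "p n \<in> borel_measurable borel" for n using pc by (rule borel_measurable_continuous_onI)
  have p01: "0 \<le> p n x" "p n x \<le> 1" for n x by (auto simp: p_def)
  have p0: "p n x = 0" if "norm x > real (Suc n)" for n and x :: "real^3"
  proof -
    have "(real (Suc n))\<^sup>2 \<le> (norm x)\<^sup>2" using that by (intro power_mono) auto
    then show ?thesis by (simp add: p_def dot_square_norm field_simps)
  qed
  have dn: "norm (d n x) \<le> 4 / real (Suc n)" for n x
  proof (cases "norm x > real (Suc n)")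
    case True then show ?thesis by (simp add: d_def p0)
  next
    case False
    have "norm (d n x) = 4 / (real (Suc n))\<^sup>2 * (p n x * norm x)" using p01[of n x] by (simp add: d_def)
    also have "\<dots> \<le> 4 / (real (Suc n))\<^sup>2 * (1 * real (Suc n))"
      using False p01[of n x] by (intro mult_left_mono mult_mono) auto
    finally show ?thesis by (simp add: power2_eq_square del: of_nat_Suc)
  qed
  have zero: "(LINT x|lborel. (\<Sum>i\<in>UNIV. u x $ i * of_real (G n x $ i))) = 0" for n
  proof -
    have "((\<lambda>x. cut n x * f x) has_derivative (\<lambda>v. G n x \<bullet> v)) (at x)" for x
      using has_derivative_mult[OF dcut[of n x] deriv[of x]]
      by (simp add: G_def inner_add_left algebra_simps)
    moreover have "continuous_on UNIV (G n)"
    proof -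
      have fc: "continuous_on UNIV f"
        by (rule continuous_at_imp_continuous_on) (use deriv has_derivative_continuous in blast)
      have "continuous_on UNIV (cut n)" unfolding cut_def using pc[of n] by (intro continuous_intros)
      moreover have "continuous_on UNIV (d n)" unfolding d_def using pc[of n] by (intro continuous_intros)
      ultimately show ?thesis unfolding G_def using fc g by (intro continuous_intros)
    qed
    moreover have "compact (closure {x. cut n x * f x \<noteq> 0})"
    proof -
      have "norm x \<le> real (Suc n)" if "cut n x * f x \<noteq> 0" for x :: "real^3"
        using that p0[of n x] by (auto simp: cut_def not_less[symmetric])
      then have "bounded {x. cut n x * f x \<noteq> 0}" unfolding bounded_iff by blast
      then show ?thesis by (simp add: compact_closure)
    qed
    ultimately show ?thesis
      using u unfolding L2_div_def weakly_divergence_free_def by blast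
  qed
  have "(\<lambda>n. LINT x|lborel. (\<Sum>i\<in>UNIV. u x $ i * of_real (G n x $ i))) \<longlonglongrightarrow> (LINT x|lborel. (\<Sum>i\<in>UNIV. u x $ i * of_real (g x $ i)))"
  proof (rule integral_dominated_convergence)
    show "integrable lborel (\<lambda>x. \<Sum>i\<in>UNIV. norm (u x $ i) * norm (g x) + 4 * (norm (u x $ i) * norm (f x)))"
      by (intro Bochner_Integration.integrable_sum Bochner_Integration.integrable_add integrable_mult_right
          integrable_norm_mult square_integrable_component u2 f2 g2)
    show "AE x in lborel. (\<lambda>n. \<Sum>i\<in>UNIV. u x $ i * of_real (G n x $ i)) \<longlonglongrightarrow> (\<Sum>i\<in>UNIV. u x $ i * of_real (g x $ i))"
    proof (rule AE_I2)
      fix x :: "real^3"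
      have n2: "(\<lambda>n. 1 / real (Suc n)) \<longlonglongrightarrow> 0" by (rule LIMSEQ_Suc[OF lim_1_over_n])
      have "(\<lambda>n. max 0 (1 - (x \<bullet> x) * (1 / real (Suc n))\<^sup>2)) \<longlonglongrightarrow> max 0 (1 - (x \<bullet> x) * 0\<^sup>2)"
        by (intro tendsto_intros n2)
      then have p1: "(\<lambda>n. p n x) \<longlonglongrightarrow> 1" by (simp add: p_def power_divide)
      have "(\<lambda>n. cut n x) \<longlonglongrightarrow> 1\<^sup>2" unfolding cut_def by (intro tendsto_intros p1)
      moreover have "(\<lambda>n. d n x) \<longlonglongrightarrow> 0"
      proof (rule Lim_null_comparison)
        show "\<forall>\<^sub>F n in sequentially. norm (d n x) \<le> 4 * (1 / real (Suc n))" using dn by simp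
        show "(\<lambda>n. 4 * (1 / real (Suc n))) \<longlonglongrightarrow> 0" using tendsto_mult_right_zero[OF n2] .
      qed
      ultimately have "(\<lambda>n. G n x) \<longlonglongrightarrow> 1\<^sup>2 *\<^sub>R g x + f x *\<^sub>R 0"
        unfolding G_def by (intro tendsto_intros)
      then have "(\<lambda>n. G n x) \<longlonglongrightarrow> g x" by simp
      then show "(\<lambda>n. \<Sum>i\<in>UNIV. u x $ i * of_real (G n x $ i)) \<longlonglongrightarrow> (\<Sum>i\<in>UNIV. u x $ i * of_real (g x $ i))"
        by (intro tendsto_intros)
    qed
    show "AE x in lborel. norm (\<Sum>i\<in>UNIV. u x $ i * of_real (G n x $ i)) \<le> (\<Sum>i\<in>UNIV. norm (u x $ i) * norm (g x) + 4 * (norm (u x $ i) * norm (f x)))" for n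
    proof (intro AE_I2 sum_norm_le)
      fix x :: "real^3" and i :: 3
      have "norm (G n x) \<le> norm (cut n x *\<^sub>R g x) + norm (f x *\<^sub>R d n x)"
        unfolding G_def by (rule norm_triangle_ineq)
      also have "\<dots> \<le> 1 * norm (g x) + norm (f x) * 4"
      proof -
        have "\<bar>cut n x\<bar> \<le> 1" using p01[of n x] by (simp add: cut_def power_le_one)
        moreover have "norm (d n x) \<le> 4" using dn[of n x] by (rule order_trans) (simp add: field_simps)
        ultimately have "\<bar>cut n x\<bar> * norm (g x) \<le> 1 * norm (g x)" "norm (f x) * norm (d n x) \<le> norm (f x) * 4"
          by (intro mult_right_mono mult_left_mono; simp)+
        then show ?thesis by simp
      qed
      finally have "\<bar>G n x $ i\<bar> \<le> norm (g x) + 4 * norm (f x)"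
        using component_le_norm_cart[of "G n x" i] by simp
      then have "norm (u x $ i) * \<bar>G n x $ i\<bar> \<le> norm (u x $ i) * (norm (g x) + 4 * norm (f x))"
        by (rule mult_left_mono) simp
      then show "norm (u x $ i * of_real (G n x $ i)) \<le> norm (u x $ i) * norm (g x) + 4 * (norm (u x $ i) * norm (f x))"
        by (simp add: norm_mult algebra_simps)
    qed
    have [measurable]: "(\<lambda>x. G n x $ i) \<in> borel_measurable borel" for n i
      unfolding G_def cut_def d_def by measurable
    show "(\<lambda>x. \<Sum>i\<in>UNIV. u x $ i * of_real (G n x $ i)) \<in> borel_measurable lborel" for n
      by measurable
    show "(\<lambda>x. \<Sum>i\<in>UNIV. u x $ i * of_real (g x $ i)) \<in> borel_measurable lborel"
      by measurable
  qed
  then show ?thesis by (simp add: zero LIMSEQ_const_iff)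
qed

definition unnormalised_inv_fourier :: "(real^'n \<Rightarrow> complex) \<Rightarrow> real^'n \<Rightarrow> complex" where
  "unnormalised_inv_fourier m x = (LINT \<xi>|lborel. m \<xi> * plane_wave x \<xi>)"

lemma bounded_support_mult_wave:
  assumes m: "bounded_support (m :: real^'n \<Rightarrow> complex)"
  shows "bounded_support (\<lambda>\<xi>. m \<xi> * plane_wave x \<xi>)"
  using bounded_support_measurable[OF m]
  by (intro bounded_support_dominated[OF m, of _ 1]) (auto simp: norm_mult)

lemma bounded_support_coordinate:
  assumes m: "bounded_support (m :: real^'n \<Rightarrow> complex)"
  shows "bounded_support (\<lambda>\<xi>. m \<xi> * of_real (\<xi> $ i))"
proof -
  note [measurable] = bounded_support_measurable[OF m]
  obtain B r where B: "0 < B" "0 < r" "\<And>x. norm (m x) \<le> B" "\<And>x. norm x > r \<Longrightarrow> m x = 0"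
    using bounded_supportE[OF m] by metis
  show ?thesis
  proof (rule bounded_supportI[of _ "B * r" r])
    show "norm (m \<xi> * of_real (\<xi> $ i)) \<le> B * r" for \<xi>
    proof (cases "norm \<xi> > r")
      case False
      then have "\<bar>\<xi> $ i\<bar> \<le> r" using component_le_norm_cart[of \<xi> i] by simp
      then show ?thesis using B by (auto simp: norm_mult intro!: mult_mono)
    qed (use B in auto)
  qed (use B in auto)
qed

text \<open>
  Differentiation under the integral.  On the bounded support of the symbol the Taylor remainder of
  the wave is at most quadratic in the increment, uniformly in the frequency.
\<close>

lemma has_derivative_unnormalised_inv_fourier:
  fixes m :: "real^'n \<Rightarrow> complex"
  assumes m: "bounded_support m"
  shows "(unnormalised_inv_fourier m has_derivative
    (\<lambda>v. \<Sum>i\<in>UNIV. of_real (v $ i) * (\<i> * unnormalised_inv_fourier (\<lambda>\<xi>. m \<xi> * of_real (\<xi> $ i)) x))) (at x)"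
proof -
  note mi = bounded_support_coordinate[OF m]
  obtain B r where B: "0 < B" "0 < r" "\<And>x. norm (m x) \<le> B" "\<And>x. norm x > r \<Longrightarrow> m x = 0"
    using bounded_supportE[OF m] by metis
  define A where "A v = (\<Sum>i\<in>UNIV. of_real (v $ i) * (\<i> * unnormalised_inv_fourier (\<lambda>\<xi>. m \<xi> * of_real (\<xi> $ i)) x))" for v
  define C where "C = (LINT \<xi>|lborel. norm (m \<xi>)) * r\<^sup>2"
  have mint: "integrable lborel (\<lambda>\<xi>. m \<xi> * plane_wave y \<xi>)" for y
    by (rule bounded_support_integrable[OF bounded_support_mult_wave[OF m]])
  have miint: "integrable lborel (\<lambda>\<xi>. m \<xi> * of_real (\<xi> $ i) * plane_wave x \<xi>)" for i
    by (rule bounded_support_integrable[OF bounded_support_mult_wave[OF mi]])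
  have A_eq: "A v = (LINT \<xi>|lborel. m \<xi> * plane_wave x \<xi> * (\<i> * of_real (v \<bullet> \<xi>)))" for v
  proof -
    have "A v = (\<Sum>i\<in>UNIV. LINT \<xi>|lborel. of_real (v $ i) * (\<i> * (m \<xi> * of_real (\<xi> $ i) * plane_wave x \<xi>)))"
      unfolding A_def unnormalised_inv_fourier_def by (simp only: Bochner_Integration.integral_mult_right_zero)
    also have "\<dots> = (LINT \<xi>|lborel. (\<Sum>i\<in>UNIV. of_real (v $ i) * (\<i> * (m \<xi> * of_real (\<xi> $ i) * plane_wave x \<xi>))))"
      using miint by (intro Bochner_Integration.integral_sum[symmetric] integrable_mult_right)
    also have "\<dots> = (LINT \<xi>|lborel. m \<xi> * plane_wave x \<xi> * (\<i> * of_real (v \<bullet> \<xi>)))"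
      by (simp add: inner_vec_def sum_distrib_left mult_ac)
    finally show ?thesis .
  qed
  have Aint: "integrable lborel (\<lambda>\<xi>. m \<xi> * plane_wave x \<xi> * (\<i> * of_real (v \<bullet> \<xi>)))" for v
  proof -
    have "integrable lborel (\<lambda>\<xi>. \<Sum>i\<in>UNIV. of_real (v $ i) * (\<i> * (m \<xi> * of_real (\<xi> $ i) * plane_wave x \<xi>)))"
      using miint by (intro Bochner_Integration.integrable_sum integrable_mult_right)
    then show ?thesis by (simp add: inner_vec_def sum_distrib_left mult_ac)
  qed
  have bound: "norm (unnormalised_inv_fourier m y - unnormalised_inv_fourier m x - A (y - x)) \<le> C * (norm (y - x))\<^sup>2" for y
  proof -
    define v where "v = y - x"
    define R where "R \<xi> = plane_wave v \<xi> - 1 - \<i> * of_real (v \<bullet> \<xi>)" for \<xi>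
    have R: "norm (R \<xi>) \<le> (v \<bullet> \<xi>)\<^sup>2" for \<xi>
    proof -
      have "norm (iexp (v \<bullet> \<xi>) - (\<Sum>k\<le>1. (\<i> * (v \<bullet> \<xi>)) ^ k / fact k)) \<le> \<bar>v \<bullet> \<xi>\<bar> ^ Suc 1 / fact (Suc 1)"
        by (rule iexp_approx1)
      moreover have "(\<Sum>k\<le>1. (\<i> * complex_of_real (v \<bullet> \<xi>)) ^ k / fact k) = 1 + \<i> * of_real (v \<bullet> \<xi>)"
        by (simp add: atMost_Suc)
      moreover have "iexp (v \<bullet> \<xi>) - (1 + \<i> * of_real (v \<bullet> \<xi>)) = R \<xi>"
        unfolding R_def plane_wave_def cis_conv_exp by (rule diff_diff_eq[symmetric])
      ultimately have "norm (R \<xi>) \<le> \<bar>v \<bullet> \<xi>\<bar> ^ Suc 1 / fact (Suc 1)" by (simp only:)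
      also have "\<dots> = (v \<bullet> \<xi>)\<^sup>2 / 2" by (simp add: power2_eq_square)
      also have "\<dots> \<le> (v \<bullet> \<xi>)\<^sup>2" by simp
      finally show ?thesis .
    qed
    have "unnormalised_inv_fourier m y - unnormalised_inv_fourier m x - A v = (LINT \<xi>|lborel. m \<xi> * plane_wave y \<xi> - m \<xi> * plane_wave x \<xi> - m \<xi> * plane_wave x \<xi> * (\<i> * of_real (v \<bullet> \<xi>)))"
      unfolding unnormalised_inv_fourier_def A_eq using mint Aint by simp
    also have "\<dots> = (LINT \<xi>|lborel. m \<xi> * plane_wave x \<xi> * R \<xi>)"
    proof (rule Bochner_Integration.integral_cong[OF refl])
      fix \<xi>
      have "plane_wave y \<xi> = plane_wave x \<xi> * plane_wave v \<xi>"
        using plane_wave_add_left[of x v \<xi>] by (simp add: v_def)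
      then show "m \<xi> * plane_wave y \<xi> - m \<xi> * plane_wave x \<xi> - m \<xi> * plane_wave x \<xi> * (\<i> * of_real (v \<bullet> \<xi>)) = m \<xi> * plane_wave x \<xi> * R \<xi>"
        by (simp add: R_def algebra_simps)
    qed
    finally have eq: "unnormalised_inv_fourier m y - unnormalised_inv_fourier m x - A v = (LINT \<xi>|lborel. m \<xi> * plane_wave x \<xi> * R \<xi>)" .
    have "norm (LINT \<xi>|lborel. m \<xi> * plane_wave x \<xi> * R \<xi>) \<le> (LINT \<xi>|lborel. norm (m \<xi>) * (r\<^sup>2 * (norm v)\<^sup>2))"
    proof (rule Bochner_Integration.integral_norm_bound_integral)
      show "integrable lborel (\<lambda>\<xi>. norm (m \<xi>) * (r\<^sup>2 * (norm v)\<^sup>2))"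
        using bounded_support_integrable[OF m] by simp
      have "integrable lborel (\<lambda>\<xi>. m \<xi> * plane_wave y \<xi> - m \<xi> * plane_wave x \<xi> - m \<xi> * plane_wave x \<xi> * (\<i> * of_real (v \<bullet> \<xi>)))"
        using mint Aint by (intro Bochner_Integration.integrable_diff)
      also have "(\<lambda>\<xi>. m \<xi> * plane_wave y \<xi> - m \<xi> * plane_wave x \<xi> - m \<xi> * plane_wave x \<xi> * (\<i> * of_real (v \<bullet> \<xi>))) = (\<lambda>\<xi>. m \<xi> * plane_wave x \<xi> * R \<xi>)"
      proof
        fix \<xi>
        have "plane_wave y \<xi> = plane_wave x \<xi> * plane_wave v \<xi>"
          using plane_wave_add_left[of x v \<xi>] by (simp add: v_def)
        then show "m \<xi> * plane_wave y \<xi> - m \<xi> * plane_wave x \<xi> - m \<xi> * plane_wave x \<xi> * (\<i> * of_real (v \<bullet> \<xi>)) = m \<xi> * plane_wave x \<xi> * R \<xi>"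
          by (simp add: R_def algebra_simps)
      qed
      finally show "integrable lborel (\<lambda>\<xi>. m \<xi> * plane_wave x \<xi> * R \<xi>)" .
      fix \<xi>
      show "norm (m \<xi> * plane_wave x \<xi> * R \<xi>) \<le> norm (m \<xi>) * (r\<^sup>2 * (norm v)\<^sup>2)"
      proof (cases "norm \<xi> > r")
        case True then show ?thesis by (simp add: B)
      next
        case False
        have "\<bar>v \<bullet> \<xi>\<bar> \<le> norm v * norm \<xi>" by (rule Cauchy_Schwarz_ineq2)
        also have "\<dots> \<le> norm v * r" using False by (intro mult_left_mono) auto
        finally have "(v \<bullet> \<xi>)\<^sup>2 \<le> (norm v * r)\<^sup>2" by (metis abs_ge_zero power2_abs power_mono)
        then have "norm (R \<xi>) \<le> r\<^sup>2 * (norm v)\<^sup>2" using R[of \<xi>] by (simp add: power_mult_distrib mult.commute)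
        then show ?thesis by (simp add: norm_mult mult_left_mono)
      qed
    qed
    then show ?thesis using eq by (simp add: C_def v_def mult_ac)
  qed
  have "bounded_linear A"
    unfolding A_def[abs_def]
  proof (rule bounded_linear_sum)
    fix i :: 'n
    have "bounded_linear (\<lambda>v::real^'n. complex_of_real (v $ i))"
      by (rule bounded_linear_compose[OF bounded_linear_of_real bounded_linear_vec_nth])
    then show "bounded_linear (\<lambda>v. of_real (v $ i) * (\<i> * unnormalised_inv_fourier (\<lambda>\<xi>. m \<xi> * of_real (\<xi> $ i)) x))"
      by (rule bounded_linear_compose[OF bounded_linear_mult_left])
  qed
  then have "(unnormalised_inv_fourier m has_derivative A) (at x)"
  proof (rule has_derivativeI_sandwich[of 1, rotated])
    show "norm ((unnormalised_inv_fourier m y - unnormalised_inv_fourier m x) - A (y - x)) / norm (y - x) \<le> C * norm (y - x)" if "y \<noteq> x" for y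
      using bound[of y] that by (simp add: field_simps power2_eq_square)
    have "((\<lambda>y. C * norm (y - x)) \<longlongrightarrow> C * norm (x - x)) (at x)" by (intro tendsto_intros)
    then show "((\<lambda>y. C * norm (y - x)) \<longlongrightarrow> 0) (at x)" by simp
  qed auto
  then show ?thesis unfolding A_def .
qed

lemma unnormalised_inv_fourier_continuous:
  assumes "bounded_support m" shows "continuous_on UNIV (unnormalised_inv_fourier m)"
  by (rule continuous_at_imp_continuous_on) (use has_derivative_unnormalised_inv_fourier[OF assms] has_derivative_continuous in blast)

lemma unnormalised_inv_fourier_square_integrable:
  fixes m :: "real^'n \<Rightarrow> complex"
  assumes m: "bounded_support m" shows "square_integrable lborel (unnormalised_inv_fourier m)"
proof -
  have [measurable]: "unnormalised_inv_fourier m \<in> borel_measurable borel"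
    by (rule borel_measurable_continuous_onI[OF unnormalised_inv_fourier_continuous[OF m]])
  have [measurable]: "fourier m \<in> borel_measurable borel"
    using bounded_support_measurable[OF m] by measurable
  have eq: "unnormalised_inv_fourier m x = fourier m (- x)" for x by (simp add: unnormalised_inv_fourier_def fourier_def)
  have "(\<integral>\<^sup>+x. ennreal ((norm (unnormalised_inv_fourier m x))\<^sup>2) \<partial>lborel) = (\<integral>\<^sup>+x. ennreal ((norm (fourier m x))\<^sup>2) \<partial>lborel)"
    unfolding eq using nn_integral_lborel_scale[of "\<lambda>x. ennreal ((norm (fourier m x))\<^sup>2)" "-1"] by simp
  also have "\<dots> < \<infinity>" by (simp add: plancherel[OF m])
  finally show ?thesis unfolding square_integrable_def by (intro conjI integrableI_bounded) auto
qed

text \<open>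
  The field is the gradient of the function with the transform \<open>-\<i> m\<close>.  Test functions being real, the
  real and the imaginary part of the potential are treated separately, by means of the linear form \<open>P\<close>.
\<close>

lemma L2_div_orthogonal_smooth_gradient:
  assumes u: "u \<in> L2_div" and m: "bounded_support (m :: real^3 \<Rightarrow> complex)"
  shows "L2_inner u (inv_fourier (\<lambda>\<xi>. \<chi> i. m \<xi> * of_real (\<xi> $ i))) = 0"
proof -
  have u2: "square_integrable lborel u" using u by (simp add: L2_div_def square_integrable_def)
  define G where "G i = unnormalised_inv_fourier (\<lambda>\<xi>. m \<xi> * of_real (\<xi> $ i))" for i :: 3
  define c where "c = complex_of_real ((2 * pi) powr (- 3 / 2))"
  note mi = bounded_support_coordinate[OF m]
  have Gsq: "square_integrable lborel (G i)" for i unfolding G_def by (rule unnormalised_inv_fourier_square_integrable[OF mi])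
  have Gc: "continuous_on UNIV (G i)" for i unfolding G_def by (rule unnormalised_inv_fourier_continuous[OF mi])
  have part: "(LINT x|lborel. (\<Sum>i\<in>UNIV. u x $ i * of_real (P (\<i> * G i x)))) = 0"
    if P: "bounded_linear P" and P1: "\<And>z. \<bar>P z\<bar> \<le> norm z" for P :: "complex \<Rightarrow> real"
  proof -
    interpret P: bounded_linear P by fact
    define f where "f x = P (unnormalised_inv_fourier m x)" for x
    define g :: "real^3 \<Rightarrow> real^3" where "g x = (\<chi> i. P (\<i> * G i x))" for x
    have Pm: "P \<in> borel_measurable borel"
      by (intro borel_measurable_continuous_onI linear_continuous_on P)
    have "(LINT x|lborel. (\<Sum>i\<in>UNIV. u x $ i * of_real (g x $ i))) = 0"
    proof (rule L2_div_orthogonal_gradient[OF u])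
      show "(f has_derivative (\<lambda>v. g x \<bullet> v)) (at x)" for x
      proof -
        have "(f has_derivative (\<lambda>v. P (\<Sum>i\<in>UNIV. of_real (v $ i) * (\<i> * G i x)))) (at x)"
          unfolding f_def G_def by (rule P.has_derivative[OF has_derivative_unnormalised_inv_fourier[OF m]])
        also have "(\<lambda>v. P (\<Sum>i\<in>UNIV. of_real (v $ i) * (\<i> * G i x))) = (\<lambda>v. g x \<bullet> v)"
        proof
          fix v :: "real^3"
          have pr: "P (of_real (v $ i) * z) = v $ i * P z" for i z
            using P.scaleR[of "v $ i" z] by (simp add: scaleR_conv_of_real)
          show "P (\<Sum>i\<in>UNIV. of_real (v $ i) * (\<i> * G i x)) = g x \<bullet> v"
            unfolding P.sum pr g_def inner_vec_def by (simp add: mult.commute)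
        qed
        finally show ?thesis .
      qed
      show gc: "continuous_on UNIV g" unfolding g_def
        using Gc by (intro continuous_on_vec_lambda P.continuous_on continuous_intros)
      show "square_integrable lborel f"
      proof (rule square_integrable_bound[OF unnormalised_inv_fourier_square_integrable[OF m]])
        show "f \<in> borel_measurable lborel" unfolding f_def
          using measurable_compose[OF square_integrable_measurable[OF unnormalised_inv_fourier_square_integrable[OF m]] Pm] by simp
        show "norm (f x) \<le> 1 * norm (unnormalised_inv_fourier m x)" for x using P1 by (simp add: f_def)
      qed
      show "square_integrable lborel g"
      proof -
        have "square_integrable lborel (\<lambda>x. \<Sum>i\<in>UNIV. P (\<i> * G i x) *\<^sub>R axis i (1::real))"
        proof (intro square_integrable_sum)
          fix i :: 3
          show "square_integrable lborel (\<lambda>x. P (\<i> * G i x) *\<^sub>R axis i (1::real))"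
          proof (rule square_integrable_bound[OF Gsq[of i]])
            have "(\<lambda>x. P (\<i> * G i x)) \<in> borel_measurable lborel"
              using square_integrable_measurable[OF Gsq[of i]] by (intro measurable_compose[OF _ Pm]) simp
            then show "(\<lambda>x. P (\<i> * G i x) *\<^sub>R axis i (1::real)) \<in> borel_measurable lborel" by simp
            show "norm (P (\<i> * G i x) *\<^sub>R axis i (1::real)) \<le> 1 * norm (G i x)" for x
              using P1[of "\<i> * G i x"] by (simp add: norm_mult norm_axis_1)
          qed
        qed
        also have "(\<lambda>x. \<Sum>i\<in>UNIV. P (\<i> * G i x) *\<^sub>R axis i (1::real)) = g"
          by (auto simp: g_def vec_eq_iff axis_def if_distrib cong: if_cong)
        finally show ?thesis .
      qed
    qed
    then show ?thesis by (simp add: g_def)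
  qed
  have uG: "integrable lborel (\<lambda>x. u x $ i * of_real (P (\<i> * G i x)))" 
    if P: "bounded_linear P" and P1: "\<And>z. \<bar>P z\<bar> \<le> norm z" for P :: "complex \<Rightarrow> real" and i
  proof (rule Bochner_Integration.integrable_bound[OF integrable_norm_mult[OF square_integrable_component[OF u2, of i] Gsq[of i]]])
    have Pm: "P \<in> borel_measurable borel"
      by (intro borel_measurable_continuous_onI linear_continuous_on P)
    note [measurable] = square_integrable_measurable[OF square_integrable_component[OF u2, of i]]
    have [measurable]: "(\<lambda>x. P (\<i> * G i x)) \<in> borel_measurable lborel"
      using square_integrable_measurable[OF Gsq[of i]] by (intro measurable_compose[OF _ Pm]) simp
    show "(\<lambda>x. u x $ i * of_real (P (\<i> * G i x))) \<in> borel_measurable lborel" by measurable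
    show "AE x in lborel. norm (u x $ i * of_real (P (\<i> * G i x))) \<le> norm (norm (u x $ i) * norm (G i x))"
    proof (rule AE_I2)
      fix x
      have "\<bar>P (\<i> * G i x)\<bar> \<le> norm (G i x)" using P1[of "\<i> * G i x"] by (simp add: norm_mult)
      then show "norm (u x $ i * of_real (P (\<i> * G i x))) \<le> norm (norm (u x $ i) * norm (G i x))"
        by (simp add: norm_mult mult_left_mono)
    qed
  qed
  have ReIm: "bounded_linear Re" "\<And>z. \<bar>Re z\<bar> \<le> norm z" "bounded_linear Im" "\<And>z. \<bar>Im z\<bar> \<le> norm z"
    by (auto intro: bounded_linear_Re bounded_linear_Im abs_Re_le_cmod abs_Im_le_cmod)
  have eq: "u x $ i * cnj (inv_fourier (\<lambda>\<xi>. \<chi> i. m \<xi> * of_real (\<xi> $ i)) x $ i) =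
    \<i> * c * (u x $ i * of_real (Re (\<i> * G i x))) + c * (u x $ i * of_real (Im (\<i> * G i x)))" for x i
  proof -
    have 1: "cnj (G i x) = \<i> * of_real (Re (\<i> * G i x)) + of_real (Im (\<i> * G i x))" by (auto simp: complex_eq_iff)
    have 2: "inv_fourier (\<lambda>\<xi>. \<chi> i. m \<xi> * of_real (\<xi> $ i)) x $ i = c * G i x"
      by (simp add: inv_fourier_nth c_def G_def unnormalised_inv_fourier_def)
    have 3: "cnj c = c" by (simp add: c_def)
    show ?thesis unfolding 2 complex_cnj_mult 3 1 by (simp only: distrib_left mult_ac)
  qed
  have "L2_inner u (inv_fourier (\<lambda>\<xi>. \<chi> i. m \<xi> * of_real (\<xi> $ i))) =
    (LINT x|lborel. \<i> * c * (\<Sum>i\<in>UNIV. u x $ i * of_real (Re (\<i> * G i x))) + c * (\<Sum>i\<in>UNIV. u x $ i * of_real (Im (\<i> * G i x))))"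
    unfolding L2_inner_def eq by (simp only: sum.distrib sum_distrib_left)
  also have "\<dots> = \<i> * c * (LINT x|lborel. (\<Sum>i\<in>UNIV. u x $ i * of_real (Re (\<i> * G i x)))) + c * (LINT x|lborel. (\<Sum>i\<in>UNIV. u x $ i * of_real (Im (\<i> * G i x))))"
    using uG[OF ReIm(1,2)] uG[OF ReIm(3,4)]
    by (subst Bochner_Integration.integral_add) (auto simp del: times_complex.sel intro!: integrable_mult_right Bochner_Integration.integrable_sum)
  also have "\<dots> = 0"
    using part[OF ReIm(1,2)] part[OF ReIm(3,4)] by (simp only: mult_zero_right add_0_right)
  finally show ?thesis .
qed

lemma inv_fourier_diff:
  assumes F: "bounded_support F" and G: "bounded_support G"
  shows "inv_fourier (\<lambda>\<xi>. F \<xi> - G \<xi>) = (\<lambda>x. inv_fourier F x - inv_fourier G x)"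
proof (intro ext, subst vec_eq_iff, intro allI)
  fix x and i :: 3
  have "integrable lborel (\<lambda>\<xi>. H \<xi> $ i * plane_wave x \<xi>)" if "bounded_support H" for H :: "real^3 \<Rightarrow> complex^3"
    by (rule bounded_support_integrable[OF bounded_support_mult_wave[OF bounded_support_component[OF that]]])
  then show "inv_fourier (\<lambda>\<xi>. F \<xi> - G \<xi>) x $ i = (inv_fourier F x - inv_fourier G x) $ i"
    using F G by (simp add: inv_fourier_nth left_diff_distrib right_diff_distrib)
qed

lemma L2_inner_diff_right:
  assumes "square_integrable lborel u" "square_integrable lborel v" "square_integrable lborel w"
  shows "L2_inner u (\<lambda>x. v x - w x) = L2_inner u v - L2_inner u w"
proof -
  have "cnj (L2_inner (\<lambda>x. v x - w x) u) = cnj (L2_inner v u - L2_inner w u)"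
    by (simp only: L2_inner_diff_left assms)
  then show ?thesis by (simp add: L2_inner_cnj)
qed

text \<open>The Cauchy--Schwarz inequality in the form with a free parameter \<open>t\<close>.\<close>

lemma L2_inner_bound:
  assumes u: "square_integrable lborel u" and v: "square_integrable lborel v" and t: "t > 0"
  shows "norm (L2_inner u v) \<le> (t * (LINT x|lborel. (norm (u x))\<^sup>2) + (LINT x|lborel. (norm (v x))\<^sup>2) / t) / 2"
proof -
  have int: "integrable lborel (\<lambda>x. (t * (norm (u x))\<^sup>2 + (norm (v x))\<^sup>2 / t) / 2)"
    using integrable_norm_sq[OF u] integrable_norm_sq[OF v] by simp
  have "norm (L2_inner u v) \<le> (LINT x|lborel. (t * (norm (u x))\<^sup>2 + (norm (v x))\<^sup>2 / t) / 2)"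
    unfolding L2_inner_def
  proof (rule Bochner_Integration.integral_norm_bound_integral[OF integrable_L2_inner[OF u v] int])
    fix x
    have "norm (u x $ i * cnj (v x $ i)) \<le> (t * (norm (u x $ i))\<^sup>2 + (norm (v x $ i))\<^sup>2 / t) / 2" for i
      using two_mult_le_weighted[OF t, of "norm (u x $ i)" "norm (v x $ i)"] by (simp add: norm_mult)
    then have "norm (\<Sum>i\<in>UNIV. u x $ i * cnj (v x $ i)) \<le> (\<Sum>i\<in>UNIV. (t * (norm (u x $ i))\<^sup>2 + (norm (v x $ i))\<^sup>2 / t) / 2)"
      by (intro sum_norm_le)
    also have "\<dots> = (t * (norm (u x))\<^sup>2 + (norm (v x))\<^sup>2 / t) / 2"
      unfolding norm_sq_cart by (simp add: sum.distrib sum_distrib_left flip: sum_divide_distrib)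
    finally show "norm (\<Sum>i\<in>UNIV. u x $ i * cnj (v x $ i)) \<le> (t * (norm (u x))\<^sup>2 + (norm (v x))\<^sup>2 / t) / 2" .
  qed
  also have "\<dots> = (t * (LINT x|lborel. (norm (u x))\<^sup>2) + (LINT x|lborel. (norm (v x))\<^sup>2) / t) / 2"
    using integrable_norm_sq[OF u] integrable_norm_sq[OF v] by simp
  finally show ?thesis .
qed

definition longitudinal :: "(real^3 \<Rightarrow> complex) \<Rightarrow> real^3 \<Rightarrow> complex^3" where
  "longitudinal m \<xi> = (\<chi> i. m \<xi> * of_real (sgn \<xi> $ i))"

lemma norm_longitudinal_le: "norm (longitudinal m \<xi>) \<le> norm (m \<xi>)"
proof -
  have "longitudinal m \<xi> = m \<xi> *s (\<chi> i. of_real (sgn \<xi> $ i))"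
    by (simp add: longitudinal_def vec_eq_iff)
  then have "norm (longitudinal m \<xi>) = norm (m \<xi>) * norm (sgn \<xi>)"
    by (simp add: norm_smult) (simp add: norm_vec_def)
  also have "\<dots> \<le> norm (m \<xi>) * 1" by (intro mult_left_mono) (auto simp: norm_sgn)
  finally show ?thesis by simp
qed

lemma bounded_support_longitudinal:
  assumes m: "bounded_support m" shows "bounded_support (longitudinal m)"
proof (rule bounded_support_dominated[OF m, of _ 1])
  note [measurable] = bounded_support_measurable[OF m]
  have [measurable]: "(\<lambda>\<xi>::real^3. sgn \<xi> $ i) \<in> borel_measurable borel" for i
    unfolding sgn_div_norm by measurable
  show "longitudinal m \<in> borel_measurable borel"
    unfolding longitudinal_def by (rule borel_measurable_vec_lambda) measurable
qed (simp add: norm_longitudinal_le)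

text \<open>
  A field whose Fourier transform is parallel to the frequency is a gradient, up to the
  singularity of the symbol \<open>1 / |\<xi>|\<close> of the potential at frequency 0; this is removed by a
  limit in the mean square.
\<close>

theorem L2_div_orthogonal_longitudinal:
  assumes u: "u \<in> L2_div" and m: "bounded_support m"
  shows "L2_inner u (inv_fourier (longitudinal m)) = 0"
proof -
  have u2: "square_integrable lborel u" using u by (simp add: L2_div_def square_integrable_def)
  note [measurable] = bounded_support_measurable[OF m]
  obtain B r where B: "0 < B" "0 < r" "\<And>x. norm (m x) \<le> B" "\<And>x. norm x > r \<Longrightarrow> m x = 0"
    using bounded_supportE[OF m] by metis
  define F where "F = longitudinal m"
  have F: "bounded_support F" unfolding F_def by (rule bounded_support_longitudinal[OF m])
  \<comment> \<open>The symbol of the potential, cut off near frequency 0.\<close>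
  define mn where "mn n \<xi> = (if norm \<xi> > 1 / real (Suc n) then m \<xi> / of_real (norm \<xi>) else 0)" for n and \<xi> :: "real^3"
  define Fn :: "nat \<Rightarrow> real^3 \<Rightarrow> complex^3" where "Fn n \<xi> = (\<chi> i. mn n \<xi> * of_real (\<xi> $ i))" for n \<xi>
  have mn: "bounded_support (mn n)" for n
  proof (rule bounded_support_dominated[OF m, of _ "real (Suc n)"])
    show "mn n \<in> borel_measurable borel" unfolding mn_def by measurable
    show "norm (mn n \<xi>) \<le> real (Suc n) * norm (m \<xi>)" for \<xi>
    proof (cases "norm \<xi> > 1 / real (Suc n)")
      case True
      have pos: "0 < norm \<xi>" by (rule less_trans[OF _ True]) simp
      have "1 < norm \<xi> * real (Suc n)" using True by (simp add: divide_less_eq del: of_nat_Suc)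
      then have "1 / norm \<xi> \<le> real (Suc n)"
        using pos by (simp add: divide_le_eq mult.commute del: of_nat_Suc)
      then have "norm (m \<xi>) * (1 / norm \<xi>) \<le> norm (m \<xi>) * real (Suc n)" by (rule mult_left_mono) simp
      then show ?thesis using True by (simp add: mn_def norm_divide mult.commute)
    qed (simp add: mn_def)
  qed
  have Fn_eq: "Fn n \<xi> = (if norm \<xi> > 1 / real (Suc n) then F \<xi> else 0)" for n \<xi>
    unfolding vec_eq_iff Fn_def mn_def F_def longitudinal_def
    by (simp add: sgn_div_norm field_simps)
  have Fn: "bounded_support (Fn n)" for n
  proof (rule bounded_support_dominated[OF F, of _ 1])
    note [measurable] = bounded_support_measurable[OF F]
    show "Fn n \<in> borel_measurable borel" unfolding Fn_eq[abs_def] by measurable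
  qed (simp add: Fn_eq)
  define E where "E n \<xi> = F \<xi> - Fn n \<xi>" for n \<xi>
  have E: "bounded_support (E n)" for n
  proof (rule bounded_support_dominated[OF F, of _ 1])
    note [measurable] = bounded_support_measurable[OF F] bounded_support_measurable[OF Fn]
    show "E n \<in> borel_measurable borel" unfolding E_def by measurable
  qed (simp add: E_def Fn_eq)
  define z where "z = L2_inner u (inv_fourier F)"
  have z: "z = L2_inner u (inv_fourier (E n))" for n
  proof -
    have "L2_inner u (inv_fourier (Fn n)) = 0"
      unfolding Fn_def by (rule L2_div_orthogonal_smooth_gradient[OF u mn])
    then show ?thesis
      unfolding E_def inv_fourier_diff[OF F Fn] z_def
      by (subst L2_inner_diff_right) (auto intro!: u2 plancherel_inv_fourier F Fn)
  qed
  have lim: "(\<lambda>n. LINT \<xi>|lborel. (norm (E n \<xi>))\<^sup>2) \<longlonglongrightarrow> 0"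
    unfolding E_def
  proof (rule square_integrable_dominated_convergence[OF bounded_support_square_integrable[OF F]])
    show "(\<lambda>n. Fn n \<xi>) \<longlonglongrightarrow> F \<xi>" for \<xi>
    proof (cases "\<xi> = 0")
      case True
      have "F 0 = 0" by (simp add: F_def longitudinal_def vec_eq_iff)
      with True show ?thesis by (simp add: Fn_eq)
    next
      case False
      have "(\<lambda>n. 1 / real (Suc n)) \<longlonglongrightarrow> 0" by (rule LIMSEQ_Suc[OF lim_1_over_n])
      then have "\<forall>\<^sub>F n in sequentially. 1 / real (Suc n) < norm \<xi>"
        using False by (intro order_tendstoD) auto
      then have "\<forall>\<^sub>F n in sequentially. Fn n \<xi> = F \<xi>" by eventually_elim (simp add: Fn_eq)
      then show ?thesis by (rule tendsto_eventually)
    qed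
    show "norm (F \<xi> - Fn n \<xi>) \<le> norm (F \<xi>)" for n \<xi> by (simp add: Fn_eq)
  qed (use bounded_support_measurable[OF F] bounded_support_measurable[OF Fn] in auto)
  define N where "N = (LINT x|lborel. (norm (u x))\<^sup>2)"
  have le: "norm z \<le> t * N / 2" if t: "t > 0" for t
  proof (rule LIMSEQ_le_const)
    have "(\<lambda>n. (t * N + (LINT \<xi>|lborel. (norm (E n \<xi>))\<^sup>2) / t) / 2) \<longlonglongrightarrow> (t * N + 0 / t) / 2"
      using t by (intro tendsto_intros lim) auto
    then show "(\<lambda>n. (t * N + (LINT \<xi>|lborel. (norm (E n \<xi>))\<^sup>2) / t) / 2) \<longlonglongrightarrow> t * N / 2" by simp
    have "norm z \<le> (t * N + (LINT \<xi>|lborel. (norm (E n \<xi>))\<^sup>2) / t) / 2" for n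
      using L2_inner_bound[OF u2 plancherel_inv_fourier(1)[OF E[of n]] t]
      by (simp add: z[of n] N_def plancherel_inv_fourier(2)[OF E])
    then show "\<exists>n0. \<forall>n\<ge>n0. norm z \<le> (t * N + (LINT \<xi>|lborel. (norm (E n \<xi>))\<^sup>2) / t) / 2" by blast
  qed
  have "norm z \<le> 0"
  proof (rule LIMSEQ_le_const)
    have "(\<lambda>n. (1 / real (Suc n)) * N / 2) \<longlonglongrightarrow> 0 * N / 2"
      by (intro tendsto_intros LIMSEQ_Suc[OF lim_1_over_n]) auto
    then show "(\<lambda>n. (1 / real (Suc n)) * N / 2) \<longlonglongrightarrow> 0" by simp
    show "\<exists>n0. \<forall>n\<ge>n0. norm z \<le> (1 / real (Suc n)) * N / 2"
      using le[of "1 / real (Suc _)"] by auto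
  qed
  then show ?thesis by (simp add: z_def F_def)
qed

section \<open>Integrals of polynomials over the sphere\<close>

lemma set_integral_FTC_real:
  fixes f F :: "real \<Rightarrow> real"
  assumes "a \<le> b" "\<And>x. (F has_real_derivative f x) (at x)" "continuous_on UNIV f"
  shows "(LINT x:{a..b}|lborel. f x) = F b - F a"
proof -
  have "isCont f x" for x using assms(3) by (simp add: continuous_on_eq_continuous_at)
  then have "(LINT x|lborel. f x * indicator {a..b} x) = F b - F a"
    using assms by (intro integral_FTC_Icc_real) auto
  then show ?thesis by (simp add: set_lebesgue_integral_def mult.commute)
qed

lemma set_integrable_continuous:
  fixes f :: "real \<Rightarrow> 'a::{banach, second_countable_topology}"
  assumes "continuous_on UNIV f"
  shows "set_integrable lborel {a..b} f"
  by (rule borel_integrable_atLeastAtMost') (rule continuous_on_subset[OF assms], simp)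

definition circle_moment :: "nat \<Rightarrow> nat \<Rightarrow> real" where
  "circle_moment a b = (LINT \<phi>:{0..2 * pi}|lborel. cos \<phi> ^ a * sin \<phi> ^ b)"

definition polar_moment :: "nat \<Rightarrow> nat \<Rightarrow> real" where
  "polar_moment s c = (LINT \<theta>:{0..pi}|lborel. sin \<theta> ^ Suc s * cos \<theta> ^ c)"

text \<open>Integration by parts, in the form that the derivative of a periodic product integrates to 0.\<close>

lemma circle_moment_parts:
  "real (Suc b) * circle_moment (Suc (Suc a)) b = real (Suc a) * circle_moment a (Suc (Suc b))"
proof -
  have "(LINT \<phi>:{0..2*pi}|lborel. real (Suc b) * (cos \<phi> ^ Suc (Suc a) * sin \<phi> ^ b) - real (Suc a) * (cos \<phi> ^ a * sin \<phi> ^ Suc (Suc b)))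
     = cos (2 * pi) ^ Suc a * sin (2 * pi) ^ Suc b - cos 0 ^ Suc a * sin 0 ^ Suc b"
  proof (rule set_integral_FTC_real)
    show "((\<lambda>\<phi>. cos \<phi> ^ Suc a * sin \<phi> ^ Suc b) has_real_derivative
       real (Suc b) * (cos \<phi> ^ Suc (Suc a) * sin \<phi> ^ b) - real (Suc a) * (cos \<phi> ^ a * sin \<phi> ^ Suc (Suc b))) (at \<phi>)" for \<phi> :: real
      by (rule DERIV_cong[OF DERIV_mult[OF DERIV_power_Suc[OF DERIV_cos] DERIV_power_Suc[OF DERIV_sin]]])
        (simp add: algebra_simps)
  qed (auto intro!: continuous_intros)
  also have "\<dots> = 0" by simp
  finally show ?thesis
    unfolding circle_moment_def
    by (subst (asm) set_integral_diff) (auto intro!: set_integrable_mult_right set_integrable_continuous continuous_intros simp del: of_nat_Suc power_Suc)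
qed

lemma circle_moment_pythagoras: "circle_moment (Suc (Suc a)) b + circle_moment a (Suc (Suc b)) = circle_moment a b"
proof -
  have "cos x ^ Suc (Suc a) * sin x ^ b + cos x ^ a * sin x ^ Suc (Suc b) = cos x ^ a * sin x ^ b" for x :: real
  proof -
    have "cos x ^ Suc (Suc a) * sin x ^ b + cos x ^ a * sin x ^ Suc (Suc b) = cos x ^ a * sin x ^ b * (cos x * cos x) + cos x ^ a * sin x ^ b * (sin x * sin x)"
      by simp
    also have "\<dots> = cos x ^ a * sin x ^ b * ((cos x)\<^sup>2 + (sin x)\<^sup>2)"
      by (simp only: power2_eq_square distrib_left)
    finally show ?thesis by simp
  qed
  then show ?thesis
    unfolding circle_moment_def
    by (subst set_integral_add(2)[symmetric]) (auto intro!: set_integrable_continuous continuous_intros simp del: power_Suc)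
qed

text \<open>
  Integration by parts and \<open>cos\<^sup>2 + sin\<^sup>2 = 1\<close> are two linear equations for the two moments of degree
  \<open>a + b + 2\<close>.
\<close>

lemma circle_moment_Suc_Suc:
  "real (a + b + 2) * circle_moment (Suc (Suc a)) b = real (Suc a) * circle_moment a b"
  "real (a + b + 2) * circle_moment a (Suc (Suc b)) = real (Suc b) * circle_moment a b"
  unfolding circle_moment_pythagoras[of a b, symmetric] distrib_left
  using circle_moment_parts[of b a] by (simp_all add: algebra_simps)

lemma circle_moment_1:
  "circle_moment (Suc 0) b = 0" "circle_moment a (Suc 0) = 0"
proof -
  have "(LINT \<phi>:{0..2*pi}|lborel. cos \<phi> ^ Suc 0 * sin \<phi> ^ b) = sin (2 * pi) ^ Suc b / real (Suc b) - sin 0 ^ Suc b / real (Suc b)"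
  proof (rule set_integral_FTC_real)
    show "((\<lambda>\<phi>. sin \<phi> ^ Suc b / real (Suc b)) has_real_derivative cos \<phi> ^ Suc 0 * sin \<phi> ^ b) (at \<phi>)" for \<phi> :: real
      by (rule DERIV_cong[OF DERIV_cdivide[OF DERIV_power_Suc[OF DERIV_sin]]]) (simp add: field_simps)
  qed (auto intro!: continuous_intros)
  then show "circle_moment (Suc 0) b = 0" by (simp add: circle_moment_def)
  have "(LINT \<phi>:{0..2*pi}|lborel. cos \<phi> ^ a * sin \<phi> ^ Suc 0) = (- cos (2 * pi)) * cos (2 * pi) ^ a / real (Suc a) - (- cos 0) * cos 0 ^ a / real (Suc a)"
  proof (rule set_integral_FTC_real)
    have "((\<lambda>\<phi>. - (cos \<phi> ^ Suc a) / real (Suc a)) has_real_derivative cos \<phi> ^ a * sin \<phi> ^ Suc 0) (at \<phi>)" for \<phi> :: real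
      by (rule DERIV_cong[OF DERIV_cdivide[OF DERIV_minus[OF DERIV_power_Suc[OF DERIV_cos]]]]) (simp add: field_simps)
    then show "((\<lambda>\<phi>. (- cos \<phi>) * cos \<phi> ^ a / real (Suc a)) has_real_derivative cos \<phi> ^ a * sin \<phi> ^ Suc 0) (at \<phi>)" for \<phi> :: real
      by simp
  qed (auto intro!: continuous_intros)
  then show "circle_moment a (Suc 0) = 0" by (simp add: circle_moment_def)
qed

lemma circle_moment_0: "circle_moment 0 0 = 2 * pi"
proof -
  have "(LINT \<phi>:{0..2*pi}|lborel. 1) = 2 * pi - (0::real)"
    by (rule set_integral_FTC_real) (auto intro!: derivative_eq_intros)
  then show ?thesis by (simp add: circle_moment_def)
qed

lemma polar_moment_parts:
  "real (s + 2) * polar_moment s (Suc (Suc c)) = real (Suc c) * polar_moment (Suc (Suc s)) c"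
proof -
  have "(LINT \<theta>:{0..pi}|lborel. real (s + 2) * (sin \<theta> ^ Suc s * cos \<theta> ^ Suc (Suc c)) - real (Suc c) * (sin \<theta> ^ Suc (Suc (Suc s)) * cos \<theta> ^ c))
     = sin pi ^ Suc (Suc s) * cos pi ^ Suc c - sin 0 ^ Suc (Suc s) * cos 0 ^ Suc c"
  proof (rule set_integral_FTC_real)
    show "((\<lambda>\<theta>. sin \<theta> ^ Suc (Suc s) * cos \<theta> ^ Suc c) has_real_derivative
       real (s + 2) * (sin \<theta> ^ Suc s * cos \<theta> ^ Suc (Suc c)) - real (Suc c) * (sin \<theta> ^ Suc (Suc (Suc s)) * cos \<theta> ^ c)) (at \<theta>)" for \<theta> :: real
      by (rule DERIV_cong[OF DERIV_mult[OF DERIV_power_Suc[OF DERIV_sin] DERIV_power_Suc[OF DERIV_cos]]])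
        (simp add: algebra_simps)
  qed (auto intro!: continuous_intros)
  also have "\<dots> = 0" by simp
  finally show ?thesis
    unfolding polar_moment_def
    by (subst (asm) set_integral_diff) (auto intro!: set_integrable_mult_right set_integrable_continuous continuous_intros simp del: of_nat_Suc power_Suc of_nat_add)
qed

lemma polar_moment_pythagoras: "polar_moment s (Suc (Suc c)) + polar_moment (Suc (Suc s)) c = polar_moment s c"
proof -
  have "sin x ^ Suc s * cos x ^ Suc (Suc c) + sin x ^ Suc (Suc (Suc s)) * cos x ^ c = sin x ^ Suc s * cos x ^ c" for x :: real
  proof -
    have "sin x ^ Suc s * cos x ^ Suc (Suc c) + sin x ^ Suc (Suc (Suc s)) * cos x ^ c = sin x ^ Suc s * cos x ^ c * (cos x * cos x) + sin x ^ Suc s * cos x ^ c * (sin x * sin x)"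
      by simp
    also have "\<dots> = sin x ^ Suc s * cos x ^ c * ((cos x)\<^sup>2 + (sin x)\<^sup>2)"
      by (simp only: power2_eq_square distrib_left)
    finally show ?thesis by simp
  qed
  then show ?thesis
    unfolding polar_moment_def
    by (subst set_integral_add(2)[symmetric]) (auto intro!: set_integrable_continuous continuous_intros simp del: power_Suc)
qed

lemma polar_moment_Suc_Suc:
  "real (s + c + 3) * polar_moment (Suc (Suc s)) c = real (s + 2) * polar_moment s c"
  "real (s + c + 3) * polar_moment s (Suc (Suc c)) = real (Suc c) * polar_moment s c"
  unfolding polar_moment_pythagoras[of s c, symmetric] distrib_left
  using polar_moment_parts[of s c] by (simp_all add: algebra_simps)

lemma polar_moment_1: "polar_moment s (Suc 0) = 0"
proof -
  have "(LINT \<theta>:{0..pi}|lborel. sin \<theta> ^ Suc s * cos \<theta> ^ Suc 0) = sin pi ^ Suc (Suc s) / real (Suc (Suc s)) - sin 0 ^ Suc (Suc s) / real (Suc (Suc s))"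
  proof (rule set_integral_FTC_real)
    show "((\<lambda>\<theta>. sin \<theta> ^ Suc (Suc s) / real (Suc (Suc s))) has_real_derivative sin \<theta> ^ Suc s * cos \<theta> ^ Suc 0) (at \<theta>)" for \<theta> :: real
      by (rule DERIV_cong[OF DERIV_cdivide[OF DERIV_power_Suc[OF DERIV_sin]]]) (simp add: field_simps)
  qed (auto intro!: continuous_intros)
  then show ?thesis by (simp add: polar_moment_def)
qed

lemma polar_moment_0: "polar_moment 0 0 = 2"
proof -
  have "(LINT \<theta>:{0..pi}|lborel. sin \<theta>) = (- cos pi) - (- cos (0::real))"
    by (rule set_integral_FTC_real) (auto intro!: derivative_eq_intros continuous_intros)
  then show ?thesis by (simp add: polar_moment_def)
qed

fun gauss_moment :: "nat \<Rightarrow> real" where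
  "gauss_moment 0 = 1"
| "gauss_moment (Suc 0) = 0"
| "gauss_moment (Suc (Suc n)) = real (Suc n) * gauss_moment n"

text \<open>
  For even \<open>n\<close> this is the mean of \<open>|x|\<^sup>n\<close> under the standard Gaussian measure of \<open>\<real>\<^sup>3\<close>.  For odd \<open>n\<close>,
  where the means of all homogeneous polynomials vanish, it is just some positive number.
\<close>

fun radial_factor :: "nat \<Rightarrow> real" where
  "radial_factor 0 = 1"
| "radial_factor (Suc 0) = 1"
| "radial_factor (Suc (Suc n)) = real (n + 3) * radial_factor n"

lemma radial_factor_pos: "radial_factor n > 0"
  by (induction n rule: radial_factor.induct) auto

text \<open>
  Both sides satisfy the same recursions, by which two is added to one of the exponents, and both
  vanish if an exponent is 1.
\<close>

lemma sphere_moment_gauss_moment: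
  "radial_factor (a + b + c) * (circle_moment a b * polar_moment (a + b) c / (4 * pi)) =
   gauss_moment a * gauss_moment b * gauss_moment c"
proof -
  define T where "T a b c = circle_moment a b * polar_moment (a + b) c / (4 * pi)" for a b c
  have T1: "real (a + b + c + 3) * T a b (Suc (Suc c)) = real (Suc c) * T a b c" for a b c
  proof -
    have "real (a + b + c + 3) * T a b (Suc (Suc c)) = circle_moment a b * (real (a + b + c + 3) * polar_moment (a + b) (Suc (Suc c))) / (4 * pi)"
      by (simp add: T_def)
    then show ?thesis unfolding polar_moment_Suc_Suc by (simp add: T_def)
  qed
  have T2: "real (a + b + 3) * T a (Suc (Suc b)) 0 = real (Suc b) * T a b 0" for a b
  proof -
    have p: "real (a + b + 3) * polar_moment (Suc (Suc (a + b))) 0 = real (a + b + 2) * polar_moment (a + b) 0"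
      using polar_moment_Suc_Suc(1)[of "a + b" 0] by simp
    have "real (a + b + 3) * T a (Suc (Suc b)) 0 = circle_moment a (Suc (Suc b)) * (real (a + b + 3) * polar_moment (Suc (Suc (a + b))) 0) / (4 * pi)"
      by (simp add: T_def)
    also have "\<dots> = (real (a + b + 2) * circle_moment a (Suc (Suc b))) * polar_moment (a + b) 0 / (4 * pi)"
      unfolding p by (simp only: mult_ac)
    also have "\<dots> = real (Suc b) * T a b 0" unfolding circle_moment_Suc_Suc by (simp add: T_def)
    finally show ?thesis .
  qed
  have T3: "real (a + 3) * T (Suc (Suc a)) 0 0 = real (Suc a) * T a 0 0" for a
  proof -
    have p: "real (a + 3) * polar_moment (Suc (Suc a)) 0 = real (a + 2) * polar_moment a 0"
      using polar_moment_Suc_Suc(1)[of a 0] by simp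
    have "real (a + 3) * T (Suc (Suc a)) 0 0 = circle_moment (Suc (Suc a)) 0 * (real (a + 3) * polar_moment (Suc (Suc a)) 0) / (4 * pi)"
      by (simp add: T_def)
    also have "\<dots> = (real (a + 2) * circle_moment (Suc (Suc a)) 0) * polar_moment a 0 / (4 * pi)"
      unfolding p by (simp only: mult_ac)
    also have "\<dots> = real (Suc a) * T a 0 0" using circle_moment_Suc_Suc(1)[of a 0] by (simp add: T_def)
    finally show ?thesis .
  qed
  have T0: "radial_factor a * T a 0 0 = gauss_moment a" for a
  proof (induction a rule: gauss_moment.induct)
    case 1 show ?case by (simp add: T_def circle_moment_0 polar_moment_0)
  next
    case 2 show ?case by (simp add: T_def circle_moment_1)
  next
    case (3 a)
    have "radial_factor (Suc (Suc a)) * T (Suc (Suc a)) 0 0 = radial_factor a * (real (a + 3) * T (Suc (Suc a)) 0 0)"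
      by (simp only: radial_factor.simps mult_ac)
    also have "\<dots> = real (Suc a) * (radial_factor a * T a 0 0)" unfolding T3 by (simp only: mult_ac)
    finally show ?case by (simp only: 3 gauss_moment.simps)
  qed
  have T0': "radial_factor (a + b) * T a b 0 = gauss_moment a * gauss_moment b" for a b
  proof (induction b rule: gauss_moment.induct)
    case 1 show ?case using T0[of a] by simp
  next
    case 2 show ?case by (simp add: T_def circle_moment_1)
  next
    case (3 b)
    have "radial_factor (a + Suc (Suc b)) * T a (Suc (Suc b)) 0 = radial_factor (a + b) * (real (a + b + 3) * T a (Suc (Suc b)) 0)"
      by (simp only: add_Suc_right radial_factor.simps mult_ac)
    also have "\<dots> = real (Suc b) * (radial_factor (a + b) * T a b 0)" unfolding T2 by (simp only: mult_ac)
    finally show ?case by (simp only: 3 gauss_moment.simps mult_ac)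
  qed
  have "radial_factor (a + b + c) * T a b c = gauss_moment a * gauss_moment b * gauss_moment c"
  proof (induction c rule: gauss_moment.induct)
    case 1 show ?case using T0'[of a b] by simp
  next
    case 2 show ?case by (simp add: T_def polar_moment_1)
  next
    case (3 c)
    have "radial_factor (a + b + Suc (Suc c)) * T a b (Suc (Suc c)) = radial_factor (a + b + c) * (real (a + b + c + 3) * T a b (Suc (Suc c)))"
      by (simp only: add_Suc_right radial_factor.simps mult_ac)
    also have "\<dots> = real (Suc c) * (radial_factor (a + b + c) * T a b c)" unfolding T1 by (simp only: mult_ac)
    also have "\<dots> = gauss_moment a * gauss_moment b * (real (Suc c) * gauss_moment c)" unfolding 3 by (simp only: mult_ac)
    finally show ?case by (simp only: gauss_moment.simps)
  qed
  then show ?thesis by (simp add: T_def)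
qed

lemma std_normal_moment: "has_bochner_integral lborel (\<lambda>x. std_normal_density x * x ^ n) (gauss_moment n)"
proof (cases "even n")
  case True
  then obtain k where n: "n = 2 * k" by (auto elim: evenE)
  have "gauss_moment (2 * k) = fact (2 * k) / (2 ^ k * fact k)"
  proof (induction k)
    case (Suc k)
    have "gauss_moment (2 * Suc k) = real (2 * k + 1) * gauss_moment (2 * k)" by (simp add: add.commute)
    also have "\<dots> = real (2 * k + 1) * (fact (2 * k) / (2 ^ k * fact k))" by (simp only: Suc)
    also have "\<dots> = fact (2 * Suc k) / (2 ^ Suc k * fact (Suc k))"
    proof -
      have 1: "fact (2 * Suc k) = (2 * real (Suc k)) * (real (2 * k + 1) * fact (2 * k))" by (simp add: algebra_simps)
      have 2: "2 ^ Suc k * fact (Suc k) = (2 * real (Suc k)) * (2 ^ k * fact k)" by (simp add: algebra_simps)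
      have 3: "2 * real (Suc k) \<noteq> 0" by simp
      show ?thesis unfolding 1 2 times_divide_eq_right by (rule mult_divide_mult_cancel_left[OF 3, symmetric])
    qed
    finally show ?case .
  qed simp
  then show ?thesis using std_normal_moment_even[of k] by (simp add: n)
next
  case False
  then obtain k where n: "n = 2 * k + 1" by (auto elim: oddE)
  have "gauss_moment (2 * k + 1) = 0" by (induction k) auto
  then show ?thesis using std_normal_moment_odd[of k] by (simp add: n)
qed

definition monomial3 :: "nat \<Rightarrow> nat \<Rightarrow> nat \<Rightarrow> real^3 \<Rightarrow> complex" where
  "monomial3 a b c x = of_real (x $ 1 ^ a * x $ 2 ^ b * x $ 3 ^ c)"

text \<open>
  Generated from monomials rather than given by coefficients, so that closure under products and
  linear substitutions is proved by induction.
\<close>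

inductive hom_poly :: "nat \<Rightarrow> (real^3 \<Rightarrow> complex) \<Rightarrow> bool" where
  mono: "hom_poly (a + b + c) (\<lambda>x. k * monomial3 a b c x)"
| add: "hom_poly d f \<Longrightarrow> hom_poly d g \<Longrightarrow> hom_poly d (\<lambda>x. f x + g x)"

definition gauss_weight :: "real^3 \<Rightarrow> real" where
  "gauss_weight x = (\<Prod>i\<in>UNIV. std_normal_density (x $ i))"

text \<open>The product density depends on the norm only; this is the source of the rotation invariance.\<close>

lemma gauss_weight_norm: "gauss_weight x = (1 / sqrt (2 * pi)) ^ 3 * exp (- (norm x)\<^sup>2 / 2)"
proof -
  have "gauss_weight x = (\<Prod>i\<in>UNIV. 1 / sqrt (2 * pi) * exp (- (x $ i)\<^sup>2 / 2))"
    by (simp add: gauss_weight_def normal_density_def)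
  also have "\<dots> = (1 / sqrt (2 * pi)) ^ 3 * exp (\<Sum>i\<in>UNIV. - (x $ i)\<^sup>2 / 2)"
    by (simp add: prod.distrib exp_sum prod_dividef power_divide)
  also have "(\<Sum>i\<in>UNIV. - (x $ i)\<^sup>2 / 2) = - (norm x)\<^sup>2 / 2"
    by (simp add: norm_sq_cart sum_negf flip: sum_divide_distrib)
  finally show ?thesis .
qed

lemma prod_UNIV_3: "(\<Prod>i\<in>(UNIV :: 3 set). f i) = f 1 * f 2 * f 3"
  unfolding UNIV_3 by (simp add: ac_simps)

lemma monomial3_gauss:
  "has_bochner_integral lborel (\<lambda>x. monomial3 a b c x * of_real (gauss_weight x)) (of_real (gauss_moment a * gauss_moment b * gauss_moment c))"
proof -
  define e :: "3 \<Rightarrow> nat" where "e i = (if i = 1 then a else if i = 2 then b else c)" for i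
  have e: "e 1 = a" "e 2 = b" "e 3 = c" by (simp_all add: e_def)
  have i: "integrable lborel (\<lambda>t. std_normal_density t * t ^ e i)" for i
    by (rule integrable.intros[OF std_normal_moment])
  have eq: "(\<Prod>i\<in>UNIV. std_normal_density (x $ i) * x $ i ^ e i) = x $ 1 ^ a * x $ 2 ^ b * x $ 3 ^ c * gauss_weight x" for x :: "real^3"
    by (simp only: prod_UNIV_3 e gauss_weight_def mult_ac)
  have "has_bochner_integral lborel (\<lambda>x::real^3. x $ 1 ^ a * x $ 2 ^ b * x $ 3 ^ c * gauss_weight x) (gauss_moment a * gauss_moment b * gauss_moment c)"
    unfolding has_bochner_integral_iff eq[symmetric]
  proof
    show "integrable lborel (\<lambda>x. \<Prod>i\<in>UNIV. std_normal_density (x $ i) * x $ i ^ e i)"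
      by (rule integrable_lborel_cart_prod[OF i])
    have "(LINT x|lborel. (\<Prod>i\<in>UNIV. std_normal_density ((x::real^3) $ i) * x $ i ^ e i)) = (\<Prod>i\<in>UNIV. gauss_moment (e i))"
      by (simp only: integral_lborel_cart_prod[OF i] has_bochner_integral_integral_eq[OF std_normal_moment])
    then show "(LINT x|lborel. (\<Prod>i\<in>UNIV. std_normal_density ((x::real^3) $ i) * x $ i ^ e i)) = gauss_moment a * gauss_moment b * gauss_moment c"
      by (simp only: prod_UNIV_3 e)
  qed
  from has_bochner_integral_of_real[OF this, where 'a=complex] show ?thesis
    by (simp add: monomial3_def)
qed

text \<open>What is required of a function for the iterated integral to be additive at it.\<close>

definition sphere_integrable :: "(real^3 \<Rightarrow> complex) \<Rightarrow> bool" where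
  "sphere_integrable g \<longleftrightarrow>
     (\<forall>\<phi>. set_integrable lborel {0..pi} (\<lambda>\<theta>. of_real (sin \<theta>) * g (sphere_point 3 \<theta> \<phi>))) \<and>
     set_integrable lborel {0..2 * pi} (\<lambda>\<phi>. LINT \<theta>:{0..pi}|lborel. of_real (sin \<theta>) * g (sphere_point 3 \<theta> \<phi>))"

lemma sphere_integral_add:
  assumes f: "sphere_integrable f" and g: "sphere_integrable g"
  shows "sphere_integrable (\<lambda>x. f x + g x)"
    and "sphere_integral (\<lambda>x. f x + g x) = sphere_integral f + sphere_integral g"
proof -
  let ?F = "\<lambda>f \<phi> \<theta>. complex_of_real (sin \<theta>) * f (sphere_point 3 \<theta> \<phi>)"
  have F: "set_integrable lborel {0..pi} (?F f \<phi>)" "set_integrable lborel {0..pi} (?F g \<phi>)" for \<phi>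
    using f g by (auto simp: sphere_integrable_def)
  have G: "set_integrable lborel {0..2 * pi} (\<lambda>\<phi>. LINT \<theta>:{0..pi}|lborel. ?F f \<phi> \<theta>)"
    "set_integrable lborel {0..2 * pi} (\<lambda>\<phi>. LINT \<theta>:{0..pi}|lborel. ?F g \<phi> \<theta>)"
    using f g by (auto simp: sphere_integrable_def)
  have eq: "(LINT \<theta>:{0..pi}|lborel. of_real (sin \<theta>) * (f (sphere_point 3 \<theta> \<phi>) + g (sphere_point 3 \<theta> \<phi>))) =
    (LINT \<theta>:{0..pi}|lborel. ?F f \<phi> \<theta>) + (LINT \<theta>:{0..pi}|lborel. ?F g \<phi> \<theta>)" for \<phi>
    by (simp only: distrib_left set_integral_add(2)[OF F])
  show "sphere_integrable (\<lambda>x. f x + g x)"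
    unfolding sphere_integrable_def eq
    using set_integral_add(1)[OF F] set_integral_add(1)[OF G] by (simp add: distrib_left)
  show "sphere_integral (\<lambda>x. f x + g x) = sphere_integral f + sphere_integral g"
    unfolding sphere_integral_def eq set_integral_add(2)[OF G] by (simp only: distrib_left)
qed

lemma sphere_integral_cmult:
  assumes f: "sphere_integrable f"
  shows "sphere_integrable (\<lambda>x. k * f x)" and "sphere_integral (\<lambda>x. k * f x) = k * sphere_integral f"
  using f unfolding sphere_integrable_def sphere_integral_def
  by (auto simp: mult.left_commute[of _ k])

lemma set_integral_complex_of_real:
  "set_lebesgue_integral M A (\<lambda>x. complex_of_real (f x)) = of_real (set_lebesgue_integral M A f)"
  unfolding set_lebesgue_integral_def by (simp flip: of_real_mult add: scaleR_conv_of_real)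

lemma sphere_integrable_monomial3: "sphere_integrable (monomial3 a b c)"
  and sphere_integral_monomial3:
    "sphere_integral (monomial3 a b c) = of_real (circle_moment a b * polar_moment (a + b) c / (4 * pi))"
proof -
  have pt: "complex_of_real (sin \<theta>) * monomial3 a b c (sphere_point 3 \<theta> \<phi>) =
    of_real (cos \<phi> ^ a * sin \<phi> ^ b) * of_real (sin \<theta> ^ Suc (a + b) * cos \<theta> ^ c)" for \<theta> \<phi>
    by (simp add: monomial3_def sphere_point_def power_mult_distrib power_add mult_ac)
  have si: "set_integrable lborel {0..pi} (\<lambda>\<theta>. complex_of_real (sin \<theta> ^ Suc (a + b) * cos \<theta> ^ c))"
    by (intro set_integrable_continuous continuous_intros)
  have in1: "(LINT \<theta>:{0..pi}|lborel. of_real (sin \<theta>) * monomial3 a b c (sphere_point 3 \<theta> \<phi>)) =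
    of_real (polar_moment (a + b) c) * of_real (cos \<phi> ^ a * sin \<phi> ^ b)" for \<phi>
    unfolding pt by (subst set_integral_mult_right) (simp add: set_integral_complex_of_real polar_moment_def del: of_real_mult of_real_power power_Suc)
  show "sphere_integrable (monomial3 a b c)"
    unfolding sphere_integrable_def in1 unfolding pt
    by (intro conjI allI set_integrable_mult_right si set_integrable_continuous continuous_intros)
  have "sphere_integral (monomial3 a b c) = of_real (1 / (4 * pi)) * (of_real (polar_moment (a + b) c) * of_real (circle_moment a b))"
    unfolding sphere_integral_def in1 by (subst set_integral_mult_right) (simp add: set_integral_complex_of_real circle_moment_def del: of_real_mult of_real_power)
  then show "sphere_integral (monomial3 a b c) = of_real (circle_moment a b * polar_moment (a + b) c / (4 * pi))"
    by simp
qed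

lemma hom_poly_sphere_integrable: "hom_poly d f \<Longrightarrow> sphere_integrable f"
  by (induction rule: hom_poly.induct) (auto intro: sphere_integral_add sphere_integral_cmult sphere_integrable_monomial3)

text \<open>
  The mean of a homogeneous polynomial over the sphere is, up to a factor depending on its degree
  only, its Gaussian mean.  The latter is visibly invariant under rotations, hence so is the former.
\<close>

lemma hom_poly_gauss:
  assumes "hom_poly d f"
  shows "has_bochner_integral lborel (\<lambda>x. f x * of_real (gauss_weight x)) (of_real (radial_factor d) * sphere_integral f)"
  using assms
proof (induction rule: hom_poly.induct)
  case (mono a b c k)
  have "complex_of_real (radial_factor (a + b + c)) * sphere_integral (monomial3 a b c) = of_real (gauss_moment a * gauss_moment b * gauss_moment c)"
    unfolding sphere_integral_monomial3 of_real_mult[symmetric] sphere_moment_gauss_moment ..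
  then have eq: "complex_of_real (radial_factor (a + b + c)) * (k * sphere_integral (monomial3 a b c)) = k * of_real (gauss_moment a * gauss_moment b * gauss_moment c)"
    by (simp add: mult.left_commute)
  have "has_bochner_integral lborel (\<lambda>x. k * (monomial3 a b c x * of_real (gauss_weight x))) (k * of_real (gauss_moment a * gauss_moment b * gauss_moment c))"
    by (rule has_bochner_integral_mult_right) (simp only: monomial3_gauss)
  then show ?case
    unfolding sphere_integral_cmult(2)[OF sphere_integrable_monomial3] eq by (simp only: mult.assoc)
next
  case (add d f g)
  have "has_bochner_integral lborel (\<lambda>x. f x * of_real (gauss_weight x) + g x * of_real (gauss_weight x))
    (of_real (radial_factor d) * sphere_integral f + of_real (radial_factor d) * sphere_integral g)"
    by (rule has_bochner_integral_add[OF add.IH])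
  then show ?case
    using add.hyps by (simp only: distrib_left distrib_right sphere_integral_add(2) hom_poly_sphere_integrable)
qed

lemma hom_poly_cmult: "hom_poly d f \<Longrightarrow> hom_poly d (\<lambda>x. k * f x)"
proof (induction rule: hom_poly.induct)
  case (mono a b c l)
  show ?case using hom_poly.mono[of a b c "k * l"] by (simp add: mult.assoc)
next
  case (add d f g) then show ?case using hom_poly.add[OF add.IH] by (simp add: distrib_left)
qed

lemma hom_poly_mult: "hom_poly d f \<Longrightarrow> hom_poly e g \<Longrightarrow> hom_poly (d + e) (\<lambda>x. f x * g x)"
proof (induction rule: hom_poly.induct)
  case (mono a b c k)
  from \<open>hom_poly e g\<close> show ?case
  proof (induction rule: hom_poly.induct)
    case (mono a' b' c' k')
    have "(\<lambda>x. k * monomial3 a b c x * (k' * monomial3 a' b' c' x)) = (\<lambda>x. (k * k') * monomial3 (a + a') (b + b') (c + c') x)"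
      by (simp add: monomial3_def power_add mult_ac)
    then show ?case using hom_poly.mono[of "a + a'" "b + b'" "c + c'" "k * k'"] by (simp add: add_ac)
  next
    case (add e f g) then show ?case using hom_poly.add[OF add.IH] by (simp add: distrib_left)
  qed
next
  case (add d f g')
  then show ?case using hom_poly.add[OF add.IH[OF add.prems]] by (simp add: distrib_right)
qed

lemma hom_poly_const: "hom_poly 0 (\<lambda>x. k)"
  using hom_poly.mono[of 0 0 0 k] by (simp add: monomial3_def)

lemma hom_poly_power: "hom_poly d f \<Longrightarrow> hom_poly (d * n) (\<lambda>x. f x ^ n)"
proof (induction n)
  case 0 then show ?case using hom_poly_const[of 1] by simp
next
  case (Suc n) then show ?case using hom_poly_mult[OF Suc.prems Suc.IH[OF Suc.prems]] by (simp add: add.commute)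
qed

lemma hom_poly_coordinate: "hom_poly 1 (\<lambda>x. of_real (x $ i))"
proof -
  consider "i = 1" | "i = 2" | "i = 3" using exhaust_3 by blast
  then show ?thesis
    using hom_poly.mono[of 1 0 0 1] hom_poly.mono[of 0 1 0 1] hom_poly.mono[of 0 0 1 1]
    by cases (simp_all add: monomial3_def)
qed

lemma hom_poly_linear: "hom_poly 1 (\<lambda>x. of_real ((Q *v x) $ i))" for Q :: "real^3^3"
proof -
  have "hom_poly 1 (\<lambda>x. of_real (Q $ i $ 1) * of_real (x $ 1) + of_real (Q $ i $ 2) * of_real (x $ 2) + of_real (Q $ i $ 3) * of_real (x $ 3))"
    by (intro hom_poly.add hom_poly_cmult hom_poly_coordinate)
  then show ?thesis by (simp add: matrix_vector_mult_def sum_3)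
qed

lemma hom_poly_compose: "hom_poly d f \<Longrightarrow> hom_poly d (\<lambda>x. f (Q *v x))" for Q :: "real^3^3"
proof (induction rule: hom_poly.induct)
  case (mono a b c k)
  have "hom_poly (1 * a + 1 * b + 1 * c) (\<lambda>x. of_real ((Q *v x) $ 1) ^ a * of_real ((Q *v x) $ 2) ^ b * of_real ((Q *v x) $ 3) ^ c)"
    by (intro hom_poly_mult hom_poly_power hom_poly_linear)
  then have "hom_poly (a + b + c) (\<lambda>x. k * (of_real ((Q *v x) $ 1) ^ a * of_real ((Q *v x) $ 2) ^ b * of_real ((Q *v x) $ 3) ^ c))"
    by (intro hom_poly_cmult) simp
  then show ?case by (simp add: monomial3_def)
next
  case (add d f g) then show ?case by (intro hom_poly.add)
qed

lemma hom_poly_cnj: "hom_poly d f \<Longrightarrow> hom_poly d (\<lambda>x. cnj (f x))"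
proof (induction rule: hom_poly.induct)
  case (mono a b c k)
  show ?case using hom_poly.mono[of a b c "cnj k"] by (simp add: monomial3_def)
next
  case (add d f g) then show ?case using hom_poly.add[OF add.IH] by simp
qed

lemma hom_poly_rotation_invariant:
  assumes Q: "orthogonal_matrix Q" and f: "hom_poly d f"
  shows "sphere_integral (\<lambda>x. f (Q *v x)) = sphere_integral f"
proof -
  define g where "g x = f x * of_real (gauss_weight x)" for x
  have g: "has_bochner_integral lborel g (of_real (radial_factor d) * sphere_integral f)"
    unfolding g_def by (rule hom_poly_gauss[OF f])
  then have gm: "g \<in> borel_measurable borel"
    using borel_measurable_has_bochner_integral by fastforce
  have "has_bochner_integral lborel (\<lambda>x. g (Q *v x)) (of_real (radial_factor d) * sphere_integral (\<lambda>x. f (Q *v x)))"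
    using hom_poly_gauss[OF hom_poly_compose[OF f, of Q]]
    by (simp add: g_def gauss_weight_norm norm_orthogonal_matrix[OF Q])
  then have "of_real (radial_factor d) * sphere_integral (\<lambda>x. f (Q *v x)) = of_real (radial_factor d) * sphere_integral f"
    using g integral_lborel_orthogonal[OF Q gm] by (simp add: has_bochner_integral_iff)
  then show ?thesis using radial_factor_pos[of d] by simp
qed

text \<open>
  Values off the sphere are disregarded by the last rule, since the harmonics are defined by geographic
  coordinates and agree with polynomials on the sphere only.
\<close>

inductive sphere_poly :: "(real^3 \<Rightarrow> complex) \<Rightarrow> bool" where
  hom: "hom_poly d f \<Longrightarrow> sphere_poly f"
| add: "sphere_poly f \<Longrightarrow> sphere_poly g \<Longrightarrow> sphere_poly (\<lambda>x. f x + g x)"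
| cong: "sphere_poly f \<Longrightarrow> (\<And>x. norm x = 1 \<Longrightarrow> g x = f x) \<Longrightarrow> sphere_poly g"

lemma norm_sphere_point: "norm (sphere_point 3 \<theta> \<phi>) = 1"
proof -
  have "(sin \<theta> * cos \<phi>)\<^sup>2 + (sin \<theta> * sin \<phi>)\<^sup>2 + (cos \<theta>)\<^sup>2 = (sin \<theta>)\<^sup>2 * ((cos \<phi>)\<^sup>2 + (sin \<phi>)\<^sup>2) + (cos \<theta>)\<^sup>2"
    by (simp only: power_mult_distrib distrib_left)
  then have "(sin \<theta> * cos \<phi>)\<^sup>2 + (sin \<theta> * sin \<phi>)\<^sup>2 + (cos \<theta>)\<^sup>2 = 1" by simp
  then show ?thesis
    by (simp add: norm_vec_def L2_set_def sum_3 sphere_point_def)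
qed

lemma sphere_integral_cong:
  assumes "\<And>x. norm x = 1 \<Longrightarrow> f x = g x"
  shows "sphere_integral f = sphere_integral g"
  unfolding sphere_integral_def by (simp add: assms norm_sphere_point)

lemma sphere_integrable_cong:
  assumes "\<And>x. norm x = 1 \<Longrightarrow> f x = g x"
  shows "sphere_integrable f \<longleftrightarrow> sphere_integrable g"
  unfolding sphere_integrable_def by (simp add: assms norm_sphere_point)

lemma sphere_poly_integrable: "sphere_poly f \<Longrightarrow> sphere_integrable f"
proof (induction rule: sphere_poly.induct)
  case (hom d f) then show ?case by (rule hom_poly_sphere_integrable)
next
  case (add f g) then show ?case by (intro sphere_integral_add(1))
next
  case (cong f g) then show ?case using sphere_integrable_cong[of f g] by simp
qed

theorem sphere_integral_rotation_invariant:
  assumes Q: "orthogonal_matrix Q" and f: "sphere_poly f"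
  shows "sphere_integral (\<lambda>x. f (Q *v x)) = sphere_integral f" and "sphere_poly (\<lambda>x. f (Q *v x))"
proof -
  have "sphere_poly (\<lambda>x. f (Q *v x)) \<and> sphere_integral (\<lambda>x. f (Q *v x)) = sphere_integral f"
    using f
  proof (induction rule: sphere_poly.induct)
    case (hom d f)
    then show ?case using hom_poly_rotation_invariant[OF Q hom] hom_poly_compose[OF hom] sphere_poly.hom by blast
  next
    case (add f g)
    then show ?case using sphere_poly.add[of "\<lambda>x. f (Q *v x)" "\<lambda>x. g (Q *v x)"]
      by (simp add: sphere_integral_add sphere_poly_integrable)
  next
    case (cong f g)
    have "sphere_poly (\<lambda>x. g (Q *v x))"
      by (rule sphere_poly.cong[of "\<lambda>x. f (Q *v x)"]) (use cong norm_orthogonal_matrix[OF Q] in auto)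
    moreover have "sphere_integral (\<lambda>x. g (Q *v x)) = sphere_integral (\<lambda>x. f (Q *v x))"
      by (rule sphere_integral_cong) (use cong norm_orthogonal_matrix[OF Q] in auto)
    moreover have "sphere_integral g = sphere_integral f"
      by (rule sphere_integral_cong) (use cong in auto)
    ultimately show ?case using cong by simp
  qed
  then show "sphere_integral (\<lambda>x. f (Q *v x)) = sphere_integral f" "sphere_poly (\<lambda>x. f (Q *v x))" by auto
qed

lemma sphere_poly_mult: "sphere_poly f \<Longrightarrow> sphere_poly g \<Longrightarrow> sphere_poly (\<lambda>x. f x * g x)"
proof (induction rule: sphere_poly.induct)
  case (hom d f)
  from \<open>sphere_poly g\<close> show ?case
  proof (induction rule: sphere_poly.induct)
    case (hom e g) then show ?case using hom_poly_mult[OF \<open>hom_poly d f\<close>] sphere_poly.hom by blast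
  next
    case (add g1 g2) then show ?case using sphere_poly.add[OF add.IH] by (simp add: distrib_left)
  next
    case (cong g1 g2) show ?case by (rule sphere_poly.cong[OF cong.IH]) (simp add: cong.hyps)
  qed
next
  case (add f1 f2) then show ?case using sphere_poly.add[OF add.IH[OF add.prems]] by (simp add: distrib_right)
next
  case (cong f1 f2) show ?case by (rule sphere_poly.cong[OF cong.IH[OF cong.prems]]) (simp add: cong.hyps)
qed

lemma sphere_poly_cnj: "sphere_poly f \<Longrightarrow> sphere_poly (\<lambda>x. cnj (f x))"
proof (induction rule: sphere_poly.induct)
  case (hom d f) then show ?case using hom_poly_cnj sphere_poly.hom by blast
next
  case (add f g) then show ?case using sphere_poly.add[OF add.IH] by simp
next
  case (cong f g) show ?case by (rule sphere_poly.cong[OF cong.IH]) (simp add: cong.hyps)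
qed

lemma sphere_poly_const: "sphere_poly (\<lambda>x. k)"
  using hom_poly_const sphere_poly.hom by blast

lemma sphere_poly_cmult: "sphere_poly f \<Longrightarrow> sphere_poly (\<lambda>x. k * f x)"
  by (rule sphere_poly_mult[OF sphere_poly_const])

lemma sphere_poly_sum: "(\<And>i. i \<in> I \<Longrightarrow> sphere_poly (f i)) \<Longrightarrow> sphere_poly (\<lambda>x. \<Sum>i\<in>I. f i x)"
  by (induction I rule: infinite_finite_induct) (auto intro: sphere_poly_const sphere_poly.add)

lemma sphere_integral_sum:
  assumes "finite I" "\<And>i. i \<in> I \<Longrightarrow> sphere_poly (f i)"
  shows "sphere_integral (\<lambda>x. \<Sum>i\<in>I. f i x) = (\<Sum>i\<in>I. sphere_integral (f i))"
  using assms
proof (induction I rule: finite_induct)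
  case empty
  then show ?case by (simp add: sphere_integral_def)
next
  case (insert i I)
  then show ?case
    using sphere_integral_add(2)[of "f i" "\<lambda>x. \<Sum>i\<in>I. f i x"] sphere_poly_sum[of I f]
    by (simp add: sphere_poly_integrable)
qed

lemma sphere_poly_continuous_extension:
  "sphere_poly f \<Longrightarrow> \<exists>g. continuous_on UNIV g \<and> (\<forall>x. norm x = 1 \<longrightarrow> f x = g x)"
proof (induction rule: sphere_poly.induct)
  case (hom d f)
  then have "continuous_on UNIV f"
  proof (induction rule: hom_poly.induct)
    case (mono a b c k) show ?case unfolding monomial3_def by (intro continuous_intros)
  next
    case (add d f g) then show ?case by (intro continuous_intros)
  qed
  then show ?case by blast
next
  case (add f g)
  then obtain f' g' where "continuous_on UNIV f'" "\<forall>x. norm x = 1 \<longrightarrow> f x = f' x" "continuous_on UNIV g'" "\<forall>x. norm x = 1 \<longrightarrow> g x = g' x" by blast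
  then show ?case by (intro exI[of _ "\<lambda>x. f' x + g' x"]) (auto intro!: continuous_intros)
next
  case (cong f g) then show ?case by metis
qed

section \<open>Legendre polynomials\<close>

definition antideriv :: "real poly \<Rightarrow> real poly" where
  "antideriv p = (\<Sum>i\<le>degree p. monom (coeff p i / real (Suc i)) (Suc i))"

lemma pderiv_antideriv: "pderiv (antideriv p) = p"
proof -
  have "pderiv (antideriv p) = (\<Sum>i\<le>degree p. monom (coeff p i) i)"
    unfolding antideriv_def using higher_pderiv_sum[of 1 "\<lambda>i. monom (coeff p i / real (Suc i)) (Suc i)" "{..degree p}"]
    by (simp add: pderiv_monom del: of_nat_Suc)
  then show ?thesis by (simp add: poly_as_sum_of_monoms)
qed

text \<open>The integral over \<open>[-1, 1]\<close>, in a form that keeps the computations with Legendre polynomials algebraic.\<close>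

definition segment_integral :: "real poly \<Rightarrow> real" where
  "segment_integral p = poly (antideriv p) 1 - poly (antideriv p) (-1)"

lemma segment_integral_pderiv: "segment_integral (pderiv F) = poly F 1 - poly F (-1)"
proof -
  have "pderiv (antideriv (pderiv F) - F) = 0" by (simp add: pderiv_diff pderiv_antideriv)
  then obtain c where "antideriv (pderiv F) - F = [:c:]"
    by (metis degree_eq_zeroE pderiv_eq_0_iff)
  then have "antideriv (pderiv F) = F + [:c:]" by (simp add: algebra_simps)
  then show ?thesis by (simp add: segment_integral_def)
qed

lemma segment_integral_add: "segment_integral (p + q) = segment_integral p + segment_integral q"
  using segment_integral_pderiv[of "antideriv p + antideriv q"]
  by (simp add: pderiv_add pderiv_antideriv segment_integral_def)

lemma segment_integral_smult: "segment_integral (smult c p) = c * segment_integral p"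
  using segment_integral_pderiv[of "smult c (antideriv p)"]
  by (simp add: pderiv_smult pderiv_antideriv segment_integral_def right_diff_distrib)

lemma segment_integral_minus: "segment_integral (- p) = - segment_integral p"
  using segment_integral_smult[of "-1" p] by simp

lemma segment_integral_parts:
  assumes "poly p 1 = 0" "poly p (-1) = 0"
  shows "segment_integral (pderiv p * q) = - segment_integral (p * pderiv q)"
proof -
  have "pderiv p * q = pderiv (p * q) + - (p * pderiv q)" by (simp add: pderiv_mult mult.commute)
  then have "segment_integral (pderiv p * q) = segment_integral (pderiv (p * q)) + segment_integral (- (p * pderiv q))"
    by (simp only: segment_integral_add)
  then show ?thesis using assms by (simp add: segment_integral_pderiv segment_integral_minus)
qed

abbreviation rodrigues_base :: "real poly" where
  "rodrigues_base \<equiv> [:- 1, 0, 1:]"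

lemma pderiv_power_mult:
  "pderiv (w ^ Suc n * s) = w ^ n * (w * pderiv s + smult (of_nat (Suc n)) (pderiv w * s))"
  for w s :: "real poly"
  unfolding pderiv_mult pderiv_power_Suc by (simp add: algebra_simps del: of_nat_Suc)

lemma higher_pderiv_base_power_dvd:
  "k \<le> l \<Longrightarrow> rodrigues_base ^ (l - k) dvd (pderiv ^^ k) (rodrigues_base ^ l * r)"
proof (induction k)
  case (Suc k)
  define n where "n = l - Suc k"
  have n: "l - k = Suc n" using Suc.prems by (simp add: n_def)
  from Suc n obtain s where s: "(pderiv ^^ k) (rodrigues_base ^ l * r) = rodrigues_base ^ Suc n * s"
    by (auto simp: dvd_def)
  have "(pderiv ^^ Suc k) (rodrigues_base ^ l * r) = pderiv (rodrigues_base ^ Suc n * s)"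
    by (simp only: funpow.simps comp_def s)
  also have "\<dots> = rodrigues_base ^ n * (rodrigues_base * pderiv s + smult (of_nat (Suc n)) (pderiv rodrigues_base * s))"
    by (rule pderiv_power_mult)
  finally show ?case unfolding n_def[symmetric] by (metis dvd_triv_left)
qed simp

text \<open>All boundary terms vanish, because the lower derivatives of \<open>(x\<^sup>2 - 1)\<^sup>l r\<close> are still divisible by \<open>x\<^sup>2 - 1\<close>.\<close>

lemma segment_integral_iterated_parts:
  "k \<le> l \<Longrightarrow> segment_integral ((pderiv ^^ k) (rodrigues_base ^ l * r) * q) =
     (- 1) ^ k * segment_integral (rodrigues_base ^ l * r * (pderiv ^^ k) q)"
proof (induction k arbitrary: q)
  case (Suc k)
  define V where "V = (pderiv ^^ k) (rodrigues_base ^ l * r)"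
  have "rodrigues_base dvd rodrigues_base ^ (l - k)" using Suc.prems by (simp add: dvd_power)
  then have "rodrigues_base dvd V"
    unfolding V_def using higher_pderiv_base_power_dvd[of k l r] Suc.prems by (meson Suc_leD dvd_trans)
  then have V: "poly V 1 = 0" "poly V (-1) = 0" by (auto elim!: dvdE)
  have "segment_integral ((pderiv ^^ Suc k) (rodrigues_base ^ l * r) * q) = segment_integral (pderiv V * q)"
    by (simp add: V_def)
  also have "\<dots> = - segment_integral (V * pderiv q)" by (rule segment_integral_parts[OF V])
  also have "\<dots> = - ((- 1) ^ k * segment_integral (rodrigues_base ^ l * r * (pderiv ^^ k) (pderiv q)))"
    unfolding V_def using Suc by simp
  finally show ?case by (simp add: funpow_swap1)
qed simp

lemma coeff_mult_at_sum:
  fixes p q :: "real poly"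
  assumes "degree p \<le> a" "degree q \<le> b"
  shows "coeff (p * q) (a + b) = coeff p a * coeff q b"
proof -
  have "coeff (p * q) (a + b) = (\<Sum>i\<le>a + b. if i = a then coeff p a * coeff q b else 0)"
    unfolding coeff_mult
  proof (intro sum.cong refl)
    fix i assume "i \<in> {..a + b}"
    show "coeff p i * coeff q (a + b - i) = (if i = a then coeff p a * coeff q b else 0)"
    proof (cases i a rule: linorder_cases)
      case less
      then have "degree q < a + b - i" using assms by simp
      then show ?thesis using less by (simp add: coeff_eq_0)
    next
      case greater
      then have "degree p < i" using assms by simp
      then show ?thesis using greater by (simp add: coeff_eq_0)
    qed simp
  qed
  then show ?thesis by simp
qed

lemma degree_base_power: "degree (rodrigues_base ^ l) = 2 * l"
  by (simp add: degree_power_eq)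

lemma coeff_base_power: "coeff (rodrigues_base ^ l) (2 * l) = 1"
  using lead_coeff_power[of rodrigues_base l] by (simp add: degree_base_power)

lemma pochhammer_fact_shift: "pochhammer (real (Suc k)) n = fact (k + n) / fact k"
proof (induction n)
  case (Suc n)
  have f: "fact (k + Suc n) = fact (k + n) * (real (Suc k) + real n)" by (simp add: algebra_simps)
  show ?case unfolding f pochhammer_Suc Suc.IH by simp
qed simp

lemma coeff_higher_pderiv_fact: "coeff ((pderiv ^^ m) p) k = fact (k + m) / fact k * coeff p (k + m)" for p :: "real poly"
  unfolding coeff_higher_pderiv pochhammer_fact_shift ..

lemma degree_legendre_le: "degree (legendre_poly l) \<le> l"
  unfolding legendre_poly_def by (simp add: degree_higher_pderiv degree_base_power)

lemma coeff_legendre: "coeff (legendre_poly l) l = fact (2 * l) / (2 ^ l * (fact l)\<^sup>2)"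
proof -
  have "coeff ((pderiv ^^ l) (rodrigues_base ^ l)) l = fact (l + l) / fact l * coeff (rodrigues_base ^ l) (l + l)"
    by (rule coeff_higher_pderiv_fact)
  also have "\<dots> = fact (2 * l) / fact l" using coeff_base_power[of l] by (simp add: mult_2)
  finally show ?thesis by (simp add: legendre_poly_def power2_eq_square)
qed

text \<open>The integral of \<open>(1 - x\<^sup>2)\<^sup>l\<close> over \<open>[-1, 1]\<close>.\<close>

definition base_integral :: "nat \<Rightarrow> real" where
  "base_integral l = (- 1) ^ l * segment_integral (rodrigues_base ^ l)"

lemma base_integral_eq: "base_integral l = 2 ^ (2 * l + 1) * (fact l)\<^sup>2 / fact (2 * l + 1)"
proof (induction l)
  case 0
  have "segment_integral 1 = 2" using segment_integral_pderiv[of "[:0, 1:]"] by (simp add: pderiv_pCons one_pCons)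
  then show ?case by (simp add: base_integral_def)
next
  case (Suc l)
  \<comment> \<open>The recursion results from integrating the derivative of \<open>x (x\<^sup>2 - 1)\<^sup>l\<^sup>+\<^sup>1\<close>.\<close>
  have "pderiv ([:0, 1:] * rodrigues_base ^ Suc l) = smult (real (2 * l + 3)) (rodrigues_base ^ Suc l) + smult (2 * real (Suc l)) (rodrigues_base ^ l)"
  proof -
    have e: "w ^ l * (w + smult c (w + 1)) = smult (1 + c) (w ^ Suc l) + smult c (w ^ l)" for w :: "real poly" and c
      by (simp add: algebra_simps smult_add_left smult_add_right)
    have "pderiv ([:0, 1:] * rodrigues_base ^ Suc l) = rodrigues_base ^ l * (rodrigues_base * pderiv [:0, 1:] + smult (of_nat (Suc l)) (pderiv rodrigues_base * [:0, 1:]))"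
      using pderiv_power_mult[of rodrigues_base l "[:0, 1:]"] by (simp only: mult.commute)
    also have "rodrigues_base * pderiv [:0, 1:] + smult (of_nat (Suc l)) (pderiv rodrigues_base * [:0, 1:]) = rodrigues_base + smult (2 * real (Suc l)) (rodrigues_base + 1)"
      by (simp add: pderiv_pCons one_pCons)
    also have "rodrigues_base ^ l * \<dots> = smult (1 + 2 * real (Suc l)) (rodrigues_base ^ Suc l) + smult (2 * real (Suc l)) (rodrigues_base ^ l)"
      by (rule e)
    finally show ?thesis by (simp only: of_nat_Suc of_nat_add of_nat_mult of_nat_numeral distrib_left) (simp add: add.commute)
  qed
  from arg_cong[OF this, of segment_integral]
  have "real (2 * l + 3) * segment_integral (rodrigues_base ^ Suc l) = - (2 * real (Suc l)) * segment_integral (rodrigues_base ^ l)"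
    unfolding segment_integral_pderiv by (simp add: segment_integral_add segment_integral_smult algebra_simps)
  then have "(- 1) ^ Suc l * (real (2 * l + 3) * segment_integral (rodrigues_base ^ Suc l)) = (- 1) ^ Suc l * (- (2 * real (Suc l)) * segment_integral (rodrigues_base ^ l))"
    by (simp only:)
  then have "real (2 * l + 3) * base_integral (Suc l) = 2 * real (Suc l) * base_integral l"
    unfolding base_integral_def by (simp only: power_Suc mult_ac) (simp add: algebra_simps)
  then have "base_integral (Suc l) = 2 * real (Suc l) / real (2 * l + 3) * base_integral l"
    by (simp add: field_simps)
  also have "\<dots> = 2 * real (Suc l) / real (2 * l + 3) * (2 ^ (2 * l + 1) * (fact l)\<^sup>2 / fact (2 * l + 1))"
    by (simp only: Suc)
  also have "\<dots> = 2 ^ (2 * Suc l + 1) * (fact (Suc l))\<^sup>2 / fact (2 * Suc l + 1)"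
  proof -
    have f: "fact (2 * Suc l + 1) = real (2 * l + 3) * (2 * real (Suc l)) * fact (2 * l + 1)"
      by (simp add: algebra_simps)
    have g: "2 ^ (2 * Suc l + 1) * (fact (Suc l))\<^sup>2 = (2 * real (Suc l)) * (2 * real (Suc l)) * (2 ^ (2 * l + 1) * (fact l)\<^sup>2 :: real)"
      by (simp add: power2_eq_square algebra_simps)
    have e: "x / w * (y / z) = (x * x * y) / (w * x * z)" if "x \<noteq> 0" for x y z w :: real
      using that by (simp add: field_simps)
    show ?thesis unfolding f g by (rule e) simp
  qed
  finally show ?case .
qed

text \<open>The \<open>l\<close> derivatives of Rodrigues' formula are moved to \<open>q\<close>, of which they leave the top coefficient.\<close>

lemma legendre_integral:
  assumes "degree q \<le> l"
  shows "segment_integral (legendre_poly l * q) = coeff q l * (base_integral l / 2 ^ l)"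
proof -
  have "(pderiv ^^ l) q = [:fact l * coeff q l:]"
  proof (rule poly_eqI)
    fix n
    show "coeff ((pderiv ^^ l) q) n = coeff [:fact l * coeff q l:] n"
    proof (cases n)
      case 0
      then show ?thesis by (simp add: coeff_higher_pderiv_fact)
    next
      case (Suc n')
      then have "coeff q (n + l) = 0" using assms by (intro coeff_eq_0) simp
      then show ?thesis using Suc by (simp add: coeff_higher_pderiv_fact)
    qed
  qed
  then have "segment_integral ((pderiv ^^ l) (rodrigues_base ^ l * 1) * q) = (- 1) ^ l * segment_integral (smult (fact l * coeff q l) (rodrigues_base ^ l))"
    by (subst segment_integral_iterated_parts) (simp_all add: mult.commute)
  then show ?thesis
    by (simp add: legendre_poly_def segment_integral_smult base_integral_def mult_ac)
qed

text \<open>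
  Integrating by parts \<open>m\<close> times moves all derivatives and the weight \<open>(1 - x\<^sup>2)\<^sup>m\<close> onto the factor of
  degree \<open>k\<close>, which becomes a polynomial of degree \<open>k \<le> l\<close>; its coefficient of degree \<open>l\<close> decides.
\<close>

lemma assoc_legendre_orthogonal:
  assumes "m \<le> k" "k \<le> l"
  shows "segment_integral ([:1, 0, - 1:] ^ m * ((pderiv ^^ m) (legendre_poly l) * (pderiv ^^ m) (legendre_poly k))) =
    (if k = l then 2 / real (2 * l + 1) * (fact (l + m) / fact (l - m)) else 0)"
proof -
  define r where "r = (pderiv ^^ m) (legendre_poly k)"
  define T where "T = rodrigues_base ^ m * r"
  have dr: "degree r \<le> k - m" unfolding r_def using degree_legendre_le[of k] by (simp add: degree_higher_pderiv)
  have dT: "degree T \<le> 2 * m + (k - m)"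
    unfolding T_def using dr degree_mult_le[of "rodrigues_base ^ m" r] degree_base_power[of m] by linarith
  have dTm: "degree ((pderiv ^^ m) T) \<le> l" using dT assms by (simp add: degree_higher_pderiv)
  have w: "[:1, 0, - 1:] ^ m = smult ((- 1) ^ m) (rodrigues_base ^ m)"
  proof -
    have "[:1, 0, - 1 :: real:] = smult (- 1) rodrigues_base" by simp
    then show ?thesis by (simp only: smult_power)
  qed
  have "segment_integral ([:1, 0, - 1:] ^ m * ((pderiv ^^ m) (legendre_poly l) * r)) = (- 1) ^ m * segment_integral (rodrigues_base ^ m * r * (pderiv ^^ m) (legendre_poly l))"
    unfolding w by (simp add: segment_integral_smult mult_ac)
  also have "\<dots> = segment_integral ((pderiv ^^ m) T * legendre_poly l)"
    unfolding T_def by (subst segment_integral_iterated_parts) auto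
  also have "\<dots> = coeff ((pderiv ^^ m) T) l * (base_integral l / 2 ^ l)"
    using legendre_integral[OF dTm] by (simp add: mult.commute)
  also have "coeff ((pderiv ^^ m) T) l = fact (l + m) / fact l * coeff T (l + m)"
    by (rule coeff_higher_pderiv_fact)
  also have "coeff T (l + m) = (if k = l then fact l / fact (l - m) * (fact (2 * l) / (2 ^ l * (fact l)\<^sup>2)) else 0)"
  proof (cases "k = l")
    case True
    have "coeff T (2 * m + (l - m)) = coeff (rodrigues_base ^ m) (2 * m) * coeff r (l - m)"
      unfolding T_def by (rule coeff_mult_at_sum) (use dr True degree_base_power[of m] in auto)
    moreover have "coeff r (l - m) = fact (l - m + m) / fact (l - m) * coeff (legendre_poly l) (l - m + m)"
      unfolding r_def True by (rule coeff_higher_pderiv_fact)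
    moreover have "2 * m + (l - m) = l + m" "l - m + m = l" using assms True by auto
    ultimately show ?thesis using True by (simp only: coeff_base_power coeff_legendre mult_1_left if_True simp_thms)
  next
    case False
    then have "degree T < l + m" using dT assms by linarith
    then show ?thesis using False by (simp add: coeff_eq_0)
  qed
  also have "fact (l + m) / fact l * (if k = l then fact l / fact (l - m) * (fact (2 * l) / (2 ^ l * (fact l)\<^sup>2)) else 0) * (base_integral l / 2 ^ l) =
     (if k = l then 2 / real (2 * l + 1) * (fact (l + m) / fact (l - m)) else 0)"
  proof -
    have p: "(2::real) ^ (2 * l + 1) = 2 * (2 ^ l * 2 ^ l)" 
      unfolding power_add mult.commute[of 2 l] power_mult power2_eq_square power_one_right by (rule mult.commute)
    have f: "fact (2 * l + 1) = real (2 * l + 1) * fact (2 * l)"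
      unfolding Suc_eq_plus1[symmetric] by (rule fact_Suc)
    have e: "a / x * (x / b * (F / (t * x\<^sup>2))) * (2 * (t * t) * x\<^sup>2 / (N * F) / t) = 2 / N * (a / b)"
      if "x > 0" "b > 0" "F > 0" "t > 0" "N > 0" for a b x F t N :: real
      using that by (simp add: field_simps power2_eq_square)
    have pos: "0 < real (2 * l + 1)" by simp
    have "fact (l + m) / fact l * (fact l / fact (l - m) * (fact (2 * l) / (2 ^ l * (fact l)\<^sup>2))) * (base_integral l / 2 ^ l) =
      2 / real (2 * l + 1) * (fact (l + m) / fact (l - m))"
      unfolding base_integral_eq p f
      by (rule e[OF fact_gt_zero fact_gt_zero fact_gt_zero zero_less_power[OF zero_less_numeral] pos])
    then show ?thesis by (cases "k = l") (simp_all only: simp_thms if_True if_False mult_zero_left mult_zero_right)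
  qed
  finally show ?thesis by (simp add: r_def)
qed

section \<open>Spherical harmonics\<close>

text \<open>
  The complex coordinate \<open>x + \<i> \<sigma> y\<close> of the equatorial plane, where \<open>\<sigma> = \<plusminus>1\<close> is the sign of the order
  of a harmonic.
\<close>

definition equatorial :: "int \<Rightarrow> real^3 \<Rightarrow> complex" where
  "equatorial \<sigma> \<omega> = Complex (\<omega> $ 1) (of_int \<sigma> * \<omega> $ 2)"

definition harm_norm :: "nat \<Rightarrow> nat \<Rightarrow> real" where
  "harm_norm l m = sqrt (real (2 * l + 1) * fact (l - m) / fact (l + m))"

definition harm_sign :: "int \<Rightarrow> nat \<Rightarrow> real" where
  "harm_sign \<sigma> m = (if \<sigma> = 1 then (- 1) ^ m else 1)"

text \<open>
  The factor of the harmonic of order \<open>\<sigma> m\<close> that depends on the height; the other factor is the power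
  \<open>m\<close> of the equatorial coordinate.  The phases of the definition of the associated functions survive
  in the positive orders only.
\<close>

definition harm_factor :: "int \<Rightarrow> nat \<Rightarrow> nat \<Rightarrow> real poly" where
  "harm_factor \<sigma> l m = smult (harm_sign \<sigma> m * harm_norm l m) ((pderiv ^^ m) (legendre_poly l))"

lemma equatorial_polar:
  assumes "norm \<omega> = 1" "\<sigma> = 1 \<or> \<sigma> = - 1"
  shows "equatorial \<sigma> \<omega> = of_real (sin (colat 3 \<omega>)) * cis (of_int \<sigma> * longi 3 \<omega>)"
  using sphere_point_coords(2,3)[OF assms(1), of 3, unfolded axis3_arith] assms(2)
  by (auto simp: equatorial_def complex_eq_iff)

text \<open>
  The factor \<open>sin\<^sup>m \<theta>\<close> of the associated function and the phase \<open>e\<^sup>i\<^sup>m\<^sup>\<phi>\<close> combine to a power of the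
  equatorial coordinate.  The formula holds at the poles too, where the longitude is a convention:
  there the equatorial coordinate vanishes.
\<close>

lemma sph_harm_poly:
  assumes \<omega>: "norm \<omega> = 1" and m: "m \<le> l" and \<sigma>: "\<sigma> = 1 \<or> (\<sigma> = - 1 \<and> m \<noteq> 0)"
  shows "sph_harm l (\<sigma> * int m) \<omega> = of_real (poly (harm_factor \<sigma> l m) (\<omega> $ 3)) * equatorial \<sigma> \<omega> ^ m"
proof -
  have abs: "\<bar>\<omega> $ 3\<bar> \<le> 1" using component_le_norm_cart[of \<omega> 3] \<omega> by simp
  have c: "cos (colat 3 \<omega>) = \<omega> $ 3" using abs by (simp add: colat_def cos_arccos_abs)
  have s: "sqrt (1 - (\<omega> $ 3)\<^sup>2) = sin (colat 3 \<omega>)" using abs by (simp add: colat_def sin_arccos_abs)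
  define D where "D = poly ((pderiv ^^ m) (legendre_poly l)) (\<omega> $ 3)"
  have al: "assoc_legendre_nonneg l m (cos (colat 3 \<omega>)) = (- 1) ^ m * sin (colat 3 \<omega>) ^ m * D"
    unfolding assoc_legendre_nonneg_def c s D_def ..
  have e: "exp (\<i> * of_int (\<sigma> * int m) * of_real (longi 3 \<omega>)) = cis (of_int \<sigma> * longi 3 \<omega>) ^ m"
    by (simp add: cis_conv_exp flip: exp_of_nat_mult) (simp add: mult_ac)
  have eq: "of_real (sin (colat 3 \<omega>) ^ m) * cis (of_int \<sigma> * longi 3 \<omega>) ^ m = equatorial \<sigma> \<omega> ^ m"
    using equatorial_polar[OF \<omega>, of \<sigma>] \<sigma> by (auto simp: power_mult_distrib)
  have pm: "poly (harm_factor \<sigma> l m) (\<omega> $ 3) = harm_sign \<sigma> m * harm_norm l m * D"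
    by (simp add: harm_factor_def D_def)
  from \<sigma> show ?thesis
  proof
    assume 1: "\<sigma> = 1"
    have n1: "nat (int l - \<sigma> * int m) = l - m" "nat (int l + \<sigma> * int m) = l + m" using m 1 by (simp_all add: nat_diff_distrib)
    have "sph_harm l (\<sigma> * int m) \<omega> = of_real (harm_norm l m) * of_real ((- 1) ^ m * sin (colat 3 \<omega>) ^ m * D) * cis (of_int \<sigma> * longi 3 \<omega>) ^ m"
      unfolding sph_harm_def n1 e assoc_legendre_def al[symmetric] harm_norm_def using 1 by (simp add: add.commute)
    also have "\<dots> = of_real ((- 1) ^ m * harm_norm l m * D) * (of_real (sin (colat 3 \<omega>) ^ m) * cis (of_int \<sigma> * longi 3 \<omega>) ^ m)"
      by (simp add: mult_ac)
    finally show ?thesis unfolding eq pm by (simp add: harm_sign_def 1)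
  next
    assume 2: "\<sigma> = - 1 \<and> m \<noteq> 0"
    have n2: "nat (int l - \<sigma> * int m) = l + m" "nat (int l + \<sigma> * int m) = l - m" "nat (- (\<sigma> * int m)) = m"
      using m 2 by (simp_all add: nat_diff_distrib nat_add_distrib)
    have neg: "\<not> 0 \<le> \<sigma> * int m" using 2 by simp
    have "sqrt ((2 * real l + 1) * fact (l + m) / fact (l - m)) * (fact (l - m) / fact (l + m)) = harm_norm l m"
    proof -
      define a b where "a = (fact (l - m) :: real)" and "b = (fact (l + m) :: real)"
      have ab: "a > 0" "b > 0" by (simp_all add: a_def b_def)
      have "sqrt ((2 * real l + 1) * b / a) * (a / b) = sqrt ((2 * real l + 1) * b / a) * sqrt ((a / b)\<^sup>2)"
        using ab by simp
      also have "\<dots> = sqrt ((2 * real l + 1) * b / a * (a / b)\<^sup>2)" by (simp only: real_sqrt_mult)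
      also have "(2 * real l + 1) * b / a * (a / b)\<^sup>2 = (2 * real l + 1) * a / b"
        using ab by (simp add: field_simps power2_eq_square)
      finally show ?thesis by (simp add: harm_norm_def a_def b_def add.commute)
    qed
    then have nrm: "complex_of_real (sqrt ((2 * real l + 1) * fact (l + m) / fact (l - m))) * of_real (fact (l - m) / fact (l + m)) = of_real (harm_norm l m)"
      by (simp only: flip: of_real_mult)
    have sgn: "(- 1) ^ m * ((- 1) ^ m * x) = x" for x :: real by (simp add: power_mult_distrib[symmetric] mult.assoc[symmetric])
    have "sph_harm l (\<sigma> * int m) \<omega> = of_real (sqrt ((2 * real l + 1) * fact (l + m) / fact (l - m))) *
       of_real (fact (l - m) / fact (l + m) * ((- 1) ^ m * ((- 1) ^ m * (sin (colat 3 \<omega>) ^ m * D)))) * cis (of_int \<sigma> * longi 3 \<omega>) ^ m"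
      unfolding sph_harm_def n2 e assoc_legendre_def if_not_P[OF neg] al by (simp only: mult_ac)
    also have "\<dots> = (of_real (sqrt ((2 * real l + 1) * fact (l + m) / fact (l - m))) * of_real (fact (l - m) / fact (l + m))) * of_real D * (of_real (sin (colat 3 \<omega>) ^ m) * cis (of_int \<sigma> * longi 3 \<omega>) ^ m)"
      unfolding sgn by (simp only: of_real_mult mult_ac)
    finally show ?thesis unfolding nrm eq pm using 2 by (simp add: harm_sign_def)
  qed
qed

text \<open>The substitution \<open>x = cos \<theta>\<close>.\<close>

lemma polar_integral_segment:
  "(LINT \<theta>:{0..pi}|lborel. sin \<theta> * poly G (cos \<theta>)) = segment_integral G"
proof -
  define F where "F = antideriv G"
  have "(LINT \<theta>:{0..pi}|lborel. sin \<theta> * poly G (cos \<theta>)) = (- poly F (cos pi)) - (- poly F (cos 0))"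
  proof (rule set_integral_FTC_real)
    show "((\<lambda>\<theta>. - poly F (cos \<theta>)) has_real_derivative sin \<theta> * poly G (cos \<theta>)) (at \<theta>)" for \<theta>
      using DERIV_chain2[OF poly_DERIV DERIV_cos, of F \<theta>]
      by (auto simp: F_def pderiv_antideriv mult.commute intro: DERIV_cong[OF DERIV_minus])
  qed (auto intro!: continuous_intros)
  then show ?thesis by (simp add: segment_integral_def F_def)
qed

lemma int_sign_cases:
  fixes m :: int
  obtains \<sigma> :: int and k where "m = \<sigma> * int k" "\<sigma> = 1 \<or> (\<sigma> = - 1 \<and> k \<noteq> 0)" "k = nat \<bar>m\<bar>"
proof (cases "0 \<le> m")
  case True then show ?thesis by (intro that[of 1 "nat m"]) auto
next
  case False then show ?thesis by (intro that[of "- 1" "nat (- m)"]) auto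
qed

lemma sph_harm_sphere_point:
  assumes \<theta>: "\<theta> \<in> {0..pi}" and m: "\<bar>m\<bar> \<le> int l"
  shows "sph_harm l m (sphere_point 3 \<theta> \<phi>) =
    of_real (poly (harm_factor (if 0 \<le> m then 1 else - 1) l (nat \<bar>m\<bar>)) (cos \<theta>) * sin \<theta> ^ nat \<bar>m\<bar>) * cis (of_int m * \<phi>)"
proof -
  obtain \<sigma> k where s: "m = \<sigma> * int k" "\<sigma> = 1 \<or> (\<sigma> = - 1 \<and> k \<noteq> 0)" "k = nat \<bar>m\<bar>" by (rule int_sign_cases)
  have \<sigma>: "\<sigma> = (if 0 \<le> m then 1 else - 1)" using s(1,2) by (auto simp: zero_le_mult_iff)
  have k: "k \<le> l" using m s(3) by simp
  have e: "equatorial \<sigma> (sphere_point 3 \<theta> \<phi>) = of_real (sin \<theta>) * cis (of_int \<sigma> * \<phi>)"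
    using s(2) by (auto simp: equatorial_def sphere_point_def complex_eq_iff)
  have z: "sphere_point 3 \<theta> \<phi> $ 3 = cos \<theta>" by (simp add: sphere_point_def)
  have c: "cis (of_int \<sigma> * \<phi>) ^ k = cis (of_int m * \<phi>)" 
  proof -
    have "real k * (of_int \<sigma> * \<phi>) = of_int m * \<phi>" by (simp add: s(1))
    with Complex.DeMoivre[of "of_int \<sigma> * \<phi>" k] show ?thesis by (simp only:)
  qed
  have "sph_harm l m (sphere_point 3 \<theta> \<phi>) = of_real (poly (harm_factor \<sigma> l k) (cos \<theta>)) * (of_real (sin \<theta>) ^ k * cis (of_int m * \<phi>))"
    using sph_harm_poly[OF norm_sphere_point k s(2), of \<theta> \<phi>]
    unfolding s(1)[symmetric] e z power_mult_distrib c .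
  then show ?thesis unfolding \<sigma>[symmetric] s(3)[symmetric] by (simp add: mult.assoc)
qed

text \<open>
  The integral over the longitude separates the orders; for equal orders the integral over the
  colatitude is that of two associated Legendre functions.
\<close>

lemma sph_harm_orthonormal:
  assumes m: "\<bar>m\<bar> \<le> int l" and m': "\<bar>m'\<bar> \<le> int l'"
  shows "sphere_integral (\<lambda>\<omega>. sph_harm l m \<omega> * cnj (sph_harm l' m' \<omega>)) = (if l = l' \<and> m = m' then 1 else 0)"
proof -
  define A where "A l m \<theta> = poly (harm_factor (if 0 \<le> m then 1 else - 1) l (nat \<bar>m\<bar>)) (cos \<theta>) * sin \<theta> ^ nat \<bar>m\<bar>" for l and m :: int and \<theta>
  define C where "C = (LINT \<theta>:{0..pi}|lborel. sin \<theta> * (A l m \<theta> * A l' m' \<theta>))"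
  have pt: "of_real (sin \<theta>) * (sph_harm l m (sphere_point 3 \<theta> \<phi>) * cnj (sph_harm l' m' (sphere_point 3 \<theta> \<phi>))) =
    cis (of_int (m - m') * \<phi>) * of_real (sin \<theta> * (A l m \<theta> * A l' m' \<theta>))" if "\<theta> \<in> {0..pi}" for \<theta> \<phi>
  proof -
    have c: "cis (of_int m * \<phi>) * cnj (cis (of_int m' * \<phi>)) = cis (of_int (m - m') * \<phi>)"
      by (simp add: cis_cnj cis_mult left_diff_distrib)
    have "of_real s * (of_real a * x * cnj (of_real b * y)) = (x * cnj y) * of_real (s * (a * b))" for s a b x y
      by (simp add: mult_ac)
    then show ?thesis
      unfolding sph_harm_sphere_point[OF that m] sph_harm_sphere_point[OF that m'] A_def[symmetric] c[symmetric] .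
  qed
  have inner: "(LINT \<theta>:{0..pi}|lborel. of_real (sin \<theta>) * (sph_harm l m (sphere_point 3 \<theta> \<phi>) * cnj (sph_harm l' m' (sphere_point 3 \<theta> \<phi>)))) =
    cis (of_int (m - m') * \<phi>) * of_real C" for \<phi>
  proof -
    have "(LINT \<theta>:{0..pi}|lborel. of_real (sin \<theta>) * (sph_harm l m (sphere_point 3 \<theta> \<phi>) * cnj (sph_harm l' m' (sphere_point 3 \<theta> \<phi>)))) =
      (LINT \<theta>:{0..pi}|lborel. cis (of_int (m - m') * \<phi>) * of_real (sin \<theta> * (A l m \<theta> * A l' m' \<theta>)))"
      by (rule set_lebesgue_integral_cong) (use pt in auto)
    also have "\<dots> = cis (of_int (m - m') * \<phi>) * (LINT \<theta>:{0..pi}|lborel. of_real (sin \<theta> * (A l m \<theta> * A l' m' \<theta>)))"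
      by (rule set_integral_mult_right)
    finally show ?thesis unfolding set_integral_complex_of_real C_def .
  qed
  have I: "sphere_integral (\<lambda>\<omega>. sph_harm l m \<omega> * cnj (sph_harm l' m' \<omega>)) = of_real (1 / (4 * pi)) * ((if m = m' then of_real (2 * pi) else 0) * of_real C)"
    unfolding sphere_integral_def inner set_integral_mult_left
      integral_cis_period[of 0, unfolded add_0_left] by simp
  show ?thesis
  proof (cases "m = m'")
    case False then show ?thesis unfolding I by simp
  next
    case True
    define k where "k = nat \<bar>m\<bar>"
    define \<sigma> :: int where "\<sigma> = (if 0 \<le> m then 1 else - 1)"
    have k: "k \<le> l" "k \<le> l'" using m m' True by (simp_all add: k_def)
    define P where "P = [:1, 0, - 1:] ^ k * ((pderiv ^^ k) (legendre_poly l) * (pderiv ^^ k) (legendre_poly l'))"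
    define c where "c = (harm_sign \<sigma> k)\<^sup>2 * (harm_norm l k * harm_norm l' k)"
    have "C = (LINT \<theta>:{0..pi}|lborel. sin \<theta> * poly (smult c P) (cos \<theta>))"
    proof -
      have s: "poly ([:1, 0, - 1:] ^ k) (cos \<theta>) = sin \<theta> ^ k * sin \<theta> ^ k" for \<theta> :: real
      proof -
        have "poly [:1, 0, - 1:] (cos \<theta>) = sin \<theta> * sin \<theta>"
          using sin_squared_eq[of \<theta>] by (simp add: power2_eq_square)
        then show ?thesis by (simp only: poly_power power_mult_distrib)
      qed
      have "A l m \<theta> * A l' m' \<theta> = poly (smult c P) (cos \<theta>)" for \<theta>
        unfolding A_def True[symmetric] k_def[symmetric] \<sigma>_def[symmetric] harm_factor_def P_def c_def poly_smult poly_mult power2_eq_square s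
        by (simp only: mult_ac)
      then show ?thesis by (simp add: C_def)
    qed
    also have "\<dots> = c * segment_integral P" by (simp only: polar_integral_segment segment_integral_smult)
    also have "segment_integral P = (if l = l' then 2 / real (2 * l + 1) * (fact (l + k) / fact (l - k)) else 0)"
    proof (cases "l' \<le> l")
      case True
      then show ?thesis unfolding P_def assoc_legendre_orthogonal[OF k(2) True] by (simp only: eq_commute[of l l'])
    next
      case False
      then have "l \<le> l'" by simp
      from assoc_legendre_orthogonal[OF k(1) this] False show ?thesis
        unfolding P_def mult.commute[of "(pderiv ^^ k) (legendre_poly l)"] by auto
    qed
    also have "c * \<dots> = (if l = l' then 2 else 0)"
    proof (cases "l = l'")
      case True
      have "(harm_sign \<sigma> k)\<^sup>2 = 1" by (simp add: harm_sign_def power2_eq_square flip: power_mult_distrib)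
      moreover have "harm_norm l k * harm_norm l k = real (2 * l + 1) * fact (l - k) / fact (l + k)"
        unfolding harm_norm_def by (rule real_sqrt_mult_self[THEN trans]) (simp add: abs_of_nonneg del: of_nat_add of_nat_mult)
      ultimately have c: "c = real (2 * l + 1) * fact (l - k) / fact (l + k)" using True by (simp only: c_def mult_1_left)
      have e: "N * a / b * (2 / N * (b / a)) = 2" if "a > 0" "b > 0" "N > 0" for a b N :: real
        using that by (simp add: field_simps)
      have pos: "0 < real (2 * l + 1)" by simp
      show ?thesis unfolding c if_P[OF True] by (rule e[OF fact_gt_zero fact_gt_zero pos])
    qed simp
    finally have "C = (if l = l' then 2 else 0)" .
    then show ?thesis unfolding I using True by simp
  qed
qed

text \<open>
  Polynomials of degree at most \<open>n\<close>, generated by the products of a power of the vertical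
  coordinate and a power of the equatorial coordinate or its conjugate.  On the sphere these
  generate everything, since there the product of the two equatorial coordinates is \<open>1 - z\<^sup>2\<close>.
\<close>

inductive harm_poly :: "nat \<Rightarrow> (real^3 \<Rightarrow> complex) \<Rightarrow> bool" where
  gen: "\<sigma> = 1 \<or> \<sigma> = - 1 \<Longrightarrow> m + c \<le> n \<Longrightarrow> harm_poly n (\<lambda>\<omega>. k * (equatorial \<sigma> \<omega> ^ m * of_real (\<omega> $ 3) ^ c))"
| add: "harm_poly n f \<Longrightarrow> harm_poly n g \<Longrightarrow> harm_poly n (\<lambda>\<omega>. f \<omega> + g \<omega>)"
| cong: "harm_poly n f \<Longrightarrow> (\<And>\<omega>. norm \<omega> = 1 \<Longrightarrow> g \<omega> = f \<omega>) \<Longrightarrow> harm_poly n g"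

lemma harm_poly_mono: "harm_poly n f \<Longrightarrow> n \<le> n' \<Longrightarrow> harm_poly n' f"
proof (induction rule: harm_poly.induct)
  case (gen \<sigma> m c n k) then show ?case by (intro harm_poly.gen) auto
qed (auto intro: harm_poly.add harm_poly.cong)

lemma harm_poly_cmult: "harm_poly n f \<Longrightarrow> harm_poly n (\<lambda>\<omega>. a * f \<omega>)"
proof (induction rule: harm_poly.induct)
  case (gen \<sigma> m c n k) then show ?case using harm_poly.gen[of \<sigma> m c n "a * k"] by (simp add: mult.assoc)
next
  case (add n f g) then show ?case using harm_poly.add[OF add.IH] by (simp add: distrib_left)
next
  case (cong n f g) show ?case by (rule harm_poly.cong[OF cong.IH]) (simp add: cong.hyps)
qed

lemma harm_poly_vertical: "harm_poly n f \<Longrightarrow> harm_poly (Suc n) (\<lambda>\<omega>. of_real (\<omega> $ 3) * f \<omega>)"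
proof (induction rule: harm_poly.induct)
  case (gen \<sigma> m c n k) then show ?case using harm_poly.gen[of \<sigma> m "Suc c" "Suc n" k] by (simp add: mult_ac)
next
  case (add n f g) then show ?case using harm_poly.add[OF add.IH] by (simp add: distrib_left)
next
  case (cong n f g) show ?case by (rule harm_poly.cong[OF cong.IH]) (simp add: cong.hyps)
qed

lemma equatorial_product:
  assumes "norm \<omega> = 1" shows "equatorial 1 \<omega> * equatorial (- 1) \<omega> = 1 - of_real (\<omega> $ 3) ^ 2"
proof -
  have "(\<omega> $ 1)\<^sup>2 + (\<omega> $ 2)\<^sup>2 + (\<omega> $ 3)\<^sup>2 = 1"
    using assms by (simp add: norm_eq_1 inner_vec_def sum_3 power2_eq_square)
  then have "(\<omega> $ 1)\<^sup>2 + (\<omega> $ 2)\<^sup>2 = 1 - (\<omega> $ 3)\<^sup>2" by simp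
  then show ?thesis
    by (simp add: equatorial_def complex_eq_iff power2_eq_square)
qed

lemma harm_poly_equatorial:
  assumes \<tau>: "\<tau> = 1 \<or> \<tau> = - 1"
  shows "harm_poly n f \<Longrightarrow> harm_poly (Suc n) (\<lambda>\<omega>. equatorial \<tau> \<omega> * f \<omega>)"
proof (induction rule: harm_poly.induct)
  case (gen \<sigma> m c n k)
  show ?case
  proof (cases "\<sigma> = \<tau>")
    case True
    then show ?thesis using gen harm_poly.gen[of \<sigma> "Suc m" c "Suc n" k] by (simp add: mult_ac)
  next
    case False
    show ?thesis
    proof (cases m)
      case 0
      then show ?thesis using gen \<tau> harm_poly.gen[of \<tau> 1 c "Suc n" k] by (simp add: mult_ac)
    next
      case (Suc m')
      have "harm_poly (Suc n) (\<lambda>\<omega>. k * (equatorial \<sigma> \<omega> ^ m' * of_real (\<omega> $ 3) ^ c) + (- k) * (equatorial \<sigma> \<omega> ^ m' * of_real (\<omega> $ 3) ^ (c + 2)))"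
        using gen Suc by (intro harm_poly.add harm_poly.gen) auto
      then show ?thesis
      proof (rule harm_poly.cong)
        fix \<omega> :: "real^3" assume "norm \<omega> = 1"
        then have eq: "equatorial \<tau> \<omega> * equatorial \<sigma> \<omega> = 1 - of_real (\<omega> $ 3) ^ 2"
          using equatorial_product[of \<omega>] gen(1) \<tau> False by (auto simp: mult.commute)
        have "equatorial \<tau> \<omega> * (k * (equatorial \<sigma> \<omega> ^ m * of_real (\<omega> $ 3) ^ c)) = (equatorial \<tau> \<omega> * equatorial \<sigma> \<omega>) * (k * (equatorial \<sigma> \<omega> ^ m' * of_real (\<omega> $ 3) ^ c))"
          unfolding Suc power_Suc by (simp only: mult_ac)
        then show "equatorial \<tau> \<omega> * (k * (equatorial \<sigma> \<omega> ^ m * of_real (\<omega> $ 3) ^ c)) =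
          k * (equatorial \<sigma> \<omega> ^ m' * of_real (\<omega> $ 3) ^ c) + (- k) * (equatorial \<sigma> \<omega> ^ m' * of_real (\<omega> $ 3) ^ (c + 2))"
          unfolding eq by (simp add: algebra_simps power2_eq_square)
      qed
    qed
  qed
next
  case (add n f g) then show ?case using harm_poly.add[OF add.IH] by (simp add: distrib_left)
next
  case (cong n f g) show ?case by (rule harm_poly.cong[OF cong.IH]) (simp add: cong.hyps)
qed

lemma harm_poly_coordinate: "harm_poly n f \<Longrightarrow> harm_poly (Suc n) (\<lambda>\<omega>. of_real (\<omega> $ i) * f \<omega>)"
proof -
  assume f: "harm_poly n f"
  have e: "harm_poly (Suc n) (\<lambda>\<omega>. a * (equatorial 1 \<omega> * f \<omega>) + b * (equatorial (- 1) \<omega> * f \<omega>))" for a b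
    by (intro harm_poly.add harm_poly_cmult harm_poly_equatorial f) auto
  have x: "of_real (\<omega> $ 1) * z = 1 / 2 * (equatorial 1 \<omega> * z) + 1 / 2 * (equatorial (- 1) \<omega> * z)" for \<omega> z
    by (simp add: equatorial_def complex_eq_iff field_simps)
  have y: "of_real (\<omega> $ 2) * z = - \<i> / 2 * (equatorial 1 \<omega> * z) + \<i> / 2 * (equatorial (- 1) \<omega> * z)" for \<omega> z
    by (simp add: equatorial_def complex_eq_iff field_simps)
  consider "i = 1" | "i = 2" | "i = 3" using exhaust_3 by blast
  then show "harm_poly (Suc n) (\<lambda>\<omega>. of_real (\<omega> $ i) * f \<omega>)"
  proof cases
    case 1 show ?thesis unfolding 1 x by (rule e)
  next
    case 2 show ?thesis unfolding 2 y by (rule e)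
  next
    case 3 show ?thesis unfolding 3 by (rule harm_poly_vertical[OF f])
  qed
qed

lemma hom_poly_harm_poly: "hom_poly d f \<Longrightarrow> harm_poly d f"
proof (induction rule: hom_poly.induct)
  case (mono a b c k)
  have p: "harm_poly (j + n) (\<lambda>\<omega>. of_real (\<omega> $ i) ^ j * f \<omega>)" if "harm_poly n f" for i j n f
    using that
  proof (induction j)
    case (Suc j)
    from harm_poly_coordinate[OF Suc.IH[OF Suc.prems], of i] show ?case by (simp add: mult.assoc)
  qed simp
  have "harm_poly 0 (\<lambda>\<omega>. k)" using harm_poly.gen[of 1 0 0 0 k] by simp
  from p[OF p[OF p[OF this, of c 3], of b 2], of a 1] show ?case
    by (simp add: monomial3_def mult_ac add_ac)
next
  case (add d f g) then show ?case by (intro harm_poly.add)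
qed

lemma sphere_poly_harm_poly: "sphere_poly f \<Longrightarrow> \<exists>n. harm_poly n f"
proof (induction rule: sphere_poly.induct)
  case (hom d f) then show ?case using hom_poly_harm_poly by blast
next
  case (add f g)
  then obtain n n' where "harm_poly n f" "harm_poly n' g" by blast
  then have "harm_poly (max n n') f" "harm_poly (max n n') g" by (auto intro: harm_poly_mono)
  then show ?case using harm_poly.add by blast
next
  case (cong f g) then show ?case using harm_poly.cong by blast
qed

lemma hom_poly_equatorial: "\<sigma> = 1 \<or> \<sigma> = - 1 \<Longrightarrow> hom_poly 1 (equatorial \<sigma>)"
proof -
  assume \<sigma>: "\<sigma> = 1 \<or> \<sigma> = - 1"
  have "hom_poly 1 (\<lambda>\<omega>. of_real (\<omega> $ 1) + (\<i> * of_int \<sigma>) * of_real (\<omega> $ 2))"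
    by (intro hom_poly.add hom_poly_cmult hom_poly_coordinate)
  also have "(\<lambda>\<omega>. of_real (\<omega> $ 1) + (\<i> * of_int \<sigma>) * of_real (\<omega> $ 2)) = equatorial \<sigma>"
    using \<sigma> by (auto simp: equatorial_def complex_eq_iff)
  finally show ?thesis .
qed

lemma harm_poly_compose:
  assumes Q: "orthogonal_matrix Q"
  shows "harm_poly n f \<Longrightarrow> harm_poly n (\<lambda>\<omega>. f (Q *v \<omega>))"
proof (induction rule: harm_poly.induct)
  case (gen \<sigma> m c n k)
  have "hom_poly (1 * m + 1 * c) (\<lambda>\<omega>. equatorial \<sigma> \<omega> ^ m * of_real (\<omega> $ 3) ^ c)"
    using gen by (intro hom_poly_mult hom_poly_power hom_poly_equatorial hom_poly_coordinate)
  from hom_poly_harm_poly[OF hom_poly_compose[OF hom_poly_cmult[OF this, of k], of Q]] show ?case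
    by (rule harm_poly_mono) (use gen in simp)
next
  case (add n f g) then show ?case by (intro harm_poly.add)
next
  case (cong n f g) show ?case
    by (rule harm_poly.cong[OF cong.IH]) (simp add: cong.hyps norm_orthogonal_matrix[OF Q])
qed

lemma equatorial_poly_harm_poly:
  assumes "\<sigma> = 1 \<or> \<sigma> = - 1" "m + degree A \<le> n"
  shows "harm_poly n (\<lambda>\<omega>. of_real (poly A (\<omega> $ 3)) * equatorial \<sigma> \<omega> ^ m)"
proof -
  have z: "harm_poly n (\<lambda>\<omega>. 0)" using harm_poly.gen[of 1 0 0 n 0] by simp
  have "harm_poly n (\<lambda>\<omega>. \<Sum>i\<in>I. of_real (coeff A i) * (equatorial \<sigma> \<omega> ^ m * of_real (\<omega> $ 3) ^ i))" if "finite I" "I \<subseteq> {..degree A}" for I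
    using that
  proof (induction I rule: finite_induct)
    case (insert i I)
    then have "harm_poly n (\<lambda>\<omega>. of_real (coeff A i) * (equatorial \<sigma> \<omega> ^ m * of_real (\<omega> $ 3) ^ i) + (\<Sum>i\<in>I. of_real (coeff A i) * (equatorial \<sigma> \<omega> ^ m * of_real (\<omega> $ 3) ^ i)))"
      using assms by (intro harm_poly.add harm_poly.gen) auto
    then show ?case using insert by simp
  qed (use z in simp)
  from this[of "{..degree A}"] show ?thesis
    by (simp add: poly_altdef sum_distrib_right sum_distrib_left mult_ac)
qed

lemma harm_factor_degree: "m + degree (harm_factor \<sigma> l m) \<le> l" if "m \<le> l"
proof -
  have "degree (harm_factor \<sigma> l m) \<le> degree ((pderiv ^^ m) (legendre_poly l))"
    unfolding harm_factor_def by (rule degree_smult_le)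
  also have "\<dots> \<le> l - m" using degree_legendre_le[of l] by (simp add: degree_higher_pderiv)
  finally show ?thesis using that by simp
qed

lemma sph_harm_harm_poly:
  assumes "\<bar>m\<bar> \<le> int l" shows "harm_poly l (sph_harm l m)"
proof -
  obtain \<sigma> k where s: "m = \<sigma> * int k" "\<sigma> = 1 \<or> (\<sigma> = - 1 \<and> k \<noteq> 0)" "k = nat \<bar>m\<bar>" by (rule int_sign_cases)
  have k: "k \<le> l" using assms s(3) by simp
  have "harm_poly l (\<lambda>\<omega>. of_real (poly (harm_factor \<sigma> l k) (\<omega> $ 3)) * equatorial \<sigma> \<omega> ^ k)"
    by (rule equatorial_poly_harm_poly) (use s(2) harm_factor_degree[OF k] in auto)
  then show ?thesis
    by (rule harm_poly.cong) (simp only: s(1) sph_harm_poly[OF _ k s(2)])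
qed

lemma harm_poly_sphere_poly: "harm_poly n f \<Longrightarrow> sphere_poly f"
proof (induction rule: harm_poly.induct)
  case (gen \<sigma> m c n k)
  have "hom_poly (1 * m + 1 * c) (\<lambda>\<omega>. equatorial \<sigma> \<omega> ^ m * of_real (\<omega> $ 3) ^ c)"
    using gen by (intro hom_poly_mult hom_poly_power hom_poly_equatorial hom_poly_coordinate)
  from sphere_poly.hom[OF hom_poly_cmult[OF this, of k]] show ?case .
qed (auto intro: sphere_poly.add sphere_poly.cong)

lemma sph_harm_sphere_poly: "\<bar>m\<bar> \<le> int l \<Longrightarrow> sphere_poly (sph_harm l m)"
  using harm_poly_sphere_poly sph_harm_harm_poly by blast

definition harm_span :: "nat \<Rightarrow> (real^3 \<Rightarrow> complex) \<Rightarrow> bool" where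
  "harm_span n f \<longleftrightarrow> (\<exists>c. \<forall>\<omega>. norm \<omega> = 1 \<longrightarrow> f \<omega> = sph_window n c \<omega>)"

lemma harm_span_add: "harm_span n f \<Longrightarrow> harm_span n g \<Longrightarrow> harm_span n (\<lambda>\<omega>. f \<omega> + g \<omega>)"
proof -
  assume "harm_span n f" "harm_span n g"
  then obtain c d where "\<forall>\<omega>. norm \<omega> = 1 \<longrightarrow> f \<omega> = sph_window n c \<omega>" "\<forall>\<omega>. norm \<omega> = 1 \<longrightarrow> g \<omega> = sph_window n d \<omega>"
    by (auto simp: harm_span_def)
  then show ?thesis
    unfolding harm_span_def by (intro exI[of _ "\<lambda>l m. c l m + d l m"]) (simp add: sph_window_def distrib_right sum.distrib)
qed

lemma harm_span_cong: "harm_span n f \<Longrightarrow> (\<And>\<omega>. norm \<omega> = 1 \<Longrightarrow> g \<omega> = f \<omega>) \<Longrightarrow> harm_span n g"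
  unfolding harm_span_def by metis

lemma harm_span_sph_harm:
  assumes "l \<le> n" "\<bar>m\<bar> \<le> int l" shows "harm_span n (\<lambda>\<omega>. k * sph_harm l m \<omega>)"
proof -
  have "sph_window n (\<lambda>l' m'. if l' = l \<and> m' = m then k else 0) \<omega> = k * sph_harm l m \<omega>" for \<omega>
  proof -
    have "sph_window n (\<lambda>l' m'. if l' = l \<and> m' = m then k else 0) \<omega> = (\<Sum>l'\<le>n. if l' = l then k * sph_harm l m \<omega> else 0)"
      unfolding sph_window_def
    proof (intro sum.cong refl)
      fix l'
      show "(\<Sum>m'\<in>{- int l'..int l'}. (if l' = l \<and> m' = m then k else 0) * sph_harm l' m' \<omega>) = (if l' = l then k * sph_harm l m \<omega> else 0)"
      proof (cases "l' = l")
        case True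
        have "(\<Sum>m'\<in>{- int l'..int l'}. (if l' = l \<and> m' = m then k else 0) * sph_harm l' m' \<omega>) = (\<Sum>m'\<in>{- int l'..int l'}. if m' = m then k * sph_harm l m \<omega> else 0)"
          using True by (intro sum.cong) auto
        also have "\<dots> = k * sph_harm l m \<omega>" using True assms(2) by (subst sum.delta) auto
        finally show ?thesis using True by simp
      qed simp
    qed
    then show ?thesis using assms(1) by simp
  qed
  then show ?thesis unfolding harm_span_def by metis
qed

text \<open>
  The harmonic of degree \<open>m + k\<close> and order \<open>\<sigma> m\<close> is the \<open>m\<close>-th power of the equatorial coordinate times a
  polynomial in the height of degree exactly \<open>k\<close>.  So subtracting a multiple of it removes the top
  coefficient of \<open>A\<close>.
\<close>

lemma harm_span_equatorial_poly:
  assumes \<sigma>: "\<sigma> = 1 \<or> (\<sigma> = - 1 \<and> m \<noteq> 0)"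
  shows "(\<forall>i\<ge>k. coeff A i = 0) \<Longrightarrow> m + k \<le> Suc n \<Longrightarrow> harm_span n (\<lambda>\<omega>. of_real (poly A (\<omega> $ 3)) * equatorial \<sigma> \<omega> ^ m)"
proof (induction k arbitrary: A)
  case 0
  then have "A = 0" by (intro poly_eqI) simp
  then show ?case using harm_span_sph_harm[of 0 n 0 0] by simp
next
  case (Suc k)
  define l where "l = m + k"
  define D where "D = harm_factor \<sigma> l m"
  have l: "m \<le> l" "l \<le> n" using Suc.prems by (auto simp: l_def)
  have "coeff ((pderiv ^^ m) (legendre_poly l)) k = fact (k + m) / fact k * coeff (legendre_poly l) (k + m)"
    by (rule coeff_higher_pderiv_fact)
  also have "\<dots> \<noteq> 0" using coeff_legendre[of l] by (simp add: l_def add.commute)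
  finally have dk: "coeff D k \<noteq> 0"
    by (simp add: D_def harm_factor_def harm_sign_def harm_norm_def)
  have dD: "degree D \<le> k" using harm_factor_degree[OF l(1), of \<sigma>] by (simp add: D_def l_def)
  define a where "a = coeff A k / coeff D k"
  have "harm_span n (\<lambda>\<omega>. of_real (poly (A - smult a D) (\<omega> $ 3)) * equatorial \<sigma> \<omega> ^ m)"
  proof (rule Suc.IH)
    show "\<forall>i\<ge>k. coeff (A - smult a D) i = 0"
    proof (intro allI impI)
      fix i assume "k \<le> i"
      show "coeff (A - smult a D) i = 0"
      proof (cases "i = k")
        case True then show ?thesis using dk by (simp add: a_def)
      next
        case False
        then have "degree D < i" "Suc k \<le> i" using dD \<open>k \<le> i\<close> by auto
        then show ?thesis using Suc.prems by (simp add: coeff_eq_0)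
      qed
    qed
  qed (use Suc.prems in simp)
  moreover have "harm_span n (\<lambda>\<omega>. of_real a * sph_harm l (\<sigma> * int m) \<omega>)"
    using l \<sigma> by (intro harm_span_sph_harm) (auto simp: abs_mult)
  ultimately have "harm_span n (\<lambda>\<omega>. of_real (poly (A - smult a D) (\<omega> $ 3)) * equatorial \<sigma> \<omega> ^ m + of_real a * sph_harm l (\<sigma> * int m) \<omega>)"
    by (rule harm_span_add)
  then show ?case
    by (rule harm_span_cong) (simp add: sph_harm_poly[OF _ l(1) \<sigma>] D_def algebra_simps)
qed

lemma harm_poly_span: "harm_poly n f \<Longrightarrow> harm_span n f"
proof (induction rule: harm_poly.induct)
  case (gen \<sigma> m c n k)
  have base: "harm_span n (\<lambda>\<omega>. of_real (poly (monom 1 c) (\<omega> $ 3)) * equatorial (if m = 0 then 1 else \<sigma>) \<omega> ^ m)"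
    using gen by (intro harm_span_equatorial_poly[where k="Suc c"]) auto
  have "harm_span n (\<lambda>\<omega>. k * (of_real (poly (monom 1 c) (\<omega> $ 3)) * equatorial (if m = 0 then 1 else \<sigma>) \<omega> ^ m))"
  proof -
    from base obtain b where "\<forall>\<omega>. norm \<omega> = 1 \<longrightarrow> of_real (poly (monom 1 c) (\<omega> $ 3)) * equatorial (if m = 0 then 1 else \<sigma>) \<omega> ^ m = sph_window n b \<omega>"
      by (auto simp: harm_span_def)
    then show ?thesis unfolding harm_span_def
      by (intro exI[of _ "\<lambda>l m. k * b l m"]) (simp add: sph_window_def sum_distrib_left mult.assoc)
  qed
  then show ?case by (rule harm_span_cong) (auto simp: poly_monom mult_ac)
next
  case (add n f g) then show ?case by (intro harm_span_add)
next
  case (cong n f g) then show ?case using harm_span_cong by blast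
qed

lemma sphere_integral_degree_order_sum:
  assumes "\<And>l m. m \<in> {- int l..int l} \<Longrightarrow> sphere_poly (f l m)"
  shows "sphere_integral (\<lambda>\<omega>. \<Sum>l\<le>n. \<Sum>m\<in>{- int l..int l}. a l m * f l m \<omega>) =
    (\<Sum>l\<le>n. \<Sum>m\<in>{- int l..int l}. a l m * sphere_integral (f l m))"
proof -
  have p: "sphere_poly (\<lambda>\<omega>. a l m * f l m \<omega>)" if "m \<in> {- int l..int l}" for l m
    using assms that by (intro sphere_poly_cmult)
  have "sphere_integral (\<lambda>\<omega>. \<Sum>l\<le>n. \<Sum>m\<in>{- int l..int l}. a l m * f l m \<omega>) =
    (\<Sum>l\<le>n. sphere_integral (\<lambda>\<omega>. \<Sum>m\<in>{- int l..int l}. a l m * f l m \<omega>))"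
    by (intro sphere_integral_sum sphere_poly_sum p) auto
  also have "\<dots> = (\<Sum>l\<le>n. \<Sum>m\<in>{- int l..int l}. sphere_integral (\<lambda>\<omega>. a l m * f l m \<omega>))"
    by (intro sum.cong refl sphere_integral_sum p) auto
  also have "\<dots> = (\<Sum>l\<le>n. \<Sum>m\<in>{- int l..int l}. a l m * sphere_integral (f l m))"
    by (intro sum.cong refl sphere_integral_cmult(2) sphere_poly_integrable assms)
  finally show ?thesis .
qed

lemma harm_product_sphere_poly:
  "\<bar>m\<bar> \<le> int l \<Longrightarrow> \<bar>m'\<bar> \<le> int l' \<Longrightarrow> sphere_poly (\<lambda>\<omega>. sph_harm l m \<omega> * cnj (sph_harm l' m' \<omega>))"
  by (intro sphere_poly_mult sphere_poly_cnj sph_harm_sphere_poly)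

lemma sph_window_coeff:
  assumes f: "\<And>\<omega>. norm \<omega> = 1 \<Longrightarrow> f \<omega> = sph_window n c \<omega>" and l: "l \<le> n" and m: "m \<in> {- int l..int l}"
  shows "sphere_integral (\<lambda>\<omega>. f \<omega> * cnj (sph_harm l m \<omega>)) = c l m"
proof -
  have am: "\<bar>m\<bar> \<le> int l" using m by auto
  have "sphere_integral (\<lambda>\<omega>. f \<omega> * cnj (sph_harm l m \<omega>)) = sphere_integral (\<lambda>\<omega>. \<Sum>l'\<le>n. \<Sum>m'\<in>{- int l'..int l'}. c l' m' * (sph_harm l' m' \<omega> * cnj (sph_harm l m \<omega>)))"
    by (rule sphere_integral_cong) (simp add: f sph_window_def sum_distrib_right mult.assoc)
  also have "\<dots> = (\<Sum>l'\<le>n. \<Sum>m'\<in>{- int l'..int l'}. c l' m' * sphere_integral (\<lambda>\<omega>. sph_harm l' m' \<omega> * cnj (sph_harm l m \<omega>)))"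
    by (rule sphere_integral_degree_order_sum) (use am harm_product_sphere_poly in auto)
  also have "\<dots> = (\<Sum>l'\<le>n. \<Sum>m'\<in>{- int l'..int l'}. if l' = l \<and> m' = m then c l m else 0)"
    using am by (intro sum.cong refl) (auto simp: sph_harm_orthonormal)
  also have "\<dots> = (\<Sum>l'\<le>n. if l' = l then c l m else 0)"
  proof (intro sum.cong refl)
    fix l'
    show "(\<Sum>m'\<in>{- int l'..int l'}. if l' = l \<and> m' = m then c l m else 0) = (if l' = l then c l m else 0)"
      using m by (cases "l' = l") auto
  qed
  also have "\<dots> = c l m" using l by simp
  finally show ?thesis .
qed

text \<open>
  The harmonics of degree \<open>l\<close> are the polynomials of degree \<open>l\<close> orthogonal to all polynomials of
  lower degree.  Both conditions are invariant under rotations; hence a rotated harmonic is a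
  combination of harmonics of the same degree, with coefficients given by the Wigner matrix.
\<close>

theorem sph_harm_rotated:
  assumes Q: "orthogonal_matrix Q" and m': "m' \<in> {- int l..int l}" and \<omega>: "norm \<omega> = 1"
  shows "sph_harm l m' (matrix_inv Q *v \<omega>) = (\<Sum>m\<in>{- int l..int l}. wigner_D Q l m m' * sph_harm l m \<omega>)"
proof -
  have QT: "orthogonal_matrix (matrix_inv Q)" by (rule orthogonal_matrix_inv[OF Q])
  note inv = orthogonal_matrix_inv_cancel(2)[OF Q]
  define f where "f = (\<lambda>x. sph_harm l m' (matrix_inv Q *v x))"
  have am': "\<bar>m'\<bar> \<le> int l" using m' by auto
  have fp: "harm_poly l f" unfolding f_def by (rule harm_poly_compose[OF QT sph_harm_harm_poly[OF am']])
  then obtain c where c: "\<And>x. norm x = 1 \<Longrightarrow> f x = sph_window l c x"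
    using harm_poly_span unfolding harm_span_def by blast
  have low: "c l1 m1 = 0" if l1: "l1 < l" and m1: "m1 \<in> {- int l1..int l1}" for l1 m1
  proof -
    have am1: "\<bar>m1\<bar> \<le> int l1" using m1 by auto
    have "harm_poly l1 (\<lambda>x. sph_harm l1 m1 (Q *v x))" by (rule harm_poly_compose[OF Q sph_harm_harm_poly[OF am1]])
    then obtain d where d: "\<And>x. norm x = 1 \<Longrightarrow> sph_harm l1 m1 (Q *v x) = sph_window l1 d x"
      using harm_poly_span unfolding harm_span_def by blast
    have "c l1 m1 = sphere_integral (\<lambda>x. f x * cnj (sph_harm l1 m1 x))"
      using sph_window_coeff[OF c _ m1] l1 by simp
    \<comment> \<open>Rotating back moves the rotation to the harmonic of lower degree.\<close>
    also have "\<dots> = sphere_integral (\<lambda>x. f (Q *v x) * cnj (sph_harm l1 m1 (Q *v x)))"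
      by (rule sphere_integral_rotation_invariant(1)[OF Q, symmetric])
        (intro sphere_poly_mult sphere_poly_cnj harm_poly_sphere_poly[OF fp] sph_harm_sphere_poly am1)
    also have "\<dots> = sphere_integral (\<lambda>x. \<Sum>l2\<le>l1. \<Sum>m2\<in>{- int l2..int l2}. cnj (d l2 m2) * (sph_harm l m' x * cnj (sph_harm l2 m2 x)))"
      by (rule sphere_integral_cong) (simp add: f_def inv d sph_window_def sum_distrib_left mult_ac)
    also have "\<dots> = (\<Sum>l2\<le>l1. \<Sum>m2\<in>{- int l2..int l2}. cnj (d l2 m2) * sphere_integral (\<lambda>x. sph_harm l m' x * cnj (sph_harm l2 m2 x)))"
      by (rule sphere_integral_degree_order_sum) (use am' harm_product_sphere_poly in auto)
    also have "\<dots> = 0"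
      using am' l1 by (intro sum.neutral ballI) (auto simp: sph_harm_orthonormal)
    finally show ?thesis .
  qed
  have top: "c l m = wigner_D Q l m m'" if "m \<in> {- int l..int l}" for m
    using sph_window_coeff[OF c _ that] by (simp add: wigner_D_def f_def)
  have "f \<omega> = (\<Sum>l1\<le>l. \<Sum>m1\<in>{- int l1..int l1}. c l1 m1 * sph_harm l1 m1 \<omega>)"
    using c[OF \<omega>] by (simp add: sph_window_def)
  also have "\<dots> = (\<Sum>l1\<le>l. if l1 = l then (\<Sum>m1\<in>{- int l..int l}. c l m1 * sph_harm l m1 \<omega>) else 0)"
    by (intro sum.cong refl) (auto intro!: sum.neutral simp: low)
  also have "\<dots> = (\<Sum>m1\<in>{- int l..int l}. wigner_D Q l m1 m' * sph_harm l m1 \<omega>)"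
    by (simp add: top)
  finally show ?thesis by (simp add: f_def)
qed

theorem sph_window_rotated_coeffs:
  assumes Q: "orthogonal_matrix Q" and \<omega>: "norm \<omega> = 1"
  shows "sph_window L (rotated_coeffs Q \<kappa>) \<omega> = sph_window L \<kappa> (matrix_inv Q *v \<omega>)"
  unfolding sph_window_def rotated_coeffs_def
proof (rule sum.cong[OF refl])
  fix l
  have "(\<Sum>m'\<in>{- int l..int l}. \<kappa> l m' * sph_harm l m' (matrix_inv Q *v \<omega>)) =
    (\<Sum>m'\<in>{- int l..int l}. \<Sum>m\<in>{- int l..int l}. wigner_D Q l m m' * \<kappa> l m' * sph_harm l m \<omega>)"
    by (intro sum.cong refl) (simp add: sph_harm_rotated[OF Q _ \<omega>] sum_distrib_left mult_ac)
  also have "\<dots> = (\<Sum>m\<in>{- int l..int l}. \<Sum>m'\<in>{- int l..int l}. wigner_D Q l m m' * \<kappa> l m' * sph_harm l m \<omega>)"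
    by (rule sum.swap)
  finally show "(\<Sum>m\<in>{- int l..int l}. (\<Sum>m'\<in>{- int l..int l}. wigner_D Q l m m' * \<kappa> l m') * sph_harm l m \<omega>) =
      (\<Sum>m'\<in>{- int l..int l}. \<kappa> l m' * sph_harm l m' (matrix_inv Q *v \<omega>))"
    by (simp add: sum_distrib_right)
qed

lemma sph_window_sphere_poly: "sphere_poly (sph_window L w)"
  unfolding sph_window_def
  by (intro sphere_poly_sum sphere_poly_cmult sph_harm_sphere_poly) auto

text \<open>
  The product coefficients are those of a product of harmonics, so the bilinear form yields the
  coefficients of the square of the window.
\<close>

lemma sph_prod_form_eq:
  assumes m: "m \<in> {- int l..int l}"
  shows "sph_prod_form L w l m = sphere_integral (\<lambda>\<omega>. (sph_window L w \<omega>)\<^sup>2 * cnj (sph_harm l m \<omega>))"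
proof -
  let ?y = "\<lambda>\<omega>. cnj (sph_harm l m \<omega>)"
  have y: "sphere_poly ?y" using m by (intro sphere_poly_cnj sph_harm_sphere_poly) auto
  have p: "sphere_poly (\<lambda>\<omega>. sph_harm l1 m1 \<omega> * sph_window L w \<omega> * ?y \<omega>)" if "m1 \<in> {- int l1..int l1}" for l1 m1
    using that by (intro sphere_poly_mult y sph_window_sphere_poly sph_harm_sphere_poly) auto
  have q: "sphere_poly (\<lambda>\<omega>. sph_harm l1 m1 \<omega> * sph_harm l2 m2 \<omega> * ?y \<omega>)"
    if "m1 \<in> {- int l1..int l1}" "m2 \<in> {- int l2..int l2}" for l1 m1 l2 m2
    using that by (intro sphere_poly_mult y sph_harm_sphere_poly) auto
  have "sphere_integral (\<lambda>\<omega>. (sph_window L w \<omega>)\<^sup>2 * ?y \<omega>) =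
    sphere_integral (\<lambda>\<omega>. \<Sum>l1\<le>L. \<Sum>m1\<in>{- int l1..int l1}. w l1 m1 * (sph_harm l1 m1 \<omega> * sph_window L w \<omega> * ?y \<omega>))"
  proof (rule sphere_integral_cong)
    fix \<omega> :: "real^3"
    have "(sph_window L w \<omega>)\<^sup>2 * ?y \<omega> = (\<Sum>l1\<le>L. \<Sum>m1\<in>{- int l1..int l1}. w l1 m1 * sph_harm l1 m1 \<omega>) * (sph_window L w \<omega> * ?y \<omega>)"
      by (simp add: sph_window_def power2_eq_square mult.assoc)
    then show "(sph_window L w \<omega>)\<^sup>2 * ?y \<omega> = (\<Sum>l1\<le>L. \<Sum>m1\<in>{- int l1..int l1}. w l1 m1 * (sph_harm l1 m1 \<omega> * sph_window L w \<omega> * ?y \<omega>))"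
      by (simp only: sum_distrib_right mult.assoc)
  qed
  also have "\<dots> = (\<Sum>l1\<le>L. \<Sum>m1\<in>{- int l1..int l1}. w l1 m1 * sphere_integral (\<lambda>\<omega>. sph_harm l1 m1 \<omega> * sph_window L w \<omega> * ?y \<omega>))"
    by (rule sphere_integral_degree_order_sum[OF p])
  also have "\<dots> = (\<Sum>l1\<le>L. \<Sum>m1\<in>{- int l1..int l1}. w l1 m1 * (\<Sum>l2\<le>L. \<Sum>m2\<in>{- int l2..int l2}. w l2 m2 * sph_prod_coeff l1 m1 l2 m2 l m))"
  proof (intro sum.cong refl arg_cong[where f="(*) _"])
    fix l1 m1 assume m1: "m1 \<in> {- int l1..int l1}"
    have "sphere_integral (\<lambda>\<omega>. sph_harm l1 m1 \<omega> * sph_window L w \<omega> * ?y \<omega>) =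
      sphere_integral (\<lambda>\<omega>. \<Sum>l2\<le>L. \<Sum>m2\<in>{- int l2..int l2}. w l2 m2 * (sph_harm l1 m1 \<omega> * sph_harm l2 m2 \<omega> * ?y \<omega>))"
    proof (rule sphere_integral_cong)
      fix \<omega> :: "real^3"
      show "sph_harm l1 m1 \<omega> * sph_window L w \<omega> * ?y \<omega> = (\<Sum>l2\<le>L. \<Sum>m2\<in>{- int l2..int l2}. w l2 m2 * (sph_harm l1 m1 \<omega> * sph_harm l2 m2 \<omega> * ?y \<omega>))"
        unfolding sph_window_def sum_distrib_left sum_distrib_right by (simp only: mult_ac)
    qed
    also have "\<dots> = (\<Sum>l2\<le>L. \<Sum>m2\<in>{- int l2..int l2}. w l2 m2 * sph_prod_coeff l1 m1 l2 m2 l m)"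
      unfolding sph_prod_coeff_def by (rule sphere_integral_degree_order_sum[OF q[OF m1]])
    finally show "sphere_integral (\<lambda>\<omega>. sph_harm l1 m1 \<omega> * sph_window L w \<omega> * ?y \<omega>) =
      (\<Sum>l2\<le>L. \<Sum>m2\<in>{- int l2..int l2}. w l2 m2 * sph_prod_coeff l1 m1 l2 m2 l m)" .
  qed
  finally show ?thesis unfolding sph_prod_form_def by (simp only: sum_distrib_left mult_ac)
qed

text \<open>
  A polynomial on the sphere is determined by its coefficients, so the algebraic condition on the
  rotated coefficients says that the squares of the rotated windows form a partition of unity.
\<close>

theorem sum_windows_squared:
  assumes angular: "\<And>l m. m \<in> {- int l..int l} \<Longrightarrow>
      (if l = 0 \<and> m = 0 then 1 else 0) = (\<Sum>t\<in>T. sph_prod_form L (w t) l m)"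
    and T: "finite T" and \<omega>: "norm \<omega> = 1"
  shows "(\<Sum>t\<in>T. (sph_window L (w t) \<omega>)\<^sup>2) = 1"
proof -
  define g where "g = (\<lambda>\<omega>. \<Sum>t\<in>T. (sph_window L (w t) \<omega>)\<^sup>2)"
  have sq: "sphere_poly (\<lambda>\<omega>. (sph_window L (w t) \<omega>)\<^sup>2)" for t
    unfolding power2_eq_square by (intro sphere_poly_mult sph_window_sphere_poly)
  have gp: "sphere_poly g" unfolding g_def by (intro sphere_poly_sum sq)
  then obtain n c where c: "\<And>x. norm x = 1 \<Longrightarrow> g x = sph_window n c x"
    using sphere_poly_harm_poly[OF gp] harm_poly_span by (metis harm_span_def)
  have coeff: "c l m = (if l = 0 \<and> m = 0 then 1 else 0)" if l: "l \<le> n" and m: "m \<in> {- int l..int l}" for l m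
  proof -
    have "c l m = sphere_integral (\<lambda>x. \<Sum>t\<in>T. (sph_window L (w t) x)\<^sup>2 * cnj (sph_harm l m x))"
      using sph_window_coeff[OF c l m] by (simp add: g_def sum_distrib_right)
    also have "\<dots> = (\<Sum>t\<in>T. sph_prod_form L (w t) l m)"
      unfolding sph_prod_form_eq[OF m] using m
      by (intro sphere_integral_sum T sphere_poly_mult sphere_poly_cnj sph_harm_sphere_poly sq) auto
    finally show ?thesis using angular[OF m] by simp
  qed
  have "g \<omega> = (\<Sum>l\<le>n. \<Sum>m\<in>{- int l..int l}. if l = 0 \<and> m = 0 then sph_harm 0 0 \<omega> else 0)"
    unfolding c[OF \<omega>] sph_window_def by (intro sum.cong refl) (auto simp: coeff)
  also have "\<dots> = (\<Sum>l\<le>n. if l = 0 then sph_harm 0 0 \<omega> else 0)"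
    by (intro sum.cong refl) auto
  also have "\<dots> = sph_harm 0 0 \<omega>" by simp
  also have "\<dots> = 1"
    using sph_harm_poly[OF \<omega>, of 0 0 1] by (simp add: harm_factor_def harm_sign_def harm_norm_def legendre_poly_def)
  finally show ?thesis by (simp add: g_def)
qed

section \<open>The wavelet frame\<close>

text \<open>
  The projections of \<open>r\<close> to the three \<open>e\<^sub>a \<times> \<omega>\<close> are, up to the sign, the coordinates of \<open>r \<times> \<omega>\<close>; so this is
  the identity \<open>|r \<times> \<omega>|\<^sup>2 + \<langle>r, \<omega>\<rangle>\<^sup>2 = |r|\<^sup>2 |\<omega>|\<^sup>2\<close>.
\<close>

lemma cross_axis_tight_frame_real:
  fixes r \<omega> :: "real^3"
  shows "(\<Sum>a\<in>UNIV. (r \<bullet> cross3 (axis a 1) \<omega>)\<^sup>2) + (r \<bullet> \<omega>)\<^sup>2 = (norm r)\<^sup>2 * (norm \<omega>)\<^sup>2"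
proof -
  have e: "r \<bullet> cross3 (axis 1 1) \<omega> = r $ 3 * \<omega> $ 2 - r $ 2 * \<omega> $ 3"
    "r \<bullet> cross3 (axis 2 1) \<omega> = r $ 1 * \<omega> $ 3 - r $ 3 * \<omega> $ 1"
    "r \<bullet> cross3 (axis 3 1) \<omega> = r $ 2 * \<omega> $ 1 - r $ 1 * \<omega> $ 2"
    by (simp_all add: cross3_def inner_vec_def sum_3 axis_def)
  show ?thesis
    unfolding sum_3 e power2_norm_eq_inner by (simp add: inner_vec_def sum_3 power2_eq_square algebra_simps)
qed

lemma sum_mult_of_real:
  "(\<Sum>i\<in>UNIV. v $ i * of_real (w $ i)) = Complex (vec_Re v \<bullet> w) (vec_Im v \<bullet> w)" for v :: "complex^3"
  by (simp add: complex_eq_iff vec_Re_def vec_Im_def inner_vec_def sum_3)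

lemma cross_axis_tight_frame:
  fixes v :: "complex^3" and \<omega> :: "real^3"
  shows "(\<Sum>a\<in>UNIV. (norm (\<Sum>i\<in>UNIV. v $ i * of_real (cross3 (axis a 1) \<omega> $ i)))\<^sup>2) +
    (norm (\<Sum>i\<in>UNIV. v $ i * of_real (\<omega> $ i)))\<^sup>2 = (norm v)\<^sup>2 * (norm \<omega>)\<^sup>2"
proof -
  have "(\<Sum>a\<in>UNIV. (norm (\<Sum>i\<in>UNIV. v $ i * of_real (cross3 (axis a 1) \<omega> $ i)))\<^sup>2) + (norm (\<Sum>i\<in>UNIV. v $ i * of_real (\<omega> $ i)))\<^sup>2
    = ((\<Sum>a\<in>UNIV. (vec_Re v \<bullet> cross3 (axis a 1) \<omega>)\<^sup>2) + (vec_Re v \<bullet> \<omega>)\<^sup>2) + ((\<Sum>a\<in>UNIV. (vec_Im v \<bullet> cross3 (axis a 1) \<omega>)\<^sup>2) + (vec_Im v \<bullet> \<omega>)\<^sup>2)"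
    unfolding sum_mult_of_real by (simp add: cmod_power2 sum.distrib)
  then show ?thesis
    unfolding cross_axis_tight_frame_real norm_sq_vec_Re_Im[of v] by (simp add: distrib_right)
qed

definition wavelet_symbol :: "nat \<Rightarrow> (nat \<Rightarrow> int \<Rightarrow> complex) \<Rightarrow> (real \<Rightarrow> complex) \<Rightarrow> real^3 \<Rightarrow> complex" where
  "wavelet_symbol L \<kappa> h \<xi> = - \<i> * sph_window L \<kappa> (sgn \<xi>) * h (norm \<xi>)"

text \<open>The wavelets of the three axes, and under the index \<open>None\<close> the longitudinal field that completes them.\<close>

definition extended_hat ::
    "nat \<Rightarrow> (nat \<Rightarrow> int \<Rightarrow> complex) \<Rightarrow> (real \<Rightarrow> complex) \<Rightarrow> 3 option \<Rightarrow> real^3 \<Rightarrow> complex^3" where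
  "extended_hat L \<kappa> h a = (case a of Some b \<Rightarrow> mother_wavelet_hat L \<kappa> h b | None \<Rightarrow> longitudinal (wavelet_symbol L \<kappa> h))"

lemma mother_wavelet_hat_nth:
  "mother_wavelet_hat L \<kappa> h a \<xi> $ i = wavelet_symbol L \<kappa> h \<xi> * of_real (tangent_field a (sgn \<xi>) $ i)"
  by (simp add: mother_wavelet_hat_def wavelet_symbol_def)

lemma bounded_support_wavelet_symbol:
  assumes hm: "h \<in> borel_measurable borel" and hb: "\<And>r. r > pi \<Longrightarrow> h r = 0" and h1: "\<And>r. r > 0 \<Longrightarrow> norm (h r) \<le> 1"
  shows "bounded_support (wavelet_symbol L \<kappa> h)"
proof -
  note [measurable] = hm
  obtain g where g: "continuous_on UNIV g" "\<And>x. norm x = 1 \<Longrightarrow> sph_window L \<kappa> x = g x"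
    using sphere_poly_continuous_extension[OF sph_window_sphere_poly] by metis
  have [measurable]: "g \<in> borel_measurable borel" using g(1) by (rule borel_measurable_continuous_onI)
  have [measurable]: "(sgn :: real^3 \<Rightarrow> real^3) \<in> borel_measurable borel"
    unfolding sgn_div_norm[abs_def] by measurable
  have "compact (g ` sphere 0 1)"
    by (rule compact_continuous_image) (use g(1) continuous_on_subset in auto)
  then obtain B where B: "\<And>x. norm x = 1 \<Longrightarrow> norm (g x) \<le> B"
    using compact_imp_bounded by (fastforce simp: bounded_iff)
  \<comment> \<open>The coordinates behind the harmonics are not continuous; the polynomial \<open>g\<close> replaces them for \<open>\<xi> \<noteq> 0\<close>.\<close>
  have eq: "wavelet_symbol L \<kappa> h = (\<lambda>\<xi>. if \<xi> = 0 then wavelet_symbol L \<kappa> h 0 else - \<i> * g (sgn \<xi>) * h (norm \<xi>))"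
    by (auto simp: wavelet_symbol_def g(2) norm_sgn)
  show ?thesis
  proof (rule bounded_supportI[of _ "norm (wavelet_symbol L \<kappa> h 0) + \<bar>B\<bar>" pi])
    show "wavelet_symbol L \<kappa> h \<in> borel_measurable borel" by (subst eq) measurable
    show "wavelet_symbol L \<kappa> h \<xi> = 0" if "norm \<xi> > pi" for \<xi> using hb[OF that] by (simp add: wavelet_symbol_def)
    show "norm (wavelet_symbol L \<kappa> h \<xi>) \<le> norm (wavelet_symbol L \<kappa> h 0) + \<bar>B\<bar>" for \<xi>
    proof (cases "\<xi> = 0")
      case False
      have "norm (wavelet_symbol L \<kappa> h \<xi>) = norm (g (sgn \<xi>)) * norm (h (norm \<xi>))"
        using False by (simp add: wavelet_symbol_def norm_mult g(2) norm_sgn)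
      also have "\<dots> \<le> \<bar>B\<bar> * 1"
        using False B[of "sgn \<xi>"] h1[of "norm \<xi>"] by (intro mult_mono) (auto simp: norm_sgn)
      finally show ?thesis by (simp add: add_increasing)
    qed simp
  qed
qed

lemma bounded_support_extended_hat:
  assumes "h \<in> borel_measurable borel" "\<And>r. r > pi \<Longrightarrow> h r = 0" "\<And>r. r > 0 \<Longrightarrow> norm (h r) \<le> 1"
  shows "bounded_support (extended_hat L \<kappa> h a)"
proof -
  note m = bounded_support_wavelet_symbol[OF assms, of L \<kappa>]
  note [measurable] = bounded_support_measurable[OF m]
  show ?thesis
  proof (cases a)
    case None
    then show ?thesis using bounded_support_longitudinal[OF m] by (simp add: extended_hat_def)
  next
    case (Some b)
    have [measurable]: "(sgn :: real^3 \<Rightarrow> real^3) \<in> borel_measurable borel"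
      unfolding sgn_div_norm[abs_def] by measurable
    have [measurable]: "(\<lambda>x. cross3 (axis b 1) x $ i) \<in> borel_measurable borel" for i
    proof (intro borel_measurable_continuous_onI)
      have "continuous_on UNIV (\<lambda>x. cross3 (axis b 1) x)"
        by (intro continuous_on_cross continuous_intros)
      then show "continuous_on UNIV (\<lambda>x. cross3 (axis b 1) x $ i)" by (intro continuous_intros)
    qed
    \<comment> \<open>At \<open>\<xi> = 0\<close>, where \<open>sgn \<xi>\<close> is not on the sphere, the tangent field has some value without meaning.\<close>
    define t where "t \<xi> = (if \<xi> = 0 then tangent_field b 0 else cross3 (axis b 1) (sgn \<xi>))" for \<xi> :: "real^3"
    have t: "tangent_field b (sgn \<xi>) = t \<xi>" for \<xi>
      by (simp add: t_def tangent_field_eq_cross3 norm_sgn)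
    define K where "K = 1 + norm (tangent_field b 0)"
    have tK: "norm (t \<xi>) \<le> K" for \<xi>
    proof (cases "\<xi> = 0")
      case False
      have "(norm (cross3 (axis b 1) (sgn \<xi>)))\<^sup>2 + (axis b 1 \<bullet> sgn \<xi>)\<^sup>2 = 1"
        using False by (simp add: norm_cross_dot norm_sgn)
      then have "(norm (cross3 (axis b 1) (sgn \<xi>)))\<^sup>2 \<le> 1\<^sup>2" by (smt (verit) one_power2 zero_le_power2)
      then have "norm (cross3 (axis b 1) (sgn \<xi>)) \<le> 1" by (rule power2_le_imp_le) simp
      with False show ?thesis by (simp add: t_def K_def add_increasing2)
    qed (simp add: t_def K_def)
    have eq: "mother_wavelet_hat L \<kappa> h b \<xi> = wavelet_symbol L \<kappa> h \<xi> *s (\<chi> i. of_real (t \<xi> $ i))" for \<xi>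
      by (simp add: vec_eq_iff mother_wavelet_hat_nth t)
    have "bounded_support (mother_wavelet_hat L \<kappa> h b)"
    proof (rule bounded_support_dominated[OF m, of _ K])
      have "(\<lambda>\<xi>. \<chi> i. wavelet_symbol L \<kappa> h \<xi> * of_real (t \<xi> $ i)) \<in> borel_measurable borel"
      proof (rule borel_measurable_vec_lambda)
        fix i
        have "(\<lambda>\<xi>. t \<xi> $ i) \<in> borel_measurable borel"
          unfolding t_def if_distrib[where f="\<lambda>x. x $ i"] by measurable
        then show "(\<lambda>\<xi>. wavelet_symbol L \<kappa> h \<xi> * of_real (t \<xi> $ i)) \<in> borel_measurable borel" by measurable
      qed
      then show "mother_wavelet_hat L \<kappa> h b \<in> borel_measurable borel"
        by (simp add: eq[abs_def] vector_scalar_mult_def)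
      have nt: "norm (\<chi> i. complex_of_real (t \<xi> $ i)) = norm (t \<xi>)" for \<xi> by (simp add: norm_vec_def)
      show "norm (mother_wavelet_hat L \<kappa> h b \<xi>) \<le> K * norm (wavelet_symbol L \<kappa> h \<xi>)" for \<xi>
        unfolding eq norm_smult nt using tK[of \<xi>] by (simp add: mult.commute mult_right_mono)
    qed
    then show ?thesis using Some by (simp add: extended_hat_def)
  qed
qed

lemma extended_hat_bandlimited:
  assumes "\<And>r. r > pi \<Longrightarrow> h r = 0" "norm \<xi> > pi"
  shows "extended_hat L \<kappa> h a \<xi> = 0"
  using assms by (cases a) (auto simp: extended_hat_def longitudinal_def mother_wavelet_hat_nth wavelet_symbol_def vec_eq_iff)

lemma sgn_orthogonal_matrix:
  assumes "orthogonal_matrix (Q::real^3^3)" shows "sgn (Q *v x) = Q *v sgn x"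
  by (simp add: sgn_div_norm norm_orthogonal_matrix[OF assms] matrix_vector_mult_scaleR)

lemma sum_UNIV_option3: "(\<Sum>a\<in>UNIV. g a) = (\<Sum>b\<in>(UNIV :: 3 set). g (Some b)) + g None"
  for g :: "3 option \<Rightarrow> 'b::comm_monoid_add"
  by (simp add: UNIV_option_conv sum.reindex add.commute)

text \<open>
  The rotation is moved from the four directions to the vector \<open>v\<close>; then the tight frame property
  applies.
\<close>

theorem extended_hat_square_sum:
  assumes Q: "orthogonal_matrix Q" and \<eta>: "\<eta> \<noteq> 0"
  shows "(\<Sum>a\<in>UNIV. (norm (\<Sum>i\<in>UNIV. v $ i * cnj (rotate_field Q (extended_hat L \<kappa> h a) \<eta> $ i)))\<^sup>2) =
    (norm (sph_window L \<kappa> (matrix_inv Q *v sgn \<eta>)))\<^sup>2 * (norm (h (norm \<eta>)))\<^sup>2 * (norm v)\<^sup>2"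
proof -
  have QT: "orthogonal_matrix (matrix_inv Q)" "orthogonal_matrix (transpose Q)"
    unfolding matrix_inv_orthogonal[OF Q] using Q by (simp_all add: orthogonal_matrix_transpose)
  define \<zeta> where "\<zeta> = matrix_inv Q *v \<eta>"
  have \<zeta>: "\<zeta> \<noteq> 0" "norm \<zeta> = norm \<eta>" "sgn \<zeta> = matrix_inv Q *v sgn \<eta>"
    using \<eta> norm_orthogonal_matrix[OF QT(1), of \<eta>] by (auto simp: \<zeta>_def sgn_orthogonal_matrix[OF QT(1)])
  define v' where "v' = map_matrix complex_of_real (transpose Q) *v v"
  have nv': "norm v' = norm v" unfolding v'_def by (rule norm_map_matrix_of_real[OF QT(2)])
  define s where "s = wavelet_symbol L \<kappa> h \<zeta>"
  have pair: "(\<Sum>i\<in>UNIV. v $ i * cnj (rotate_field Q F \<eta> $ i)) = cnj s * (\<Sum>l\<in>UNIV. v' $ l * of_real (d $ l))"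
    if F: "\<And>l. F \<zeta> $ l = s * of_real (d $ l)" for F d
  proof -
    have "(\<Sum>i\<in>UNIV. v $ i * cnj (rotate_field Q F \<eta> $ i)) = (\<Sum>i\<in>UNIV. \<Sum>l\<in>UNIV. cnj s * (of_real (Q $ i $ l) * v $ i * of_real (d $ l)))"
      unfolding rotate_field_nth \<zeta>_def[symmetric] by (simp add: F sum_distrib_left mult_ac)
    also have "\<dots> = (\<Sum>l\<in>UNIV. \<Sum>i\<in>UNIV. cnj s * (of_real (Q $ i $ l) * v $ i * of_real (d $ l)))"
      by (rule sum.swap)
    also have "\<dots> = cnj s * (\<Sum>l\<in>UNIV. v' $ l * of_real (d $ l))"
      by (simp add: v'_def matrix_vector_mult_def map_matrix_def transpose_def sum_distrib_left sum_distrib_right mult_ac)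
    finally show ?thesis .
  qed
  have p1: "(\<Sum>i\<in>UNIV. v $ i * cnj (rotate_field Q (extended_hat L \<kappa> h (Some b)) \<eta> $ i)) = cnj s * (\<Sum>l\<in>UNIV. v' $ l * of_real (cross3 (axis b 1) (sgn \<zeta>) $ l))" for b
    by (rule pair) (simp add: extended_hat_def mother_wavelet_hat_nth s_def tangent_field_eq_cross3 norm_sgn \<zeta>(1))
  have p2: "(\<Sum>i\<in>UNIV. v $ i * cnj (rotate_field Q (extended_hat L \<kappa> h None) \<eta> $ i)) = cnj s * (\<Sum>l\<in>UNIV. v' $ l * of_real (sgn \<zeta> $ l))"
    by (rule pair) (simp add: extended_hat_def longitudinal_def s_def)
  have ns: "(norm (cnj s * z))\<^sup>2 = (norm s)\<^sup>2 * (norm z)\<^sup>2" for z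
    by (simp add: norm_mult power_mult_distrib)
  have "(\<Sum>a\<in>UNIV. (norm (\<Sum>i\<in>UNIV. v $ i * cnj (rotate_field Q (extended_hat L \<kappa> h a) \<eta> $ i)))\<^sup>2) =
    (norm s)\<^sup>2 * ((\<Sum>b\<in>UNIV. (norm (\<Sum>l\<in>UNIV. v' $ l * of_real (cross3 (axis b 1) (sgn \<zeta>) $ l)))\<^sup>2) + (norm (\<Sum>l\<in>UNIV. v' $ l * of_real (sgn \<zeta> $ l)))\<^sup>2)"
    unfolding sum_UNIV_option3 p1 p2 ns by (simp only: distrib_left sum_distrib_left)
  also have "\<dots> = (norm s)\<^sup>2 * (norm v)\<^sup>2"
    unfolding cross_axis_tight_frame nv' using \<zeta>(1) by (simp add: norm_sgn)
  also have "(norm s)\<^sup>2 = (norm (sph_window L \<kappa> (matrix_inv Q *v sgn \<eta>)))\<^sup>2 * (norm (h (norm \<eta>)))\<^sup>2"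
    by (simp add: s_def wavelet_symbol_def norm_mult power_mult_distrib \<zeta>)
  finally show ?thesis .
qed

text \<open>
  Rotation and dilation map frequency rays to frequency rays, and a translation alters the symbol only.
  So the members of the fourth family are longitudinal with a symbol of their own.
\<close>

lemma longitudinal_frame_function:
  assumes Q: "orthogonal_matrix Q" and m: "bounded_support m"
  obtains m' where "bounded_support m'" "frame_function Q (inv_fourier (longitudinal m)) j k = inv_fourier (longitudinal m')"
proof -
  have QT: "orthogonal_matrix (matrix_inv Q)" by (rule orthogonal_matrix_inv[OF Q])
  note inv = orthogonal_matrix_inv_cancel(1)[OF Q]
  note [measurable] = bounded_support_measurable[OF m]
  obtain B r where B: "0 < B" "0 < r" "\<And>x. norm (m x) \<le> B" "\<And>x. norm x > r \<Longrightarrow> m x = 0"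
    using bounded_supportE[OF m] by metis
  define a where "a = (2::real) powi (- j)"
  have a: "a > 0" by (simp add: a_def)
  define c where "c = complex_of_real (2 powr (- 3 * real_of_int j / 2) / (2 * pi) powr (3 / 2))"
  define m' where "m' \<xi> = c * plane_wave (- (a *\<^sub>R lattice_point k)) \<xi> * m (matrix_inv Q *v (a *\<^sub>R \<xi>))" for \<xi>
  have [measurable]: "(*v) (matrix_inv Q) \<in> borel_measurable borel"
    by (intro borel_measurable_continuous_onI continuous_intros)
  have "bounded_support m'"
  proof (rule bounded_supportI[of _ "norm c * B" "r / a"])
    show "m' \<in> borel_measurable borel" unfolding m'_def by measurable
    show "norm (m' \<xi>) \<le> norm c * B" for \<xi> using B(3) by (simp add: m'_def norm_mult mult_left_mono)
    show "m' \<xi> = 0" if "norm \<xi> > r / a" for \<xi>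
    proof -
      have "norm (matrix_inv Q *v (a *\<^sub>R \<xi>)) > r"
        unfolding norm_orthogonal_matrix[OF QT] using that a by (simp add: field_simps)
      then show ?thesis by (simp add: m'_def B(4))
    qed
  qed
  moreover have "frame_function_hat Q (longitudinal m) j k = longitudinal m'"
  proof (intro ext, subst vec_eq_iff, intro allI)
    fix \<xi> i
    have s: "sgn (matrix_inv Q *v (a *\<^sub>R \<xi>)) = matrix_inv Q *v sgn \<xi>"
      using a by (simp add: sgn_orthogonal_matrix[OF QT] sgn_scaleR)
    have "rotate_field Q (longitudinal m) (a *\<^sub>R \<xi>) $ i = m (matrix_inv Q *v (a *\<^sub>R \<xi>)) * of_real ((Q *v (matrix_inv Q *v sgn \<xi>)) $ i)"
      unfolding rotate_field_nth longitudinal_def vec_lambda_beta s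
      by (simp add: matrix_vector_mult_def[of Q] sum_distrib_left mult_ac)
    then show "frame_function_hat Q (longitudinal m) j k \<xi> $ i = longitudinal m' \<xi> $ i"
      unfolding frame_function_hat_def a_def[symmetric] c_def[symmetric] vector_smult_component inv
      by (simp add: longitudinal_def m'_def mult.assoc)
  qed
  ultimately show thesis
    using that frame_function_inv_fourier[OF Q bounded_support_longitudinal[OF m]] by metis
qed

lemma nn_integral_count_space_swap:
  assumes "countable B"
  shows "(\<integral>\<^sup>+x. \<integral>\<^sup>+y. f x y \<partial>count_space B \<partial>count_space A) = (\<integral>\<^sup>+y. \<integral>\<^sup>+x. f x y \<partial>count_space A \<partial>count_space B)"
  by (rule nn_integral_count_space_nn_integral[OF assms, of "\<lambda>y x. f x y"]) simp

lemma has_sum_nn_integral_count_space: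
  fixes f :: "'a \<Rightarrow> real"
  assumes A: "countable A" and f: "\<And>x. 0 \<le> f x" and s: "(f has_sum s) A"
  shows "(\<integral>\<^sup>+x. ennreal (f x) \<partial>count_space A) = ennreal s"
proof (rule nn_integral_count_space_realI[OF A f])
  show "sum f F \<le> s" if "finite F" "F \<subseteq> A" for F
    using finite_sum_le_has_sum[OF s that] f by simp
  show "\<exists>F. finite F \<and> F \<subseteq> A \<and> s - e \<le> sum f F" if e: "e > 0" for e
  proof -
    obtain F where "finite F" "F \<subseteq> A" "dist (sum f F) s \<le> e"
      using has_sum_finite_approximation[OF s e] by blast
    then show ?thesis by (intro exI[of _ F]) (auto simp: dist_real_def)
  qed
qed

text \<open>
  On the Fourier side the square sum over all translates is an integral, the sum over the four
  directions is the squared length of the vector, the sum over the orientations is 1 by the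
  partition of unity, and the sum over the scales is 1 by the Calderon condition.
\<close>

theorem extended_parseval:
  fixes L M :: "int \<Rightarrow> nat" and \<kappa> :: "int \<Rightarrow> nat \<Rightarrow> int \<Rightarrow> complex" and h :: "real \<Rightarrow> complex"
    and Q :: "int \<Rightarrow> nat \<Rightarrow> real^3^3"
  assumes Q: "\<And>j t. t \<in> {1..M j} \<Longrightarrow> orthogonal_matrix (Q j t)"
    and h: "h \<in> borel_measurable borel" "\<And>r. r > pi \<Longrightarrow> h r = 0" "\<And>r. r > 0 \<Longrightarrow> norm (h r) \<le> 1"
    and calderon: "\<And>\<xi> :: real^3. \<xi> \<noteq> 0 \<Longrightarrow> ((\<lambda>j :: int. (norm (h (2 powi (- j) * norm \<xi>)))\<^sup>2) has_sum 1) UNIV"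
    and windows: "\<And>j \<omega>. norm \<omega> = 1 \<Longrightarrow> (\<Sum>t = 1..M j. (norm (sph_window (L j) (\<kappa> j) (matrix_inv (Q j t) *v \<omega>)))\<^sup>2) = 1"
    and u: "bounded_support u"
  shows "(\<integral>\<^sup>+(a, j, k, t). ennreal ((norm (L2_inner u (frame_function (Q j t) (inv_fourier (extended_hat (L j) (\<kappa> j) h a)) j k)))\<^sup>2) \<partial>count_space {(a, j, k, t). t \<in> {1..M j}}) =
    ennreal (LINT x|lborel. (norm (u x))\<^sup>2)"
proof -
  define F where "F j a = extended_hat (L j) (\<kappa> j) h a" for j a
  have F: "bounded_support (F j a)" for j a unfolding F_def by (rule bounded_support_extended_hat[OF h])
  define c where "c a j k t = ennreal ((norm (L2_inner u (frame_function (Q j t) (inv_fourier (F j a)) j k)))\<^sup>2)" for a j k t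
  \<comment> \<open>Weighting by \<open>\<delta>\<close> makes the range of \<open>t\<close> independent of \<open>j\<close>, so that the sums can be exchanged.\<close>
  define \<delta> where "\<delta> j t = (indicator {1..M j} t :: ennreal)" for j t
  define v :: "real^3 \<Rightarrow> complex^3" where "v \<xi> = (\<chi> i. fourier (\<lambda>x. u x $ i) \<xi>)" for \<xi>
  define p where "p a j t \<xi> = (norm (\<Sum>i\<in>UNIV. v \<xi> $ i * cnj (rotate_field (Q j t) (F j a) ((2 powi (- j)) *\<^sub>R \<xi>) $ i)))\<^sup>2" for a j t \<xi>
  have um [measurable]: "u \<in> borel_measurable borel" by (rule bounded_support_measurable[OF u])
  have vm [measurable]: "(\<lambda>\<xi>. v \<xi> $ i) \<in> borel_measurable borel" for i
    unfolding v_def by simp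
  define C where "C = ennreal (1 / (2 * pi) ^ 3)"
  have cnt: "countable (UNIV :: 'z::countable set)" by simp
  have pm [measurable]: "(\<lambda>\<xi>. \<delta> j t * ennreal (p a j t \<xi>)) \<in> borel_measurable borel" for a j t
  proof (cases "t \<in> {1..M j}")
    case True
    have [measurable]: "rotate_field (Q j t) (F j a) \<in> borel_measurable borel"
      by (rule bounded_support_measurable[OF bounded_support_rotate_field[OF Q[OF True] F]])
    show ?thesis unfolding p_def by measurable
  qed (simp add: \<delta>_def)
  have sumk: "(\<integral>\<^sup>+k. \<delta> j t * c a j k t \<partial>count_space UNIV) = C * (\<integral>\<^sup>+\<xi>. \<delta> j t * ennreal (p a j t \<xi>) \<partial>lborel)" for a j t
  proof (cases "t \<in> {1..M j}")
    case True
    have "(\<integral>\<^sup>+k. c a j k t \<partial>count_space UNIV) = C * (\<integral>\<^sup>+\<xi>. ennreal (p a j t \<xi>) \<partial>lborel)"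
      unfolding c_def C_def p_def v_def vec_lambda_beta
      by (rule translates_square_sum[OF Q[OF True] F _ u]) (simp add: F_def extended_hat_bandlimited[OF h(2)])
    then show ?thesis using True by (simp add: \<delta>_def)
  qed (simp add: \<delta>_def)
  have pointwise: "(\<integral>\<^sup>+j. \<integral>\<^sup>+t. \<integral>\<^sup>+a. \<delta> j t * ennreal (p a j t \<xi>) \<partial>count_space UNIV \<partial>count_space UNIV \<partial>count_space UNIV) = ennreal ((norm (v \<xi>))\<^sup>2)"
    if \<xi>: "\<xi> \<noteq> 0" for \<xi>
  proof -
    define H where "H j = (norm (h (2 powi (- j) * norm \<xi>)))\<^sup>2" for j :: int
    define w where "w j t = (norm (sph_window (L j) (\<kappa> j) (matrix_inv (Q j t) *v sgn \<xi>)))\<^sup>2" for j t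
    have suma: "(\<integral>\<^sup>+a. \<delta> j t * ennreal (p a j t \<xi>) \<partial>count_space UNIV) = \<delta> j t * ennreal (w j t * (H j * (norm (v \<xi>))\<^sup>2))" for j t
    proof (cases "t \<in> {1..M j}")
      case True
      have pos: "(2::real) powi (- j) > 0" by simp
      have "(\<Sum>a\<in>UNIV. p a j t \<xi>) = w j t * (H j * (norm (v \<xi>))\<^sup>2)"
        unfolding p_def F_def w_def H_def using extended_hat_square_sum[OF Q[OF True], of "(2 powi (- j)) *\<^sub>R \<xi>"] \<xi> pos
        by (simp add: sgn_scaleR mult.assoc)
      then have "(\<Sum>a\<in>UNIV. ennreal (p a j t \<xi>)) = ennreal (w j t * (H j * (norm (v \<xi>))\<^sup>2))"
        by (subst sum_ennreal) (simp_all add: p_def)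
      then show ?thesis using True by (simp add: \<delta>_def nn_integral_count_space_finite)
    qed (simp add: \<delta>_def)
    have sumt: "(\<integral>\<^sup>+t. \<delta> j t * ennreal (w j t * (H j * (norm (v \<xi>))\<^sup>2)) \<partial>count_space UNIV) = ennreal (H j * (norm (v \<xi>))\<^sup>2)" for j
    proof -
      have "(\<integral>\<^sup>+t. \<delta> j t * ennreal (w j t * (H j * (norm (v \<xi>))\<^sup>2)) \<partial>count_space UNIV) = (\<Sum>t = 1..M j. ennreal (w j t * (H j * (norm (v \<xi>))\<^sup>2)))"
        by (subst nn_integral_count_space'[of "{1..M j}"]) (auto simp: \<delta>_def)
      also have "\<dots> = ennreal ((\<Sum>t = 1..M j. w j t) * (H j * (norm (v \<xi>))\<^sup>2))"
        by (subst sum_ennreal) (auto simp: w_def H_def sum_distrib_right)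
      also have "(\<Sum>t = 1..M j. w j t) = 1" unfolding w_def using \<xi> by (intro windows) (simp add: norm_sgn)
      finally show ?thesis by simp
    qed
    have "(\<integral>\<^sup>+j. ennreal (H j * (norm (v \<xi>))\<^sup>2) \<partial>count_space UNIV) = (\<integral>\<^sup>+j. ennreal (H j) \<partial>count_space UNIV) * ennreal ((norm (v \<xi>))\<^sup>2)"
      by (simp add: ennreal_mult H_def nn_integral_multc)
    also have "(\<integral>\<^sup>+j. ennreal (H j) \<partial>count_space UNIV) = 1"
      unfolding H_def using has_sum_nn_integral_count_space[OF _ _ calderon[OF \<xi>]] by simp
    finally show ?thesis by (simp add: suma sumt)
  qed
  have "(\<integral>\<^sup>+(a, j, k, t). c a j k t \<partial>count_space {(a, j, k, t). t \<in> {1..M j}}) = (\<integral>\<^sup>+(a, j, k, t). \<delta> j t * c a j k t \<partial>count_space UNIV)"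
    by (subst nn_integral_count_space_indicator) (auto simp: \<delta>_def indicator_def intro!: nn_integral_cong)
  also have "\<dots> = (\<integral>\<^sup>+a. \<integral>\<^sup>+j. \<integral>\<^sup>+k. \<integral>\<^sup>+t. \<delta> j t * c a j k t \<partial>count_space UNIV \<partial>count_space UNIV \<partial>count_space UNIV \<partial>count_space UNIV)"
    by (simp flip: nn_integral_fst_count_space)
  also have "\<dots> = (\<integral>\<^sup>+a. \<integral>\<^sup>+j. \<integral>\<^sup>+t. \<integral>\<^sup>+k. \<delta> j t * c a j k t \<partial>count_space UNIV \<partial>count_space UNIV \<partial>count_space UNIV \<partial>count_space UNIV)"
    by (intro nn_integral_cong nn_integral_count_space_swap cnt)
  also have "\<dots> = (\<integral>\<^sup>+j. \<integral>\<^sup>+a. \<integral>\<^sup>+t. \<integral>\<^sup>+k. \<delta> j t * c a j k t \<partial>count_space UNIV \<partial>count_space UNIV \<partial>count_space UNIV \<partial>count_space UNIV)"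
    by (rule nn_integral_count_space_swap[OF cnt])
  also have "\<dots> = (\<integral>\<^sup>+j. \<integral>\<^sup>+t. \<integral>\<^sup>+a. \<integral>\<^sup>+k. \<delta> j t * c a j k t \<partial>count_space UNIV \<partial>count_space UNIV \<partial>count_space UNIV \<partial>count_space UNIV)"
    by (intro nn_integral_cong nn_integral_count_space_swap cnt)
  also have "\<dots> = C * (\<integral>\<^sup>+j. \<integral>\<^sup>+t. \<integral>\<^sup>+a. \<integral>\<^sup>+\<xi>. \<delta> j t * ennreal (p a j t \<xi>) \<partial>lborel \<partial>count_space UNIV \<partial>count_space UNIV \<partial>count_space UNIV)"
    by (simp add: sumk nn_integral_cmult)
  also have "(\<integral>\<^sup>+j. \<integral>\<^sup>+t. \<integral>\<^sup>+a. \<integral>\<^sup>+\<xi>. \<delta> j t * ennreal (p a j t \<xi>) \<partial>lborel \<partial>count_space UNIV \<partial>count_space UNIV \<partial>count_space UNIV) =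
     (\<integral>\<^sup>+j. \<integral>\<^sup>+t. \<integral>\<^sup>+\<xi>. \<integral>\<^sup>+a. \<delta> j t * ennreal (p a j t \<xi>) \<partial>count_space UNIV \<partial>lborel \<partial>count_space UNIV \<partial>count_space UNIV)"
    by (intro nn_integral_cong nn_integral_count_space_nn_integral[symmetric]) auto
  also have "\<dots> = (\<integral>\<^sup>+j. \<integral>\<^sup>+\<xi>. \<integral>\<^sup>+t. \<integral>\<^sup>+a. \<delta> j t * ennreal (p a j t \<xi>) \<partial>count_space UNIV \<partial>count_space UNIV \<partial>lborel \<partial>count_space UNIV)"
    by (intro nn_integral_cong nn_integral_count_space_nn_integral[symmetric]) (auto simp: nn_integral_count_space_finite)
  also have "\<dots> = (\<integral>\<^sup>+\<xi>. \<integral>\<^sup>+j. \<integral>\<^sup>+t. \<integral>\<^sup>+a. \<delta> j t * ennreal (p a j t \<xi>) \<partial>count_space UNIV \<partial>count_space UNIV \<partial>count_space UNIV \<partial>lborel)"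
    by (intro nn_integral_count_space_nn_integral[symmetric]) (auto simp: nn_integral_count_space_finite nn_integral_count_space_nat)
  also have "\<dots> = (\<integral>\<^sup>+\<xi>. ennreal ((norm (v \<xi>))\<^sup>2) \<partial>lborel)"
  proof (rule nn_integral_cong_AE)
    have "AE \<xi> in lborel. (\<xi>::real^3) \<noteq> 0" by (rule AE_lborel_singleton)
    then show "AE \<xi> in lborel. (\<integral>\<^sup>+j. \<integral>\<^sup>+t. \<integral>\<^sup>+a. \<delta> j t * ennreal (p a j t \<xi>) \<partial>count_space UNIV \<partial>count_space UNIV \<partial>count_space UNIV) = ennreal ((norm (v \<xi>))\<^sup>2)"
      by eventually_elim (rule pointwise)
  qed
  also have "C * \<dots> = ennreal (LINT x|lborel. (norm (u x))\<^sup>2)"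
  proof -
    note ui = bounded_support_component[OF u]
    have card3: "CARD(3) = 3" by simp
    have "(\<integral>\<^sup>+\<xi>. ennreal ((norm (v \<xi>))\<^sup>2) \<partial>lborel) = (\<integral>\<^sup>+\<xi>. (\<Sum>i\<in>UNIV. ennreal ((norm (fourier (\<lambda>x. u x $ i) \<xi>))\<^sup>2)) \<partial>lborel)"
      unfolding norm_sq_cart v_def vec_lambda_beta by (subst sum_ennreal) simp_all
    also have "\<dots> = (\<Sum>i\<in>UNIV. \<integral>\<^sup>+\<xi>. ennreal ((norm (fourier (\<lambda>x. u x $ i) \<xi>))\<^sup>2) \<partial>lborel)"
      using vm unfolding v_def vec_lambda_beta by (intro nn_integral_sum) measurable
    also have "\<dots> = (\<Sum>i\<in>UNIV. ennreal ((2 * pi) ^ 3 * (LINT x|lborel. (norm (u x $ i))\<^sup>2)))"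
      using card3 by (simp only: plancherel[OF ui])
    finally have "C * (\<integral>\<^sup>+\<xi>. ennreal ((norm (v \<xi>))\<^sup>2) \<partial>lborel) = (\<Sum>i\<in>UNIV. C * ennreal ((2 * pi) ^ 3 * (LINT x|lborel. (norm (u x $ i))\<^sup>2)))"
      by (simp only: sum_distrib_left)
    also have "\<dots> = (\<Sum>i\<in>UNIV. ennreal (LINT x|lborel. (norm (u x $ i))\<^sup>2))"
      unfolding C_def by (intro sum.cong refl) (subst ennreal_mult[symmetric], simp_all)
    also have "\<dots> = ennreal (LINT x|lborel. (norm (u x))\<^sup>2)"
      unfolding norm_sq_cart using integrable_norm_sq[OF bounded_support_square_integrable[OF ui]]
      by (simp add: sum_ennreal)
    finally show ?thesis .
  qed
  finally show ?thesis by (simp add: c_def F_def)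
qed

theorem proposition4:
  fixes L M :: "int \<Rightarrow> nat"
    and \<kappa> :: "int \<Rightarrow> nat \<Rightarrow> int \<Rightarrow> complex"
    and orient :: "int \<Rightarrow> nat \<Rightarrow> real ^ 3"
    and R :: "real ^ 3 \<Rightarrow> real ^ 3 ^ 3"
    and h :: "real \<Rightarrow> complex"
    and w :: "int \<Rightarrow> nat \<Rightarrow> nat \<Rightarrow> int \<Rightarrow> complex"
    and u :: "real ^ 3 \<Rightarrow> complex ^ 3"
    and \<psi> :: "3 \<Rightarrow> int \<Rightarrow> int ^ 3 \<Rightarrow> nat \<Rightarrow> real ^ 3 \<Rightarrow> complex ^ 3"
  assumes orientations: "\<And>j t. t \<in> {1..M j} \<Longrightarrow> orient j t \<in> sphere 0 1"
    and rotations: "\<And>p. p \<in> sphere 0 1 \<Longrightarrow> rotation_matrix (R p) \<and> R p *v axis 3 1 = p"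
    and real_window: "\<And>j \<omega>. \<omega> \<in> sphere 0 1 \<Longrightarrow> sph_window (L j) (\<kappa> j) \<omega> \<in> \<real>"
    and h_measurable: "h \<in> borel_measurable borel"
    and h_bandlimited: "\<And>r. r > pi \<Longrightarrow> h r = 0"
    and w_def: "\<And>j t. w j t = rotated_coeffs (R (orient j t)) (\<kappa> j)"
    and calderon: "\<And>\<xi> :: real ^ 3. \<xi> \<noteq> 0 \<Longrightarrow>
          ((\<lambda>j :: int. (norm (h (2 powi (- j) * norm \<xi>)))\<^sup>2) has_sum 1) UNIV"
    and angular: "\<And>j l m. m \<in> {- int l..int l} \<Longrightarrow>
          (if l = 0 \<and> m = 0 then 1 else 0) = (\<Sum>t = 1..M j. sph_prod_form (L j) (w j t) l m)"
    and \<psi>_def: "\<And>a j k t. \<psi> a j k t =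
          frame_function (R (orient j t)) (mother_wavelet (L j) (\<kappa> j) h a) j k"
    and u: "u \<in> L2_div"
  shows "has_L2_sum (\<lambda>(a, j, k, t) x. L2_inner u (\<psi> a j k t) *s \<psi> a j k t x) u
           {(a, j, k, t). t \<in> {1..M j}}"
proof -
  define Q where "Q j t = R (orient j t)" for j t
  have Q: "orthogonal_matrix (Q j t)" if "t \<in> {1..M j}" for j t
    using rotations[OF orientations[OF that]] by (simp add: Q_def rotation_matrix_def)
  have h_le: "norm (h r) \<le> 1" if "r > 0" for r
  proof -
    \<comment> \<open>A single term of the Calderon sum is at most the sum.\<close>
    have n: "norm (r *\<^sub>R axis 1 1 :: real^3) = r" using that by simp
    then have "r *\<^sub>R axis 1 1 \<noteq> (0 :: real^3)" using that by fastforce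
    from finite_sum_le_has_sum[OF calderon[OF this(1)], of "{0}"] n
    have "(norm (h r))\<^sup>2 \<le> 1\<^sup>2" by simp
    then show ?thesis by (rule power2_le_imp_le) simp
  qed
  note h = h_measurable h_bandlimited h_le
  have windows: "(\<Sum>t = 1..M j. (norm (sph_window (L j) (\<kappa> j) (matrix_inv (Q j t) *v \<omega>)))\<^sup>2) = 1"
    if \<omega>: "norm \<omega> = 1" for j \<omega>
  proof -
    \<comment> \<open>The condition on the coefficients concerns squares; these are squared moduli as the window is real.\<close>
    have "(\<Sum>t = 1..M j. (sph_window (L j) (w j t) \<omega>)\<^sup>2) = 1"
      by (rule sum_windows_squared[OF angular _ \<omega>]) auto
    moreover have "(sph_window (L j) (w j t) \<omega>)\<^sup>2 = of_real ((norm (sph_window (L j) (\<kappa> j) (matrix_inv (Q j t) *v \<omega>)))\<^sup>2)"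
      if t: "t \<in> {1..M j}" for t
    proof -
      have QT: "orthogonal_matrix (matrix_inv (Q j t))" by (rule orthogonal_matrix_inv[OF Q[OF t]])
      have "sph_window (L j) (\<kappa> j) (matrix_inv (Q j t) *v \<omega>) \<in> \<real>"
        using \<omega> by (intro real_window) (simp add: norm_orthogonal_matrix[OF QT])
      then show ?thesis
        unfolding w_def Q_def[symmetric] sph_window_rotated_coeffs[OF Q[OF t] \<omega>]
        by (auto elim!: Reals_cases simp flip: of_real_power)
    qed
    ultimately have "complex_of_real (\<Sum>t = 1..M j. (norm (sph_window (L j) (\<kappa> j) (matrix_inv (Q j t) *v \<omega>)))\<^sup>2) = 1"
      by simp
    then show ?thesis by (simp only: of_real_eq_1_iff)
  qed
  \<comment> \<open>The index set \<open>J\<close> of the four families contains that of the theorem by way of \<open>\<iota>\<close>.\<close>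
  define \<phi> where "\<phi> = (\<lambda>(a, j, k, t). frame_function (Q j t) (inv_fourier (extended_hat (L j) (\<kappa> j) h a)) j k)"
  define J :: "(3 option \<times> int \<times> (int^3) \<times> nat) set" where "J = {(a, j, k, t). t \<in> {1..M j}}"
  define I :: "(3 \<times> int \<times> (int^3) \<times> nat) set" where "I = {(a, j, k, t). t \<in> {1..M j}}"
  define \<iota> :: "3 \<times> int \<times> (int^3) \<times> nat \<Rightarrow> 3 option \<times> int \<times> (int^3) \<times> nat" where "\<iota> = (\<lambda>(a, r). (Some a, r))"
  have J: "countable J"
  proof -
    have "countable (UNIV \<times> UNIV \<times> UNIV \<times> UNIV :: (3 option \<times> int \<times> (int^3) \<times> nat) set)"
      by (intro countable_SIGMA countable_int_vec) (auto intro: countable_finite)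
    then show ?thesis by (rule countable_subset[rotated]) auto
  qed
  have inj: "inj \<iota>" by (auto simp: \<iota>_def inj_on_def)
  have IJ: "\<iota> ` I \<subseteq> J" by (auto simp: \<iota>_def I_def J_def)
  have I: "countable I"
    using countable_subset[OF IJ J] countable_image_inj_on[OF _ inj_on_subset[OF inj subset_UNIV]] by blast
  have hat: "bounded_support (extended_hat (L j) (\<kappa> j) h a)" for j a
    by (rule bounded_support_extended_hat[OF h])
  have \<phi>_sq: "square_integrable lborel (\<phi> i)" if "i \<in> J" for i
  proof -
    obtain a j k t where i: "i = (a, j, k, t)" by (cases i)
    with that have t: "t \<in> {1..M j}" by (simp add: J_def)
    show ?thesis unfolding i \<phi>_def prod.case frame_function_inv_fourier[OF Q[OF t] hat]
      by (rule plancherel_inv_fourier(1)[OF bounded_support_frame_function_hat[OF Q[OF t] hat]])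
  qed
  have pars: "(\<integral>\<^sup>+i. ennreal ((norm (L2_inner v (\<phi> i)))\<^sup>2) \<partial>count_space J) = ennreal (LINT x|lborel. (norm (v x))\<^sup>2)"
    if "bounded_support v" for v
    using extended_parseval[OF Q h calderon windows that]
    unfolding J_def \<phi>_def by (simp add: case_prod_unfold)
  note ext = parseval_extend[OF J \<phi>_sq pars]
  have u2: "square_integrable lborel u" using u by (simp add: L2_div_def square_integrable_def)
  have \<phi>\<iota>: "\<phi> (\<iota> (a, j, k, t)) = \<psi> a j k t" for a j k t
    by (simp add: \<phi>_def \<iota>_def \<psi>_def mother_wavelet_def extended_hat_def Q_def)
  have none: "L2_inner u (\<phi> (None, j, k, t)) = 0" if t: "t \<in> {1..M j}" for j k t
  proof -
    obtain m' where m': "bounded_support m'"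
      "frame_function (Q j t) (inv_fourier (longitudinal (wavelet_symbol (L j) (\<kappa> j) h))) j k = inv_fourier (longitudinal m')"
      using longitudinal_frame_function[OF Q[OF t] bounded_support_wavelet_symbol[OF h]] .
    show ?thesis
      unfolding \<phi>_def prod.case extended_hat_def option.case m'(2)
      by (rule L2_div_orthogonal_longitudinal[OF u m'(1)])
  qed
  have "has_L2_sum (\<lambda>i x. L2_inner u (\<phi> (\<iota> i)) *s \<phi> (\<iota> i) x) u I"
  proof (rule frame_reconstruction[OF I _ u2])
    show "square_integrable lborel (\<phi> (\<iota> i))" if "i \<in> I" for i using \<phi>_sq IJ that by blast
    show "(\<Sum>i\<in>F. (norm (L2_inner g (\<phi> (\<iota> i))))\<^sup>2) \<le> (LINT x|lborel. (norm (g x))\<^sup>2)"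
      if "finite F" "F \<subseteq> I" "square_integrable lborel g" for F g
    proof -
      have "(\<Sum>i\<in>F. (norm (L2_inner g (\<phi> (\<iota> i))))\<^sup>2) = (\<Sum>i\<in>\<iota> ` F. (norm (L2_inner g (\<phi> i)))\<^sup>2)"
        using inj_on_subset[OF inj subset_UNIV] by (simp add: sum.reindex)
      also have "\<dots> \<le> (LINT x|lborel. (norm (g x))\<^sup>2)"
        using that IJ by (intro ext(2)) auto
      finally show ?thesis .
    qed
    have bij: "bij_betw \<iota> I (\<iota> ` I)" using inj_on_subset[OF inj subset_UNIV] by (simp add: bij_betw_def)
    have "(\<integral>\<^sup>+i. ennreal ((norm (L2_inner u (\<phi> (\<iota> i))))\<^sup>2) \<partial>count_space I) = (\<integral>\<^sup>+i. ennreal ((norm (L2_inner u (\<phi> i)))\<^sup>2) \<partial>count_space (\<iota> ` I))"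
      by (rule nn_integral_bij_count_space[OF bij])
    also have "\<dots> = (\<integral>\<^sup>+i. ennreal ((norm (L2_inner u (\<phi> i)))\<^sup>2) \<partial>count_space J)"
    proof -
      have "L2_inner u (\<phi> i) = 0" if "i \<in> J" "i \<notin> \<iota> ` I" for i
      proof -
        obtain a j k t where i: "i = (a, j, k, t)" by (cases i)
        have "a = None"
        proof (cases a)
          case (Some b)
          then have "i = \<iota> (b, j, k, t)" "(b, j, k, t) \<in> I" using that(1) by (auto simp: i \<iota>_def I_def J_def)
          with that(2) show ?thesis by blast
        qed
        with none[of t j k] that(1) show ?thesis by (simp add: i J_def)
      qed
      then show ?thesis
        using IJ by (intro nn_integral_count_space_eq) auto
    qed
    also have "\<dots> = ennreal (LINT x|lborel. (norm (u x))\<^sup>2)" by (rule ext(1)[OF _ _ u2])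
    finally show "(\<integral>\<^sup>+i. ennreal ((norm (L2_inner u (\<phi> (\<iota> i))))\<^sup>2) \<partial>count_space I) = ennreal (LINT x|lborel. (norm (u x))\<^sup>2)" .
  qed
  also have "(\<lambda>i x. L2_inner u (\<phi> (\<iota> i)) *s \<phi> (\<iota> i) x) = (\<lambda>(a, j, k, t) x. L2_inner u (\<psi> a j k t) *s \<psi> a j k t x)"
    by (auto simp: \<phi>\<iota>)
  finally show ?thesis by (simp add: I_def)
qed

end
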